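(* Consider the game, with agents $i\in\mathcal I=\{1,\dots,N\}$, described in the context, and suppose that: (1) for each $i\in\mathcal I$, $g_i:\mathbb R^{n_i}\to\mathbb R^m$ is componentwise convex and twice continuously differentiable; the set $\mathcal X=\Omega\cap\{x\in\mathbb R^n\mid g(x)\le \mathbf 0_m\}$ satisfies Slater's constraint qualification; $J_i$ is continuously differentiable and $J_i(\cdot,x_{-i})$ is convex for every $x_{-i}$; (2) the pseudo-gradient $F$ is $\mu$-strongly monotone for some $\mu>0$ and $\theta_0$-Lipschitz continuous for some $\theta_0>0$; (3) the communication graph $\mathcal G(\mathcal I,\mathcal E)$ is undirected and connected; (4) $\Omega=\mathbb R^n$. Let $\gamma_i>0$ for all $i\in\mathcal I$, and let every scalar component $x_{i,\ell}$ of agent $i$'s strategy ($\ell\in\mathcal K_i=\{1,\dots,n_i\}$) obey mixed-order integrator dynamics of order $r_{i,\ell}\ge1$, in closed loop with the following controller, for all $i\in\mathcal I$ and $\ell\in\mathcal K_i$: $$\begin{aligned} x_{i,\ell}^{(r_{i,\ell})}&=u_{i,\ell}=\tilde u_{i,\ell}-\sum_{j=1}^{r_{i,\ell}-1}c_{i,\ell,j-1}x_{i,\ell}^{(j)},\\ \tilde u_i&=-\nabla_{x_i}J_i(\boldsymbol\zeta^i_i,\boldsymbol\zeta^i_{-i})-\tfrac{\partial}{\partial x_i}g_i(\boldsymbol\zeta^i_i)^\top\lambda_i-\sum_{j\in\mathcal N_i}(k_i\rho^i_i-k_j\rho^j_i),\\ \dot{\boldsymbol\zeta}^i_{-i}&=-\sum_{j\in\mathcal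 N_i}(k_i\rho^i_{-i}-k_j\rho^j_{-i}),\qquad \boldsymbol\zeta^i_i=\zeta_i=\mathrm{col}((\zeta_{i,\ell})_{\ell\in\mathcal K_i}),\\ \dot k_i&=\gamma_i\|\rho^i\|^2,\qquad\rho^i=\sum_{j\in\mathcal N_i}(\boldsymbol\zeta^i-\boldsymbol\zeta^j),\\ \dot z_i&=\sum_{j\in\mathcal N_i}(\lambda_i-\lambda_j),\\ \dot\lambda_i&=\Pi_{\mathbb R^m_{\ge0}}\Big(\lambda_i,\;g_i(\boldsymbol\zeta^i_i)-z_i-\sum_{j\in\mathcal N_i}(\lambda_i-\lambda_j)\Big). \end{aligned}$$ Then, for any initial condition with $z_i(0)=\mathbf 0_m$ and $\lambda_i(0)\in\mathbb R^m_{\ge0}$ for all $i\in\mathcal I$ (and arbitrary initial values of $x_{i,\ell},\dots,x_{i,\ell}^{(r_{i,\ell}-1)}$, $\boldsymbol\zeta^i_{-i}$ and $k_i\in\mathbb R$), this system has a unique Carathéodory solution (on $[0,\infty)$). The solution converges to an equilibrium $\mathrm{col}(\bar x,\bar{\boldsymbol\zeta},\bar{\boldsymbol k},\bar{\boldsymbol z},\bar{\boldsymbol\lambda})$ with $\bar x=x^*$, $\bar{\boldsymbol\zeta}=\mathbf 1_N\otimes x^*$, $\bar{\boldsymbol\lambda}=\mathbf 1_N\otimes\lambda^*$, where $(x^*,\lambda^* )$ satisfies the KKT conditions $$\mathbf 0_n\in F(x^* )+\tfrac{\partial}{\partial x}g(x^* )^\top\lambda^*+\mathrm N_\Omega(x^*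 ),\qquad \mathbf 0_m\in -g(x^* )+\mathrm N_{\mathbb R^m_{\ge0}}(\lambda^* );$$ hence $x^*$ is the variational generalized Nash equilibrium (v-GNE) of the game.
   Context: Game. Agent $i$ chooses $x_i\in\Omega_i\subseteq\mathbb R^{n_i}$; $n=\sum_i n_i$, $x=\mathrm{col}((x_i)_{i\in\mathcal I})$ (stacking), $x_{-i}=\mathrm{col}((x_j)_{j\ne i})$, $\Omega=\times_i\Omega_i\subseteq\mathbb R^n$. Agent $i$ has cost $J_i(x_i,x_{-i})\in\mathbb R$. The coupling constraints are $g(x):=\sum_{i}g_i(x_i)\le\mathbf 0_m$, with $g_i:\mathbb R^{n_i}\to\mathbb R^m$, and $\mathcal X=\Omega\cap\{x\mid g(x)\le\mathbf 0_m\}$. A generalized Nash equilibrium (GNE) is $x^*$ such that, for all $i$, $x_i^*\in\operatorname{argmin}_{y_i}J_i(y_i,x_{-i}^* )$ subject to $(y_i,x_{-i}^* )\in\mathcal X$. A v-GNE is a GNE whose individual KKT systems hold with equal dual variables for all agents, i.e. $x^*$ for which there is $\lambda^*$ such that $(x^*,\lambda^* )$ satisfies the KKT conditions displayed in the claim. Pseudo-gradient: $F(x):=\mathrm{col}((\nabla_{x_i}J_i(x_i,x_{-i}))_{i\in\mathcal I})$; it is $\mu$-strongly monotone if $(F(x)-F(y))^\top(x-y)\ge\mu\|x-y\|^2$ for all $x,y$. Graph: $\mathcal N_i=\{j\mid(i,j)\in\mathcal E\}$ is the set of neighbors of $i$ in $\mathcal G$ (unweighted). Multi-integrators: $x_{i,\ell}:=[x_i]_\ell$,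 $u_{i,\ell}:=[u_i]_\ell$, $\tilde u_{i,\ell}:=[\tilde u_i]_\ell$ are scalar components, $x^{(j)}$ is the $j$-th time derivative. The constants $(c_{i,\ell,0}:=1,c_{i,\ell,1},\dots,c_{i,\ell,r_{i,\ell}-2},c_{i,\ell,r_{i,\ell}-1}:=1)$ are the ascending coefficients of a Hurwitz polynomial of order $r_{i,\ell}-1$ (any choice). The quantities $\zeta_{i,\ell}$ are defined by $\zeta_{i,\ell}:=x_{i,\ell}+\sum_{j=1}^{r_{i,\ell}-1}c_{i,\ell,j}x_{i,\ell}^{(j)}$ if $r_{i,\ell}>1$, and $\zeta_{i,\ell}:=x_{i,\ell}$ if $r_{i,\ell}=1$. Each agent $i$ holds $\boldsymbol\zeta^i=\mathrm{col}((\boldsymbol\zeta^i_j)_{j\in\mathcal I})\in\mathbb R^n$ where $\boldsymbol\zeta^i_i=\zeta_i$ and, for $j\ne i$, $\boldsymbol\zeta^i_j\in\mathbb R^{n_j}$ is an estimate of $\zeta_j$; $\boldsymbol\zeta^i_{-i}=\mathrm{col}((\boldsymbol\zeta^i_j)_{j\ne i})$, $\boldsymbol\zeta=\mathrm{col}((\boldsymbol\zeta^i)_i)\in\mathbb R^{Nn}$. Similarly $\rho^i=\mathrm{col}((\rho^i_j)_{j\in\mathcal I})\in\mathbb R^n$ with $\rho^i_j\in\mathbb R^{n_j}$; in the dynamics of agent $i$, $\rho^j_i$ denotes the $i$-th block of $\rho^j$, and $\rho^i_{-i}$, $\rho^j_{-i}$ denote $\rho^i$, $\rho^j$ with the $i$-th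 block removed. $\boldsymbol k=\mathrm{col}((k_i)_i)$, $\boldsymbol z=\mathrm{col}((z_i)_i)$, $\boldsymbol\lambda=\mathrm{col}((\lambda_i)_i)$, with $k_i\in\mathbb R$, $z_i,\lambda_i\in\mathbb R^m$. The state of the system consists of all $x_{i,\ell},\dots,x_{i,\ell}^{(r_{i,\ell}-1)}$, $\boldsymbol\zeta^i_{-i}$, $k_i$, $z_i$, $\lambda_i$. Convex analysis: for closed convex $S$, $\mathrm N_S(x)=\{v\mid\sup_{z\in S}v^\top(z-x)\le0\}$ is the normal cone, $\mathrm T_S(x)=\mathrm{cl}(\bigcup_{\delta>0}\frac1\delta(S-x))$ the tangent cone, and $\Pi_S(x,v):=\mathrm{proj}_{\mathrm T_S(x)}(v)$ (Euclidean projection). A Carathéodory solution is an absolutely continuous function with the given initial value satisfying the differential equation for almost all $t\ge0$. An equilibrium is a point where the right-hand side vanishes. *)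

theory Defs
  imports "HOL-Analysis.Analysis" "HOL-Computational_Algebra.Polynomial"
begin

section \<open>Analysis\<close>

definition C1 :: "('a::real_normed_vector \<Rightarrow> 'b::real_normed_vector) \<Rightarrow> bool" where
  "C1 f \<longleftrightarrow> (\<exists>f'. (\<forall>x. (f has_derivative blinfun_apply (f' x)) (at x)) \<and> continuous_on UNIV f')"

definition C2 :: "('a::real_normed_vector \<Rightarrow> 'b::real_normed_vector) \<Rightarrow> bool" where
  "C2 f \<longleftrightarrow> (\<exists>f'. (\<forall>x. (f has_derivative blinfun_apply (f' x)) (at x)) \<and> C1 f')"

definition grad :: "('a::real_inner \<Rightarrow> real) \<Rightarrow> 'a \<Rightarrow> 'a" where
  "grad f x = (THE D. GDERIV f x :> D)"

definition strongly_monotone :: "real \<Rightarrow> ('a::real_inner \<Rightarrow> 'a) \<Rightarrow> bool" where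
  "strongly_monotone \<mu> F \<longleftrightarrow> (\<forall>x y. (F x - F y) \<bullet> (x - y) \<ge> \<mu> * (norm (x - y))\<^sup>2)"

text \<open>No condition \<open>x \<in> S\<close> is built in; it is stated separately wherever the cone is used.\<close>

definition normal_cone :: "'a::real_inner set \<Rightarrow> 'a \<Rightarrow> 'a set" where
  "normal_cone S x = {v. \<forall>z\<in>S. v \<bullet> (z - x) \<le> 0}"

definition tangent_cone :: "'a::real_normed_vector set \<Rightarrow> 'a \<Rightarrow> 'a set" where
  "tangent_cone S x = closure (\<Union>\<delta>\<in>{0<..}. (\<lambda>z. (1 / \<delta>) *\<^sub>R (z - x)) ` S)"

definition proj_tangent :: "'a::euclidean_space set \<Rightarrow> 'a \<Rightarrow> 'a \<Rightarrow> 'a" where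
  "proj_tangent S x v = closest_point (tangent_cone S x) v"

definition hurwitz :: "real poly \<Rightarrow> bool" where
  "hurwitz p \<longleftrightarrow> (\<forall>s. poly (map_poly complex_of_real p) s = 0 \<longrightarrow> Re s < 0)"

definition abs_continuous_on :: "real set \<Rightarrow> (real \<Rightarrow> real) \<Rightarrow> bool" where
  "abs_continuous_on S f \<longleftrightarrow>
     (\<forall>\<epsilon>>0. \<exists>\<delta>>0. \<forall>d T. d division_of T \<and> T \<subseteq> S \<and> (\<Sum>K\<in>d. Sup K - Inf K) < \<delta>
        \<longrightarrow> (\<Sum>K\<in>d. \<bar>f (Sup K) - f (Inf K)\<bar>) < \<epsilon>)"

section \<open>Ordinary differential equations on a finite set of coordinates\<close>

text \<open>The state space is \<open>\<real>\<^sup>C\<close> for a finite set \<open>C\<close> of coordinates. States are total functions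
  \<open>'c \<Rightarrow> real\<close> whose values outside \<open>C\<close> are irrelevant. On the unbounded interval \<open>[0,\<infinity>)\<close>,
  absolute continuity is meant on every compact subinterval.\<close>

definition caratheodory_solution ::
    "'c set \<Rightarrow> (('c \<Rightarrow> real) \<Rightarrow> 'c \<Rightarrow> real) \<Rightarrow> ('c \<Rightarrow> real) \<Rightarrow> (real \<Rightarrow> 'c \<Rightarrow> real) \<Rightarrow> bool" where
  "caratheodory_solution C f s0 \<phi> \<longleftrightarrow>
     (\<forall>q\<in>C. \<phi> 0 q = s0 q) \<and>
     (\<forall>q\<in>C. \<forall>T\<ge>0. abs_continuous_on {0..T} (\<lambda>t. \<phi> t q)) \<and>
     (AE t in lebesgue. 0 \<le> t \<longrightarrow>
        (\<forall>q\<in>C. ((\<lambda>\<tau>. \<phi> \<tau> q) has_real_derivative f (\<phi> t) q) (at t)))"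

definition equilibrium :: "'c set \<Rightarrow> (('c \<Rightarrow> real) \<Rightarrow> 'c \<Rightarrow> real) \<Rightarrow> ('c \<Rightarrow> real) \<Rightarrow> bool" where
  "equilibrium C f s \<longleftrightarrow> (\<forall>q\<in>C. f s q = 0)"

definition converges_to :: "'c set \<Rightarrow> (real \<Rightarrow> 'c \<Rightarrow> real) \<Rightarrow> ('c \<Rightarrow> real) \<Rightarrow> bool" where
  "converges_to C \<phi> s \<longleftrightarrow> (\<forall>q\<in>C. ((\<lambda>t. \<phi> t q) \<longlongrightarrow> s q) at_top)"

section \<open>The game\<close>

text \<open>The index type \<open>'n\<close> enumerates the scalar components of all agents' strategies, and
  \<open>own l\<close> is the agent whose strategy contains component \<open>l\<close>. Hence the stacked vector \<open>x\<close> is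
  of type \<open>real^'n\<close>, its block \<open>x\<^sub>i\<close> consists of the \<open>x $ l\<close> with \<open>own l = i\<close>, and \<open>n\<^sub>i\<close> is
  the number of such \<open>l\<close>.

  \<open>block_upd own i y x\<close> is the profile \<open>(y\<^sub>i, x\<^sub>-\<^sub>i)\<close>. A function of \<open>x\<^sub>i\<close> alone is a function on
  \<open>real^'n\<close> satisfying \<open>depends_on_block own i\<close>; a vector in the space of \<open>x\<^sub>i\<close> is a vector
  that vanishes outside block \<open>i\<close>.\<close>

definition block_upd :: "('n::finite \<Rightarrow> 'i) \<Rightarrow> 'i \<Rightarrow> real^'n \<Rightarrow> real^'n \<Rightarrow> real^'n" where
  "block_upd own i y x = (\<chi> l. if own l = i then y $ l else x $ l)"

definition depends_on_block :: "('n::finite \<Rightarrow> 'i) \<Rightarrow> 'i \<Rightarrow> (real^'n \<Rightarrow> 'a) \<Rightarrow> bool" where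
  "depends_on_block own i f \<longleftrightarrow> (\<forall>x y. (\<forall>l. own l = i \<longrightarrow> x $ l = y $ l) \<longrightarrow> f x = f y)"

text \<open>The gradient in \<open>x\<^sub>i\<close> with \<open>x\<^sub>-\<^sub>i\<close> frozen; its components outside block \<open>i\<close> are \<open>0\<close>.\<close>

definition block_grad :: "('n::finite \<Rightarrow> 'i) \<Rightarrow> 'i \<Rightarrow> (real^'n \<Rightarrow> real) \<Rightarrow> real^'n \<Rightarrow> real^'n" where
  "block_grad own i f x = grad (\<lambda>y. f (block_upd own i y x)) x"

definition pseudo_gradient ::
    "('n::finite \<Rightarrow> 'i) \<Rightarrow> ('i \<Rightarrow> real^'n \<Rightarrow> real) \<Rightarrow> real^'n \<Rightarrow> real^'n" where
  "pseudo_gradient own J x = (\<chi> l. block_grad own (own l) (J (own l)) x $ l)"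

definition coupling :: "('i::finite \<Rightarrow> real^'n \<Rightarrow> real^'m) \<Rightarrow> real^'n \<Rightarrow> real^'m" where
  "coupling g x = (\<Sum>i\<in>UNIV. g i x)"

definition feasible :: "(real^'n) set \<Rightarrow> ('i::finite \<Rightarrow> real^'n \<Rightarrow> real^'m) \<Rightarrow> (real^'n) set" where
  "feasible \<Omega> g = \<Omega> \<inter> {x. coupling g x \<le> 0}"

text \<open>Strict inequality is required in every component, which is stronger than the strict
  part \<open><\<close> of the componentwise order on \<open>real^'m\<close>.\<close>

definition slater :: "(real^'n::finite) set \<Rightarrow> ('i::finite \<Rightarrow> real^'n \<Rightarrow> real^'m) \<Rightarrow> bool" where
  "slater \<Omega> g \<longleftrightarrow> (\<exists>x\<in>rel_interior \<Omega>. \<forall>a. coupling g x $ a < 0)"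

definition GNE ::
    "('n::finite \<Rightarrow> 'i::finite) \<Rightarrow> (real^'n) set \<Rightarrow> ('i \<Rightarrow> real^'n \<Rightarrow> real) \<Rightarrow>
     ('i \<Rightarrow> real^'n \<Rightarrow> real^'m) \<Rightarrow> real^'n \<Rightarrow> bool" where
  "GNE own \<Omega> J g x \<longleftrightarrow>
     (\<forall>i. is_arg_min (\<lambda>y. J i (block_upd own i y x)) (\<lambda>y. block_upd own i y x \<in> feasible \<Omega> g) x)"

definition KKT ::
    "('n::finite \<Rightarrow> 'i::finite) \<Rightarrow> (real^'n) set \<Rightarrow> ('i \<Rightarrow> real^'n \<Rightarrow> real) \<Rightarrow>
     ('i \<Rightarrow> real^'n \<Rightarrow> real^'m) \<Rightarrow> real^'n \<Rightarrow> real^'m::finite \<Rightarrow> bool" where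
  "KKT own \<Omega> J g x lam \<longleftrightarrow>
     x \<in> \<Omega> \<and> 0 \<le> lam \<and>
     0 \<in> (+) (pseudo_gradient own J x + transpose (jacobian (coupling g) (at x)) *v lam)
           ` normal_cone \<Omega> x \<and>
     0 \<in> (+) (- coupling g x) ` normal_cone {0..} lam"

definition v_GNE ::
    "('n::finite \<Rightarrow> 'i::finite) \<Rightarrow> (real^'n) set \<Rightarrow> ('i \<Rightarrow> real^'n \<Rightarrow> real) \<Rightarrow>
     ('i \<Rightarrow> real^'n \<Rightarrow> real^'m::finite) \<Rightarrow> real^'n \<Rightarrow> bool" where
  "v_GNE own \<Omega> J g x \<longleftrightarrow> GNE own \<Omega> J g x \<and> (\<exists>lam. KKT own \<Omega> J g x lam)"

section \<open>The closed loop\<close>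

text \<open>\<open>Deriv l j\<close> is the \<open>j\<close>-th time derivative of component \<open>l\<close>; \<open>Est i l\<close> is agent \<open>i\<close>'s estimate
  belonging to a component \<open>l\<close> of another agent; \<open>Gain i\<close>, \<open>Aux i a\<close> and \<open>Dual i a\<close> are \<open>k\<^sub>i\<close>
  and the \<open>a\<close>-th components of \<open>z\<^sub>i\<close> and \<open>\<lambda>\<^sub>i\<close>.\<close>

datatype ('i, 'n, 'm) coord = Deriv 'n nat | Est 'i 'n | Gain 'i | Aux 'i 'm | Dual 'i 'm

type_synonym ('i, 'n, 'm) state = "('i, 'n, 'm) coord \<Rightarrow> real"

definition coords :: "('n \<Rightarrow> 'i) \<Rightarrow> ('n \<Rightarrow> nat) \<Rightarrow> ('i, 'n, 'm) coord set" where
  "coords own r = {Deriv l j |l j. j < r l} \<union> {Est i l |i l. own l \<noteq> i}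
     \<union> range Gain \<union> {Aux i a |i a. True} \<union> {Dual i a |i a. True}"

definition aux_var :: "('i, 'n, 'm::finite) state \<Rightarrow> 'i \<Rightarrow> real^'m" where
  "aux_var s i = (\<chi> a. s (Aux i a))"

definition dual_var :: "('i, 'n, 'm::finite) state \<Rightarrow> 'i \<Rightarrow> real^'m" where
  "dual_var s i = (\<chi> a. s (Dual i a))"

text \<open>The sum is empty when \<open>r l = 1\<close>.\<close>

definition zeta ::
    "('n \<Rightarrow> nat) \<Rightarrow> ('n \<Rightarrow> nat \<Rightarrow> real) \<Rightarrow> ('i, 'n, 'm) state \<Rightarrow> 'n \<Rightarrow> real" where
  "zeta r c s l = s (Deriv l 0) + (\<Sum>j=1..r l - 1. c l j * s (Deriv l j))"

text \<open>The vector \<open>\<zeta>\<^sup>i\<close>: agent \<open>i\<close>'s own block holds the true \<open>\<zeta>\<^sub>i\<close>.\<close>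

definition estimate ::
    "('n::finite \<Rightarrow> 'i) \<Rightarrow> ('n \<Rightarrow> nat) \<Rightarrow> ('n \<Rightarrow> nat \<Rightarrow> real) \<Rightarrow>
     ('i, 'n, 'm) state \<Rightarrow> 'i \<Rightarrow> real^'n" where
  "estimate own r c s i = (\<chi> l. if own l = i then zeta r c s l else s (Est i l))"

definition neighbors :: "('i \<times> 'i) set \<Rightarrow> 'i \<Rightarrow> 'i set" where
  "neighbors E i = {j. (i, j) \<in> E}"

definition rho ::
    "('n::finite \<Rightarrow> 'i) \<Rightarrow> ('i \<times> 'i) set \<Rightarrow> ('n \<Rightarrow> nat) \<Rightarrow> ('n \<Rightarrow> nat \<Rightarrow> real) \<Rightarrow>
     ('i, 'n, 'm) state \<Rightarrow> 'i \<Rightarrow> real^'n" where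
  "rho own E r c s i = (\<Sum>j\<in>neighbors E i. estimate own r c s i - estimate own r c s j)"

definition weighted_disagreement ::
    "('n::finite \<Rightarrow> 'i) \<Rightarrow> ('i \<times> 'i) set \<Rightarrow> ('n \<Rightarrow> nat) \<Rightarrow> ('n \<Rightarrow> nat \<Rightarrow> real) \<Rightarrow>
     ('i, 'n, 'm) state \<Rightarrow> 'i \<Rightarrow> real^'n" where
  "weighted_disagreement own E r c s i =
     (\<Sum>j\<in>neighbors E i. s (Gain i) *\<^sub>R rho own E r c s i - s (Gain j) *\<^sub>R rho own E r c s j)"

definition dual_disagreement ::
    "('i \<times> 'i) set \<Rightarrow> ('i, 'n, 'm::finite) state \<Rightarrow> 'i \<Rightarrow> real^'m" where
  "dual_disagreement E s i = (\<Sum>j\<in>neighbors E i. dual_var s i - dual_var s j)"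

text \<open>Only the components in block \<open>i\<close> of this vector enter the dynamics. The Jacobian of \<open>g i\<close>
  has zero columns outside block \<open>i\<close>, since \<open>g i\<close> depends on block \<open>i\<close> only.\<close>

definition u_tilde ::
    "('n::finite \<Rightarrow> 'i) \<Rightarrow> ('i \<times> 'i) set \<Rightarrow> ('n \<Rightarrow> nat) \<Rightarrow> ('n \<Rightarrow> nat \<Rightarrow> real) \<Rightarrow>
     ('i \<Rightarrow> real^'n \<Rightarrow> real) \<Rightarrow> ('i \<Rightarrow> real^'n \<Rightarrow> real^'m::finite) \<Rightarrow>
     ('i, 'n, 'm) state \<Rightarrow> 'i \<Rightarrow> real^'n" where
  "u_tilde own E r c J g s i =
     - block_grad own i (J i) (estimate own r c s i)
     - transpose (jacobian (g i) (at (estimate own r c s i))) *v dual_var s i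
     - weighted_disagreement own E r c s i"

definition control ::
    "('n::finite \<Rightarrow> 'i) \<Rightarrow> ('i \<times> 'i) set \<Rightarrow> ('n \<Rightarrow> nat) \<Rightarrow> ('n \<Rightarrow> nat \<Rightarrow> real) \<Rightarrow>
     ('i \<Rightarrow> real^'n \<Rightarrow> real) \<Rightarrow> ('i \<Rightarrow> real^'n \<Rightarrow> real^'m::finite) \<Rightarrow>
     ('i, 'n, 'm) state \<Rightarrow> 'n \<Rightarrow> real" where
  "control own E r c J g s l =
     u_tilde own E r c J g s (own l) $ l - (\<Sum>j=1..r l - 1. c l (j - 1) * s (Deriv l j))"

fun closed_loop ::
    "('n::finite \<Rightarrow> 'i) \<Rightarrow> ('i \<times> 'i) set \<Rightarrow> ('i \<Rightarrow> real) \<Rightarrow> ('n \<Rightarrow> nat) \<Rightarrow> ('n \<Rightarrow> nat \<Rightarrow> real) \<Rightarrow>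
     ('i \<Rightarrow> real^'n \<Rightarrow> real) \<Rightarrow> ('i \<Rightarrow> real^'n \<Rightarrow> real^'m::finite) \<Rightarrow>
     ('i, 'n, 'm) state \<Rightarrow> ('i, 'n, 'm) coord \<Rightarrow> real" where
  "closed_loop own E \<gamma> r c J g s (Deriv l j) =
     (if Suc j < r l then s (Deriv l (Suc j)) else control own E r c J g s l)"
| "closed_loop own E \<gamma> r c J g s (Est i l) = - weighted_disagreement own E r c s i $ l"
| "closed_loop own E \<gamma> r c J g s (Gain i) = \<gamma> i * (norm (rho own E r c s i))\<^sup>2"
| "closed_loop own E \<gamma> r c J g s (Aux i a) = dual_disagreement E s i $ a"
| "closed_loop own E \<gamma> r c J g s (Dual i a) =
     proj_tangent {0..} (dual_var s i)
       (g i (estimate own r c s i) - aux_var s i - dual_disagreement E s i) $ a"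

end

theory Submission
  imports Defs "HOL-Computational_Algebra.Fundamental_Theorem_Algebra"
begin

text \<open>
  The variables \<open>\<zeta>\<close> turn every chain of integrators into a single integrator, so the loop is a
  primal-dual flow with estimates. With \<open>w\<^sub>i = \<integral> \<lambda>\<^sub>i\<close> one has \<open>z = L w\<close> for the graph Laplacian \<open>L\<close>;
  choosing \<open>L w' = z'\<close> for an equilibrium \<open>(x, \<lambda>', z')\<close> and a large constant gain \<open>k'\<close>,
  \<open>V = 1/2 \<Sum>|\<zeta>\<^sup>i - x|\<^sup>2 + \<Sum> (k\<^sub>i - k')\<^sup>2 / (2 \<gamma>\<^sub>i) + 1/2 \<Sum>|\<lambda>\<^sub>i - \<lambda>'|\<^sup>2 + 1/2 (w - w') \<bullet> (z - z')\<close>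
  decreases: the gain absorbs the errors due to the estimates. This bounds the solution and, by
  Barbalat's lemma, gives consensus at \<open>x\<close>. Along a suitable sequence of times the multipliers and
  \<open>z\<close> tend to another equilibrium; for that one \<open>V\<close> decreases to the contribution of the gains
  alone, which gives convergence. The chains then converge because they are filters of \<open>\<zeta>\<close> with
  Hurwitz characteristic polynomial. Solutions are obtained by a Picard iteration in which the
  projected components \<open>\<lambda>\<^sub>i\<close> are Skorokhod reflections of their unprojected integrals.
\<close>


section \<open>Absolute continuity\<close>

text \<open>Two features of the loop shape the proof. The projection makes the right-hand side
  discontinuous in the multipliers, so solutions are differentiable only almost everywhere:
  monotonicity has to be derived from almost-everywhere derivatives of absolutely continuous
  functions, and uniqueness rests on a one-sided Lipschitz estimate. The other terms are only
  locally Lipschitz, so a priori bounds on finite horizons come before existence, which is obtained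
  from a truncated field.

  The discontinuity also stands in the way of an invariance principle. Instead, the unprojected
  rates of the multipliers vary ever more slowly over windows of fixed length, because \<zeta>
  converges and \<open>L \<lambda>\<close>, the derivative of \<open>z\<close>, tends to 0; a
  limiting rate of the wrong sign would then contradict boundedness.

  The gain threshold depends on the game and the graph but not on the equilibrium, so the same
  construction serves the initial KKT point and the limit point found later. The second one matters
  because KKT fixes \<open>x\<close> but leaves the multipliers and \<open>z\<close> open.\<close>

lemma abs_continuous_on_subset:
  "abs_continuous_on S f \<Longrightarrow> S' \<subseteq> S \<Longrightarrow> abs_continuous_on S' f"
  unfolding abs_continuous_on_def by (meson subset_trans)

lemma division_length:
  fixes d :: "real set set"
  assumes "d division_of T" "K \<in> d"
  obtains a b where "K = {a..b}" "a \<le> b" "Inf K = a" "Sup K = b" "{a..b} \<subseteq> T"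
proof -
  obtain a b where ab: "K = cbox a b" "K \<noteq> {}" "K \<subseteq> T"
    using division_ofD(2,3,4)[OF assms(1)] assms(2) by metis
  then show thesis using that[of a b] by (auto simp: box_real)
qed

lemma abs_continuous_on_lipschitz:
  assumes "\<And>s t. s \<in> S \<Longrightarrow> t \<in> S \<Longrightarrow> \<bar>f s - f t\<bar> \<le> L * \<bar>s - t\<bar>"
  shows "abs_continuous_on S f"
  unfolding abs_continuous_on_def
proof (intro allI impI)
  fix e :: real assume e: "e > 0"
  show "\<exists>\<delta>>0. \<forall>d T. d division_of T \<and> T \<subseteq> S \<and> (\<Sum>K\<in>d. Sup K - Inf K) < \<delta> \<longrightarrow>
      (\<Sum>K\<in>d. \<bar>f (Sup K) - f (Inf K)\<bar>) < e"
  proof (intro exI[of _ "e / (\<bar>L\<bar> + 1)"] conjI allI impI)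
    show "e / (\<bar>L\<bar> + 1) > 0" using e by auto
    fix d T assume *: "d division_of T \<and> T \<subseteq> S \<and> (\<Sum>K\<in>d. Sup K - Inf K) < e / (\<bar>L\<bar> + 1)"
    have "(\<Sum>K\<in>d. \<bar>f (Sup K) - f (Inf K)\<bar>) \<le> (\<Sum>K\<in>d. (\<bar>L\<bar> + 1) * (Sup K - Inf K))"
    proof (rule sum_mono)
      fix K assume "K \<in> d"
      then obtain a b where K: "K = {a..b}" "a \<le> b" "Inf K = a" "Sup K = b" "{a..b} \<subseteq> T"
        using division_length * by metis
      have "\<bar>f b - f a\<bar> \<le> L * \<bar>b - a\<bar>" using assms[of b a] K(2,5) * by (auto simp: subset_iff)
      also have "\<dots> \<le> (\<bar>L\<bar> + 1) * (b - a)" using K(2) by (simp add: mult_right_mono)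
      finally show "\<bar>f (Sup K) - f (Inf K)\<bar> \<le> (\<bar>L\<bar> + 1) * (Sup K - Inf K)" using K by simp
    qed
    also have "\<dots> = (\<bar>L\<bar> + 1) * (\<Sum>K\<in>d. Sup K - Inf K)" by (simp add: sum_distrib_left)
    also have "\<dots> < (\<bar>L\<bar> + 1) * (e / (\<bar>L\<bar> + 1))"
      using * by (intro mult_strict_left_mono) auto
    also have "\<dots> = e" by (auto simp: field_simps)
    finally show "(\<Sum>K\<in>d. \<bar>f (Sup K) - f (Inf K)\<bar>) < e" .
  qed
qed

lemma abs_continuous_on_const: "abs_continuous_on S (\<lambda>t. c)"
  by (rule abs_continuous_on_lipschitz[where L = 0]) auto

lemma abs_continuous_on_imp_continuous:
  assumes "abs_continuous_on {a..b} f"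
  shows "continuous_on {a..b} f"
  unfolding continuous_on_iff
proof (intro ballI allI impI)
  fix x e :: real assume x: "x \<in> {a..b}" and e: "0 < e"
  obtain \<delta> where d: "\<delta> > 0" "\<And>d T. d division_of T \<Longrightarrow> T \<subseteq> {a..b} \<Longrightarrow> (\<Sum>K\<in>d. Sup K - Inf K) < \<delta>
      \<Longrightarrow> (\<Sum>K\<in>d. \<bar>f (Sup K) - f (Inf K)\<bar>) < e"
    using assms e unfolding abs_continuous_on_def by meson
  have main: "\<bar>f v - f u\<bar> < e" if "u \<le> v" "{u..v} \<subseteq> {a..b}" "v - u < \<delta>" for u v
  proof -
    have "{{u..v}} division_of {u..v}"
      using division_of_self[of u v] that by (simp add: cbox_interval)
    from d(2)[OF this that(2)] show ?thesis using that by simp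
  qed
  show "\<exists>d>0. \<forall>x'\<in>{a..b}. dist x' x < d \<longrightarrow> dist (f x') (f x) < e"
  proof (intro exI[of _ \<delta>] conjI ballI impI d(1))
    fix y assume y: "y \<in> {a..b}" "dist y x < \<delta>"
    show "dist (f y) (f x) < e"
      using main[of x y] main[of y x] x y by (cases "x \<le> y") (auto simp: dist_real_def abs_minus_commute)
  qed
qed

text \<open>A single closure principle: whatever has increments dominated by those of
  \<open>f\<close> and \<open>g\<close> inherits absolute continuity. Sums, differences and products
  are instances, and so is the transfer to a function that agrees with another one on
  \<open>S\<close>.\<close>

lemma abs_continuous_on_combine:
  assumes f: "abs_continuous_on S f" and g: "abs_continuous_on S g" and M: "M > 0"
    and h: "\<And>s t. s \<in> S \<Longrightarrow> t \<in> S \<Longrightarrow> \<bar>h s - h t\<bar> \<le> M * (\<bar>f s - f t\<bar> + \<bar>g s - g t\<bar>)"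
  shows "abs_continuous_on S h"
  unfolding abs_continuous_on_def
proof (intro allI impI)
  fix e :: real assume e: "e > 0"
  then have e': "e / (2 * M) > 0" using M by simp
  obtain \<delta>1 where d1: "\<delta>1 > 0" "\<And>d T. d division_of T \<Longrightarrow> T \<subseteq> S \<Longrightarrow> (\<Sum>K\<in>d. Sup K - Inf K) < \<delta>1
      \<Longrightarrow> (\<Sum>K\<in>d. \<bar>f (Sup K) - f (Inf K)\<bar>) < e / (2 * M)"
    using f e' unfolding abs_continuous_on_def by meson
  obtain \<delta>2 where d2: "\<delta>2 > 0" "\<And>d T. d division_of T \<Longrightarrow> T \<subseteq> S \<Longrightarrow> (\<Sum>K\<in>d. Sup K - Inf K) < \<delta>2
      \<Longrightarrow> (\<Sum>K\<in>d. \<bar>g (Sup K) - g (Inf K)\<bar>) < e / (2 * M)"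
    using g e' unfolding abs_continuous_on_def by meson
  show "\<exists>\<delta>>0. \<forall>d T. d division_of T \<and> T \<subseteq> S \<and> (\<Sum>K\<in>d. Sup K - Inf K) < \<delta> \<longrightarrow>
      (\<Sum>K\<in>d. \<bar>h (Sup K) - h (Inf K)\<bar>) < e"
  proof (intro exI[of _ "min \<delta>1 \<delta>2"] conjI allI impI)
    fix d T assume *: "d division_of T \<and> T \<subseteq> S \<and> (\<Sum>K\<in>d. Sup K - Inf K) < min \<delta>1 \<delta>2"
    have "(\<Sum>K\<in>d. \<bar>h (Sup K) - h (Inf K)\<bar>)
        \<le> (\<Sum>K\<in>d. M * (\<bar>f (Sup K) - f (Inf K)\<bar> + \<bar>g (Sup K) - g (Inf K)\<bar>))"
    proof (rule sum_mono)
      fix K assume "K \<in> d"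
      then obtain a b where K: "K = {a..b}" "a \<le> b" "Inf K = a" "Sup K = b" "{a..b} \<subseteq> T"
        using division_length * by metis
      show "\<bar>h (Sup K) - h (Inf K)\<bar> \<le> M * (\<bar>f (Sup K) - f (Inf K)\<bar> + \<bar>g (Sup K) - g (Inf K)\<bar>)"
        using h[of b a] K * by (auto simp: subset_iff)
    qed
    also have "\<dots> = M * ((\<Sum>K\<in>d. \<bar>f (Sup K) - f (Inf K)\<bar>) + (\<Sum>K\<in>d. \<bar>g (Sup K) - g (Inf K)\<bar>))"
      unfolding sum.distrib[symmetric] sum_distrib_left ..
    also have "\<dots> < M * (e / (2 * M) + e / (2 * M))"
      using d1(2)[of d T] d2(2)[of d T] * M by (intro mult_strict_left_mono add_strict_mono) auto
    also have "\<dots> = e" using M by (auto simp: field_simps)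
    finally show "(\<Sum>K\<in>d. \<bar>h (Sup K) - h (Inf K)\<bar>) < e" .
  qed (use d1 d2 in auto)
qed

lemma abs_continuous_on_add:
  "abs_continuous_on S f \<Longrightarrow> abs_continuous_on S g \<Longrightarrow> abs_continuous_on S (\<lambda>t. f t + g t)"
  by (rule abs_continuous_on_combine[where M = 1 and f = f and g = g]) auto

lemma abs_continuous_on_diff:
  "abs_continuous_on S f \<Longrightarrow> abs_continuous_on S g \<Longrightarrow> abs_continuous_on S (\<lambda>t. f t - g t)"
  by (rule abs_continuous_on_combine[where M = 1 and f = f and g = g]) auto

lemma abs_continuous_on_sum:
  "(\<And>x. x \<in> A \<Longrightarrow> abs_continuous_on S (f x)) \<Longrightarrow> abs_continuous_on S (\<lambda>t. \<Sum>x\<in>A. f x t)"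
  by (induction A rule: infinite_finite_induct)
     (auto intro: abs_continuous_on_const abs_continuous_on_add)

lemma abs_continuous_on_mult:
  assumes f: "abs_continuous_on {a..b} f" and g: "abs_continuous_on {a..b} g"
  shows "abs_continuous_on {a..b} (\<lambda>t. f t * g t)"
proof -
  have "bounded (f ` {a..b})" "bounded (g ` {a..b})"
    using f g abs_continuous_on_imp_continuous compact_continuous_image compact_imp_bounded compact_Icc by metis+
  then obtain B1 B2 where B: "\<And>t. t \<in> {a..b} \<Longrightarrow> \<bar>f t\<bar> \<le> B1" "\<And>t. t \<in> {a..b} \<Longrightarrow> \<bar>g t\<bar> \<le> B2"
    unfolding bounded_iff real_norm_def ball_simps by blast
  define M where "M = max 1 (max B1 B2)"
  show ?thesis
  proof (rule abs_continuous_on_combine[OF f g, of M])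
    show "M > 0" by (simp add: M_def)
    fix s t assume st: "s \<in> {a..b}" "t \<in> {a..b}"
    have "\<bar>f s * g s - f t * g t\<bar> = \<bar>(f s - f t) * g s + f t * (g s - g t)\<bar>" by (simp add: algebra_simps)
    also have "\<dots> \<le> \<bar>f s - f t\<bar> * \<bar>g s\<bar> + \<bar>f t\<bar> * \<bar>g s - g t\<bar>"
      by (metis abs_mult abs_triangle_ineq)
    also have "\<dots> \<le> \<bar>f s - f t\<bar> * M + M * \<bar>g s - g t\<bar>"
      using B[of s] B[of t] st by (intro add_mono mult_mono) (auto simp: M_def)
    finally show "\<bar>f s * g s - f t * g t\<bar> \<le> M * (\<bar>f s - f t\<bar> + \<bar>g s - g t\<bar>)"
      by (simp add: algebra_simps)
  qed
qed

lemma abs_continuous_on_C1: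
  fixes f :: "real \<Rightarrow> real"
  assumes d: "\<And>t. t \<in> {a..b} \<Longrightarrow> (f has_real_derivative f' t) (at t within {a..b})"
    and c: "continuous_on {a..b} f'"
  shows "abs_continuous_on {a..b} f"
proof -
  have "bounded (f' ` {a..b})"
    using c compact_continuous_image compact_imp_bounded compact_Icc by metis
  then obtain B where B: "\<And>t. t \<in> {a..b} \<Longrightarrow> \<bar>f' t\<bar> \<le> B"
    unfolding bounded_iff real_norm_def ball_simps by blast
  show ?thesis
  proof (rule abs_continuous_on_lipschitz[where L = B])
    fix s t assume "s \<in> {a..b}" "t \<in> {a..b}"
    then show "\<bar>f s - f t\<bar> \<le> B * \<bar>s - t\<bar>"
      using field_differentiable_bound[of "{a..b}" f f' B s t] d B by (auto simp: real_norm_def)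
  qed
qed

section \<open>Increments from almost-everywhere derivatives\<close>

lemma sum_length_division:
  fixes d :: "real set set"
  assumes "d division_of T"
  shows "(\<Sum>K\<in>d. Sup K - Inf K) = measure lebesgue T"
proof -
  have "measure lebesgue (\<Union>d) = (\<Sum>K\<in>d. measure lebesgue K)"
  proof (rule measure_negligible_finite_Union)
    show "finite d" using assms by auto
    show "K \<in> lmeasurable" if K: "K \<in> d" for K
      using division_length[OF assms K] by (metis lmeasurable_interval(1))
    show "pairwise (\<lambda>S T. negligible (S \<inter> T)) d"
    proof (rule pairwiseI)
      fix K L assume KL: "K \<in> d" "L \<in> d" "K \<noteq> L"
      then have i: "interior K \<inter> interior L = {}" using division_ofD(5)[OF assms] by blast
      obtain a b where ab: "K = {a..b}" using division_length[OF assms KL(1)] by metis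
      obtain u v where uv: "L = {u..v}" using division_length[OF assms KL(2)] by metis
      \<comment> \<open>Intervals with disjoint interiors meet in end points at most, so their
        lengths add up like measures. This is how small measure of an open cover becomes small total
        length.\<close>
      have "K \<inter> L \<subseteq> {a,b,u,v}"
      proof
        fix x assume x: "x \<in> K \<inter> L"
        show "x \<in> {a,b,u,v}"
        proof (rule ccontr)
          assume "x \<notin> {a,b,u,v}"
          then have "x \<in> {a<..<b}" "x \<in> {u<..<v}" using x ab uv by auto
          then show False using i ab uv by (auto simp: interior_cbox)
        qed
      qed
      then show "negligible (K \<inter> L)" by (meson finite.emptyI finite.insertI finite_subset negligible_finite)
    qed
  qed
  moreover have "measure lebesgue K = Sup K - Inf K" if K: "K \<in> d" for K
  proof -
    obtain a b where "K = {a..b}" "a \<le> b" "Inf K = a" "Sup K = b"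
      using division_length[OF assms K] by metis
    then show ?thesis by simp
  qed
  moreover have "\<Union>d = T" using assms by auto
  ultimately show ?thesis by simp
qed

text \<open>On a Cousin partition, intervals tagged outside the null set are controlled by the
  derivative, and the remaining ones have small total length, hence small total variation.\<close>

lemma AE_deriv_nonpos_imp_le:
  fixes f :: "real \<Rightarrow> real"
  assumes ab: "a \<le> b" and ac: "abs_continuous_on {a..b} f"
    and der: "AE t in lebesgue. a \<le> t \<and> t \<le> b \<longrightarrow> (\<exists>D\<le>0. (f has_real_derivative D) (at t))"
  shows "f b \<le> f a"
proof (rule field_le_epsilon)
  fix \<epsilon>0 :: real assume "\<epsilon>0 > 0"
  define e where "e = \<epsilon>0 / (b - a + 1)"
  have e: "e > 0" "e * (b - a) + e = \<epsilon>0"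
  proof -
    have "b - a + 1 > 0" using ab by simp
    then show "e > 0" using \<open>\<epsilon>0 > 0\<close> by (simp add: e_def)
    have "e * (b - a) + e = e * (b - a + 1)" by (simp add: algebra_simps)
    also have "\<dots> = \<epsilon>0" using \<open>b - a + 1 > 0\<close> by (simp add: e_def)
    finally show "e * (b - a) + e = \<epsilon>0" .
  qed
  obtain \<delta> where d: "\<delta> > 0" "\<And>d T. d division_of T \<Longrightarrow> T \<subseteq> {a..b} \<Longrightarrow> (\<Sum>K\<in>d. Sup K - Inf K) < \<delta>
      \<Longrightarrow> (\<Sum>K\<in>d. \<bar>f (Sup K) - f (Inf K)\<bar>) < e"
    using ac e unfolding abs_continuous_on_def by meson
  obtain N where N0: "N \<in> null_sets lebesgue"
    "{t \<in> space lebesgue. \<not> (a \<le> t \<and> t \<le> b \<longrightarrow> (\<exists>D\<le>0. (f has_real_derivative D) (at t)))} \<subseteq> N"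
    using der unfolding eventually_ae_filter by blast
  have N: "N \<in> null_sets lebesgue"
    "\<And>t. t \<notin> N \<Longrightarrow> a \<le> t \<Longrightarrow> t \<le> b \<Longrightarrow> \<exists>D\<le>0. (f has_real_derivative D) (at t)"
    using N0 by auto
  \<comment> \<open>Outer regularity: the null set is covered by an open set of measure below the
    \<delta> that absolute continuity assigns to \<open>e\<close>.\<close>
  obtain G where G: "open G" "N \<subseteq> G" "G - N \<in> lmeasurable" "emeasure lebesgue (G - N) < ennreal \<delta>"
    using sets_lebesgue_outer_open[of N \<delta>] N(1) d(1) by auto
  have Nm: "N \<in> lmeasurable" "measure lebesgue N = 0"
    using N(1) unfolding negligible_iff_null_sets[symmetric] negligible_iff_measure by auto
  have Gm: "G \<in> lmeasurable" "measure lebesgue G < \<delta>"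
  proof -
    have G_eq: "G = (G - N) \<union> N" using G(2) by auto
    have "(G - N) \<union> N \<in> lmeasurable" using G(3) Nm(1) by (rule fmeasurable.Un)
    then show "G \<in> lmeasurable" using G_eq by simp
    have "measure lebesgue ((G - N) \<union> N) \<le> measure lebesgue (G - N) + measure lebesgue N"
      by (rule measure_Un_le) (use G(3) Nm(1) in auto)
    then have "measure lebesgue G \<le> measure lebesgue (G - N)" using G_eq Nm(2) by simp
    also have "\<dots> < \<delta>"
      using G(3,4) d(1) by (simp add: emeasure_eq_measure2 ennreal_less_iff)
    finally show "measure lebesgue G < \<delta>" .
  qed
  \<comment> \<open>Straddle estimate: the two one-sided inequalities add up to an upper bound for
    the increment over any small interval that contains \<open>t\<close>, wherever \<open>t\<close>
    lies in it.\<close>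
  have "\<exists>r>0. \<forall>s. \<bar>s - t\<bar> < r \<longrightarrow> (s \<ge> t \<longrightarrow> f s - f t \<le> e * (s - t)) \<and> (s \<le> t \<longrightarrow> f t - f s \<le> e * (t - s))"
    if t: "t \<in> {a..b}" "t \<notin> N" for t
  proof -
    obtain D where D: "D \<le> 0" "(f has_real_derivative D) (at t)" using N(2)[of t] t by auto
    have "(f has_derivative (\<lambda>h. h * D)) (at t)" using D(2) by (simp add: has_field_derivative_def mult_commute_abs)
    then obtain r where r: "r > 0" "\<And>s. norm (s - t) < r \<Longrightarrow> norm (f s - f t - (s - t) * D) \<le> e * norm (s - t)"
      using e(1) unfolding has_derivative_at_alt by blast
    show ?thesis
    proof (intro exI[of _ r] conjI allI impI r(1))
      fix s assume s: "\<bar>s - t\<bar> < r"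
      { assume st: "s \<ge> t"
        have "(s - t) * D \<le> 0" using st D(1) by (simp add: mult_nonneg_nonpos)
        then show "f s - f t \<le> e * (s - t)" using r(2)[of s] s st by auto }
      { assume st: "s \<le> t"
        have "(s - t) * D \<ge> 0" using st D(1) by (simp add: mult_nonpos_nonpos)
        then show "f t - f s \<le> e * (t - s)" using r(2)[of s] s st by auto }
    qed
  qed
  then have "\<forall>t\<in>{a..b} - N. \<exists>r>0. \<forall>s. \<bar>s - t\<bar> < r \<longrightarrow>
      (s \<ge> t \<longrightarrow> f s - f t \<le> e * (s - t)) \<and> (s \<le> t \<longrightarrow> f t - f s \<le> e * (t - s))"
    by blast
  from bchoice[OF this] obtain rad where "\<forall>t\<in>{a..b} - N. rad t > 0 \<and> (\<forall>s. \<bar>s - t\<bar> < rad t \<longrightarrow>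
      (s \<ge> t \<longrightarrow> f s - f t \<le> e * (s - t)) \<and> (s \<le> t \<longrightarrow> f t - f s \<le> e * (t - s)))"
    by auto
  then have rad: "\<And>t. t \<in> {a..b} \<Longrightarrow> t \<notin> N \<Longrightarrow> rad t > 0"
    "\<And>t s. t \<in> {a..b} \<Longrightarrow> t \<notin> N \<Longrightarrow> \<bar>s - t\<bar> < rad t \<Longrightarrow> s \<ge> t \<Longrightarrow> f s - f t \<le> e * (s - t)"
    "\<And>t s. t \<in> {a..b} \<Longrightarrow> t \<notin> N \<Longrightarrow> \<bar>s - t\<bar> < rad t \<Longrightarrow> s \<le> t \<Longrightarrow> f t - f s \<le> e * (t - s)"
    by blast+
  \<comment> \<open>Intervals tagged in the null set are forced into \<open>G\<close>, all others
    into the radius of the straddle estimate. Points outside \<open>{a..b}\<close> never occur as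
    tags.\<close>
  define \<gamma> where "\<gamma> t = (if t \<in> N then G else if t \<in> {a..b} then ball t (rad t) else UNIV)" for t
  have "gauge \<gamma>" unfolding gauge_def \<gamma>_def using G rad(1) by auto
  then obtain p where p: "p tagged_division_of {a..b}" "\<gamma> fine p" using fine_division_exists_real by blast
  have fin: "finite p" using p(1) by auto
  define p1 where "p1 = {x\<in>p. fst x \<in> N}"
  have "f b - f a = (\<Sum>(x,K)\<in>p. f (Sup K) - f (Inf K))"
    using additive_tagged_division_1[OF ab p(1), of f] by simp
  also have "\<dots> = (\<Sum>(x,K)\<in>p1. f (Sup K) - f (Inf K)) + (\<Sum>(x,K)\<in>p - p1. f (Sup K) - f (Inf K))"
    by (subst sum.subset_diff[of p1 p]) (auto simp: p1_def fin)
  also have "(\<Sum>(x,K)\<in>p - p1. f (Sup K) - f (Inf K)) \<le> (\<Sum>(x,K)\<in>p - p1. e * (Sup K - Inf K))"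
  proof (rule sum_mono, clarify)
    fix x K assume xK: "(x, K) \<in> p" "(x, K) \<notin> p1"
    then have x: "x \<in> K" "K \<subseteq> {a..b}" "x \<notin> N" using p(1) by (auto simp: p1_def)
    obtain u v where K: "K = cbox u v" using p(1) xK by blast
    have uv: "u \<le> x" "x \<le> v" "Inf K = u" "Sup K = v" using x K by auto
    have "K \<subseteq> ball x (rad x)"
      using p(2) xK x by (force simp: fine_def \<gamma>_def)
    moreover have "u \<in> K" "v \<in> K" using K uv by auto
    ultimately have "u \<in> ball x (rad x)" "v \<in> ball x (rad x)" by auto
    then have "\<bar>u - x\<bar> < rad x" "\<bar>v - x\<bar> < rad x" by (simp_all add: dist_real_def abs_minus_commute)
    then have "f v - f x \<le> e * (v - x)" "f x - f u \<le> e * (x - u)"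
      using rad(2)[of x v] rad(3)[of x u] x uv by auto
    then show "f (Sup K) - f (Inf K) \<le> e * (Sup K - Inf K)" using uv by (simp add: algebra_simps)
  qed
  also have "(\<Sum>(x,K)\<in>p - p1. e * (Sup K - Inf K)) \<le> (\<Sum>(x,K)\<in>p. e * (Sup K - Inf K))"
  proof (rule sum_mono2)
    fix y assume "y \<in> p - (p - p1)"
    moreover obtain x K where y: "y = (x, K)" by fastforce
    ultimately have "(x, K) \<in> p" by auto
    then have x: "x \<in> K" "\<exists>u v. K = cbox u v" using tagged_division_ofD(2,4)[OF p(1)] by blast+
    then have "Inf K \<le> Sup K" by auto
    then show "0 \<le> (case y of (x, K) \<Rightarrow> e * (Sup K - Inf K))" using e(1) y by auto
  qed (use fin in auto)
  also have "(\<Sum>(x,K)\<in>p. e * (Sup K - Inf K)) = e * (b - a)"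
    using additive_tagged_division_1[OF ab p(1), of "\<lambda>t. e * t"] by (simp add: algebra_simps)
  also have "(\<Sum>(x,K)\<in>p1. f (Sup K) - f (Inf K)) \<le> (\<Sum>(x,K)\<in>p1. \<bar>f (Sup K) - f (Inf K)\<bar>)"
    by (rule sum_mono) auto
  also have "\<dots> < e"
  proof -
    have pp: "p1 tagged_division_of (\<Union>(snd ` p1))"
    proof (rule tagged_partial_division_of_Union_self)
      have "p tagged_partial_division_of {a..b}" using p(1) by (simp add: tagged_division_of_def)
      then show "p1 tagged_partial_division_of {a..b}"
        by (rule tagged_partial_division_subset) (auto simp: p1_def)
    qed
    have dd: "snd ` p1 division_of (\<Union>(snd ` p1))" by (rule division_of_tagged_division[OF pp])
    \<comment> \<open>\<open>Sup {}\<close> and \<open>Inf {}\<close> have no prescribed values,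
      while the passage from tagged pairs to their intervals requires degenerate boxes to contribute
      0. Hence the explicit value on the empty set.\<close>
    define v where "v K = (if K = {} then 0 else \<bar>f (Sup K) - f (Inf K)\<bar>)" for K
    have ne: "K \<noteq> {}" if "K \<in> snd ` p1" for K using division_ofD(3)[OF dd that] .
    have "(\<Sum>(x,K)\<in>p1. \<bar>f (Sup K) - f (Inf K)\<bar>) = (\<Sum>(x,K)\<in>p1. v K)"
      by (rule sum.cong) (use ne in \<open>force simp: v_def\<close>)+
    also have "\<dots> = (\<Sum>K\<in>snd ` p1. v K)"
    proof (rule sum.over_tagged_division_lemma[OF pp])
      fix a b :: real assume "box a b = {}"
      then show "v (cbox a b) = 0"
        by (cases "a = b") (auto simp: v_def)
    qed
    also have "\<dots> = (\<Sum>K\<in>snd ` p1. \<bar>f (Sup K) - f (Inf K)\<bar>)"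
      by (rule sum.cong) (use ne in \<open>auto simp: v_def\<close>)
    also have "\<dots> < e"
    proof (rule d(2)[OF dd])
      show "\<Union> (snd ` p1) \<subseteq> {a..b}" using p(1) by (force simp: p1_def)
      have "(\<Sum>K\<in>snd ` p1. Sup K - Inf K) = measure lebesgue (\<Union>(snd ` p1))"
        by (rule sum_length_division[OF dd])
      also have "\<dots> \<le> measure lebesgue G"
      proof (rule measure_mono_fmeasurable)
        show "\<Union> (snd ` p1) \<subseteq> G" using p(2) by (force simp: p1_def fine_def \<gamma>_def)
        show "\<Union> (snd ` p1) \<in> sets lebesgue"
        proof (rule sets.finite_Union)
          show "finite (snd ` p1)" using dd by auto
          show "snd ` p1 \<subseteq> sets lebesgue"
          proof
            fix K assume "K \<in> snd ` p1"
            then obtain u v where "K = {u..v}" using division_length[OF dd] by metis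
            then show "K \<in> sets lebesgue" by simp
          qed
        qed
        show "G \<in> lmeasurable" by (rule Gm)
      qed
      finally show "(\<Sum>K\<in>snd ` p1. Sup K - Inf K) < \<delta>" using Gm(2) by simp
    qed
    finally show ?thesis .
  qed
  finally have "f b - f a \<le> e * (b - a) + e" by simp
  then show "f b \<le> f a + \<epsilon>0" using e(2) by simp
qed

lemma AE_deriv_le_imp_diff_le:
  fixes f h :: "real \<Rightarrow> real"
  assumes ab: "a \<le> b" and ac: "abs_continuous_on {a..b} f" and h: "continuous_on {a..b} h"
    and der: "AE t in lebesgue. a \<le> t \<and> t \<le> b \<longrightarrow> (\<exists>D\<le>h t. (f has_real_derivative D) (at t))"
  shows "f b - f a \<le> integral {a..b} h"
proof -
  define H where "H t = integral {a..t} h" for t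
  have H: "(H has_real_derivative h t) (at t within {a..b})" if "t \<in> {a..b}" for t
    unfolding H_def using integral_has_real_derivative[OF h that] by simp
  have "f b - H b \<le> f a - H a"
  proof (rule AE_deriv_nonpos_imp_le[OF ab])
    show "abs_continuous_on {a..b} (\<lambda>t. f t - H t)"
      by (intro abs_continuous_on_diff ac abs_continuous_on_C1[OF H h])
    \<comment> \<open>At the end points the primitive has a one-sided derivative only; they form a
      null set.\<close>
    have ends: "AE t in lebesgue. t \<noteq> a" "AE t in lebesgue. t \<noteq> b"
      by (rule AE_completion[OF AE_lborel_singleton])+
    show "AE t in lebesgue. a \<le> t \<and> t \<le> b \<longrightarrow> (\<exists>D\<le>0. ((\<lambda>t. f t - H t) has_real_derivative D) (at t))"
      using der ends
    proof eventually_elim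
      case (elim t)
      show ?case
      proof
        assume t: "a \<le> t \<and> t \<le> b"
        then obtain D where D: "D \<le> h t" "(f has_real_derivative D) (at t)" using elim by auto
        have "(H has_real_derivative h t) (at t)"
          using H[of t] t elim at_within_Icc_at[of a t b] by auto
        then show "\<exists>D\<le>0. ((\<lambda>t. f t - H t) has_real_derivative D) (at t)"
          using D by (intro exI[of _ "D - h t"]) (auto intro!: derivative_eq_intros)
      qed
    qed
  qed
  then show ?thesis by (simp add: H_def)
qed

lemma AE_deriv_eq_imp_diff_eq:
  fixes f h :: "real \<Rightarrow> real"
  assumes ab: "a \<le> b" and ac: "abs_continuous_on {a..b} f" and h: "continuous_on {a..b} h"
    and der: "AE t in lebesgue. a \<le> t \<and> t \<le> b \<longrightarrow> (f has_real_derivative h t) (at t)"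
  shows "f b - f a = integral {a..b} h"
proof -
  have "f b - f a \<le> integral {a..b} h"
  proof (rule AE_deriv_le_imp_diff_le[OF ab ac h])
    show "AE t in lebesgue. a \<le> t \<and> t \<le> b \<longrightarrow> (\<exists>D\<le>h t. (f has_real_derivative D) (at t))"
      using der by eventually_elim auto
  qed
  moreover have "(\<lambda>t. 0 - f t) b - (\<lambda>t. 0 - f t) a \<le> integral {a..b} (\<lambda>t. - h t)"
  proof (rule AE_deriv_le_imp_diff_le[OF ab])
    show "abs_continuous_on {a..b} (\<lambda>t. 0 - f t)"
      by (intro abs_continuous_on_diff ac abs_continuous_on_const)
    show "continuous_on {a..b} (\<lambda>t. - h t)" using h by (intro continuous_intros)
    show "AE t in lebesgue. a \<le> t \<and> t \<le> b \<longrightarrow>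
        (\<exists>D\<le>- h t. ((\<lambda>t. 0 - f t) has_real_derivative D) (at t))"
      using der by eventually_elim (auto intro!: derivative_eq_intros exI)
  qed
  ultimately show ?thesis by simp
qed

text \<open>Such a function is a primitive of its continuous almost-everywhere derivative, hence
  differentiable everywhere. All coordinates of a solution except the multipliers become classically
  differentiable in this way.\<close>

lemma AE_deriv_continuous_imp_deriv:
  fixes f h :: "real \<Rightarrow> real"
  assumes ac: "abs_continuous_on {a..b} f" and h: "continuous_on {a..b} h"
    and der: "AE t in lebesgue. a \<le> t \<and> t \<le> b \<longrightarrow> (f has_real_derivative h t) (at t)"
    and t: "t \<in> {a..b}"
  shows "(f has_real_derivative h t) (at t within {a..b})"
proof -
  have eq: "f s = f a + integral {a..s} h" if s: "s \<in> {a..b}" for s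
  proof -
    have "f s - f a = integral {a..s} h"
    proof (rule AE_deriv_eq_imp_diff_eq)
      show "a \<le> s" using s by simp
      show "abs_continuous_on {a..s} f" using ac s by (auto intro: abs_continuous_on_subset)
      show "continuous_on {a..s} h" using h s by (auto intro: continuous_on_subset)
      show "AE t in lebesgue. a \<le> t \<and> t \<le> s \<longrightarrow> (f has_real_derivative h t) (at t)"
        using der s by (auto elim!: eventually_mono)
    qed
    then show ?thesis by simp
  qed
  have "((\<lambda>s. f a + integral {a..s} h) has_real_derivative h t) (at t within {a..b})"
    using integral_has_real_derivative[OF h t] by (auto intro!: derivative_eq_intros)
  then show ?thesis
    by (rule has_field_derivative_transform_within[OF _ zero_less_one t]) (rule eq[symmetric])
qed

lemma AE_deriv_bounded_imp_lipschitz: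
  fixes f :: "real \<Rightarrow> real"
  assumes ab: "a \<le> b" and ac: "abs_continuous_on {a..b} f"
    and der: "AE t in lebesgue. a \<le> t \<and> t \<le> b \<longrightarrow> (\<exists>D. \<bar>D\<bar> \<le> K \<and> (f has_real_derivative D) (at t))"
  shows "\<bar>f b - f a\<bar> \<le> K * (b - a)"
proof -
  have "f b - f a \<le> integral {a..b} (\<lambda>t. K)"
  proof (rule AE_deriv_le_imp_diff_le[OF ab ac])
    show "AE t in lebesgue. a \<le> t \<and> t \<le> b \<longrightarrow> (\<exists>D\<le>K. (f has_real_derivative D) (at t))"
      using der by eventually_elim (meson abs_le_D1)
  qed auto
  moreover have "(\<lambda>t. 0 - f t) b - (\<lambda>t. 0 - f t) a \<le> integral {a..b} (\<lambda>t. K)"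
  proof (rule AE_deriv_le_imp_diff_le[OF ab])
    show "abs_continuous_on {a..b} (\<lambda>t. 0 - f t)"
      by (intro abs_continuous_on_diff ac abs_continuous_on_const)
    show "AE t in lebesgue. a \<le> t \<and> t \<le> b \<longrightarrow> (\<exists>D\<le>K. ((\<lambda>t. 0 - f t) has_real_derivative D) (at t))"
      using der
    proof eventually_elim
      case (elim t)
      show ?case
      proof
        assume "a \<le> t \<and> t \<le> b"
        then obtain D where "\<bar>D\<bar> \<le> K" "(f has_real_derivative D) (at t)" using elim by auto
        then show "\<exists>D\<le>K. ((\<lambda>t. 0 - f t) has_real_derivative D) (at t)"
          by (intro exI[of _ "- D"]) (auto intro!: derivative_eq_intros)
      qed
    qed
  qed auto
  ultimately show ?thesis using ab by (auto simp: algebra_simps)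
qed

section \<open>Skorokhod reflection\<close>

text \<open>The running maximum of the negative part of \<open>Y\<close>: the least nondecreasing
  nonnegative function whose addition keeps the path from becoming negative.\<close>

definition regulator :: "(real \<Rightarrow> real) \<Rightarrow> real \<Rightarrow> real" where
  "regulator Y t = Sup ((\<lambda>s. max 0 (- Y s)) ` {0..t})"

text \<open>The Skorokhod reflection of a path at the origin.\<close>

definition reflected :: "(real \<Rightarrow> real) \<Rightarrow> real \<Rightarrow> real" where
  "reflected Y t = Y t + regulator Y t"

context
  fixes Y :: "real \<Rightarrow> real"
  assumes Y: "continuous_on {0..} Y"
begin

lemma regulator_bdd: "bdd_above ((\<lambda>s. max 0 (- Y s)) ` {0..t})"
proof -
  have "continuous_on {0..t} (\<lambda>s. max 0 (- Y s))"
    by (intro continuous_intros continuous_on_subset[OF Y]) auto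
  then show ?thesis
    by (meson bounded_imp_bdd_above compact_Icc compact_continuous_image compact_imp_bounded)
qed

lemma regulator_upper: "0 \<le> s \<Longrightarrow> s \<le> t \<Longrightarrow> max 0 (- Y s) \<le> regulator Y t"
  unfolding regulator_def by (rule cSUP_upper[OF _ regulator_bdd]) auto

lemma regulator_least:
  "0 \<le> t \<Longrightarrow> (\<And>s. 0 \<le> s \<Longrightarrow> s \<le> t \<Longrightarrow> max 0 (- Y s) \<le> B) \<Longrightarrow> regulator Y t \<le> B"
  unfolding regulator_def by (rule cSUP_least) auto

lemma regulator_mono: "0 \<le> s \<Longrightarrow> s \<le> t \<Longrightarrow> regulator Y s \<le> regulator Y t"
  by (rule regulator_least) (auto intro: regulator_upper[THEN order_trans[rotated]] order_trans[OF regulator_upper])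

lemma regulator_nonneg: "0 \<le> t \<Longrightarrow> 0 \<le> regulator Y t"
  using regulator_upper[of 0 t] by auto

lemma reflected_nonneg: "0 \<le> t \<Longrightarrow> 0 \<le> reflected Y t"
  using regulator_upper[of t t] by (auto simp: reflected_def)

lemma reflected_0: "0 \<le> Y 0 \<Longrightarrow> reflected Y 0 = Y 0"
  by (simp add: reflected_def regulator_def)

lemma regulator_attained:
  assumes "0 \<le> t" obtains u where "0 \<le> u" "u \<le> t" "regulator Y t = max 0 (- Y u)"
proof -
  have "continuous_on {0..t} (\<lambda>s. max 0 (- Y s))"
    by (intro continuous_intros continuous_on_subset[OF Y]) auto
  then obtain u where u: "u \<in> {0..t}" "\<And>s. s \<in> {0..t} \<Longrightarrow> max 0 (- Y s) \<le> max 0 (- Y u)"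
    using continuous_attains_sup[of "{0..t}" "\<lambda>s. max 0 (- Y s)"] assms by auto
  have "regulator Y t = max 0 (- Y u)"
    using regulator_least[OF assms, of "max 0 (- Y u)"] regulator_upper[of u t] u by force
  then show thesis using that u by auto
qed

text \<open>The regulator grows only while the reflected path is at zero. At a point
  \<open>u\<close> where a positive running maximum is attained one has
  \<open>Y u + regulator Y t = 0\<close>, so \<open>u\<close> cannot lie where the reflected path is
  positive.\<close>

lemma regulator_const_closed:
  assumes "0 \<le> s" "s \<le> t" "\<And>u. s < u \<Longrightarrow> u \<le> t \<Longrightarrow> reflected Y u > 0"
  shows "regulator Y t = regulator Y s"
proof -
  obtain u where u: "0 \<le> u" "u \<le> t" "regulator Y t = max 0 (- Y u)"
    using regulator_attained[of t] assms by auto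
  have "regulator Y t \<le> regulator Y s"
  proof (cases "u \<le> s")
    case True then show ?thesis using u regulator_upper[of u s] by auto
  next
    case False
    then have "reflected Y u > 0" using assms u by auto
    then have "Y u + regulator Y t > 0" using regulator_mono[OF u(1,2)] by (simp add: reflected_def)
    then have "regulator Y t \<le> 0" using u(3) by linarith
    then show ?thesis using regulator_nonneg[of s] assms by simp
  qed
  then show ?thesis using regulator_mono[OF assms(1,2)] by simp
qed

lemma regulator_lipschitz:
  assumes lip: "\<And>s t. 0 \<le> s \<Longrightarrow> s \<le> t \<Longrightarrow> t \<le> T \<Longrightarrow> \<bar>Y t - Y s\<bar> \<le> K * (t - s)" and st: "0 \<le> s" "s \<le> t" "t \<le> T" "0 \<le> K"
  shows "\<bar>regulator Y t - regulator Y s\<bar> \<le> K * (t - s)"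
proof -
  have "regulator Y t \<le> regulator Y s + K * (t - s)"
  proof (rule regulator_least)
    fix u assume u: "0 \<le> u" "u \<le> t"
    show "max 0 (- Y u) \<le> regulator Y s + K * (t - s)"
    proof (cases "u \<le> s")
      case True then show ?thesis using u regulator_upper[of u s] st by (auto intro: add_increasing2)
    next
      case False
      then have "\<bar>Y u - Y s\<bar> \<le> K * (u - s)" using lip[of s u] st u by auto
      also have "\<dots> \<le> K * (t - s)" using u st by (intro mult_left_mono) auto
      finally have "- Y u \<le> - Y s + K * (t - s)" by linarith
      then show ?thesis using regulator_upper[of s s] st by auto
    qed
  qed (use st in auto)
  then show ?thesis using regulator_mono[OF st(1,2)] by simp
qed

end

lemma regulator_diff:
  assumes Y: "continuous_on {0..} Y" and Z: "continuous_on {0..} Z" and t: "0 \<le> t"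
    and d: "\<And>s. 0 \<le> s \<Longrightarrow> s \<le> t \<Longrightarrow> \<bar>Y s - Z s\<bar> \<le> d"
  shows "\<bar>regulator Y t - regulator Z t\<bar> \<le> d"
proof -
  have "regulator Y t \<le> regulator Z t + d"
  proof (rule regulator_least[OF Y t])
    fix s assume s: "0 \<le> s" "s \<le> t"
    then show "max 0 (- Y s) \<le> regulator Z t + d"
      using d[OF s] regulator_upper[OF Z s] by (auto simp: max_def split: if_splits)
  qed
  moreover have "regulator Z t \<le> regulator Y t + d"
  proof (rule regulator_least[OF Z t])
    fix s assume s: "0 \<le> s" "s \<le> t"
    then show "max 0 (- Z s) \<le> regulator Y t + d"
      using d[OF s] regulator_upper[OF Y s] by (auto simp: max_def split: if_splits)
  qed
  ultimately show ?thesis by simp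
qed

text \<open>A supremum is 1-Lipschitz for the uniform distance of histories, and the path itself
  adds another 1. The resulting factor 2 reappears in the rate of the Picard iteration.\<close>

lemma reflected_diff:
  assumes Y: "continuous_on {0..} Y" and Z: "continuous_on {0..} Z" and t: "0 \<le> t"
    and d: "\<And>s. 0 \<le> s \<Longrightarrow> s \<le> t \<Longrightarrow> \<bar>Y s - Z s\<bar> \<le> d"
  shows "\<bar>reflected Y t - reflected Z t\<bar> \<le> 2 * d"
  using regulator_diff[OF assms] d[of t] t by (simp add: reflected_def)

lemma C1_lipschitz_on_Icc:
  fixes Y v :: "real \<Rightarrow> real"
  assumes dY: "\<And>t. t \<ge> 0 \<Longrightarrow> (Y has_real_derivative v t) (at t within {0..})" and v: "continuous_on {0..} v"
  obtains K where "K \<ge> 0" "\<And>s t. 0 \<le> s \<Longrightarrow> s \<le> t \<Longrightarrow> t \<le> T \<Longrightarrow> \<bar>Y t - Y s\<bar> \<le> K * (t - s)"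
proof -
  have "continuous_on {0..T} v" by (rule continuous_on_subset[OF v]) auto
  then have "bounded (v ` {0..T})"
    using compact_continuous_image compact_imp_bounded compact_Icc by metis
  then obtain K where K: "\<And>t. t \<in> {0..T} \<Longrightarrow> \<bar>v t\<bar> \<le> K"
    unfolding bounded_iff real_norm_def ball_simps by blast
  show thesis
  proof (rule that[of "max 0 K"])
    fix s t assume st: "0 \<le> s" "s \<le> t" "t \<le> T"
    have "norm (Y t - Y s) \<le> max 0 K * norm (t - s)"
    proof (rule field_differentiable_bound[of "{0..T}" Y v])
      fix z assume z: "z \<in> {0..T}"
      then show "(Y has_field_derivative v z) (at z within {0..T})"
        using dY[of z] by (auto intro: has_field_derivative_subset)
      show "norm (v z) \<le> max 0 K" using K[OF z] by auto
    qed (use st in auto)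
    then show "\<bar>Y t - Y s\<bar> \<le> max 0 K * (t - s)" using st by simp
  qed auto
qed

lemma continuous_on_Ici:
  fixes f :: "real \<Rightarrow> 'a::topological_space"
  assumes "\<And>T. continuous_on {0..T} f"
  shows "continuous_on {0..} f"
  unfolding continuous_on_eq_continuous_within
proof
  fix t :: real assume t: "t \<in> {0..}"
  then have "continuous (at t within {0..t+1}) f"
    using assms[of "t+1"] by (simp add: continuous_on_eq_continuous_within)
  moreover have "at t within {0..t+1} = at t within {0..}"
    by (rule at_within_nhd[of _ "{..<t+1}"]) auto
  ultimately show "continuous (at t within {0..}) f" by simp
qed

text \<open>Yields the beginning of the excursion away from zero that contains \<open>t\<close>; the
  mirror image \<open>first_zero\<close> yields the end of an excursion.\<close>

lemma last_zero:
  fixes h :: "real \<Rightarrow> real"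
  assumes "continuous_on {s..t} h" "h s = 0" "h t \<noteq> 0" "s \<le> t"
  obtains a where "s \<le> a" "a < t" "h a = 0" "\<And>u. a < u \<Longrightarrow> u \<le> t \<Longrightarrow> h u \<noteq> 0"
proof -
  define Z where "Z = {u \<in> {s..t}. h u = 0}"
  have "closed Z" unfolding Z_def using continuous_closed_preimage_constant[OF assms(1)] by simp
  then have "compact Z" unfolding Z_def
    by (metis (no_types, lifting) bounded_closed_interval bounded_subset compact_eq_bounded_closed mem_Collect_eq subsetI)
  moreover have "s \<in> Z" using assms by (simp add: Z_def)
  ultimately obtain a where a: "a \<in> Z" "\<And>u. u \<in> Z \<Longrightarrow> u \<le> a" using compact_attains_sup[of Z] by blast
  show thesis
  proof (rule that[of a])
    show "a < t" using a(1) assms(3) by (cases "a = t") (auto simp: Z_def)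
    fix u assume u: "a < u" "u \<le> t"
    show "h u \<noteq> 0"
    proof
      assume "h u = 0"
      then have "u \<in> Z" using u a(1) by (simp add: Z_def)
      then show False using a(2)[of u] u by simp
    qed
  qed (use a in \<open>auto simp: Z_def\<close>)
qed

lemma first_zero:
  fixes h :: "real \<Rightarrow> real"
  assumes "continuous_on {s..t} h" "h t = 0" "h s \<noteq> 0" "s \<le> t"
  obtains a where "s < a" "a \<le> t" "h a = 0" "\<And>u. s \<le> u \<Longrightarrow> u < a \<Longrightarrow> h u \<noteq> 0"
proof -
  have "continuous_on {-t..-s} (\<lambda>x. h (- x))"
    by (intro continuous_on_compose2[OF assms(1)] continuous_intros) auto
  then obtain a where a: "-t \<le> a" "a < -s" "h (-a) = 0" "\<And>u. a < u \<Longrightarrow> u \<le> -s \<Longrightarrow> h (-u) \<noteq> 0"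
    using last_zero[of "-t" "-s" "\<lambda>x. h (- x)"] assms by auto
  show thesis
  proof (rule that[of "-a"])
    fix u assume "s \<le> u" "u < -a"
    then show "h u \<noteq> 0" using a(4)[of "-u"] by auto
  qed (use a in auto)
qed

section \<open>Derivatives of the reflection of a continuously differentiable path\<close>

context
  fixes Y v :: "real \<Rightarrow> real"
  assumes dY: "\<And>t. t \<ge> 0 \<Longrightarrow> (Y has_real_derivative v t) (at t within {0..})"
    and v: "continuous_on {0..} v"
begin

lemma Y_cont: "continuous_on {0..} Y"
  using dY by (meson DERIV_continuous atLeast_iff continuous_on_eq_continuous_within)

lemma reflected_lipschitz:
  obtains M where "M \<ge> 0" "\<And>s t. 0 \<le> s \<Longrightarrow> s \<le> t \<Longrightarrow> t \<le> T \<Longrightarrow> \<bar>reflected Y t - reflected Y s\<bar> \<le> M * (t - s)"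
proof -
  obtain K where K: "K \<ge> 0" "\<And>s t. 0 \<le> s \<Longrightarrow> s \<le> t \<Longrightarrow> t \<le> T \<Longrightarrow> \<bar>Y t - Y s\<bar> \<le> K * (t - s)"
    using C1_lipschitz_on_Icc[OF dY v] by blast
  show thesis
  proof (rule that[of "2 * K"])
    fix s t assume st: "0 \<le> s" "s \<le> t" "t \<le> T"
    show "\<bar>reflected Y t - reflected Y s\<bar> \<le> 2 * K * (t - s)"
      using regulator_lipschitz[OF Y_cont K(2) st K(1)] K(2)[OF st] by (simp add: reflected_def)
  qed (use K in auto)
qed

lemma reflected_AC: "abs_continuous_on {0..T} (reflected Y)"
proof -
  obtain M where M: "M \<ge> 0" "\<And>s t. 0 \<le> s \<Longrightarrow> s \<le> t \<Longrightarrow> t \<le> T \<Longrightarrow> \<bar>reflected Y t - reflected Y s\<bar> \<le> M * (t - s)"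
    using reflected_lipschitz[of T] by blast
  show ?thesis
  proof (rule abs_continuous_on_lipschitz)
    fix s t assume "s \<in> {0..T}" "t \<in> {0..T}"
    then show "\<bar>reflected Y s - reflected Y t\<bar> \<le> M * \<bar>s - t\<bar>"
      using M(2)[of s t] M(2)[of t s] by (cases "s \<le> t") (auto simp: abs_minus_commute)
  qed
qed

lemma reflected_cont: "continuous_on {0..} (reflected Y)"
  by (rule continuous_on_Ici) (rule abs_continuous_on_imp_continuous[OF reflected_AC])

text \<open>Both end points may be zeros, so the formula covers whole excursions.
  \<open>regulator_const_closed\<close> tolerates a zero on the left, and continuity of the
  regulator extends the constancy to the right end.\<close>

lemma reflected_increment_pos:
  assumes "0 \<le> s" "s < t" "\<And>u. s < u \<Longrightarrow> u < t \<Longrightarrow> reflected Y u > 0"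
  shows "reflected Y t - reflected Y s = Y t - Y s"
proof -
  have eq: "regulator Y u = regulator Y s" if "u \<in> {s<..<t}" for u
    by (rule regulator_const_closed[OF Y_cont]) (use assms that in auto)
  have "continuous_on {s..t} (\<lambda>u. reflected Y u - Y u)"
    by (intro continuous_intros continuous_on_subset[OF reflected_cont] continuous_on_subset[OF Y_cont]) (use assms in auto)
  then have "continuous_on (closure {s<..<t}) (regulator Y)"
    using assms by (simp add: reflected_def)
  then have "regulator Y t = regulator Y s"
    by (rule continuous_constant_on_closure) (use eq assms in auto)
  then show ?thesis by (simp add: reflected_def)
qed

lemma dY_at: "t > 0 \<Longrightarrow> (Y has_real_derivative v t) (at t)"
  using dY[of t] at_within_interior[of t "{0..}"] by simp

lemma v_near:
  assumes "t > 0" "e > 0"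
  obtains r where "r > 0" "r \<le> t" "\<And>u. t - r < u \<Longrightarrow> u < t + r \<Longrightarrow> \<bar>v u - v t\<bar> < e"
proof -
  have "isCont v t" using v assms(1) by (intro continuous_on_interior[of "{0..}"]) auto
  then obtain d where d: "d > 0" "\<And>u. \<bar>u - t\<bar> < d \<Longrightarrow> \<bar>v u - v t\<bar> < e"
    unfolding continuous_at_eps_delta using assms(2) by (auto simp: dist_real_def)
  show thesis
    by (rule that[of "min d t"]) (use d assms in auto)
qed

lemma Y_mvt:
  assumes "0 \<le> s" "s < t" obtains \<xi> where "s < \<xi>" "\<xi> < t" "Y t - Y s = (t - s) * v \<xi>"
proof -
  have "\<exists>\<xi>\<in>{s<..<t}. Y t - Y s = (\<lambda>h. v \<xi> * h) (t - s)"
  proof (rule mvt_simple[OF assms(2)])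
    fix \<tau> assume "s \<le> \<tau>" "\<tau> \<le> t"
    then have "(Y has_real_derivative v \<tau>) (at \<tau> within {s..t})"
      using dY[of \<tau>] assms by (auto intro: has_field_derivative_subset)
    then show "(Y has_derivative (\<lambda>h. v \<tau> * h)) (at \<tau> within {s..t})"
      by (simp add: has_field_derivative_def)
  qed
  then show thesis using that by (auto simp: mult.commute)
qed

lemma reflected_deriv_pos:
  assumes t: "t > 0" "reflected Y t > 0"
  shows "(reflected Y has_real_derivative v t) (at t)"
proof -
  have "isCont (reflected Y) t" using reflected_cont t by (intro continuous_on_interior[of "{0..}"]) auto
  then obtain d where d: "d > 0" "\<And>u. \<bar>u - t\<bar> < d \<Longrightarrow> \<bar>reflected Y u - reflected Y t\<bar> < reflected Y t"
    unfolding continuous_at_eps_delta using t(2) by (auto simp: dist_real_def)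
  then have pos: "reflected Y u > 0" if "\<bar>u - t\<bar> < d" for u using that d(2)[of u] by linarith
  define r where "r = min d t"
  have eq: "Y u + regulator Y t = reflected Y u" if u: "u \<in> {t-r<..<t+r}" for u
  proof (cases "u \<le> t")
    case True
    have "regulator Y t = regulator Y u"
      by (rule regulator_const_closed[OF Y_cont]) (use u pos True in \<open>auto simp: r_def\<close>)
    then show ?thesis by (simp add: reflected_def)
  next
    case False
    have "regulator Y u = regulator Y t"
      by (rule regulator_const_closed[OF Y_cont]) (use u pos False t in \<open>auto simp: r_def\<close>)
    then show ?thesis by (simp add: reflected_def)
  qed
  have "((\<lambda>u. Y u + regulator Y t) has_real_derivative v t) (at t)"
    using dY_at[OF t(1)] by (auto intro!: derivative_eq_intros)
  then show ?thesis
    by (rule has_field_derivative_transform_within_open[of _ _ _ "{t-r<..<t+r}"])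
       (use eq d t in \<open>auto simp: r_def\<close>)
qed

text \<open>A positive drift makes \<open>Y\<close> increase strictly just before \<open>t\<close>,
  while the regulator never decreases. The reflected path would then arrive at \<open>t\<close>
  strictly above zero.\<close>

lemma reflected_zero_imp_drift_nonpos:
  assumes t: "t > 0" "reflected Y t = 0"
  shows "v t \<le> 0"
proof (rule ccontr)
  assume "\<not> v t \<le> 0"
  then obtain r where r: "r > 0" "r \<le> t" "\<And>u. t - r < u \<Longrightarrow> u < t + r \<Longrightarrow> \<bar>v u - v t\<bar> < v t"
    using v_near[OF t(1), of "v t"] by auto
  obtain \<xi> where \<xi>: "t - r < \<xi>" "\<xi> < t" "Y t - Y (t - r) = (t - (t - r)) * v \<xi>"
    using Y_mvt[of "t - r" t] r by auto
  have "\<bar>v \<xi> - v t\<bar> < v t" by (rule r(3)) (use \<xi> r in auto)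
  then have "v \<xi> > 0" by linarith
  then have "r * v \<xi> > 0" using r(1) by simp
  then have "Y t > Y (t - r)" using \<xi>(3) by simp
  moreover have "regulator Y t \<ge> regulator Y (t - r)" using r by (intro regulator_mono[OF Y_cont]) auto
  moreover have "reflected Y (t - r) \<ge> 0" using r by (intro reflected_nonneg[OF Y_cont]) auto
  ultimately show False using t(2) by (simp add: reflected_def)
qed

text \<open>Away from zeros the reflected path near \<open>t\<close> equals an increment of
  \<open>Y\<close>, taken from the last zero on the left of the point or to the next zero on its
  right. Both zeros lie no farther than \<open>t\<close>, and \<open>Y\<close> has slope below
  \<open>e\<close> there.\<close>

lemma reflected_deriv_zero_drift:
  assumes t: "t > 0" "reflected Y t = 0" "v t = 0"
  shows "(reflected Y has_real_derivative 0) (at t)"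
  unfolding has_field_derivative_def has_derivative_at_alt
proof (intro conjI allI impI)
  fix e :: real assume e: "e > 0"
  obtain r where r: "r > 0" "r \<le> t" "\<And>u. t - r < u \<Longrightarrow> u < t + r \<Longrightarrow> \<bar>v u\<bar> < e"
    using v_near[OF t(1) e] t(3) by auto
  have inc: "\<bar>Y b - Y a\<bar> \<le> e * (b - a)" if ab: "t - r < a" "a < b" "b < t + r" for a b
  proof -
    obtain \<xi> where \<xi>: "a < \<xi>" "\<xi> < b" "Y b - Y a = (b - a) * v \<xi>"
      by (rule Y_mvt[of a b]) (use ab r in auto)
    have "\<bar>v \<xi>\<bar> < e" by (rule r(3)) (use \<xi> ab in auto)
    then have "\<bar>v \<xi>\<bar> \<le> e" by simp
    then show ?thesis using \<xi>(3) ab by (simp add: abs_mult mult.commute mult_right_mono)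
  qed
  show "\<exists>d>0. \<forall>y. norm (y - t) < d \<longrightarrow> norm (reflected Y y - reflected Y t - 0 * (y - t)) \<le> e * norm (y - t)"
  proof (intro exI[of _ r] conjI allI impI r(1))
    fix u assume "norm (u - t) < r"
    then have u: "t - r < u" "u < t + r" "0 \<le> u" using r(2) by auto
    have nn: "reflected Y w \<ge> 0" if "0 \<le> w" for w by (rule reflected_nonneg[OF Y_cont that])
    have cont: "continuous_on {a..b} (reflected Y)" if "0 \<le> a" for a b
      by (rule continuous_on_subset[OF reflected_cont]) (use that in auto)
    have "reflected Y u \<le> e * \<bar>u - t\<bar>"
    proof (cases "reflected Y u = 0")
      case True then show ?thesis using e by simp
    next
      case False
      then consider "u > t" | "u < t" using t(2) by fastforce
      then show ?thesis
      proof cases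
        case 1
        obtain a where a: "t \<le> a" "a < u" "reflected Y a = 0" "\<And>w. a < w \<Longrightarrow> w \<le> u \<Longrightarrow> reflected Y w \<noteq> 0"
          using last_zero[OF cont t(2) False] 1 t(1) by auto
        have "reflected Y u - reflected Y a = Y u - Y a"
        proof (rule reflected_increment_pos)
          fix w assume "a < w" "w < u"
          then show "reflected Y w > 0" using a(4)[of w] nn[of w] a(1) t(1) by force
        qed (use a t in auto)
        then have "reflected Y u \<le> e * (u - a)" using inc[of a u] a r u by auto
        also have "\<dots> \<le> e * \<bar>u - t\<bar>" using a e by (intro mult_left_mono) auto
        finally show ?thesis .
      next
        case 2
        obtain b where b: "u < b" "b \<le> t" "reflected Y b = 0" "\<And>w. u \<le> w \<Longrightarrow> w < b \<Longrightarrow> reflected Y w \<noteq> 0"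
          using first_zero[OF cont t(2) False] 2 u by auto
        have "reflected Y b - reflected Y u = Y b - Y u"
        proof (rule reflected_increment_pos)
          fix w assume "u < w" "w < b"
          then show "reflected Y w > 0" using b(4)[of w] nn[of w] u by force
        qed (use b u in auto)
        then have "reflected Y u \<le> e * (b - u)" using inc[of u b] b r u by auto
        also have "\<dots> \<le> e * \<bar>u - t\<bar>" using b e by (intro mult_left_mono) auto
        finally show ?thesis .
      qed
    qed
    then show "norm (reflected Y u - reflected Y t - 0 * (u - t)) \<le> e * norm (u - t)"
      using nn[OF u(3)] t(2) by simp
  qed
qed (rule bounded_linear_mult_right)

text \<open>A time of non-differentiability is the right end of an excursion away from zero whose
  drift there is negative; such excursions are disjoint intervals.\<close>

lemma countable_reflected_nondiff:
  "countable {t. t > 0 \<and> reflected Y t = 0 \<and> \<not> (reflected Y has_real_derivative 0) (at t)}"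
  (is "countable ?X")
proof -
  have "\<exists>r>0. \<forall>s. t - r < s \<longrightarrow> s < t \<longrightarrow> reflected Y s \<noteq> 0" if tX: "t \<in> ?X" for t
  proof -
    from tX have t: "t > 0" "reflected Y t = 0" "\<not> (reflected Y has_real_derivative 0) (at t)" by auto
    have "v t < 0"
      using reflected_zero_imp_drift_nonpos[OF t(1,2)] reflected_deriv_zero_drift[OF t(1,2)] t(3) by fastforce
    then obtain r where r: "r > 0" "r \<le> t" "\<And>u. t - r < u \<Longrightarrow> u < t + r \<Longrightarrow> \<bar>v u - v t\<bar> < - v t"
      using v_near[OF t(1), of "- v t"] by auto
    have neg: "Y b < Y a" if ab: "t - r < a" "a < b" "b < t + r" for a b
    proof -
      obtain \<xi> where \<xi>: "a < \<xi>" "\<xi> < b" "Y b - Y a = (b - a) * v \<xi>"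
        by (rule Y_mvt[of a b]) (use ab r in auto)
      have "\<bar>v \<xi> - v t\<bar> < - v t" by (rule r(3)) (use \<xi> ab in auto)
      then have "v \<xi> < 0" by linarith
      then have "Y b - Y a < 0" using \<xi> ab by (simp add: mult_pos_neg)
      then show ?thesis by simp
    qed
    have "reflected Y s \<noteq> 0" if s: "t - r < s" "s < t" for s
    proof
      assume zs: "reflected Y s = 0"
      \<comment> \<open>An excursion beginning in this window would follow \<open>Y\<close>, which
        decreases strictly here, and would become negative. So one zero before \<open>t\<close> pins
        the path to zero up to and beyond \<open>t\<close>, giving derivative 0 at
        \<open>t\<close>.\<close>
      have zero: "reflected Y u = 0" if u: "s \<le> u" "u < t + r" for u
      proof (rule ccontr)
        assume nz: "reflected Y u \<noteq> 0"
        have "continuous_on {s..u} (reflected Y)"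
          by (rule continuous_on_subset[OF reflected_cont]) (use s r in auto)
        then obtain a where a: "s \<le> a" "a < u" "reflected Y a = 0" "\<And>w. a < w \<Longrightarrow> w \<le> u \<Longrightarrow> reflected Y w \<noteq> 0"
          using last_zero[of s u "reflected Y"] zs nz u by auto
        have "reflected Y u - reflected Y a = Y u - Y a"
        proof (rule reflected_increment_pos)
          fix w assume w: "a < w" "w < u"
          then show "reflected Y w > 0" using a(4)[of w] reflected_nonneg[OF Y_cont, of w] a(1) s r by force
        qed (use a s r in auto)
        then have "reflected Y u < 0" using neg[of a u] a s u by auto
        then show False using reflected_nonneg[OF Y_cont, of u] u s r by auto
      qed
      have "(reflected Y has_real_derivative 0) (at t)"
        by (rule has_field_derivative_transform_within_open[of "\<lambda>_. 0" _ _ "{s<..<t+r}"])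
           (use zero s r in auto)
      then show False using t(3) by simp
    qed
    then show ?thesis using r(1) by blast
  qed
  then have "\<forall>t\<in>?X. \<exists>r. r > 0 \<and> (\<forall>s. t - r < s \<longrightarrow> s < t \<longrightarrow> reflected Y s \<noteq> 0)" by blast
  from bchoice[OF this] obtain r where
    rr: "\<forall>t\<in>?X. r t > 0 \<and> (\<forall>s. t - r t < s \<longrightarrow> s < t \<longrightarrow> reflected Y s \<noteq> 0)" ..
  have r: "r t > 0" if "t \<in> ?X" for t using rr that by blast
  have rn: "reflected Y s \<noteq> 0" if "t \<in> ?X" "t - r t < s" "s < t" for s t using rr that by blast
  define I where "I t = {t - r t<..<t}" for t
  have sep: "I t \<inter> I t' = {}" if "t \<in> ?X" "t' \<in> ?X" "t < t'" for t t'
  proof -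
    have "reflected Y t = 0" using that(1) by simp
    then have "t \<le> t' - r t'" using rn[OF that(2), of t] that(3) by force
    then show ?thesis by (auto simp: I_def)
  qed
  have ne: "I t \<noteq> {}" if "t \<in> ?X" for t using r[OF that] by (simp add: I_def)
  have disj: "I t \<inter> I t' = {}" if "t \<in> ?X" "t' \<in> ?X" "t \<noteq> t'" for t t'
    using sep[of t t'] sep[of t' t] that by (cases "t < t'") (auto simp: Int_commute)
  have "countable (I ` ?X)"
  proof (rule countable_disjoint_open_subsets)
    show "\<And>S. S \<in> I ` ?X \<Longrightarrow> open S" by (auto simp: I_def)
    show "disjoint (I ` ?X)"
    proof (rule pairwiseI)
      fix A B assume "A \<in> I ` ?X" "B \<in> I ` ?X" "A \<noteq> B"
      then obtain t t' where "A = I t" "B = I t'" "t \<in> ?X" "t' \<in> ?X" "t \<noteq> t'" by blast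
      then show "disjnt A B" unfolding disjnt_def using disj by blast
    qed
  qed
  moreover have "inj_on I ?X"
  proof (rule inj_onI)
    fix t t' assume "t \<in> ?X" "t' \<in> ?X" "I t = I t'"
    then show "t = t'" using disj[of t t'] ne[of t] by blast
  qed
  ultimately show ?thesis by (rule countable_image_inj_on)
qed

text \<open>At a zero the drift is nonpositive, so \<open>max 0 (v t)\<close> is 0 and agrees with
  the derivative found outside a countable set. This is the form of the projected rate of a
  multiplier.\<close>

lemma reflected_deriv_AE:
  "AE t in lebesgue. 0 \<le> t \<longrightarrow>
     (reflected Y has_real_derivative (if reflected Y t \<le> 0 then max 0 (v t) else v t)) (at t)"
proof -
  let ?X = "{t. t > 0 \<and> reflected Y t = 0 \<and> \<not> (reflected Y has_real_derivative 0) (at t)}"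
  have "countable (?X \<union> {0})"
    using countable_reflected_nondiff by auto
  then have "AE t in lebesgue. t \<notin> ?X \<union> {0}"
    by (intro AE_completion AE_not_in countable_imp_null_set_lborel)
  then show ?thesis
  proof eventually_elim
    case (elim t)
    show ?case
    proof
      assume "0 \<le> t"
      then have t: "t > 0" using elim by auto
      show "(reflected Y has_real_derivative (if reflected Y t \<le> 0 then max 0 (v t) else v t)) (at t)"
      proof (cases "reflected Y t \<le> 0")
        case True
        then have z: "reflected Y t = 0" using reflected_nonneg[OF Y_cont, of t] t by auto
        then have "max 0 (v t) = 0" using reflected_zero_imp_drift_nonpos[OF t] by auto
        then show ?thesis using True elim t z by auto
      next
        case False
        then show ?thesis using reflected_deriv_pos[OF t] by auto
      qed
    qed
  qed
qed

end

section \<open>Lipschitz differential equations with reflected components\<close>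

context
  fixes C D :: "'c set" and f :: "('c \<Rightarrow> real) \<Rightarrow> 'c \<Rightarrow> real" and K :: real and s\<^sub>0 :: "'c \<Rightarrow> real"
  assumes finC: "finite C" and K: "K \<ge> 0"
    and lip: "\<And>s s' q. q \<in> C \<Longrightarrow> \<bar>f s q - f s' q\<bar> \<le> K * (\<Sum>p\<in>C. \<bar>s p - s' p\<bar>)"
    and s0: "\<And>q. q \<in> D \<Longrightarrow> s\<^sub>0 q \<ge> 0"
begin

definition driver :: "(real \<Rightarrow> 'c \<Rightarrow> real) \<Rightarrow> 'c \<Rightarrow> real \<Rightarrow> real" where
  "driver X q t = s\<^sub>0 q + integral {0..t} (\<lambda>\<tau>. f (X \<tau>) q)"

definition picard :: "(real \<Rightarrow> 'c \<Rightarrow> real) \<Rightarrow> real \<Rightarrow> 'c \<Rightarrow> real" where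
  "picard X t q = (if q \<in> D then reflected (driver X q) t else driver X q t)"

definition cont_path :: "(real \<Rightarrow> 'c \<Rightarrow> real) \<Rightarrow> bool" where
  "cont_path X \<longleftrightarrow> (\<forall>q\<in>C. continuous_on {0..} (\<lambda>t. X t q))"

lemma f_cont:
  assumes "cont_path X" "q \<in> C"
  shows "continuous_on {0..} (\<lambda>t. f (X t) q)"
  unfolding continuous_on_def
proof
  fix t :: real assume t: "t \<in> {0..}"
  have "((\<lambda>\<tau>. K * (\<Sum>p\<in>C. \<bar>X \<tau> p - X t p\<bar>)) \<longlongrightarrow> K * (\<Sum>p\<in>C. \<bar>X t p - X t p\<bar>)) (at t within {0..})"
    by (intro tendsto_intros) (use assms t in \<open>auto simp: cont_path_def continuous_on_def\<close>)
  then have *: "((\<lambda>\<tau>. K * (\<Sum>p\<in>C. \<bar>X \<tau> p - X t p\<bar>)) \<longlongrightarrow> 0) (at t within {0..})" by simp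
  have "((\<lambda>\<tau>. f (X \<tau>) q - f (X t) q) \<longlongrightarrow> 0) (at t within {0..})"
    by (rule Lim_null_comparison[OF _ *]) (use lip[OF assms(2)] in auto)
  then show "((\<lambda>\<tau>. f (X \<tau>) q) \<longlongrightarrow> f (X t) q) (at t within {0..})"
    by (simp add: LIM_zero_iff)
qed

lemma driver_deriv:
  assumes "cont_path X" "q \<in> C" "t \<ge> 0"
  shows "(driver X q has_real_derivative f (X t) q) (at t within {0..})"
proof -
  have "continuous_on {0..t+1} (\<lambda>t. f (X t) q)"
    by (rule continuous_on_subset[OF f_cont[OF assms(1,2)]]) auto
  moreover have "t \<in> {0..t+1}" using assms(3) by simp
  ultimately have "((\<lambda>u. integral {0..u} (\<lambda>t. f (X t) q)) has_real_derivative f (X t) q) (at t within {0..t+1})"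
    by (rule integral_has_real_derivative)
  then have "(driver X q has_real_derivative f (X t) q) (at t within {0..t+1})"
    unfolding driver_def[abs_def] by (auto intro!: derivative_eq_intros)
  moreover have "at t within {0..t+1} = at t within {0..}"
    by (rule at_within_nhd[of _ "{..<t+1}"]) auto
  ultimately show ?thesis by simp
qed

lemma driver_cont:
  assumes "cont_path X" "q \<in> C"
  shows "continuous_on {0..} (driver X q)"
  unfolding continuous_on_eq_continuous_within
proof
  fix t :: real assume "t \<in> {0..}"
  then have "(driver X q has_real_derivative f (X t) q) (at t within {0..})"
    using driver_deriv[OF assms] by simp
  then show "continuous (at t within {0..}) (driver X q)" by (rule DERIV_continuous)
qed

lemma picard_cont: "cont_path X \<Longrightarrow> cont_path (picard X)"
  unfolding cont_path_def[of "picard X"] picard_def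
proof
  fix q assume X: "cont_path X" and q: "q \<in> C"
  show "continuous_on {0..} (\<lambda>t. if q \<in> D then reflected (driver X q) t else driver X q t)"
    using driver_cont[OF X q] reflected_cont[OF driver_deriv[OF X q] f_cont[OF X q]] by (cases "q \<in> D") auto
qed

text \<open>The bound keeps the integral of \<open>e\<close> instead of its maximum. Iterated, it
  produces factorials, so the scheme converges on every interval without splitting time into short
  steps.\<close>

lemma picard_diff:
  assumes X: "cont_path X" and X': "cont_path X'" and q: "q \<in> C" and t: "0 \<le> t"
    and e: "continuous_on {0..t} e"
    and le: "\<And>\<tau> p. 0 \<le> \<tau> \<Longrightarrow> \<tau> \<le> t \<Longrightarrow> p \<in> C \<Longrightarrow> \<bar>X \<tau> p - X' \<tau> p\<bar> \<le> e \<tau>"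
  shows "\<bar>picard X t q - picard X' t q\<bar> \<le> 2 * K * real (card C) * integral {0..t} e"
proof -
  have e0: "0 \<le> e \<tau>" if "0 \<le> \<tau>" "\<tau> \<le> t" for \<tau> using le[OF that q] by linarith
  \<comment> \<open>Reflection compares whole histories, so the estimate is required for every
    \<open>u\<close> up to \<open>t\<close>. Since \<open>e\<close> is nonnegative, its integral
    over \<open>{0..t}\<close> serves for all of them.\<close>
  have driver: "\<bar>driver X q u - driver X' q u\<bar> \<le> K * real (card C) * integral {0..t} e"
    if u: "0 \<le> u" "u \<le> t" for u
  proof -
    have cf: "continuous_on {0..u} (\<lambda>t. f (X t) q)" "continuous_on {0..u} (\<lambda>t. f (X' t) q)"
      using continuous_on_subset[OF f_cont[OF X q]] continuous_on_subset[OF f_cont[OF X' q]] by auto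
    have eu: "continuous_on {0..u} e" by (rule continuous_on_subset[OF e]) (use u in auto)
    have "driver X q u - driver X' q u = integral {0..u} (\<lambda>\<tau>. f (X \<tau>) q - f (X' \<tau>) q)"
      unfolding driver_def
      by (subst integral_diff) (use cf in \<open>auto intro: integrable_continuous_interval\<close>)
    moreover have "norm (integral {0..u} (\<lambda>\<tau>. f (X \<tau>) q - f (X' \<tau>) q)) \<le> integral {0..u} (\<lambda>\<tau>. K * real (card C) * e \<tau>)"
    proof (rule integral_norm_bound_integral)
      show "(\<lambda>\<tau>. f (X \<tau>) q - f (X' \<tau>) q) integrable_on {0..u}"
        by (intro integrable_continuous_interval continuous_intros cf)
      show "(\<lambda>\<tau>. K * real (card C) * e \<tau>) integrable_on {0..u}"
        by (intro integrable_continuous_interval continuous_intros eu)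
      fix \<tau> assume \<tau>: "\<tau> \<in> {0..u}"
      have "\<bar>f (X \<tau>) q - f (X' \<tau>) q\<bar> \<le> K * (\<Sum>p\<in>C. \<bar>X \<tau> p - X' \<tau> p\<bar>)" by (rule lip[OF q])
      also have "\<dots> \<le> K * (\<Sum>p\<in>C. e \<tau>)"
        using \<tau> u K by (intro mult_left_mono sum_mono le) auto
      finally show "norm (f (X \<tau>) q - f (X' \<tau>) q) \<le> K * real (card C) * e \<tau>" by (simp add: mult.assoc)
    qed
    moreover have "integral {0..u} (\<lambda>\<tau>. K * real (card C) * e \<tau>) = K * real (card C) * integral {0..u} e" by simp
    moreover have "K * real (card C) * integral {0..u} e \<le> K * real (card C) * integral {0..t} e"
    proof (rule mult_left_mono)
      show "integral {0..u} e \<le> integral {0..t} e"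
        by (rule integral_subset_le) (use u e eu e0 in \<open>auto intro: integrable_continuous_interval\<close>)
    qed (use K in auto)
    ultimately show ?thesis by simp
  qed
  show ?thesis
  proof (cases "q \<in> D")
    case True
    then show ?thesis
      using reflected_diff[OF driver_cont[OF X q] driver_cont[OF X' q] t driver]
      by (simp add: picard_def mult.assoc)
  next
    case False
    then have "\<bar>picard X t q - picard X' t q\<bar> \<le> K * real (card C) * integral {0..t} e"
      using driver[of t] t by (simp add: picard_def)
    moreover have "0 \<le> K * real (card C) * integral {0..t} e"
      using K e0 by (intro mult_nonneg_nonneg integral_nonneg integrable_continuous_interval e) auto
    ultimately show ?thesis by simp
  qed
qed

section \<open>Convergence of the Picard iterates\<close>

definition iter :: "nat \<Rightarrow> real \<Rightarrow> 'c \<Rightarrow> real" where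
  "iter n = (picard ^^ n) (\<lambda>t. s\<^sub>0)"

lemma iter_Suc: "iter (Suc n) = picard (iter n)"
  by (simp add: iter_def)

lemma iter_cont: "cont_path (iter n)"
proof (induction n)
  case 0 show ?case by (simp add: iter_def cont_path_def)
next
  case (Suc n) then show ?case unfolding iter_Suc by (rule picard_cont)
qed

lemma integral_monomial:
  assumes "0 \<le> (t::real)" shows "integral {0..t} (\<lambda>\<tau>. \<tau> ^ n) = t ^ Suc n / real (Suc n)"
proof (rule integral_unique)
  have "((\<lambda>\<tau>. \<tau> ^ n) has_integral t ^ Suc n / real (Suc n) - 0 ^ Suc n / real (Suc n)) {0..t}"
  proof (rule fundamental_theorem_of_calculus[OF assms])
    fix x assume "x \<in> {0..t}"
    have "((\<lambda>\<tau>. \<tau> ^ Suc n / real (Suc n)) has_real_derivative x ^ n) (at x within {0..t})"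
      by (rule derivative_eq_intros refl | simp)+
    then show "((\<lambda>\<tau>. \<tau> ^ Suc n / real (Suc n)) has_vector_derivative x ^ n) (at x within {0..t})"
      by (simp add: has_real_derivative_iff_has_vector_derivative)
  qed
  then show "((\<lambda>\<tau>. \<tau> ^ n) has_integral t ^ Suc n / real (Suc n)) {0..t}" by simp
qed

definition rate :: real where "rate = 2 * K * real (card C)"

text \<open>Each pass integrates the preceding bound once and raises the power of \<open>t\<close>.
  \<open>rate\<close> collects the factor 2 of the reflection, the Lipschitz constant and the number
  of coordinates.\<close>

lemma iter_diff:
  assumes M: "\<And>t q. 0 \<le> t \<Longrightarrow> t \<le> T \<Longrightarrow> q \<in> C \<Longrightarrow> \<bar>iter 1 t q - iter 0 t q\<bar> \<le> M"
    and "0 \<le> t" "t \<le> T" "q \<in> C"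
  shows "\<bar>iter (Suc n) t q - iter n t q\<bar> \<le> M * (rate * t) ^ n / fact n"
  using assms(2-)
proof (induction n arbitrary: t q)
  case 0 then show ?case using M by simp
next
  case (Suc n)
  have "\<bar>iter (Suc (Suc n)) t q - iter (Suc n) t q\<bar>
      \<le> 2 * K * real (card C) * integral {0..t} (\<lambda>\<tau>. M * rate ^ n / fact n * \<tau> ^ n)"
    unfolding iter_Suc[of "Suc n"] iter_Suc[of n]
  proof (rule picard_diff)
    fix \<tau> p assume "0 \<le> \<tau>" "\<tau> \<le> t" "p \<in> C"
    then have "\<bar>iter (Suc n) \<tau> p - iter n \<tau> p\<bar> \<le> M * (rate * \<tau>) ^ n / fact n"
      using Suc.prems by (intro Suc.IH) auto
    then show "\<bar>picard (iter n) \<tau> p - iter n \<tau> p\<bar> \<le> M * rate ^ n / fact n * \<tau> ^ n"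
      by (simp add: iter_Suc power_mult_distrib)
  qed (use Suc.prems iter_cont picard_cont in \<open>auto intro!: continuous_intros\<close>)
  also have "integral {0..t} (\<lambda>\<tau>. M * rate ^ n / fact n * \<tau> ^ n) = M * rate ^ n / fact n * (t ^ Suc n / real (Suc n))"
    using integral_monomial[OF Suc.prems(1), of n] by (simp only: integral_mult_right)
  also have "2 * K * real (card C) * (M * rate ^ n / fact n * (t ^ Suc n / real (Suc n)))
      = M * (rate * t) ^ Suc n / fact (Suc n)"
    unfolding rate_def[symmetric] by (simp add: power_mult_distrib mult_ac)
  finally show ?case .
qed

definition limit_path :: "real \<Rightarrow> 'c \<Rightarrow> real" where
  "limit_path t q = s\<^sub>0 q + (\<Sum>n. iter (Suc n) t q - iter n t q)"

lemma iter_uniform_limit: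
  assumes q: "q \<in> C"
  shows "uniform_limit {0..T} (\<lambda>n t. iter n t q) (\<lambda>t. limit_path t q) sequentially"
proof -
  have "\<exists>M. \<forall>t\<in>{0..T}. \<bar>iter 1 t p - iter 0 t p\<bar> \<le> M" if p: "p \<in> C" for p
  proof -
    have "continuous_on {0..T} (\<lambda>t. iter 1 t p - iter 0 t p)"
      using iter_cont[of 1] iter_cont[of 0] p unfolding cont_path_def
      by (intro continuous_intros continuous_on_subset[of "{0..}" _ "{0..T}"]) auto
    then have "bounded ((\<lambda>t. iter 1 t p - iter 0 t p) ` {0..T})"
      using compact_continuous_image compact_imp_bounded compact_Icc by metis
    then show ?thesis unfolding bounded_iff real_norm_def ball_simps by blast
  qed
  then obtain Mp where Mp: "\<And>p t. p \<in> C \<Longrightarrow> t \<in> {0..T} \<Longrightarrow> \<bar>iter 1 t p - iter 0 t p\<bar> \<le> Mp p" by metis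
  define M where "M = (\<Sum>p\<in>C. \<bar>Mp p\<bar>)"
  have M: "\<bar>iter 1 t p - iter 0 t p\<bar> \<le> M" if "0 \<le> t" "t \<le> T" "p \<in> C" for t p
  proof -
    have "\<bar>iter 1 t p - iter 0 t p\<bar> \<le> \<bar>Mp p\<bar>" using Mp[of p t] that by auto
    also have "\<dots> \<le> M" unfolding M_def using that finC by (intro member_le_sum) auto
    finally show ?thesis .
  qed
  have M0: "M \<ge> 0" unfolding M_def by (rule sum_nonneg) auto
  have rate: "rate \<ge> 0" unfolding rate_def using K by simp
  have "uniform_limit {0..T} (\<lambda>n t. \<Sum>i<n. iter (Suc i) t q - iter i t q)
      (\<lambda>t. \<Sum>i. iter (Suc i) t q - iter i t q) sequentially"
  proof (rule Weierstrass_m_test)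
    fix n t assume t: "t \<in> {0..T}"
    have "\<bar>iter (Suc n) t q - iter n t q\<bar> \<le> M * (rate * t) ^ n / fact n"
      by (rule iter_diff[OF M]) (use t q in auto)
    also have "\<dots> \<le> M * (rate * T) ^ n / fact n"
      using M0 rate t by (intro divide_right_mono mult_left_mono power_mono) auto
    also have "\<dots> = M * ((rate * T) ^ n /\<^sub>R fact n)" by (simp add: field_simps)
    finally show "norm (iter (Suc n) t q - iter n t q) \<le> M * ((rate * T) ^ n /\<^sub>R fact n)" by simp
  qed (intro summable_mult summable_exp_generic)
  then have "uniform_limit {0..T} (\<lambda>n t. s\<^sub>0 q + (\<Sum>i<n. iter (Suc i) t q - iter i t q)) (\<lambda>t. limit_path t q) sequentially"
    unfolding limit_path_def by (intro uniform_limit_intros)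
  moreover have "s\<^sub>0 q + (\<Sum>i<n. iter (Suc i) t q - iter i t q) = iter n t q" for n t
    using sum_lessThan_telescope[of "\<lambda>i. iter i t q" n] by (simp add: iter_def)
  ultimately show ?thesis by simp
qed

lemma limit_path_cont: "cont_path limit_path"
  unfolding cont_path_def
proof
  fix q assume q: "q \<in> C"
  show "continuous_on {0..} (\<lambda>t. limit_path t q)"
  proof (rule continuous_on_Ici)
    fix T
    show "continuous_on {0..T} (\<lambda>t. limit_path t q)"
    proof (rule uniform_limit_theorem[OF _ iter_uniform_limit[OF q]])
      have "continuous_on {0..T} (\<lambda>t. iter n t q)" for n
        using iter_cont[of n] q unfolding cont_path_def by (meson atLeastAtMost_iff atLeast_iff continuous_on_subset subsetI)
      then show "\<forall>\<^sub>F n in sequentially. continuous_on {0..T} (\<lambda>t. iter n t q)" by simp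
    qed simp
  qed
qed

text \<open>Uniform convergence on \<open>{0..t}\<close>, simultaneous in the finitely many
  coordinates, passes through the Picard map because that map is continuous for the uniform
  distance.\<close>

lemma limit_path_fixed:
  assumes q: "q \<in> C" and t: "t \<ge> 0"
  shows "picard limit_path t q = limit_path t q"
proof -
  have "(\<lambda>n. iter n t q) \<longlonglongrightarrow> limit_path t q"
    using tendsto_uniform_limitI[OF iter_uniform_limit[OF q, of t], of t] t by simp
  then have 1: "(\<lambda>n. iter (Suc n) t q) \<longlonglongrightarrow> limit_path t q" by (rule LIMSEQ_Suc)
  have "(\<lambda>n. iter (Suc n) t q) \<longlonglongrightarrow> picard limit_path t q"
  proof (rule LIMSEQ_I)
    fix e :: real assume e: "e > 0"
    define d where "d = e / (2 * K * real (card C) * t + 1)"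
    have den: "2 * K * real (card C) * t + 1 > 0" using K t by (intro add_nonneg_pos) auto
    have d: "d > 0" using e den by (simp add: d_def)
    have "\<forall>\<^sub>F n in sequentially. \<forall>p\<in>C. \<forall>\<tau>\<in>{0..t}. dist (iter n \<tau> p) (limit_path \<tau> p) < d"
      by (rule eventually_ball_finite[OF finC]) (use uniform_limitD[OF iter_uniform_limit d] in blast)
    then obtain N where N: "\<And>n p \<tau>. n \<ge> N \<Longrightarrow> p \<in> C \<Longrightarrow> \<tau> \<in> {0..t} \<Longrightarrow> dist (iter n \<tau> p) (limit_path \<tau> p) < d"
      unfolding eventually_sequentially by blast
    show "\<exists>N. \<forall>n\<ge>N. norm (iter (Suc n) t q - picard limit_path t q) < e"
    proof (intro exI[of _ N] allI impI)
      fix n assume n: "n \<ge> N"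
      have "\<bar>picard (iter n) t q - picard limit_path t q\<bar> \<le> 2 * K * real (card C) * integral {0..t} (\<lambda>_. d)"
      proof (rule picard_diff[OF iter_cont limit_path_cont q t])
        fix \<tau> p assume "0 \<le> \<tau>" "\<tau> \<le> t" "p \<in> C"
        then show "\<bar>iter n \<tau> p - limit_path \<tau> p\<bar> \<le> d"
          using N[OF n, of p \<tau>] by (auto simp: dist_real_def)
      qed auto
      also have "\<dots> = 2 * K * real (card C) * t * d" using t by simp
      also have "\<dots> < (2 * K * real (card C) * t + 1) * d" using d by (simp add: algebra_simps)
      also have "\<dots> = e" using den by (simp add: d_def)
      finally show "norm (iter (Suc n) t q - picard limit_path t q) < e" by (simp add: iter_Suc)
    qed
  qed
  then show ?thesis using 1 by (rule LIMSEQ_unique)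
qed

lemma reflected_ode_exists:
  obtains X where "\<And>q. q \<in> C \<Longrightarrow> X 0 q = s\<^sub>0 q"
    "\<And>q T. q \<in> C \<Longrightarrow> abs_continuous_on {0..T} (\<lambda>t. X t q)"
    "\<And>q t. q \<in> C \<Longrightarrow> q \<in> D \<Longrightarrow> t \<ge> 0 \<Longrightarrow> X t q \<ge> 0"
    "AE t in lebesgue. 0 \<le> t \<longrightarrow> (\<forall>q\<in>C. ((\<lambda>\<tau>. X \<tau> q) has_real_derivative
       (if q \<in> D \<and> X t q \<le> 0 then max 0 (f (X t) q) else f (X t) q)) (at t))"
proof
  let ?X = "limit_path"
  let ?P = "picard limit_path"
  note dd = driver_deriv[OF limit_path_cont]
  note fc = f_cont[OF limit_path_cont]
  \<comment> \<open>The fixed-point identity concerns nonnegative times only. Two-sided derivatives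
    are therefore transferred on the open half-line, at the cost of the single time 0.\<close>
  have eq: "?P t q = ?X t q" if "q \<in> C" "t \<ge> 0" for t q by (rule limit_path_fixed[OF that])
  show "?X 0 q = s\<^sub>0 q" if q: "q \<in> C" for q
  proof -
    have "driver ?X q 0 = s\<^sub>0 q" by (simp add: driver_def)
    then show ?thesis
      using eq[OF q, of 0] reflected_0[OF driver_cont[OF limit_path_cont q]] s0[of q]
      by (auto simp: picard_def split: if_splits)
  qed
  show "abs_continuous_on {0..T} (\<lambda>t. ?X t q)" if q: "q \<in> C" for q T
  proof -
    have ac: "abs_continuous_on {0..T} (\<lambda>t. ?P t q)"
    proof (cases "q \<in> D")
      case True
      then show ?thesis using reflected_AC[OF dd[OF q] fc[OF q], of T] by (simp add: picard_def)
    next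
      case False
      have "abs_continuous_on {0..T} (driver ?X q)"
      proof (rule abs_continuous_on_C1)
        show "continuous_on {0..T} (\<lambda>t. f (?X t) q)" by (rule continuous_on_subset[OF fc[OF q]]) auto
        show "(driver ?X q has_real_derivative f (?X t) q) (at t within {0..T})" if "t \<in> {0..T}" for t
          using dd[OF q, of t] that by (auto intro: has_field_derivative_subset)
      qed
      then show ?thesis using False by (simp add: picard_def)
    qed
    show ?thesis
      by (rule abs_continuous_on_combine[OF ac ac zero_less_one]) (use eq[OF q] in auto)
  qed
  show "?X t q \<ge> 0" if "q \<in> C" "q \<in> D" "t \<ge> 0" for q t
    using eq[OF that(1,3)] reflected_nonneg[OF driver_cont[OF limit_path_cont that(1)] that(3)] that(2)
    by (simp add: picard_def)
  have "AE t in lebesgue. t \<noteq> 0" by (rule AE_completion[OF AE_lborel_singleton])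
  moreover have "AE t in lebesgue. \<forall>q\<in>C. q \<in> D \<longrightarrow> 0 \<le> t \<longrightarrow>
     (reflected (driver ?X q) has_real_derivative
       (if reflected (driver ?X q) t \<le> 0 then max 0 (f (?X t) q) else f (?X t) q)) (at t)"
    unfolding AE_finite_all[OF finC]
  proof
    fix q assume q: "q \<in> C"
    show "AE t in lebesgue. q \<in> D \<longrightarrow> 0 \<le> t \<longrightarrow> (reflected (driver ?X q) has_real_derivative
       (if reflected (driver ?X q) t \<le> 0 then max 0 (f (?X t) q) else f (?X t) q)) (at t)"
    proof -
      have "AE t in lebesgue. 0 \<le> t \<longrightarrow> (reflected (driver ?X q) has_real_derivative
          (if reflected (driver ?X q) t \<le> 0 then max 0 (f (?X t) q) else f (?X t) q)) (at t)"
        by (rule reflected_deriv_AE[OF dd[OF q] fc[OF q]])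
      then show ?thesis by eventually_elim auto
    qed
  qed
  ultimately show "AE t in lebesgue. 0 \<le> t \<longrightarrow> (\<forall>q\<in>C. ((\<lambda>\<tau>. ?X \<tau> q) has_real_derivative
       (if q \<in> D \<and> ?X t q \<le> 0 then max 0 (f (?X t) q) else f (?X t) q)) (at t))"
  proof eventually_elim
    case (elim t)
    show ?case
    proof (intro impI ballI)
      fix q assume t0: "0 \<le> t" and q: "q \<in> C"
      then have t: "t > 0" using elim by simp
      have "((\<lambda>\<tau>. ?P \<tau> q) has_real_derivative
         (if q \<in> D \<and> ?X t q \<le> 0 then max 0 (f (?X t) q) else f (?X t) q)) (at t)"
      proof (cases "q \<in> D")
        case True
        then have "?X t q = reflected (driver ?X q) t" using eq[OF q t0] by (simp add: picard_def)
        then show ?thesis using elim(2) True q t0 by (simp add: picard_def)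
      next
        case False
        then show ?thesis using dd[OF q t0] t at_within_interior[of t "{0..}"] by (simp add: picard_def)
      qed
      then show "((\<lambda>\<tau>. ?X \<tau> q) has_real_derivative
         (if q \<in> D \<and> ?X t q \<le> 0 then max 0 (f (?X t) q) else f (?X t) q)) (at t)"
        by (rule has_field_derivative_transform_within_open[of _ _ _ "{0<..}"]) (use eq[OF q] t in auto)
    qed
  qed
qed

end

section \<open>Hurwitz chains of integrators\<close>

text \<open>Gronwall's inequality around the steady state \<open>b / a\<close>: the deviation from
  it, multiplied by the integrating factor, cannot increase.\<close>

lemma linear_deriv_bound:
  fixes f :: "real \<Rightarrow> real"
  assumes uv: "u \<le> v" and a: "a > 0"
    and d: "\<And>t. t \<in> {u..v} \<Longrightarrow> (f has_real_derivative f' t) (at t within {u..v})"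
    and le: "\<And>t. t \<in> {u..v} \<Longrightarrow> f' t \<le> - a * f t + b"
  shows "f v \<le> b / a + exp (- a * (v - u)) * (f u - b / a)"
proof -
  define h where "h t = exp (a * (t - v)) * (f t - b / a)" for t
  have "h v \<le> h u"
  proof (rule DERIV_nonpos_imp_decreasing_open[OF uv])
    fix t assume t: "u < t" "t < v"
    have "(f has_real_derivative f' t) (at t)"
      using d[of t] t at_within_Icc_at[of u t v] by auto
    then have "(h has_real_derivative exp (a * (t - v)) * (f' t + a * f t - b)) (at t)"
      unfolding h_def using a by (auto intro!: derivative_eq_intros simp: field_simps)
    moreover have "exp (a * (t - v)) * (f' t + a * f t - b) \<le> 0"
      using le[of t] t by (intro mult_nonneg_nonpos) auto
    ultimately show "\<exists>y. (h has_real_derivative y) (at t) \<and> y \<le> 0" by blast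
  next
    have "continuous_on {u..v} f"
      using d by (meson DERIV_continuous continuous_on_eq_continuous_within)
    then show "continuous_on {u..v} h" unfolding h_def by (intro continuous_intros) auto
  qed
  then show ?thesis by (simp add: h_def algebra_simps)
qed

text \<open>The squared modulus is used because the modulus is not differentiable at 0. With the
  complex plane as a real inner product space, \<open>y \<bullet> (s * y)\<close> is
  \<open>Re s\<close> times the squared modulus; Young's inequality spends half of this decay on the
  forcing \<open>w\<close>.\<close>

lemma cmod_square_deriv:
  fixes y :: "real \<Rightarrow> complex"
  assumes "(y has_vector_derivative s * y t + w) (at t within S)" "Re s < 0"
  shows "((\<lambda>t. (norm (y t))\<^sup>2) has_real_derivative 2 * (y t \<bullet> (s * y t + w))) (at t within S)"
    and "2 * (y t \<bullet> (s * y t + w)) \<le> - (- Re s) * (norm (y t))\<^sup>2 + (norm w)\<^sup>2 / (- Re s)"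
proof -
  have "((\<lambda>t. y t \<bullet> y t) has_vector_derivative (y t \<bullet> (s * y t + w) + (s * y t + w) \<bullet> y t)) (at t within S)"
    by (rule bounded_bilinear.has_vector_derivative[OF bounded_bilinear_inner assms(1) assms(1)])
  then show "((\<lambda>t. (norm (y t))\<^sup>2) has_real_derivative 2 * (y t \<bullet> (s * y t + w))) (at t within S)"
    by (simp add: power2_norm_eq_inner has_real_derivative_iff_has_vector_derivative inner_commute)
  define a where "a = - Re s"
  have a: "a > 0" using assms(2) by (simp add: a_def)
  have sy: "y t \<bullet> (s * y t) = - a * (norm (y t))\<^sup>2"
    unfolding cmod_power2 by (simp add: inner_complex_def a_def algebra_simps power2_eq_square)
  have "2 * (norm (y t) * norm w) \<le> a * (norm (y t))\<^sup>2 + (norm w)\<^sup>2 / a"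
  proof -
    have "0 \<le> (a * norm (y t) - norm w)\<^sup>2 / a" using a by simp
    also have "\<dots> = a * (norm (y t))\<^sup>2 + (norm w)\<^sup>2 / a - 2 * (norm (y t) * norm w)"
      using a by (simp add: field_simps power2_eq_square)
    finally show ?thesis by simp
  qed
  moreover have "y t \<bullet> w \<le> norm (y t) * norm w" by (rule norm_cauchy_schwarz)
  ultimately show "2 * (y t \<bullet> (s * y t + w)) \<le> - (- Re s) * (norm (y t))\<^sup>2 + (norm w)\<^sup>2 / (- Re s)"
    unfolding a_def[symmetric] inner_add_right sy by simp
qed

text \<open>The bound is independent of the horizon \<open>T\<close>; that is what an a priori
  estimate for solutions of unknown lifetime requires.\<close>

lemma stable_scalar_bounded:
  fixes y w :: "real \<Rightarrow> complex"
  assumes s: "Re s < 0" and d: "\<And>t. t \<in> {0..T} \<Longrightarrow> (y has_vector_derivative s * y t + w t) (at t within {0..T})"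
    and w: "\<And>t. t \<in> {0..T} \<Longrightarrow> norm (w t) \<le> B" and t: "t \<in> {0..T}"
  shows "norm (y t) \<le> norm (y 0) + B / (- Re s)"
proof -
  define a where "a = - Re s"
  have a: "a > 0" using s by (simp add: a_def)
  have "norm (w 0) \<le> B" using w t by auto
  then have B: "B \<ge> 0" using norm_ge_zero[of "w 0"] by linarith
  have "(norm (y t))\<^sup>2 \<le> (B\<^sup>2 / a) / a + exp (- a * (t - 0)) * ((norm (y 0))\<^sup>2 - (B\<^sup>2 / a) / a)"
  proof (rule linear_deriv_bound[OF _ a, where f = "\<lambda>t. (norm (y t))\<^sup>2" and f' = "\<lambda>t. 2 * (y t \<bullet> (s * y t + w t))"])
    show "0 \<le> t" using t by simp
    fix u assume u: "u \<in> {0..t}"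
    then have du: "(y has_vector_derivative s * y u + w u) (at u within {0..t})"
      using d[of u] t by (auto intro: has_vector_derivative_within_subset)
    show "((\<lambda>t. (norm (y t))\<^sup>2) has_real_derivative 2 * (y u \<bullet> (s * y u + w u))) (at u within {0..t})"
      by (rule cmod_square_deriv(1)[OF du s])
    have "(norm (w u))\<^sup>2 / a \<le> B\<^sup>2 / a"
      using w[of u] u t a by (intro divide_right_mono power_mono) auto
    then show "2 * (y u \<bullet> (s * y u + w u)) \<le> - a * (norm (y u))\<^sup>2 + B\<^sup>2 / a"
      using cmod_square_deriv(2)[OF du s] by (simp add: a_def)
  qed
  also have "\<dots> = (1 - exp (- a * t)) * (B\<^sup>2 / a / a) + exp (- a * t) * (norm (y 0))\<^sup>2"
    unfolding left_diff_distrib right_diff_distrib by simp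
  also have "\<dots> \<le> 1 * (B\<^sup>2 / a / a) + 1 * (norm (y 0))\<^sup>2"
    using t a by (intro add_mono mult_right_mono) auto
  also have "\<dots> \<le> (norm (y 0) + B / a)\<^sup>2"
    using a B by (simp add: power2_eq_square algebra_simps)
  finally have "(norm (y t))\<^sup>2 \<le> (norm (y 0) + B / a)\<^sup>2" .
  then show ?thesis
    unfolding a_def[symmetric] by (rule power2_le_imp_le) (use a B in simp)
qed

lemma stable_scalar_tendsto:
  fixes y w :: "real \<Rightarrow> complex"
  assumes s: "Re s < 0" and d: "\<And>t. t \<ge> 0 \<Longrightarrow> (y has_vector_derivative s * y t + w t) (at t within {0..})"
    and w: "(w \<longlongrightarrow> w0) at_top"
  shows "(y \<longlongrightarrow> - w0 / s) at_top"
proof -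
  define a where "a = - Re s"
  have a: "a > 0" using s by (simp add: a_def)
  have s0: "s \<noteq> 0" using s by auto
  define u where "u t = y t + w0 / s" for t
  have du: "(u has_vector_derivative s * u t + (w t - w0)) (at t within {0..})" if "t \<ge> 0" for t
    unfolding u_def using d[OF that] s0 by (auto intro!: derivative_eq_intros simp: field_simps)
  have sq: "((\<lambda>t. (norm (u t))\<^sup>2) \<longlongrightarrow> 0) at_top"
  proof (rule tendstoI)
    fix e :: real assume e: "e > 0"
    have "((\<lambda>t. (norm (w t - w0))\<^sup>2) \<longlongrightarrow> (norm (w0 - w0))\<^sup>2) at_top"
      by (intro tendsto_intros w)
    \<comment> \<open>The threshold is chosen so that the forcing, after one division by
      \<open>a\<close> in Young's inequality and another in the steady state, contributes
      \<open>e / 2\<close>.\<close>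
    then have "\<forall>\<^sub>F t in at_top. (norm (w t - w0))\<^sup>2 < a * a * (e / 2)"
      by (rule order_tendstoD(2)) (use e a in auto)
    then obtain T where T: "\<And>t. t \<ge> T \<Longrightarrow> (norm (w t - w0))\<^sup>2 < a * a * (e / 2)"
      unfolding eventually_at_top_linorder by blast
    define T0 where "T0 = max T 0"
    define K where "K = (norm (u T0))\<^sup>2"
    have bound: "(norm (u t))\<^sup>2 \<le> e / 2 + exp (- a * (t - T0)) * (K - e / 2)" if t: "t \<ge> T0" for t
    proof -
      have "(norm (u t))\<^sup>2 \<le> (a * (e / 2)) / a + exp (- a * (t - T0)) * ((norm (u T0))\<^sup>2 - (a * (e / 2)) / a)"
      proof (rule linear_deriv_bound[OF t a, where f = "\<lambda>t. (norm (u t))\<^sup>2" and f' = "\<lambda>t. 2 * (u t \<bullet> (s * u t + (w t - w0)))"])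
        fix \<tau> assume \<tau>: "\<tau> \<in> {T0..t}"
        then have "\<tau> \<ge> 0" "\<tau> \<ge> T" by (auto simp: T0_def)
        have d\<tau>: "(u has_vector_derivative s * u \<tau> + (w \<tau> - w0)) (at \<tau> within {T0..t})"
          using du[OF \<open>\<tau> \<ge> 0\<close>] by (rule has_vector_derivative_within_subset) (auto simp: T0_def)
        show "((\<lambda>t. (norm (u t))\<^sup>2) has_real_derivative 2 * (u \<tau> \<bullet> (s * u \<tau> + (w \<tau> - w0)))) (at \<tau> within {T0..t})"
          by (rule cmod_square_deriv(1)[OF d\<tau> s])
        have "(norm (w \<tau> - w0))\<^sup>2 / a \<le> a * a * (e / 2) / a"
          using T[OF \<open>\<tau> \<ge> T\<close>] a by (intro divide_right_mono) auto
        also have "\<dots> = a * (e / 2)" using a by simp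
        finally have "(norm (w \<tau> - w0))\<^sup>2 / a \<le> a * (e / 2)" .
        then show "2 * (u \<tau> \<bullet> (s * u \<tau> + (w \<tau> - w0))) \<le> - a * (norm (u \<tau>))\<^sup>2 + a * (e / 2)"
          using cmod_square_deriv(2)[OF d\<tau> s, folded a_def] by linarith
      qed
      then show ?thesis using a by (simp add: K_def)
    qed
    have "filterlim (\<lambda>t::real. - T0 + t) at_top at_top"
      by (rule filterlim_tendsto_add_at_top[OF tendsto_const filterlim_ident])
    then have "filterlim (\<lambda>t. - a * (- T0 + t)) at_bot at_top"
      using a by (intro filterlim_tendsto_neg_mult_at_bot[OF tendsto_const]) auto
    then have "((\<lambda>t. exp (- a * (- T0 + t))) \<longlongrightarrow> 0) at_top"
      by (rule filterlim_compose[OF exp_at_bot])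
    then have "((\<lambda>t. e / 2 + exp (- a * (- T0 + t)) * (K - e / 2)) \<longlongrightarrow> e / 2 + 0 * (K - e / 2)) at_top"
      by (intro tendsto_intros)
    then have "((\<lambda>t. e / 2 + exp (- a * (t - T0)) * (K - e / 2)) \<longlongrightarrow> e / 2) at_top"
      by (simp add: algebra_simps)
    then have "\<forall>\<^sub>F t in at_top. e / 2 + exp (- a * (t - T0)) * (K - e / 2) < e"
      by (rule order_tendstoD(2)) (use e in auto)
    then show "\<forall>\<^sub>F t in at_top. dist ((norm (u t))\<^sup>2) 0 < e"
      using eventually_ge_at_top[of T0]
    proof eventually_elim
      case (elim t)
      then show ?case using bound[of t] by simp
    qed
  qed
  have "((\<lambda>t. sqrt ((norm (u t))\<^sup>2)) \<longlongrightarrow> sqrt 0) at_top"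
    by (intro tendsto_intros sq)
  then have "(u \<longlongrightarrow> 0) at_top" by (simp add: tendsto_norm_zero_iff)
  then have "((\<lambda>t. u t - w0 / s) \<longlongrightarrow> 0 - w0 / s) at_top" by (intro tendsto_intros)
  then show ?thesis by (simp add: u_def)
qed

section \<open>Operators p(d/dt) with stable roots, where \<open>x j\<close> plays the role of the
  j-th derivative\<close>

definition diff_op :: "complex poly \<Rightarrow> (nat \<Rightarrow> complex) \<Rightarrow> complex" where
  "diff_op p x = (\<Sum>j\<le>degree p. coeff p j * x j)"

text \<open>Says that p(d/dt) is d/dt - s composed with q(d/dt). Hence y = q(d/dt) x solves the
  first-order equation y' = s y + p(d/dt) x, and the order drops by one.\<close>

lemma diff_op_factor:
  assumes "q \<noteq> 0"
  shows "diff_op ([:-s, 1:] * q) x = diff_op q (\<lambda>j. x (Suc j)) - s * diff_op q x"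
proof -
  have deg: "degree ([:-s, 1:] * q) = Suc (degree q)"
    using assms by (subst degree_mult_eq) auto
  have c: "coeff ([:-s, 1:] * q) j = coeff (pCons 0 q) j - s * coeff q j" for j by simp
  have "diff_op ([:-s, 1:] * q) x
      = (\<Sum>j\<le>Suc (degree q). coeff (pCons 0 q) j * x j) - s * (\<Sum>j\<le>Suc (degree q). coeff q j * x j)"
    unfolding diff_op_def deg c by (simp only: sum_distrib_left sum_subtractf[symmetric] algebra_simps)
  also have "(\<Sum>j\<le>Suc (degree q). coeff q j * x j) = diff_op q x"
    by (simp add: diff_op_def coeff_eq_0)
  also have "(\<Sum>j\<le>Suc (degree q). coeff (pCons 0 q) j * x j) = diff_op q (\<lambda>j. x (Suc j))"
    unfolding diff_op_def by (subst sum.atMost_Suc_shift) simp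
  finally show ?thesis .
qed

lemma stable_factor:
  fixes p :: "complex poly"
  assumes "degree p = Suc n" "\<And>s. poly p s = 0 \<Longrightarrow> Re s < 0"
  obtains s q where "p = [:-s, 1:] * q" "degree q = n" "q \<noteq> 0" "Re s < 0" "\<And>s. poly q s = 0 \<Longrightarrow> Re s < 0"
proof -
  have "\<not> constant (poly p)" using assms(1) by (simp add: constant_degree)
  then obtain s where s: "poly p s = 0" using fundamental_theorem_of_algebra by blast
  then obtain q where q: "p = [:-s, 1:] * q" unfolding poly_eq_0_iff_dvd by (auto elim: dvdE)
  have q0: "q \<noteq> 0" using assms(1) q by auto
  have "degree p = Suc (degree q)" unfolding q using q0 by (subst degree_mult_eq) auto
  moreover have "poly p r = 0" if "poly q r = 0" for r using that q by simp
  ultimately show thesis using that[of s q] q q0 assms s by auto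
qed

text \<open>A chain of length \<open>degree q\<close> provides no differential equation for its top
  entry; that entry is recovered algebraically from the value of the operator and the lower
  entries.\<close>

lemma diff_op_top:
  assumes "q \<noteq> 0" "degree q = Suc n"
  shows "x (Suc n) = (diff_op q x - (\<Sum>j\<le>n. coeff q j * x j)) / lead_coeff q"
proof -
  have "coeff q (Suc n) \<noteq> 0" using assms by (metis leading_coeff_0_iff)
  then show ?thesis using assms by (simp add: diff_op_def)
qed

lemma diff_op_deriv:
  assumes "\<And>j. j \<le> degree q \<Longrightarrow> (x j has_vector_derivative x' j) (at t within S)"
  shows "((\<lambda>t. diff_op q (\<lambda>j. x j t)) has_vector_derivative diff_op q x') (at t within S)"
  unfolding diff_op_def using assms
  by (intro has_vector_derivative_sum has_vector_derivative_mult_right) auto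

text \<open>Induction on the degree: one stable linear factor is split off, the scalar equation
  bounds q(d/dt) x, and the induction hypothesis bounds the lower entries. \<open>B'\<close>
  precedes \<open>T\<close> and \<open>x\<close>, so it is uniform over all horizons and all
  chains.\<close>

lemma diff_op_bounded:
  fixes p :: "complex poly"
  assumes "p \<noteq> 0" "degree p = n" "\<And>s. poly p s = 0 \<Longrightarrow> Re s < 0"
  shows "\<exists>B'. \<forall>T x. (\<forall>j<n. \<forall>t\<in>{0..T}. (x j has_vector_derivative x (Suc j) t) (at t within {0..T})) \<longrightarrow>
     (\<forall>j\<le>n. norm (x j 0) \<le> B) \<longrightarrow> (\<forall>t\<in>{0..T}. norm (diff_op p (\<lambda>j. x j t)) \<le> B) \<longrightarrow>
     (\<forall>j\<le>n. \<forall>t\<in>{0..T}. norm (x j t) \<le> B')"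
  using assms
proof (induction n arbitrary: p B)
  case 0
  then obtain c where c: "p = [:c:]" "c \<noteq> 0" by (metis degree_eq_zeroE pCons_eq_0_iff)
  show ?case
    by (intro exI[of _ "B / norm c"]) (use c in \<open>auto simp: diff_op_def norm_mult field_simps\<close>)
next
  case (Suc n)
  obtain s q where q: "p = [:-s, 1:] * q" "degree q = n" "q \<noteq> 0" "Re s < 0" "\<And>s. poly q s = 0 \<Longrightarrow> Re s < 0"
    using stable_factor[OF Suc.prems(2,3)] by blast
  \<comment> \<open>The first two terms bound q(d/dt) x through its initial value and the forced
    response; the last one covers the initial data, which the induction hypothesis wants below the
    same constant.\<close>
  define B1 where "B1 = (\<Sum>j\<le>n. norm (coeff q j)) * \<bar>B\<bar> + \<bar>B\<bar> / (- Re s) + \<bar>B\<bar>"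
  obtain B2 where B2: "\<And>T x. (\<forall>j<n. \<forall>t\<in>{0..T}. (x j has_vector_derivative x (Suc j) t) (at t within {0..T})) \<Longrightarrow>
     (\<forall>j\<le>n. norm (x j 0) \<le> B1) \<Longrightarrow> (\<forall>t\<in>{0..T}. norm (diff_op q (\<lambda>j. x j t)) \<le> B1) \<Longrightarrow>
     (\<forall>j\<le>n. \<forall>t\<in>{0..T}. norm (x j t) \<le> B2)"
    using Suc.IH[OF q(3,2,5), of B1] by blast
  define B3 where "B3 = (\<bar>B\<bar> + (\<Sum>j\<le>n. norm (coeff p j)) * \<bar>B2\<bar>) / norm (lead_coeff p)"
  show ?case
  proof (intro exI[of _ "max B2 B3"] allI impI ballI)
    fix T x j t
    assume d: "\<forall>j<Suc n. \<forall>t\<in>{0..T}. (x j has_vector_derivative x (Suc j) t) (at t within {0..T})"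
      and i: "\<forall>j\<le>Suc n. norm (x j 0 :: complex) \<le> B"
      and w: "\<forall>t\<in>{0..T}. norm (diff_op p (\<lambda>j. x j t)) \<le> B"
      and j: "j \<le> Suc n" and t: "t \<in> {0..T}"
    define y where "y t = diff_op q (\<lambda>j. x j t)" for t
    have B0: "B \<ge> 0" using i[rule_format, of 0] norm_ge_zero[of "x 0 0"] by linarith
    have sB: "0 \<le> B / (- Re s)" using B0 q(4) by (intro divide_nonneg_pos) auto
    have cB: "0 \<le> (\<Sum>j\<le>n. norm (coeff q j)) * B" using B0 by (intro mult_nonneg_nonneg sum_nonneg) auto
    have y0: "norm (y 0) \<le> (\<Sum>j\<le>n. norm (coeff q j)) * B"
      unfolding y_def diff_op_def q(2) sum_distrib_right
      by (rule order_trans[OF norm_sum], rule sum_mono) (use i in \<open>auto simp: norm_mult intro!: mult_left_mono\<close>)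
    have yt: "norm (y \<tau>) \<le> B1" if \<tau>: "\<tau> \<in> {0..T}" for \<tau>
    proof -
      have "norm (y \<tau>) \<le> norm (y 0) + B / (- Re s)"
      proof (rule stable_scalar_bounded[OF q(4) _ _ \<tau>])
        fix u assume u: "u \<in> {0..T}"
        show "norm (diff_op p (\<lambda>j. x j u)) \<le> B" using w u by blast
        have "(y has_vector_derivative diff_op q (\<lambda>j. x (Suc j) u)) (at u within {0..T})"
          unfolding y_def by (rule diff_op_deriv) (use d u q(2) in auto)
        moreover have "diff_op q (\<lambda>j. x (Suc j) u) = s * y u + diff_op p (\<lambda>j. x j u)"
          unfolding q(1) diff_op_factor[OF q(3)] y_def by simp
        ultimately show "(y has_vector_derivative s * y u + diff_op p (\<lambda>j. x j u)) (at u within {0..T})" by simp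
      qed
      then show ?thesis using y0 B0 by (simp add: B1_def)
    qed
    have low: "\<forall>j\<le>n. \<forall>t\<in>{0..T}. norm (x j t) \<le> B2"
    proof (rule B2)
      show "\<forall>j\<le>n. norm (x j 0) \<le> B1"
      proof (intro allI impI)
        fix j assume "j \<le> n"
        then have "norm (x j 0) \<le> B" using i by auto
        then show "norm (x j 0) \<le> B1" unfolding B1_def using sB cB B0 by (simp add: add_increasing)
      qed
    qed (use d yt in \<open>auto simp: y_def\<close>)
    show "norm (x j t) \<le> max B2 B3"
    proof (cases "j \<le> n")
      case True then show ?thesis using low t by (auto simp: le_max_iff_disj)
    next
      case False
      then have jn: "j = Suc n" using j by simp
      have "norm (x j t) = norm (diff_op p (\<lambda>j. x j t) - (\<Sum>j\<le>n. coeff p j * x j t)) / norm (lead_coeff p)"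
        unfolding jn using diff_op_top[OF Suc.prems(1,2), of "\<lambda>j. x j t"] by (metis norm_divide)
      also have "\<dots> \<le> B3" unfolding B3_def
      proof (rule divide_right_mono)
        have "norm (\<Sum>j\<le>n. coeff p j * x j t) \<le> (\<Sum>j\<le>n. norm (coeff p j) * \<bar>B2\<bar>)"
        proof (rule order_trans[OF norm_sum], rule sum_mono)
          fix j assume "j \<in> {..n}"
          then have "norm (x j t) \<le> \<bar>B2\<bar>" using low t by force
          then show "norm (coeff p j * x j t) \<le> norm (coeff p j) * \<bar>B2\<bar>"
            by (simp add: norm_mult mult_left_mono)
        qed
        moreover have "norm (diff_op p (\<lambda>j. x j t)) \<le> \<bar>B\<bar>" using w t by force
        ultimately show "norm (diff_op p (\<lambda>j. x j t) - (\<Sum>j\<le>n. coeff p j * x j t))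
            \<le> \<bar>B\<bar> + (\<Sum>j\<le>n. norm (coeff p j)) * \<bar>B2\<bar>"
          unfolding sum_distrib_right[symmetric] by (smt (verit) norm_triangle_ineq4)
      qed simp
      finally show ?thesis by simp
    qed
  qed
qed

text \<open>The same factorization with limits in place of bounds: a stable scalar equation with
  convergent forcing converges to its steady state.\<close>

lemma diff_op_tendsto:
  fixes p :: "complex poly"
  assumes "p \<noteq> 0" "degree p = n" "\<And>s. poly p s = 0 \<Longrightarrow> Re s < 0"
    and "\<And>j t. j < n \<Longrightarrow> t \<ge> 0 \<Longrightarrow> (x j has_vector_derivative x (Suc j) t) (at t within {0..})"
    and "((\<lambda>t. diff_op p (\<lambda>j. x j t)) \<longlongrightarrow> w) at_top"
  shows "\<forall>j\<le>n. \<exists>l. (x j \<longlongrightarrow> l) at_top"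
  using assms
proof (induction n arbitrary: p w)
  case 0
  then obtain c where c: "p = [:c:]" "c \<noteq> 0" by (metis degree_eq_zeroE pCons_eq_0_iff)
  have "((\<lambda>t. c * x 0 t / c) \<longlongrightarrow> w / c) at_top"
    using 0(5) c by (intro tendsto_intros) (auto simp: diff_op_def)
  then show ?case using c(2) by auto
next
  case (Suc n)
  obtain s q where q: "p = [:-s, 1:] * q" "degree q = n" "q \<noteq> 0" "Re s < 0" "\<And>s. poly q s = 0 \<Longrightarrow> Re s < 0"
    using stable_factor[OF Suc.prems(2,3)] by blast
  define y where "y t = diff_op q (\<lambda>j. x j t)" for t
  have "(y \<longlongrightarrow> - w / s) at_top"
  proof (rule stable_scalar_tendsto[OF q(4) _ Suc.prems(5)])
    fix u :: real assume u: "u \<ge> 0"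
    have "(y has_vector_derivative diff_op q (\<lambda>j. x (Suc j) u)) (at u within {0..})"
      unfolding y_def by (rule diff_op_deriv) (use Suc.prems(4) u q(2) in auto)
    moreover have "diff_op q (\<lambda>j. x (Suc j) u) = s * y u + diff_op p (\<lambda>j. x j u)"
      unfolding q(1) diff_op_factor[OF q(3)] y_def by simp
    ultimately show "(y has_vector_derivative s * y u + diff_op p (\<lambda>j. x j u)) (at u within {0..})" by simp
  qed
  then have low: "\<forall>j\<le>n. \<exists>l. (x j \<longlongrightarrow> l) at_top"
    using Suc.IH[OF q(3,2,5)] Suc.prems(4) unfolding y_def by auto
  then obtain l where l: "\<And>j. j \<le> n \<Longrightarrow> (x j \<longlongrightarrow> l j) at_top" by metis
  have lc: "lead_coeff p \<noteq> 0" using Suc.prems(1) by (simp only: leading_coeff_0_iff not_False_eq_True)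
  have "((\<lambda>t. (diff_op p (\<lambda>j. x j t) - (\<Sum>j\<le>n. coeff p j * x j t)) / lead_coeff p)
      \<longlongrightarrow> (w - (\<Sum>j\<le>n. coeff p j * l j)) / lead_coeff p) at_top"
    using lc by (intro tendsto_intros Suc.prems(5) l) auto
  moreover have "x (Suc n) = (\<lambda>t. (diff_op p (\<lambda>j. x j t) - (\<Sum>j\<le>n. coeff p j * x j t)) / lead_coeff p)"
    using diff_op_top[OF Suc.prems(1,2), of "\<lambda>j. x j _"] by (intro ext)
  ultimately show ?case using low by (metis le_Suc_eq)
qed

section \<open>Limits of derivatives\<close>

lemma mvt_half_line:
  fixes f f' :: "real \<Rightarrow> real"
  assumes d: "\<And>t. t \<ge> 0 \<Longrightarrow> (f has_real_derivative f' t) (at t within {0..})" and t: "t \<ge> 0" "\<delta> > 0"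
  obtains \<xi> where "t < \<xi>" "\<xi> < t + \<delta>" "f (t + \<delta>) - f t = \<delta> * f' \<xi>"
proof -
  have "\<exists>\<xi>\<in>{t<..<t+\<delta>}. f (t + \<delta>) - f t = (\<lambda>h. f' \<xi> * h) (t + \<delta> - t)"
  proof (rule mvt_simple)
    fix \<tau> assume "t \<le> \<tau>" "\<tau> \<le> t + \<delta>"
    then have "(f has_real_derivative f' \<tau>) (at \<tau> within {t..t+\<delta>})"
      using d[of \<tau>] t by (auto intro: has_field_derivative_subset)
    then show "(f has_derivative (\<lambda>h. f' \<tau> * h)) (at \<tau> within {t..t+\<delta>})"
      by (simp add: has_field_derivative_def)
  qed (use t in auto)
  then show thesis using that by (auto simp: mult.commute)
qed

text \<open>Increments over unit intervals tend to 0, and by the mean value theorem they are values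
  of \<open>f'\<close> at times tending to infinity.\<close>

lemma tendsto_deriv_tendsto_imp_zero:
  fixes f f' :: "real \<Rightarrow> real"
  assumes d: "\<And>t. t \<ge> 0 \<Longrightarrow> (f has_real_derivative f' t) (at t within {0..})"
    and f: "(f \<longlongrightarrow> l) at_top" and f': "(f' \<longlongrightarrow> l') at_top"
  shows "l' = 0"
proof -
  have "\<exists>\<xi>\<in>{t<..<t+1}. f (t + 1) - f t = f' \<xi>" if t: "t \<ge> 0" for t
    using mvt_half_line[OF d t zero_less_one] by (metis greaterThanLessThan_iff mult_1)
  then obtain \<xi> where \<xi>: "\<And>t. t \<ge> 0 \<Longrightarrow> \<xi> t \<in> {t<..<t+1}" "\<And>t. t \<ge> 0 \<Longrightarrow> f (t + 1) - f t = f' (\<xi> t)"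
    by metis
  have "filterlim \<xi> at_top at_top"
    by (rule filterlim_at_top_mono[OF filterlim_ident])
       (use \<xi>(1) in \<open>auto simp: eventually_at_top_linorder intro!: exI[of _ 0] less_imp_le\<close>)
  then have "((\<lambda>t. f' (\<xi> t)) \<longlongrightarrow> l') at_top" by (rule filterlim_compose[OF f'])
  moreover have "((\<lambda>t. f (t + 1) - f t) \<longlongrightarrow> l - l) at_top"
  proof (intro tendsto_diff f)
    have "filterlim (\<lambda>t::real. 1 + t) at_top at_top"
      by (rule filterlim_tendsto_add_at_top[OF tendsto_const filterlim_ident])
    then have "filterlim (\<lambda>t::real. t + 1) at_top at_top" by (simp only: add.commute)
    then show "((\<lambda>t. f (t + 1)) \<longlongrightarrow> l) at_top" by (rule filterlim_compose[OF f])
  qed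
  then have "((\<lambda>t. f' (\<xi> t)) \<longlongrightarrow> l - l) at_top"
    by (rule Lim_transform_eventually) (use \<xi>(2) in \<open>auto simp: eventually_at_top_linorder\<close>)
  ultimately show ?thesis using tendsto_unique[of "at_top :: real filter"] by fastforce
qed

text \<open>On a window of length \<delta> the derivative differs from its mean slope by at most
  \<open>K * \<delta>\<close>, and the mean slope vanishes in the limit because \<open>f\<close>
  converges. The window is fixed first, short enough for an error below
  \<open>e / 2\<close>.\<close>

lemma barbalat:
  fixes f f' :: "real \<Rightarrow> real"
  assumes d: "\<And>t. t \<ge> 0 \<Longrightarrow> (f has_real_derivative f' t) (at t within {0..})"
    and f: "(f \<longlongrightarrow> l) at_top"
    and lip: "\<And>s t. s \<ge> 0 \<Longrightarrow> t \<ge> 0 \<Longrightarrow> \<bar>f' s - f' t\<bar> \<le> K * \<bar>s - t\<bar>"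
  shows "(f' \<longlongrightarrow> 0) at_top"
proof (rule tendstoI)
  fix e :: real assume e: "e > 0"
  have K: "K \<ge> 0" using lip[of 1 0] by auto
  define \<delta> where "\<delta> = e / (2 * K + 2)"
  have \<delta>: "\<delta> > 0" using e K by (simp add: \<delta>_def)
  have K\<delta>: "K * \<delta> < e / 2 " using e K by (simp add: \<delta>_def field_simps)
  have main: "\<bar>f' t\<bar> \<le> \<bar>f (t + \<delta>) - f t\<bar> / \<delta> + K * \<delta>" if t: "t \<ge> 0" for t
  proof -
    obtain \<xi> where \<xi>: "t < \<xi>" "\<xi> < t + \<delta>" "f (t + \<delta>) - f t = \<delta> * f' \<xi>"
      by (rule mvt_half_line[OF d t \<delta>])
    have "\<bar>f' t - f' \<xi>\<bar> \<le> K * \<bar>t - \<xi>\<bar>" using lip[of t \<xi>] t \<xi> by auto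
    also have "\<dots> \<le> K * \<delta>" using K \<xi> by (intro mult_left_mono) auto
    finally have "\<bar>f' t\<bar> \<le> \<bar>f' \<xi>\<bar> + K * \<delta>" by linarith
    moreover have "\<bar>f (t + \<delta>) - f t\<bar> / \<delta> = \<bar>f' \<xi>\<bar>" using \<xi>(3) \<delta> by (simp add: abs_mult)
    ultimately show ?thesis by simp
  qed
  have "((\<lambda>t. \<bar>f (t + \<delta>) - f t\<bar> / \<delta>) \<longlongrightarrow> \<bar>l - l\<bar> / \<delta>) at_top"
  proof (intro tendsto_intros f)
    have "filterlim (\<lambda>t::real. \<delta> + t) at_top at_top"
      by (rule filterlim_tendsto_add_at_top[OF tendsto_const filterlim_ident])
    then have "filterlim (\<lambda>t::real. t + \<delta>) at_top at_top" by (simp only: add.commute)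
    then show "((\<lambda>t. f (t + \<delta>)) \<longlongrightarrow> l) at_top" by (rule filterlim_compose[OF f])
  qed (use \<delta> in auto)
  then have "\<forall>\<^sub>F t in at_top. \<bar>f (t + \<delta>) - f t\<bar> / \<delta> < e / 2"
    by (rule order_tendstoD(2)) (use e in auto)
  then show "\<forall>\<^sub>F t in at_top. dist (f' t) 0 < e"
    using eventually_ge_at_top[of 0]
  proof eventually_elim
    case (elim t)
    then have "\<bar>f' t\<bar> < e" using main[OF elim(2)] K\<delta> by linarith
    then show ?case by simp
  qed
qed

text \<open>Complexification makes linear factors available. The hypotheses on the chain speak of
  real functions, so its entries are embedded into the complex numbers and the results read back
  through norms and real parts.\<close>

lemma
  fixes p :: "real poly"
  assumes "hurwitz p" "p \<noteq> 0"
  shows hurwitz_chain_bounded: "\<exists>B'. \<forall>T x. (\<forall>j<degree p. \<forall>t\<in>{0..T}. (x j has_real_derivative x (Suc j) t) (at t within {0..T})) \<longrightarrow>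
     (\<forall>j\<le>degree p. \<bar>x j 0\<bar> \<le> B) \<longrightarrow> (\<forall>t\<in>{0..T}. \<bar>\<Sum>j\<le>degree p. coeff p j * x j t\<bar> \<le> B) \<longrightarrow>
     (\<forall>j\<le>degree p. \<forall>t\<in>{0..T}. \<bar>x j t\<bar> \<le> B')"
    and hurwitz_chain_tendsto: "\<And>x w j. \<lbrakk>\<And>j t. j < degree p \<Longrightarrow> t \<ge> 0 \<Longrightarrow> (x j has_real_derivative x (Suc j) t) (at t within {0..});
     ((\<lambda>t. \<Sum>j\<le>degree p. coeff p j * x j t) \<longlongrightarrow> w) at_top; j \<le> degree p\<rbrakk>
     \<Longrightarrow> (x j \<longlongrightarrow> (if j = 0 then w / coeff p 0 else 0)) at_top"
proof -
  define P where "P = map_poly complex_of_real p"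
  have P: "P \<noteq> 0" "degree P = degree p" "coeff P j = of_real (coeff p j)" for j
    using assms(2) by (auto simp: P_def degree_map_poly coeff_map_poly map_poly_eq_0_iff)
  have roots: "\<And>s. poly P s = 0 \<Longrightarrow> Re s < 0" using assms(1) by (simp add: hurwitz_def P_def)
  have op: "diff_op P (\<lambda>j. of_real (x j)) = of_real (\<Sum>j\<le>degree p. coeff p j * x j)" for x
    by (simp add: diff_op_def P)
  have vd: "((\<lambda>t. complex_of_real (f t)) has_vector_derivative of_real f') (at t within S)"
    if "(f has_real_derivative f') (at t within S)" for f f' t S
    using that by (simp add: has_vector_derivative_of_real has_real_derivative_iff_has_vector_derivative)
  show "\<exists>B'. \<forall>T x. (\<forall>j<degree p. \<forall>t\<in>{0..T}. (x j has_real_derivative x (Suc j) t) (at t within {0..T})) \<longrightarrow>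
     (\<forall>j\<le>degree p. \<bar>x j 0\<bar> \<le> B) \<longrightarrow> (\<forall>t\<in>{0..T}. \<bar>\<Sum>j\<le>degree p. coeff p j * x j t\<bar> \<le> B) \<longrightarrow>
     (\<forall>j\<le>degree p. \<forall>t\<in>{0..T}. \<bar>x j t\<bar> \<le> B')"
  proof -
    obtain B' where B': "\<And>T x. (\<forall>j<degree p. \<forall>t\<in>{0..T}. (x j has_vector_derivative x (Suc j) t) (at t within {0..T})) \<Longrightarrow>
     (\<forall>j\<le>degree p. norm (x j 0) \<le> B) \<Longrightarrow> (\<forall>t\<in>{0..T}. norm (diff_op P (\<lambda>j. x j t)) \<le> B) \<Longrightarrow>
     (\<forall>j\<le>degree p. \<forall>t\<in>{0..T}. norm (x j t) \<le> B')"
      using diff_op_bounded[OF P(1,2) roots, of B] by blast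
    show ?thesis
    proof (intro exI[of _ B'] allI impI)
      fix T j and x :: "nat \<Rightarrow> real \<Rightarrow> real"
      assume *: "\<forall>j<degree p. \<forall>t\<in>{0..T}. (x j has_real_derivative x (Suc j) t) (at t within {0..T})"
        "\<forall>j\<le>degree p. \<bar>x j 0\<bar> \<le> B" "\<forall>t\<in>{0..T}. \<bar>\<Sum>j\<le>degree p. coeff p j * x j t\<bar> \<le> B" "j \<le> degree p"
      have "\<forall>j\<le>degree p. \<forall>t\<in>{0..T}. norm (complex_of_real (x j t)) \<le> B'"
        by (rule B') (use * vd in \<open>auto simp: op simp del: of_real_sum\<close>)
      then show "\<forall>t\<in>{0..T}. \<bar>x j t\<bar> \<le> B'" using *(4) by simp
    qed
  qed
  fix x w j
  assume d: "\<And>j t. j < degree p \<Longrightarrow> t \<ge> 0 \<Longrightarrow> (x j has_real_derivative x (Suc j) t) (at t within {0..})"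
    and w: "((\<lambda>t. \<Sum>j\<le>degree p. coeff p j * x j t) \<longlongrightarrow> w) at_top" and j: "j \<le> degree p"
  have "\<forall>j\<le>degree p. \<exists>l. ((\<lambda>t. complex_of_real (x j t)) \<longlongrightarrow> l) at_top"
  proof (rule diff_op_tendsto[OF P(1,2) roots])
    show "((\<lambda>t. diff_op P (\<lambda>j. of_real (x j t))) \<longlongrightarrow> of_real w) at_top"
      unfolding op using w by (rule tendsto_of_real)
  qed (use d vd in auto)
  then have "\<exists>l. (x j \<longlongrightarrow> l) at_top" if "j \<le> degree p" for j
    using that tendsto_Re[of "\<lambda>t. complex_of_real (x j t)"] by fastforce
  then obtain l where l: "\<And>j. j \<le> degree p \<Longrightarrow> (x j \<longlongrightarrow> l j) at_top" by metis
  \<comment> \<open>Each higher entry is the derivative of a convergent one, so its limit is 0. Only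
    the constant term of the operator survives in the limit and determines
    \<open>l 0\<close>.\<close>
  have l0: "l (Suc j) = 0" if "Suc j \<le> degree p" for j
    using tendsto_deriv_tendsto_imp_zero[OF d l l] that by auto
  \<comment> \<open>Otherwise 0 would be a root, and its real part is not negative.\<close>
  have c0: "coeff p 0 \<noteq> 0"
  proof
    assume "coeff p 0 = 0"
    then have "poly P 0 = 0" by (simp add: poly_0_coeff_0 P)
    then show False using roots by fastforce
  qed
  have "((\<lambda>t. \<Sum>j\<le>degree p. coeff p j * x j t) \<longlongrightarrow> (\<Sum>j\<le>degree p. coeff p j * l j)) at_top"
    by (intro tendsto_intros l) auto
  then have "w = (\<Sum>j\<le>degree p. coeff p j * l j)"
    using w tendsto_unique[of "at_top :: real filter"] by fastforce
  also have "\<dots> = (\<Sum>j\<in>{0}. coeff p j * l j)"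
  proof (rule sum.mono_neutral_right)
    show "\<forall>i\<in>{..degree p} - {0}. coeff p i * l i = 0"
    proof
      fix i assume "i \<in> {..degree p} - {0}"
      then show "coeff p i * l i = 0" using l0[of "i - 1"] by auto
    qed
  qed auto
  finally have "w = coeff p 0 * l 0" by simp
  then have "l j = (if j = 0 then w / coeff p 0 else 0)" using c0 l0[of "j - 1"] j by auto
  then show "(x j \<longlongrightarrow> (if j = 0 then w / coeff p 0 else 0)) at_top" using l[OF j] by simp
qed

section \<open>Graph Laplacians\<close>

definition laplacian :: "('i \<times> 'i) set \<Rightarrow> ('i \<Rightarrow> 'a::real_vector) \<Rightarrow> 'i \<Rightarrow> 'a" where
  "laplacian E w i = (\<Sum>j\<in>neighbors E i. w i - w j)"

lemma laplacian_diff: "laplacian E (\<lambda>i. v i - w i) i = laplacian E v i - laplacian E w i"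
  unfolding laplacian_def sum_subtractf[symmetric] by (rule sum.cong) (auto simp: algebra_simps)

lemma sum_edges:
  fixes E :: "('i::finite \<times> 'i) set"
  shows "(\<Sum>i\<in>UNIV. \<Sum>j\<in>neighbors E i. f i j) = (\<Sum>(i,j)\<in>E. f i j)"
proof -
  have "E = Sigma UNIV (neighbors E)" by (auto simp: neighbors_def)
  then show ?thesis by (subst sum.Sigma) auto
qed

lemma sum_edges_swap:
  assumes "sym E" shows "(\<Sum>(i,j)\<in>E. f i j) = (\<Sum>(i,j)\<in>E. f j i)"
  by (rule sum.reindex_bij_witness[where i = "\<lambda>(i,j). (j,i)" and j = "\<lambda>(i,j). (j,i)"])
     (use assms in \<open>auto dest: symD\<close>)

text \<open>Averaging the sum over oriented edges with its reversal symmetrizes the summand. Every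
  undirected edge occurs in both orientations, hence the division by 2.\<close>

lemma laplacian_form:
  fixes E :: "('i::finite \<times> 'i) set" and v w :: "'i \<Rightarrow> 'a::real_inner"
  assumes "sym E"
  shows "(\<Sum>i\<in>UNIV. v i \<bullet> laplacian E w i) = (\<Sum>(i,j)\<in>E. (v i - v j) \<bullet> (w i - w j)) / 2"
proof -
  have 1: "(\<Sum>i\<in>UNIV. v i \<bullet> laplacian E w i) = (\<Sum>(i,j)\<in>E. v i \<bullet> (w i - w j))"
    unfolding laplacian_def inner_sum_right sum_edges ..
  have 2: "\<dots> = (\<Sum>(i,j)\<in>E. v j \<bullet> (w j - w i))"
    by (rule sum_edges_swap[OF assms])
  have "(\<Sum>(i,j)\<in>E. v i \<bullet> (w i - w j)) + (\<Sum>(i,j)\<in>E. v j \<bullet> (w j - w i))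
      = (\<Sum>(i,j)\<in>E. (v i - v j) \<bullet> (w i - w j))"
    unfolding sum.distrib[symmetric] by (rule sum.cong) (auto simp: algebra_simps inner_diff)
  then show ?thesis using 1 2 by simp
qed

lemma laplacian_symmetric:
  fixes E :: "('i::finite \<times> 'i) set" and v w :: "'i \<Rightarrow> 'a::real_inner"
  assumes "sym E"
  shows "(\<Sum>i\<in>UNIV. v i \<bullet> laplacian E w i) = (\<Sum>i\<in>UNIV. laplacian E v i \<bullet> w i)"
  unfolding laplacian_form[OF assms] inner_commute[of "laplacian E v _"]
  by (simp add: inner_commute)

lemma laplacian_nonneg:
  fixes E :: "('i::finite \<times> 'i) set" and w :: "'i \<Rightarrow> 'a::real_inner"
  assumes "sym E"
  shows "(\<Sum>i\<in>UNIV. w i \<bullet> laplacian E w i) \<ge> 0"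
  unfolding laplacian_form[OF assms] by (auto intro!: sum_nonneg)

lemma sum_laplacian:
  fixes E :: "('i::finite \<times> 'i) set" and w :: "'i \<Rightarrow> 'a::real_vector"
  assumes "sym E"
  shows "(\<Sum>i\<in>UNIV. laplacian E w i) = 0"
proof -
  have "(\<Sum>i\<in>UNIV. laplacian E w i) = (\<Sum>(i,j)\<in>E. w i) - (\<Sum>(i,j)\<in>E. w j)"
    unfolding laplacian_def sum_edges sum_subtractf[symmetric] by (rule sum.cong) auto
  also have "\<dots> = 0" using sum_edges_swap[OF assms, of "\<lambda>i j. w i"] by simp
  finally show ?thesis .
qed

text \<open>\<open>n\<close> is the length of a path from \<open>i\<close> to \<open>j\<close>; it
  depends on the graph alone, whence its place before \<open>w\<close> and \<open>Q\<close>.\<close>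

lemma edge_bound_path:
  fixes w :: "'i \<Rightarrow> 'a::real_normed_vector"
  assumes "(i, j) \<in> E\<^sup>*"
  shows "\<exists>n::nat. \<forall>(w :: 'i \<Rightarrow> 'a) Q. (\<forall>(a,b)\<in>E. norm (w a - w b) \<le> Q) \<longrightarrow> norm (w i - w j) \<le> real n * Q"
  using assms
proof (induction rule: rtrancl_induct)
  case base show ?case by (intro exI[of _ 0]) auto
next
  case (step j k)
  then obtain n :: nat where n: "\<And>(w :: 'i \<Rightarrow> 'a) Q. (\<forall>(a,b)\<in>E. norm (w a - w b) \<le> Q) \<Longrightarrow> norm (w i - w j) \<le> real n * Q"
    by blast
  show ?case
  proof (intro exI[of _ "Suc n"] allI impI)
    fix w :: "'i \<Rightarrow> 'a" and Q assume *: "\<forall>(a,b)\<in>E. norm (w a - w b) \<le> Q"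
    have "norm (w i - w k) \<le> norm (w i - w j) + norm (w j - w k)"
      using norm_triangle_ineq[of "w i - w j" "w j - w k"] by simp
    also have "\<dots> \<le> real n * Q + Q" using n[OF *] * step(2) by (intro add_mono) auto
    finally show "norm (w i - w k) \<le> real (Suc n) * Q" by (simp add: algebra_simps)
  qed
qed

lemma edge_bound_connected:
  fixes E :: "('i::finite \<times> 'i) set"
  assumes "\<And>i j. (i, j) \<in> E\<^sup>*"
  obtains n :: nat where "\<And>(w :: 'i \<Rightarrow> 'a::real_normed_vector) Q i j.
    (\<And>a b. (a,b) \<in> E \<Longrightarrow> norm (w a - w b) \<le> Q) \<Longrightarrow> 0 \<le> Q \<Longrightarrow> norm (w i - w j) \<le> real n * Q"
proof -
  have "\<forall>p. \<exists>n::nat. \<forall>(w :: 'i \<Rightarrow> 'a) Q. (\<forall>(a,b)\<in>E. norm (w a - w b) \<le> Q)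
      \<longrightarrow> norm (w (fst p) - w (snd p)) \<le> real n * Q"
    using edge_bound_path[OF assms] by blast
  then obtain n :: "'i \<times> 'i \<Rightarrow> nat" where n: "\<And>p (w :: 'i \<Rightarrow> 'a) Q. (\<forall>(a,b)\<in>E. norm (w a - w b) \<le> Q)
      \<Longrightarrow> norm (w (fst p) - w (snd p)) \<le> real (n p) * Q"
    by metis
  show thesis
  proof (rule that[of "Max (range n)"])
    fix w :: "'i \<Rightarrow> 'a" and Q i j assume *: "\<And>a b. (a,b) \<in> E \<Longrightarrow> norm (w a - w b) \<le> Q" "0 \<le> Q"
    have "norm (w i - w j) \<le> real (n (i,j)) * Q" using n[of w Q "(i,j)"] * by auto
    also have "\<dots> \<le> real (Max (range n)) * Q" using *(2) by (intro mult_right_mono) auto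
    finally show "norm (w i - w j) \<le> real (Max (range n)) * Q" .
  qed
qed

text \<open>A Poincare inequality obtained without eigenvalues. With \<open>Q\<close> the Euclidean
  norm of all edge differences, \<open>Q * Q\<close> is twice the quadratic form, which is at most a
  multiple of \<open>Q * S\<close>, where \<open>S\<close> sums the norms of the Laplacian; one
  factor \<open>Q\<close> cancels. The final \<open>+ 1\<close> only keeps the constant
  positive.\<close>

lemma disagreement_le_laplacian:
  fixes E :: "('i::finite \<times> 'i) set"
  assumes "sym E" "\<And>i j. (i, j) \<in> E\<^sup>*"
  obtains C where "C > 0" "\<And>(w :: 'i \<Rightarrow> 'a::real_inner) i j.
    norm (w i - w j) \<le> C * (\<Sum>k\<in>UNIV. norm (laplacian E w k))"
proof -
  obtain n :: nat where n: "\<And>(w :: 'i \<Rightarrow> 'a) Q i j.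
    (\<And>a b. (a,b) \<in> E \<Longrightarrow> norm (w a - w b) \<le> Q) \<Longrightarrow> 0 \<le> Q \<Longrightarrow> norm (w i - w j) \<le> real n * Q"
    using edge_bound_connected[OF assms(2)] by blast
  show thesis
  proof (rule that[of "2 * real n * real n + 1"])
    fix w :: "'i \<Rightarrow> 'a" and i j
    define S where "S = (\<Sum>k\<in>UNIV. norm (laplacian E w k))"
    define q where "q = (\<Sum>(a,b)\<in>E. (norm (w a - w b))\<^sup>2)"
    define Q where "Q = sqrt q"
    have q0: "q \<ge> 0" unfolding q_def by (intro sum_nonneg) auto
    have Q: "Q \<ge> 0" "Q * Q = q" using q0 by (auto simp: Q_def)
    have S: "S \<ge> 0" unfolding S_def by (intro sum_nonneg) auto
    have edge: "norm (w a - w b) \<le> Q" if "(a,b) \<in> E" for a b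
    proof -
      have "(norm (w a - w b))\<^sup>2 \<le> q" unfolding q_def
        using member_le_sum[of "(a,b)" E "\<lambda>(a,b). (norm (w a - w b))\<^sup>2"] that by auto
      then show ?thesis unfolding Q_def by (rule real_le_rsqrt)
    qed
    have nQ: "norm (w a - w b) \<le> real n * Q" for a b using n[OF edge Q(1)] .
    have "q = 2 * (\<Sum>k\<in>UNIV. w k \<bullet> laplacian E w k)"
      unfolding laplacian_form[OF assms(1)] q_def by (simp add: power2_norm_eq_inner)
    \<comment> \<open>Recentring at \<open>w i\<close> is free because the Laplacian sums to zero,
      and it replaces values by differences, which \<open>Q\<close> controls along paths.\<close>
    also have "(\<Sum>k\<in>UNIV. w k \<bullet> laplacian E w k) = (\<Sum>k\<in>UNIV. (w k - w i) \<bullet> laplacian E w k)"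
      by (simp add: inner_diff_left sum_subtractf inner_sum_right[symmetric] sum_laplacian[OF assms(1)])
    also have "\<dots> \<le> (\<Sum>k\<in>UNIV. (real n * Q) * norm (laplacian E w k))"
    proof (rule sum_mono)
      fix k
      have "(w k - w i) \<bullet> laplacian E w k \<le> norm (w k - w i) * norm (laplacian E w k)"
        by (rule norm_cauchy_schwarz)
      also have "\<dots> \<le> (real n * Q) * norm (laplacian E w k)"
        using nQ by (intro mult_right_mono) auto
      finally show "(w k - w i) \<bullet> laplacian E w k \<le> (real n * Q) * norm (laplacian E w k)" .
    qed
    also have "\<dots> = real n * Q * S" by (simp add: S_def sum_distrib_left)
    finally have "Q * Q \<le> (2 * real n * S) * Q" using Q by (simp add: algebra_simps)
    then have QS: "Q \<le> 2 * real n * S"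
      using Q(1) S by (cases "Q = 0") (auto dest: mult_right_le_imp_le)
    have "norm (w i - w j) \<le> real n * (2 * real n * S)"
      using nQ[of i j] mult_left_mono[OF QS, of "real n"] by simp
    also have "\<dots> \<le> (2 * real n * real n + 1) * S" using S by (simp add: algebra_simps)
    finally show "norm (w i - w j) \<le> (2 * real n * real n + 1) * (\<Sum>k\<in>UNIV. norm (laplacian E w k))"
      unfolding S_def .
  qed (auto intro: add_nonneg_pos)
qed

text \<open>The Laplacian plus the all-ones matrix is injective, hence surjective.\<close>

lemma laplacian_surj:
  fixes E :: "('i::finite \<times> 'i) set" and z :: "'i \<Rightarrow> real^'m::finite"
  assumes "sym E" "\<And>i j. (i, j) \<in> E\<^sup>*" and z: "(\<Sum>i\<in>UNIV. z i) = 0"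
  obtains w where "\<And>i. laplacian E w i = z i"
proof -
  define T :: "real^'i \<Rightarrow> real^'i" where "T w = (\<chi> i. laplacian E (($) w) i + (\<Sum>j\<in>UNIV. w $ j))" for w
  have T_nth: "T w $ i = laplacian E (($) w) i + (\<Sum>j\<in>UNIV. w $ j)" for w i by (simp add: T_def)
  have lin: "linear T"
    unfolding T_def laplacian_def
    by (rule linearI) (auto simp: vec_eq_iff sum.distrib sum_distrib_left sum_subtractf algebra_simps)
  have sumT: "(\<Sum>i\<in>UNIV. T w $ i) = real CARD('i) * (\<Sum>j\<in>UNIV. w $ j)" for w
    by (simp add: T_nth sum.distrib sum_laplacian[OF assms(1)])
  have "inj T"
    unfolding linear_injective_0[OF lin]
  proof (intro allI impI)
    fix w assume Tw: "T w = 0"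
    then have s0: "(\<Sum>j\<in>UNIV. w $ j) = 0" using sumT[of w] by simp
    have L0: "laplacian E (($) w) i = 0" for i using T_nth[of w i] Tw s0 by simp
    obtain C where "C > 0" and C: "\<And>(w :: 'i \<Rightarrow> real) i j. norm (w i - w j) \<le> C * (\<Sum>k\<in>UNIV. norm (laplacian E w k))"
      using disagreement_le_laplacian[where ?'a = real, OF assms(1,2)] by blast
    have eq: "w $ i = w $ j" for i j using C[of "($) w" i j] L0 by simp
    have "w $ i = 0" for i
    proof -
      have "(\<Sum>j\<in>UNIV. w $ j) = (\<Sum>j\<in>(UNIV::'i set). w $ i)" by (rule sum.cong) (auto intro: eq)
      then show ?thesis using s0 by simp
    qed
    then show "w = 0" by (simp add: vec_eq_iff)
  qed
  then have "surj T" using linear_injective_imp_surjective[OF lin] by auto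
  then have "\<forall>a. \<exists>w. T w = (\<chi> i. z i $ a)" by (metis surjD)
  then obtain W where W: "\<And>a. T (W a) = (\<chi> i. z i $ a)" by metis
  \<comment> \<open>Summing \<open>T w\<close> kills the Laplacian part. As \<open>z\<close> sums to
    zero, so does the preimage; its all-ones contribution vanishes and \<open>T\<close> acts on it
    as the Laplacian.\<close>
  have "(\<Sum>j\<in>UNIV. W a $ j) = 0" for a
    using sumT[of "W a"] z by (simp add: W sum_component[symmetric])
  then have "laplacian E (($) (W a)) i = z i $ a" for a i
    using T_nth[of "W a" i] by (simp add: W)
  then have "laplacian E (\<lambda>i. \<chi> a. W a $ i) i = z i" for i
    by (simp add: laplacian_def vec_eq_iff)
  then show thesis by (rule that)
qed

section \<open>Convex analysis of the game\<close>

lemma convex_on_above_tangent: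
  fixes f :: "'a::real_normed_vector \<Rightarrow> real"
  assumes conv: "convex_on UNIV f" and d: "(f has_derivative f') (at x)"
  shows "f x + f' (y - x) \<le> f y"
proof -
  define h where "h t = f (x + t *\<^sub>R (y - x))" for t :: real
  have cv: "convex_on UNIV h"
  proof (rule convex_onI)
    fix t a b :: real assume t: "0 < t" "t < 1"
    have "x + ((1 - t) *\<^sub>R a + t *\<^sub>R b) *\<^sub>R (y - x)
        = (1 - t) *\<^sub>R (x + a *\<^sub>R (y - x)) + t *\<^sub>R (x + b *\<^sub>R (y - x))"
      by (simp add: algebra_simps)
    then show "h ((1 - t) *\<^sub>R a + t *\<^sub>R b) \<le> (1 - t) * h a + t * h b"
      unfolding h_def using convex_onD[OF conv, of t "x + a *\<^sub>R (y - x)" "x + b *\<^sub>R (y - x)"] t by simp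
  qed simp
  have "((\<lambda>t::real. x + t *\<^sub>R (y - x)) has_derivative (\<lambda>t. t *\<^sub>R (y - x))) (at 0)"
    by (auto intro!: derivative_eq_intros)
  moreover have "(f has_derivative f') (at (x + (0::real) *\<^sub>R (y - x)))" using d by simp
  ultimately have "(h has_derivative (\<lambda>t. f' (t *\<^sub>R (y - x)))) (at 0)"
    unfolding h_def by (rule has_derivative_compose)
  moreover have "f' (t *\<^sub>R (y - x)) = f' (y - x) * t" for t
    using linear_scale[OF has_derivative_linear[OF d]] by simp
  ultimately have "(h has_real_derivative f' (y - x)) (at 0)"
    by (simp add: has_field_derivative_def)
  then have "h 1 - h 0 \<ge> f' (y - x) * (1 - 0)"
    by (intro convex_on_imp_above_tangent[OF cv]) auto
  then show ?thesis by (simp add: h_def)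
qed

lemma grad_eqI:
  assumes "GDERIV f x :> D" shows "grad f x = D"
  unfolding grad_def
proof (rule the_equality[of "\<lambda>D. GDERIV f x :> D", OF assms])
  fix D' assume "GDERIV f x :> D'"
  then have "(\<lambda>h. h \<bullet> D') = (\<lambda>h. h \<bullet> D)"
    using assms unfolding gderiv_def by (rule has_derivative_unique)
  then have "\<And>h. h \<bullet> D' = h \<bullet> D" by (rule fun_cong)
  then show "D' = D" by (metis vector_eq_ldot)
qed

lemma has_derivative_imp_gderiv:
  fixes f :: "'a::euclidean_space \<Rightarrow> real"
  assumes "(f has_derivative f') (at x)"
  shows "GDERIV f x :> grad f x"
proof -
  define D where "D = (\<Sum>b\<in>Basis. f' b *\<^sub>R b)"
  have "f' h = h \<bullet> D" for h
  proof -
    have "f' h = f' (\<Sum>b\<in>Basis. (h \<bullet> b) *\<^sub>R b)" by (simp add: euclidean_representation)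
    also have "\<dots> = (\<Sum>b\<in>Basis. (h \<bullet> b) * f' b)"
      using has_derivative_linear[OF assms] by (simp add: linear_sum linear_scale)
    also have "\<dots> = h \<bullet> D" by (simp add: D_def inner_sum_right mult.commute)
    finally show ?thesis .
  qed
  then have "f' = (\<lambda>h. h \<bullet> D)" by blast
  then have "GDERIV f x :> D" using assms by (simp add: gderiv_def)
  then show ?thesis using grad_eqI by metis
qed

lemma C1_lipschitz_on_cball:
  fixes f :: "'a::euclidean_space \<Rightarrow> 'b::real_normed_vector"
  assumes "C1 f"
  obtains L where "L \<ge> 0" "\<And>x y. norm x \<le> R \<Longrightarrow> norm y \<le> R \<Longrightarrow> norm (f x - f y) \<le> L * norm (x - y)"
proof -
  obtain f' where f': "\<And>x. (f has_derivative blinfun_apply (f' x)) (at x)" "continuous_on UNIV f'"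
    using assms unfolding C1_def by blast
  have "compact (f' ` cball 0 R)"
    by (intro compact_continuous_image continuous_on_subset[OF f'(2)]) auto
  then have "bounded (f' ` cball 0 R)" by (rule compact_imp_bounded)
  then obtain B where "\<forall>y\<in>f' ` cball 0 R. norm y \<le> B" unfolding bounded_iff by blast
  then have B: "\<And>x. x \<in> cball 0 R \<Longrightarrow> norm (f' x) \<le> B" by blast
  show thesis
  proof (rule that[of "max 0 B"])
    fix x y :: 'a assume "norm x \<le> R" "norm y \<le> R"
    then show "norm (f x - f y) \<le> max 0 B * norm (x - y)"
    proof (intro differentiable_bound[of "cball 0 R" f "\<lambda>x. blinfun_apply (f' x)"])
      fix z :: 'a assume "z \<in> cball 0 R"
      then show "onorm (blinfun_apply (f' z)) \<le> max 0 B" using B[of z] by (simp add: norm_blinfun.rep_eq le_max_iff_disj)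
    qed (auto intro: has_derivative_at_withinI[OF f'(1)])
  qed auto
qed

text \<open>Solutions are the fixed points of a projected step against \<open>F\<close>. The step
  \<mu>/\<theta>^2 minimizes the squared contraction factor 1 - 2 \<tau> \<mu> + \<tau>^2
  \<theta>^2, leaving 1 - \<mu>^2/\<theta>^2, and Banach's theorem applies.\<close>

lemma strongly_monotone_VI_exists:
  fixes F :: "'a::euclidean_space \<Rightarrow> 'a"
  assumes S: "convex S" "closed S" "S \<noteq> {}"
    and mono: "\<mu> > 0" "strongly_monotone \<mu> F" and lip: "\<theta> > 0" "\<theta>-lipschitz_on UNIV F"
  obtains x where "x \<in> S" "\<And>y. y \<in> S \<Longrightarrow> F x \<bullet> (y - x) \<ge> 0"
proof -
  define \<tau> where "\<tau> = \<mu> / \<theta>\<^sup>2"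
  \<comment> \<open>The \<open>max 0\<close> keeps the radicand nonnegative without a comparison of
    \<mu> and \<theta>.\<close>
  define c where "c = sqrt (max 0 (1 - \<mu>\<^sup>2 / \<theta>\<^sup>2))"
  have \<tau>: "\<tau> > 0" using mono lip by (simp add: \<tau>_def)
  have c: "0 \<le> c" "c < 1" using mono lip by (auto simp: c_def)
  define T where "T x = closest_point S (x - \<tau> *\<^sub>R F x)" for x
  have "dist (T x) (T y) \<le> c * dist x y" for x y
  proof -
    have "dist (T x) (T y) \<le> dist (x - \<tau> *\<^sub>R F x) (y - \<tau> *\<^sub>R F y)"
      unfolding T_def by (rule closest_point_lipschitz[OF S])
    also have "\<dots> \<le> c * dist x y"
    proof (rule power2_le_imp_le)
      have m: "(F x - F y) \<bullet> (x - y) \<ge> \<mu> * (norm (x - y))\<^sup>2"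
        using mono(2) by (simp add: strongly_monotone_def)
      have "norm (F x - F y) \<le> \<theta> * norm (x - y)"
        using lipschitz_onD[OF lip(2), of x y] by (simp add: dist_norm)
      then have l: "(norm (F x - F y))\<^sup>2 \<le> \<theta>\<^sup>2 * (norm (x - y))\<^sup>2"
        using power_mono[of "norm (F x - F y)" "\<theta> * norm (x - y)" 2] by (simp add: power_mult_distrib)
      have "(dist (x - \<tau> *\<^sub>R F x) (y - \<tau> *\<^sub>R F y))\<^sup>2 = (norm ((x - y) - \<tau> *\<^sub>R (F x - F y)))\<^sup>2"
        by (simp add: dist_norm algebra_simps)
      also have "\<dots> = (norm (x - y))\<^sup>2 - 2 * \<tau> * ((F x - F y) \<bullet> (x - y)) + \<tau>\<^sup>2 * (norm (F x - F y))\<^sup>2"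
        unfolding power2_norm_eq_inner
        by (simp add: inner_diff_left inner_diff_right inner_commute power2_eq_square algebra_simps)
      also have "\<dots> \<le> (norm (x - y))\<^sup>2 - 2 * \<tau> * (\<mu> * (norm (x - y))\<^sup>2) + \<tau>\<^sup>2 * (\<theta>\<^sup>2 * (norm (x - y))\<^sup>2)"
        using m l \<tau> by (intro add_mono diff_mono mult_left_mono) auto
      also have "\<dots> = (1 - \<mu>\<^sup>2 / \<theta>\<^sup>2) * (norm (x - y))\<^sup>2"
        using lip(1) by (simp add: \<tau>_def field_simps power2_eq_square)
      also have "\<dots> \<le> max 0 (1 - \<mu>\<^sup>2 / \<theta>\<^sup>2) * (norm (x - y))\<^sup>2"
        by (intro mult_right_mono) auto
      also have "\<dots> = (c * dist x y)\<^sup>2" by (simp add: c_def dist_norm power_mult_distrib)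
      finally show "(dist (x - \<tau> *\<^sub>R F x) (y - \<tau> *\<^sub>R F y))\<^sup>2 \<le> (c * dist x y)\<^sup>2" .
    qed (use c in auto)
    finally show ?thesis .
  qed
  then obtain x where x: "T x = x" using banach_fix_type[OF c, of T] by blast
  show thesis
  proof (rule that[of x])
    show "x \<in> S" using closest_point_in_set[OF S(2,3)] x by (metis T_def)
    fix y assume y: "y \<in> S"
    have "(x - \<tau> *\<^sub>R F x - x) \<bullet> (y - x) \<le> 0"
      using closest_point_dot[OF S(1,2) y, of "x - \<tau> *\<^sub>R F x"] x by (simp add: T_def)
    then have "\<tau> * (F x \<bullet> (y - x)) \<ge> 0" by simp
    then show "F x \<bullet> (y - x) \<ge> 0" using \<tau> by (simp add: zero_le_mult_iff)
  qed
qed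

text \<open>Slater's condition excludes a separating hyperplane with vanishing objective weight.\<close>

lemma multiplier_exists:
  fixes G :: "'a::euclidean_space \<Rightarrow> real^'m::finite" and F :: 'a
  assumes conv: "\<And>a. convex_on UNIV (\<lambda>x. G x $ a)" and slater: "\<exists>y. \<forall>a. G y $ a < 0"
    and feas: "\<And>a. G x $ a \<le> 0"
    and opt: "\<And>y. (\<And>a. G y $ a \<le> 0) \<Longrightarrow> F \<bullet> (y - x) \<ge> 0"
  obtains lam where "\<And>a. lam $ a \<ge> 0" "lam \<bullet> G x = 0" "\<And>y. F \<bullet> (y - x) + lam \<bullet> G y \<ge> 0"
proof -
  \<comment> \<open>Pairs of constraint and objective levels that some \<open>y\<close> strictly
    undercuts. Convexity of the components of \<open>G\<close> makes this set convex, and optimality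
    of \<open>x\<close> keeps the origin out of it.\<close>
  define A where "A = {(u, s). \<exists>y. (\<forall>a. G y $ a < u $ a) \<and> F \<bullet> (y - x) < s}"
  have "convex A"
  proof (rule convexI)
    fix p q :: "(real^'m) \<times> real" and \<alpha> \<beta> :: real
    assume p: "p \<in> A" and q: "q \<in> A" and ab: "\<alpha> \<ge> 0" "\<beta> \<ge> 0" "\<alpha> + \<beta> = 1"
    have "\<exists>y. (\<forall>a. G y $ a < fst p $ a) \<and> F \<bullet> (y - x) < snd p" using p by (cases p) (simp add: A_def)
    then obtain y where y: "\<And>a. G y $ a < fst p $ a" "F \<bullet> (y - x) < snd p" by blast
    have "\<exists>z. (\<forall>a. G z $ a < fst q $ a) \<and> F \<bullet> (z - x) < snd q" using q by (cases q) (simp add: A_def)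
    then obtain z where z: "\<And>a. G z $ a < fst q $ a" "F \<bullet> (z - x) < snd q" by blast
    have comb: "\<alpha> * a1 + \<beta> * b1 < \<alpha> * a2 + \<beta> * b2" if "a1 < a2" "b1 < b2" for a1 a2 b1 b2 :: real
    proof (cases "\<alpha> = 0")
      case True then show ?thesis using ab that by simp
    next
      case False
      then have "\<alpha> * a1 < \<alpha> * a2" using that ab by simp
      moreover have "\<beta> * b1 \<le> \<beta> * b2" using that ab by (intro mult_left_mono) auto
      ultimately show ?thesis by simp
    qed
    have "G (\<alpha> *\<^sub>R y + \<beta> *\<^sub>R z) $ a < (\<alpha> *\<^sub>R fst p + \<beta> *\<^sub>R fst q) $ a" for a
    proof -
      have \<alpha>: "1 - \<beta> = \<alpha>" and "\<beta> \<le> 1" using ab by auto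
      have "G (\<alpha> *\<^sub>R y + \<beta> *\<^sub>R z) $ a \<le> \<alpha> * G y $ a + \<beta> * G z $ a"
        using convex_onD[OF conv, of \<beta> y z a] ab(2) \<open>\<beta> \<le> 1\<close> by (simp add: \<alpha>)
      also have "\<dots> < \<alpha> * fst p $ a + \<beta> * fst q $ a" by (rule comb[OF y(1) z(1)])
      finally show ?thesis by simp
    qed
    moreover have "F \<bullet> (\<alpha> *\<^sub>R y + \<beta> *\<^sub>R z - x) < \<alpha> * snd p + \<beta> * snd q"
    proof -
      have "x = \<alpha> *\<^sub>R x + \<beta> *\<^sub>R x" using ab by (simp add: scaleR_add_left[symmetric])
      then have "F \<bullet> (\<alpha> *\<^sub>R y + \<beta> *\<^sub>R z - x) = \<alpha> * (F \<bullet> (y - x)) + \<beta> * (F \<bullet> (z - x))"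
        by (metis (no_types, lifting) add_diff_add inner_add_right inner_scaleR_right scaleR_diff_right)
      then show ?thesis using comb[OF y(2) z(2)] by simp
    qed
    ultimately show "\<alpha> *\<^sub>R p + \<beta> *\<^sub>R q \<in> A"
      unfolding A_def by (auto simp: case_prod_unfold)
  qed
  moreover have "0 \<notin> A"
  proof
    assume "0 \<in> A"
    then obtain y where "\<And>a. G y $ a < 0" "F \<bullet> (y - x) < 0" by (auto simp: A_def zero_prod_def)
    then show False using opt[of y] by (force intro: less_imp_le)
  qed
  ultimately have "\<exists>h. h \<noteq> 0 \<and> (\<forall>w\<in>A. 0 \<le> h \<bullet> w)" by (rule separating_hyperplane_set_0)
  then obtain h where h: "h \<noteq> 0" "\<And>w. w \<in> A \<Longrightarrow> 0 \<le> h \<bullet> w" by blast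
  obtain p q where pq: "h = (p, q)" by fastforce
  have hA: "0 \<le> p \<bullet> u + q * s" if "\<And>a. G y $ a < u $ a" "F \<bullet> (y - x) < s" for u s y
    using h(2)[of "(u, s)"] that by (auto simp: A_def pq inner_prod_def)
  \<comment> \<open>Separation speaks of strict inequalities. Raising all levels by a small
    \<open>e\<close> makes them strict; \<open>e\<close> is so small that this changes the
    functional by at most half of the supposed violation.\<close>
  have hA': "0 \<le> p \<bullet> u + q * s" if le: "\<And>a. G y $ a \<le> u $ a" "F \<bullet> (y - x) \<le> s" for u s y
  proof (rule ccontr)
    assume neg: "\<not> 0 \<le> p \<bullet> u + q * s"
    define w where "w = p \<bullet> (\<chi> a. 1) + q"
    define e where "e = - (p \<bullet> u + q * s) / (2 * (\<bar>w\<bar> + 1))"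
    have e: "e > 0" using neg by (simp add: e_def)
    have "0 \<le> p \<bullet> (u + (\<chi> a. e)) + q * (s + e)"
    proof (rule hA[of y])
      show "G y $ a < (u + (\<chi> a. e)) $ a" for a using le(1)[of a] e by simp
      show "F \<bullet> (y - x) < s + e" using le(2) e by simp
    qed
    also have "\<dots> = p \<bullet> u + q * s + e * w"
    proof -
      have "p \<bullet> (\<chi> a. e) = e * (p \<bullet> (\<chi> a. 1))"
        by (simp add: inner_vec_def sum_distrib_left mult.commute)
      then show ?thesis by (simp add: inner_add_right w_def algebra_simps)
    qed
    finally have "0 \<le> p \<bullet> u + q * s + e * w" .
    moreover have "e * w \<le> e * (\<bar>w\<bar> + 1)" using e by (intro mult_left_mono) auto
    moreover have "e * (\<bar>w\<bar> + 1) = - (p \<bullet> u + q * s) / 2" by (simp add: e_def field_simps)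
    moreover have "0 \<le> Q" if "0 \<le> Q + V" "V \<le> W" "W = - Q / 2" for Q V W :: real
      using that by linarith
    ultimately show False using neg by blast
  qed
  \<comment> \<open>Levels may be raised arbitrarily. A negative coefficient would let the
    functional drop to at most -1 by raising the corresponding level by \<open>M\<close>; the same
    argument gives \<open>q0\<close>.\<close>
  have p0: "p $ a \<ge> 0" for a
  proof (rule ccontr)
    assume "\<not> p $ a \<ge> 0"
    then have neg: "p $ a < 0" by simp
    define M where "M = (\<bar>p \<bullet> G x\<bar> + 1) / (- p $ a)"
    have M: "M \<ge> 0" unfolding M_def using neg by (intro divide_nonneg_pos) auto
    have "0 \<le> p \<bullet> (G x + axis a M) + q * 0"
      by (rule hA'[of x]) (use M in \<open>auto simp: axis_def\<close>)
    also have "\<dots> = p \<bullet> G x + p $ a * M" by (simp add: inner_add_right inner_axis)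
    also have "p $ a * M = - (\<bar>p \<bullet> G x\<bar> + 1)" using neg by (simp add: M_def)
    finally show False by linarith
  qed
  have q0: "q \<ge> 0"
  proof (rule ccontr)
    assume neg: "\<not> q \<ge> 0"
    define M where "M = (\<bar>p \<bullet> G x\<bar> + 1) / (- q)"
    have "M \<ge> 0" unfolding M_def using neg by (intro divide_nonneg_pos) auto
    then have "0 \<le> p \<bullet> G x + q * M" by (intro hA'[of x]) auto
    moreover have "q * M = - (\<bar>p \<bullet> G x\<bar> + 1)" using neg by (simp add: M_def)
    ultimately show False by linarith
  qed
  have "q \<noteq> 0"
  proof
    assume qz: "q = 0"
    then have "p \<noteq> 0" using h(1) pq by (auto simp: zero_prod_def)
    then obtain a where a: "p $ a \<noteq> 0" by (auto simp: vec_eq_iff)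
    obtain y where y: "\<And>a. G y $ a < 0" using slater by blast
    have "0 \<le> p \<bullet> G y" using hA'[of y "G y" "F \<bullet> (y - x)"] qz by simp
    also have "p \<bullet> G y = (\<Sum>b\<in>UNIV. p $ b * G y $ b)" by (simp add: inner_vec_def)
    also have "\<dots> \<le> (\<Sum>b\<in>{a}. p $ b * G y $ b)"
    proof -
      have "(\<Sum>b\<in>UNIV. p $ b * G y $ b) = p $ a * G y $ a + (\<Sum>b\<in>UNIV-{a}. p $ b * G y $ b)"
        by (subst sum.remove[of _ a]) auto
      moreover have "(\<Sum>b\<in>UNIV-{a}. p $ b * G y $ b) \<le> 0"
        using p0 y by (intro sum_nonpos mult_nonneg_nonpos) (auto intro: less_imp_le)
      ultimately show ?thesis by simp
    qed
    also have "\<dots> < 0" using a p0[of a] y[of a] by (simp add: mult_pos_neg)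
    finally show False by simp
  qed
  then have qpos: "q > 0" using q0 by simp
  define lam where "lam = (1 / q) *\<^sub>R p"
  have lam0: "lam $ a \<ge> 0" for a using p0[of a] qpos by (simp add: lam_def)
  have L: "F \<bullet> (y - x) + lam \<bullet> G y \<ge> 0" for y
  proof -
    have "0 \<le> p \<bullet> G y + q * (F \<bullet> (y - x))" by (rule hA'[of y]) auto
    then have "0 \<le> (p \<bullet> G y + q * (F \<bullet> (y - x))) / q" using qpos by simp
    also have "\<dots> = F \<bullet> (y - x) + lam \<bullet> G y" using qpos by (simp add: lam_def field_simps)
    finally show ?thesis .
  qed
  have "lam \<bullet> G x \<le> 0"
    unfolding inner_vec_def using lam0 feas by (auto intro!: sum_nonpos mult_nonneg_nonpos)
  then have "lam \<bullet> G x = 0" using L[of x] by simp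
  then show thesis using that lam0 L by blast
qed

lemma inner_le_inner_nonneg:
  fixes u v w :: "real^'m::finite"
  assumes "\<And>a. w $ a \<ge> 0" "\<And>a. u $ a \<le> v $ a"
  shows "w \<bullet> u \<le> w \<bullet> v"
  unfolding inner_vec_def using assms by (auto intro!: sum_mono mult_left_mono)

section \<open>KKT points of the game\<close>

locale gne_game =
  fixes own :: "'n::finite \<Rightarrow> 'i::finite"
    and J :: "'i \<Rightarrow> real^'n \<Rightarrow> real"
    and g :: "'i \<Rightarrow> real^'n \<Rightarrow> real^'m::finite"
    and \<mu> \<theta>\<^sub>0 :: real
  assumes g_block: "\<And>i. depends_on_block own i (g i)"
    and g_convex: "\<And>i a. convex_on UNIV (\<lambda>x. g i x $ a)"
    and g_C2: "\<And>i. C2 (g i)"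
    and slater: "slater UNIV g"
    and J_C1: "\<And>i. C1 (J i)"
    and J_convex: "\<And>i x. convex_on UNIV (\<lambda>y. J i (block_upd own i y x))"
    and F_monotone: "\<mu> > 0" "strongly_monotone \<mu> (pseudo_gradient own J)"
    and F_lipschitz: "\<theta>\<^sub>0 > 0" "\<theta>\<^sub>0-lipschitz_on UNIV (pseudo_gradient own J)"
begin

abbreviation F where "F \<equiv> pseudo_gradient own J"
abbreviation G where "G i \<equiv> block_grad own i (J i)"
definition A :: "'i \<Rightarrow> real^'n \<Rightarrow> real^'m \<Rightarrow> real^'n" where
  "A i x lam = transpose (jacobian (g i) (at x)) *v lam"

lemma block_upd_self: "block_upd own i x x = x"
  by (simp add: block_upd_def vec_eq_iff)

lemma block_upd_deriv:
  "((\<lambda>y. block_upd own i y x) has_derivative (\<lambda>h. block_upd own i h 0)) (at y)"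
proof -
  have lin: "bounded_linear (\<lambda>h::real^'n. block_upd own i h 0)"
    by (rule linear_conv_bounded_linear[THEN iffD1], rule linearI) (auto simp: block_upd_def vec_eq_iff)
  have "(\<lambda>y. block_upd own i y x) = (\<lambda>y. block_upd own i y 0 + block_upd own i 0 x)"
    by (auto simp: block_upd_def vec_eq_iff)
  moreover have "((\<lambda>y. block_upd own i y 0 + block_upd own i 0 x) has_derivative (\<lambda>h. block_upd own i h 0)) (at y)"
    using bounded_linear_imp_has_derivative[OF lin] by (auto intro!: derivative_eq_intros)
  ultimately show ?thesis by simp
qed

lemma G_deriv: "((\<lambda>y. J i (block_upd own i y x)) has_derivative (\<lambda>h. h \<bullet> G i x)) (at x)"
  and G_other_block: "own l \<noteq> i \<Longrightarrow> G i x $ l = 0"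
proof -
  obtain J' where J': "\<And>x. (J i has_derivative blinfun_apply (J' x)) (at x)"
    using J_C1[of i] unfolding C1_def by blast
  have d: "((\<lambda>y. J i (block_upd own i y x)) has_derivative (\<lambda>h. blinfun_apply (J' x) (block_upd own i h 0))) (at x)"
    by (rule has_derivative_compose[OF block_upd_deriv]) (use J'[of x] in \<open>simp add: block_upd_self\<close>)
  from has_derivative_imp_gderiv[OF d]
  show gd: "((\<lambda>y. J i (block_upd own i y x)) has_derivative (\<lambda>h. h \<bullet> G i x)) (at x)"
    by (simp add: gderiv_def block_grad_def)
  assume l: "own l \<noteq> i"
  have "axis l 1 \<bullet> G i x = blinfun_apply (J' x) (block_upd own i (axis l 1) 0)"
    using has_derivative_unique[OF gd d] by (rule fun_cong)
  also have "block_upd own i (axis l 1) 0 = (0 :: real^'n)"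
    using l by (auto simp: block_upd_def vec_eq_iff axis_def)
  finally show "G i x $ l = 0" by (simp add: inner_axis' blinfun.zero_right)
qed

lemma G_own_block: "own l = i \<Longrightarrow> G i x $ l = F x $ l"
  by (auto simp: pseudo_gradient_def)

lemma J_above_tangent: "J i x + G i x \<bullet> (y - x) \<le> J i (block_upd own i y x)"
  using convex_on_above_tangent[OF J_convex G_deriv, of i x y]
  by (simp add: block_upd_self inner_commute)

lemma g_deriv: "(g i has_derivative (\<lambda>h. jacobian (g i) (at x) *v h)) (at x)"
proof -
  obtain f' where "\<And>x. (g i has_derivative blinfun_apply (f' x)) (at x)"
    using g_C2[of i] unfolding C2_def by blast
  then have "g i differentiable (at x)" by (meson differentiable_def)
  then show ?thesis by (simp add: jacobian_works)
qed

lemma A_inner: "A i x lam \<bullet> h = lam \<bullet> (jacobian (g i) (at x) *v h)"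
  unfolding A_def by (simp add: dot_lmul_matrix)

lemma g_above_tangent: "g i x $ a + (jacobian (g i) (at x) *v (y - x)) $ a \<le> g i y $ a"
proof -
  have "((\<lambda>x. g i x $ a) has_derivative (\<lambda>h. (jacobian (g i) (at x) *v h) $ a)) (at x)"
    by (rule bounded_linear.has_derivative[OF bounded_linear_vec_nth g_deriv])
  from convex_on_above_tangent[OF g_convex this] show ?thesis .
qed

text \<open>Nonnegative weights preserve the tangent inequality of each convex component. This is
  the form in which convexity of the constraints enters uniqueness and dissipation.\<close>

lemma A_above_tangent:
  assumes "\<And>a. lam $ a \<ge> 0"
  shows "A i x lam \<bullet> (y - x) \<le> lam \<bullet> (g i y - g i x)"
  unfolding A_inner
  by (rule inner_le_inner_nonneg[OF assms]) (use g_above_tangent[of i x _ y] in \<open>simp add: algebra_simps\<close>)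

text \<open>\<open>g i\<close> factors through the projection onto block \<open>i\<close>, and by
  the chain rule its derivative annihilates directions outside that block.\<close>

lemma A_other_block:
  assumes l: "own l \<noteq> i" shows "A i x lam $ l = 0"
proof -
  have eq: "g i = (\<lambda>y. g i (block_upd own i y 0))"
    using g_block[of i] unfolding depends_on_block_def by (auto simp: block_upd_def)
  have "((\<lambda>y. g i (block_upd own i y 0)) has_derivative
      (\<lambda>h. jacobian (g i) (at (block_upd own i x 0)) *v (block_upd own i h 0))) (at x)"
    by (rule has_derivative_compose[OF block_upd_deriv g_deriv])
  then have "(\<lambda>h. jacobian (g i) (at x) *v h) = (\<lambda>h. jacobian (g i) (at (block_upd own i x 0)) *v (block_upd own i h 0))"
    unfolding eq[symmetric] by (rule has_derivative_unique[OF g_deriv])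
  from fun_cong[OF this, of "axis l 1"]
  have "jacobian (g i) (at x) *v axis l 1 = 0"
  proof -
    have "block_upd own i (axis l 1) 0 = (0 :: real^'n)"
      using l by (auto simp: block_upd_def vec_eq_iff axis_def)
    then show ?thesis using \<open>jacobian (g i) (at x) *v axis l 1 = _\<close> by simp
  qed
  then have "A i x lam \<bullet> axis l 1 = 0" unfolding A_inner by simp
  then show ?thesis by (simp add: inner_axis)
qed

text \<open>Second differentiability makes the derivative of \<open>g i\<close> Lipschitz on balls.
  The factor \<open>norm lam\<close> isolates the linear dependence on the multiplier, so that
  \<open>lam\<close> is free to range over an unbounded set.\<close>

lemma A_lipschitz:
  obtains L where "L \<ge> 0" "\<And>x y lam. norm x \<le> R \<Longrightarrow> norm y \<le> R \<Longrightarrow>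
    \<bar>A i x lam $ l - A i y lam $ l\<bar> \<le> L * norm (x - y) * norm lam"
proof -
  obtain f' where f': "\<And>x. (g i has_derivative blinfun_apply (f' x)) (at x)" "C1 f'"
    using g_C2[of i] unfolding C2_def by blast
  obtain L where L: "L \<ge> 0" "\<And>x y. norm x \<le> R \<Longrightarrow> norm y \<le> R \<Longrightarrow> norm (f' x - f' y) \<le> L * norm (x - y)"
    using C1_lipschitz_on_cball[OF f'(2)] by blast
  have jac: "jacobian (g i) (at x) *v h = blinfun_apply (f' x) h" for x h
    using has_derivative_unique[OF g_deriv f'(1), of x] by (rule fun_cong)
  show thesis
  proof (rule that[OF L(1)])
    fix x y :: "real^'n" and lam assume xy: "norm x \<le> R" "norm y \<le> R"
    have nth: "A i z lam $ l = lam \<bullet> blinfun_apply (f' z) (axis l 1)" for z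
      using A_inner[of i z lam "axis l 1"] by (simp add: inner_axis jac)
    have "\<bar>A i x lam $ l - A i y lam $ l\<bar> = \<bar>lam \<bullet> blinfun_apply (f' x - f' y) (axis l 1)\<bar>"
      by (simp add: nth blinfun.diff_left inner_diff_right)
    also have "\<dots> \<le> norm lam * norm (blinfun_apply (f' x - f' y) (axis l 1))"
      by (rule Cauchy_Schwarz_ineq2)
    also have "\<dots> \<le> norm lam * (norm (f' x - f' y) * norm (axis l 1 :: real^'n))"
      by (intro mult_left_mono norm_blinfun) auto
    also have "\<dots> \<le> norm lam * (L * norm (x - y))"
      using L(2)[OF xy] by (intro mult_left_mono) auto
    finally show "\<bar>A i x lam $ l - A i y lam $ l\<bar> \<le> L * norm (x - y) * norm lam"
      by (simp add: mult_ac)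
  qed
qed

lemma g_lipschitz:
  obtains L where "L \<ge> 0" "\<And>x y. norm x \<le> R \<Longrightarrow> norm y \<le> R \<Longrightarrow> norm (g i x - g i y) \<le> L * norm (x - y)"
proof -
  obtain f' where f': "\<And>x. (g i has_derivative blinfun_apply (f' x)) (at x)" "C1 f'"
    using g_C2[of i] unfolding C2_def by blast
  then obtain f'' where "\<And>x. (f' has_derivative blinfun_apply (f'' x)) (at x)" unfolding C1_def by blast
  then have "continuous_on UNIV f'" by (meson continuous_at_imp_continuous_on has_derivative_continuous)
  then have "C1 (g i)" using f'(1) unfolding C1_def by blast
  then show thesis using C1_lipschitz_on_cball that by blast
qed

lemma coupling_nth: "coupling g x $ a = (\<Sum>i\<in>UNIV. g i x $ a)"
  by (simp add: coupling_def)

lemma coupling_convex: "convex_on UNIV (\<lambda>x. coupling g x $ a)"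
proof -
  have "convex_on UNIV (\<lambda>x. \<Sum>i\<in>I. g i x $ a)" for I :: "'i set"
    by (induction I rule: infinite_finite_induct) (auto intro!: convex_on_add g_convex simp: convex_on_const)
  then show ?thesis by (simp add: coupling_nth)
qed

lemma coupling_deriv: "(coupling g has_derivative (\<lambda>h. \<Sum>i\<in>UNIV. jacobian (g i) (at x) *v h)) (at x)"
  unfolding coupling_def[abs_def] by (rule has_derivative_sum) (rule g_deriv)

lemma coupling_jacobian: "transpose (jacobian (coupling g) (at x)) *v lam = (\<Sum>i\<in>UNIV. A i x lam)"
proof -
  have "coupling g differentiable (at x)" using coupling_deriv by (meson differentiable_def)
  then have "(coupling g has_derivative (\<lambda>h. jacobian (coupling g) (at x) *v h)) (at x)"
    by (simp add: jacobian_works)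
  then have "(\<lambda>h. jacobian (coupling g) (at x) *v h) = (\<lambda>h. \<Sum>i\<in>UNIV. jacobian (g i) (at x) *v h)"
    using coupling_deriv by (rule has_derivative_unique)
  then have *: "jacobian (coupling g) (at x) *v h = (\<Sum>i\<in>UNIV. jacobian (g i) (at x) *v h)" for h
    by (rule fun_cong)
  have "(transpose (jacobian (coupling g) (at x)) *v lam) \<bullet> h = (\<Sum>i\<in>UNIV. A i x lam) \<bullet> h" for h
  proof -
    have "(transpose (jacobian (coupling g) (at x)) *v lam) \<bullet> h = lam \<bullet> (jacobian (coupling g) (at x) *v h)"
      by (simp add: dot_lmul_matrix)
    then show ?thesis by (simp add: * inner_sum_right inner_sum_left A_inner)
  qed
  then have "\<forall>h. (transpose (jacobian (coupling g) (at x)) *v lam) \<bullet> h = (\<Sum>i\<in>UNIV. A i x lam) \<bullet> h" by blast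
  then show ?thesis unfolding vector_eq_rdot .
qed

lemma sum_A_nth: "(\<Sum>i\<in>UNIV. A i x lam $ l) = A (own l) x lam $ l"
proof -
  have "(\<Sum>i\<in>UNIV. A i x lam $ l) = (\<Sum>i\<in>{own l}. A i x lam $ l)"
    by (rule sum.mono_neutral_right) (auto intro: A_other_block)
  then show ?thesis by simp
qed

text \<open>Test points: \<open>lam\<close> moved along an axis gives the signs, while 0 and twice
  \<open>lam\<close> give both inequalities of the complementarity condition.\<close>

lemma normal_cone_orthant:
  fixes v lam :: "real^'m"
  assumes lam: "0 \<le> lam"
  shows "v \<in> normal_cone {0..} lam \<longleftrightarrow> (\<forall>a. v $ a \<le> 0) \<and> lam \<bullet> v = 0"
proof
  assume v: "v \<in> normal_cone {0..} lam"
  have 1: "v $ a \<le> 0" for a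
  proof -
    have "lam + axis a 1 \<in> {0..}"
      using lam by (auto simp: less_eq_vec_def axis_def add_increasing2)
    then have "v \<bullet> (lam + axis a 1 - lam) \<le> 0" using v unfolding normal_cone_def by blast
    then show ?thesis by (simp add: inner_axis)
  qed
  have z: "0 \<in> {0::real^'m..}" "2 *\<^sub>R lam \<in> {0..}" using lam by (auto simp: less_eq_vec_def)
  have "v \<bullet> (0 - lam) \<le> 0" using v z(1) unfolding normal_cone_def by blast
  moreover have "v \<bullet> (2 *\<^sub>R lam - lam) \<le> 0" using v z(2) unfolding normal_cone_def by blast
  ultimately have "lam \<bullet> v = 0" by (simp add: inner_commute scaleR_2)
  then show "(\<forall>a. v $ a \<le> 0) \<and> lam \<bullet> v = 0" using 1 by blast
next
  assume v: "(\<forall>a. v $ a \<le> 0) \<and> lam \<bullet> v = 0"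
  show "v \<in> normal_cone {0..} lam"
    unfolding normal_cone_def
  proof (intro CollectI ballI)
    fix z :: "real^'m" assume "z \<in> {0..}"
    then have "v \<bullet> z \<le> 0"
      using v unfolding inner_vec_def by (auto intro!: sum_nonpos mult_nonpos_nonneg simp: less_eq_vec_def)
    then show "v \<bullet> (z - lam) \<le> 0" using v by (simp add: inner_diff_right inner_commute)
  qed
qed

text \<open>The normal cone of the whole space is trivial, and in row \<open>l\<close> only the
  owner's constraint Jacobian survives; the KKT system thus splits into one equation for each
  strategy component.\<close>

lemma KKT_iff:
  "KKT own UNIV J g x lam \<longleftrightarrow> (\<forall>a. 0 \<le> lam $ a) \<and> (\<forall>l. F x $ l + A (own l) x lam $ l = 0) \<and>
     (\<forall>a. coupling g x $ a \<le> 0) \<and> lam \<bullet> coupling g x = 0"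
proof -
  have nc: "normal_cone UNIV x = {0::real^'n}"
  proof
    show "normal_cone UNIV x \<subseteq> {0::real^'n}"
    proof
      fix v :: "real^'n" assume "v \<in> normal_cone UNIV x"
      then have "v \<bullet> (x + v - x) \<le> 0" unfolding normal_cone_def by blast
      then have "v \<bullet> v \<le> 0" by simp
      then show "v \<in> {0}" using inner_ge_zero[of v] by (simp add: order_antisym)
    qed
  qed (simp add: normal_cone_def)
  have 1: "0 \<in> (+) (F x + transpose (jacobian (coupling g) (at x)) *v lam) ` normal_cone UNIV x
      \<longleftrightarrow> (\<forall>l. F x $ l + A (own l) x lam $ l = 0)"
  proof -
    have "0 \<in> (+) w ` {0} \<longleftrightarrow> w = 0" for w :: "real^'n" by auto
    then show ?thesis unfolding nc coupling_jacobian by (simp add: vec_eq_iff sum_A_nth)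
  qed
  have 2: "0 \<in> (+) (- coupling g x) ` normal_cone {0..} lam \<longleftrightarrow> coupling g x \<in> normal_cone {0..} lam"
    by (auto simp: image_iff add_eq_0_iff)
  have 3: "0 \<le> lam \<longleftrightarrow> (\<forall>a. 0 \<le> lam $ a)" by (simp add: less_eq_vec_def)
  show ?thesis unfolding KKT_def 1 2 using normal_cone_orthant[of lam "coupling g x"] 3 by auto
qed

text \<open>\<open>x\<close> solves the variational inequality of \<open>F\<close> over the feasible
  set, so it minimizes the linear function with slope \<open>F x\<close> there. Slater's condition
  turns this linear program over a convex set into a multiplier.\<close>

lemma KKT_exists: obtains x lam where "KKT own UNIV J g x lam"
proof -
  define X where "X = {x. \<forall>a. coupling g x $ a \<le> 0}"
  have sl: "\<exists>y. \<forall>a. coupling g y $ a < 0" using slater unfolding slater_def by auto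
  have ne: "X \<noteq> {}" using sl unfolding X_def by (auto intro: less_imp_le)
  have conv: "convex X"
  proof -
    have "convex {x. coupling g x $ a \<le> 0}" for a
    proof (rule convexI)
      fix x y :: "real^'n" and u v :: real
      assume xy: "x \<in> {x. coupling g x $ a \<le> 0}" "y \<in> {x. coupling g x $ a \<le> 0}"
        and uv: "0 \<le> u" "0 \<le> v" "u + v = 1"
      have u: "1 - v = u" and "v \<le> 1" using uv by auto
      have "coupling g (u *\<^sub>R x + v *\<^sub>R y) $ a \<le> u * coupling g x $ a + v * coupling g y $ a"
        using convex_onD[OF coupling_convex, of v x y a] uv(2) \<open>v \<le> 1\<close> by (simp add: u)
      also have "\<dots> \<le> 0" using xy uv by (auto intro!: add_nonpos_nonpos mult_nonneg_nonpos)
      finally show "u *\<^sub>R x + v *\<^sub>R y \<in> {x. coupling g x $ a \<le> 0}" by simp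
    qed
    then have "convex (\<Inter>a. {x. coupling g x $ a \<le> 0})" by (intro convex_INT) auto
    moreover have "X = (\<Inter>a. {x. coupling g x $ a \<le> 0})" by (auto simp: X_def)
    ultimately show ?thesis by simp
  qed
  have cont: "continuous_on UNIV (coupling g)"
    using coupling_deriv by (meson continuous_at_imp_continuous_on has_derivative_continuous)
  have cl: "closed X"
    unfolding X_def by (intro closed_Collect_all closed_Collect_le continuous_intros cont)
  obtain x where x: "x \<in> X" "\<And>y. y \<in> X \<Longrightarrow> F x \<bullet> (y - x) \<ge> 0"
    using strongly_monotone_VI_exists[OF conv cl ne F_monotone F_lipschitz] by blast
  obtain lam where lam: "\<And>a. lam $ a \<ge> 0" "lam \<bullet> coupling g x = 0"
    "\<And>y. F x \<bullet> (y - x) + lam \<bullet> coupling g y \<ge> 0"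
    by (rule multiplier_exists[OF coupling_convex sl, of x "F x"]) (use x in \<open>auto simp: X_def\<close>)
  \<comment> \<open>The Lagrangian of the linearized problem. It is nonnegative and vanishes at
    \<open>x\<close>, so its derivative vanishes there, which is stationarity.\<close>
  define h where "h y = F x \<bullet> (y - x) + lam \<bullet> coupling g y" for y
  have hd: "(h has_derivative (\<lambda>v. F x \<bullet> v + lam \<bullet> (\<Sum>i\<in>UNIV. jacobian (g i) (at x) *v v))) (at x)"
    unfolding h_def by (auto intro!: derivative_eq_intros coupling_deriv)
  have "(\<lambda>v. F x \<bullet> v + lam \<bullet> (\<Sum>i\<in>UNIV. jacobian (g i) (at x) *v v)) = (\<lambda>v. 0)"
  proof (rule differential_zero_maxmin[OF _ _ hd, of UNIV])
    show "(\<forall>y\<in>UNIV. h y \<le> h x) \<or> (\<forall>y\<in>UNIV. h x \<le> h y)"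
      using lam by (auto simp: h_def)
  qed auto
  then have z: "F x \<bullet> v + lam \<bullet> (\<Sum>i\<in>UNIV. jacobian (g i) (at x) *v v) = 0" for v by (rule fun_cong)
  have "F x $ l + A (own l) x lam $ l = 0" for l
  proof -
    have "(F x + (\<Sum>i\<in>UNIV. A i x lam)) \<bullet> axis l 1 = 0"
      using z[of "axis l 1"] by (simp add: inner_add_left inner_sum_left inner_sum_right A_inner)
    then show ?thesis by (simp add: inner_axis sum_A_nth)
  qed
  then have "KKT own UNIV J g x lam" using lam x by (auto simp: KKT_iff X_def)
  then show thesis by (rule that)
qed

lemma coupling_block_upd: "coupling g (block_upd own i y x) - coupling g x = g i y - g i x"
proof -
  have eq: "g j (block_upd own i y x) = (if j = i then g i y else g j x)" for j
    using g_block[of j] unfolding depends_on_block_def by (auto simp: block_upd_def)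
  have "coupling g (block_upd own i y x) - coupling g x = (\<Sum>j\<in>UNIV. if j = i then g i y - g i x else 0)"
    unfolding coupling_def eq sum_subtractf[symmetric] by (rule sum.cong) auto
  then show ?thesis by simp
qed

text \<open>A unilateral deviation changes the coupling constraint by \<open>g i y - g i x\<close>
  alone. Hence the common multiplier certifies optimality of each agent's own problem, with
  \<open>J_above_tangent\<close> supplying convexity of the cost.\<close>

lemma KKT_imp_GNE:
  assumes "KKT own UNIV J g x lam"
  shows "GNE own UNIV J g x"
proof -
  have k: "\<And>a. 0 \<le> lam $ a" "\<And>l. F x $ l + A (own l) x lam $ l = 0"
    "\<And>a. coupling g x $ a \<le> 0" "lam \<bullet> coupling g x = 0"
    using assms unfolding KKT_iff by auto
  show ?thesis unfolding GNE_def is_arg_min_def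
  proof (intro allI conjI notI)
    fix i
    show "block_upd own i x x \<in> feasible UNIV g"
      using k(3) by (auto simp: feasible_def block_upd_self less_eq_vec_def)
    assume "\<exists>y. block_upd own i y x \<in> feasible UNIV g \<and> J i (block_upd own i y x) < J i (block_upd own i x x)"
    then obtain y where y: "block_upd own i y x \<in> feasible UNIV g" "J i (block_upd own i y x) < J i x"
      by (auto simp: block_upd_self)
    have GA: "G i x = - A i x lam"
    proof (rule vec_eq_iff[THEN iffD2], rule allI)
      fix l
      show "G i x $ l = (- A i x lam) $ l"
        using k(2)[of l] G_own_block[of l i x] G_other_block[of l i x] A_other_block[of l i x lam]
        by (cases "own l = i") (auto simp: add_eq_0_iff)
    qed
    have "lam \<bullet> coupling g (block_upd own i y x) \<le> 0"
      using y(1) k(1) unfolding inner_vec_def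
      by (auto intro!: sum_nonpos mult_nonneg_nonpos simp: feasible_def less_eq_vec_def)
    moreover have "lam \<bullet> (coupling g (block_upd own i y x) - coupling g x) = lam \<bullet> (g i y - g i x)"
      unfolding coupling_block_upd ..
    moreover have "A i x lam \<bullet> (y - x) \<le> lam \<bullet> (g i y - g i x)" by (rule A_above_tangent[OF k(1)])
    ultimately have "G i x \<bullet> (y - x) \<ge> 0" using k(4) by (simp add: GA inner_diff_right)
    then show False using J_above_tangent[of i x y] y(2) by simp
  qed
qed

lemma KKT_imp_v_GNE: "KKT own UNIV J g x lam \<Longrightarrow> v_GNE own UNIV J g x"
  using KKT_imp_GNE by (auto simp: v_GNE_def)

text \<open>Convexity, signs and complementarity make the multiplier terms contribute nonpositively
  to \<open>(F x - F y) \<bullet> (x - y)\<close>, against strong monotonicity. The argument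
  identifies the strategies only.\<close>

lemma KKT_unique:
  assumes "KKT own UNIV J g x lam" "KKT own UNIV J g y lam'"
  shows "x = y"
proof -
  have k: "\<And>a. 0 \<le> lam $ a" "\<And>l. F x $ l + A (own l) x lam $ l = 0"
    "\<And>a. coupling g x $ a \<le> 0" "lam \<bullet> coupling g x = 0" using assms(1) unfolding KKT_iff by auto
  have k': "\<And>a. 0 \<le> lam' $ a" "\<And>l. F y $ l + A (own l) y lam' $ l = 0"
    "\<And>a. coupling g y $ a \<le> 0" "lam' \<bullet> coupling g y = 0" using assms(2) unfolding KKT_iff by auto
  have Fx: "F x = - (\<Sum>i\<in>UNIV. A i x lam)"
    using k(2) by (simp add: vec_eq_iff sum_A_nth add_eq_0_iff)
  have Fy: "F y = - (\<Sum>i\<in>UNIV. A i y lam')"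
    using k'(2) by (simp add: vec_eq_iff sum_A_nth add_eq_0_iff)
  have t1: "(\<Sum>i\<in>UNIV. A i x lam) \<bullet> (y - x) \<le> lam \<bullet> (coupling g y - coupling g x)"
    unfolding inner_sum_left coupling_def sum_subtractf[symmetric] inner_sum_right
    by (intro sum_mono A_above_tangent k)
  have t2: "(\<Sum>i\<in>UNIV. A i y lam') \<bullet> (x - y) \<le> lam' \<bullet> (coupling g x - coupling g y)"
    unfolding inner_sum_left coupling_def sum_subtractf[symmetric] inner_sum_right
    by (intro sum_mono A_above_tangent k')
  have n1: "lam \<bullet> coupling g y \<le> 0" unfolding inner_vec_def using k k' by (auto intro!: sum_nonpos mult_nonneg_nonpos)
  have n2: "lam' \<bullet> coupling g x \<le> 0" unfolding inner_vec_def using k k' by (auto intro!: sum_nonpos mult_nonneg_nonpos)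
  have "\<mu> * (norm (x - y))\<^sup>2 \<le> (F x - F y) \<bullet> (x - y)"
    using F_monotone(2) by (simp add: strongly_monotone_def)
  also have "\<dots> = (\<Sum>i\<in>UNIV. A i x lam) \<bullet> (y - x) + (\<Sum>i\<in>UNIV. A i y lam') \<bullet> (x - y)"
    unfolding Fx Fy by (simp add: inner_diff_left inner_diff_right)
  also have "\<dots> \<le> 0" using t1 t2 n1 n2 k(4) k'(4) by (simp add: inner_diff_right)
  finally have "(norm (x - y))\<^sup>2 \<le> 0" using F_monotone(1) by (simp add: mult_le_0_iff)
  then show ?thesis by simp
qed

end

section \<open>Lipschitz maps on boxes\<close>

definition in_box :: "'c set \<Rightarrow> real \<Rightarrow> ('c \<Rightarrow> real) \<Rightarrow> bool" where
  "in_box C B s \<longleftrightarrow> (\<forall>q\<in>C. \<bar>s q\<bar> \<le> B)"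

lemma in_box_zero: "B \<ge> 0 \<Longrightarrow> in_box C B (\<lambda>_. 0)"
  by (simp add: in_box_def)

text \<open>Local Lipschitz continuity on cubes, for the sum distance over \<open>C\<close>. As the
  bound vanishes for states that agree on \<open>C\<close>, it also encodes that \<open>f\<close>
  ignores all other coordinates; \<open>box_lipschitz_cong\<close> extracts this.\<close>

definition box_lipschitz :: "'c set \<Rightarrow> real \<Rightarrow> (('c \<Rightarrow> real) \<Rightarrow> 'a::real_normed_vector) \<Rightarrow> bool" where
  "box_lipschitz C B f \<longleftrightarrow> (\<exists>L\<ge>0. \<forall>s s'. in_box C B s \<longrightarrow> in_box C B s' \<longrightarrow>
     norm (f s - f s') \<le> L * (\<Sum>q\<in>C. \<bar>s q - s' q\<bar>))"

lemma box_lipschitzI: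
  assumes "L \<ge> 0" "\<And>s s'. in_box C B s \<Longrightarrow> in_box C B s' \<Longrightarrow>
     norm (f s - f s') \<le> L * (\<Sum>q\<in>C. \<bar>s q - s' q\<bar>)"
  shows "box_lipschitz C B f"
  unfolding box_lipschitz_def using assms by blast

lemma box_lipschitzE:
  assumes "box_lipschitz C B f"
  obtains L where "L \<ge> 0" "\<And>s s'. in_box C B s \<Longrightarrow> in_box C B s' \<Longrightarrow>
     norm (f s - f s') \<le> L * (\<Sum>q\<in>C. \<bar>s q - s' q\<bar>)"
  using assms unfolding box_lipschitz_def by meson

lemma box_lipschitz_bounded:
  assumes "box_lipschitz C B f" "B \<ge> 0"
  obtains M where "M \<ge> 0" "\<And>s. in_box C B s \<Longrightarrow> norm (f s) \<le> M"
proof -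
  obtain L where L: "L \<ge> 0" "\<And>s s'. in_box C B s \<Longrightarrow> in_box C B s' \<Longrightarrow>
     norm (f s - f s') \<le> L * (\<Sum>q\<in>C. \<bar>s q - s' q\<bar>)"
    using box_lipschitzE[OF assms(1)] by blast
  show thesis
  proof (rule that[of "norm (f (\<lambda>_. 0)) + L * (real (card C) * B)"])
    fix s :: "'a \<Rightarrow> real" assume s: "in_box C B s"
    have "norm (f s - f (\<lambda>_. 0)) \<le> L * (\<Sum>q\<in>C. \<bar>s q - 0\<bar>)"
      using L(2)[OF s in_box_zero[OF assms(2)]] by simp
    also have "\<dots> \<le> L * (\<Sum>q\<in>C. B)" using s L(1) by (intro mult_left_mono sum_mono) (auto simp: in_box_def)
    finally show "norm (f s) \<le> norm (f (\<lambda>_. 0)) + L * (real (card C) * B)"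
      using norm_triangle_sub[of "f s" "f (\<lambda>_. 0)"] by simp
  qed (use L assms in auto)
qed

lemma box_lipschitz_const: "box_lipschitz C B (\<lambda>s. a)"
  by (rule box_lipschitzI[of 0]) auto

lemma box_lipschitz_coord:
  assumes "finite C" "q \<in> C" shows "box_lipschitz C B (\<lambda>s. s q)"
proof (rule box_lipschitzI[of 1])
  fix s s' :: "'a \<Rightarrow> real"
  show "norm (s q - s' q) \<le> 1 * (\<Sum>q\<in>C. \<bar>s q - s' q\<bar>)"
    using assms member_le_sum[of q C "\<lambda>q. \<bar>s q - s' q\<bar>"] by simp
qed simp

lemma box_lipschitz_add:
  assumes "box_lipschitz C B f" "box_lipschitz C B h"
  shows "box_lipschitz C B (\<lambda>s. f s + h s)"
proof -
  obtain L where L: "L \<ge> 0" "\<And>s s'. in_box C B s \<Longrightarrow> in_box C B s' \<Longrightarrow>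
     norm (f s - f s') \<le> L * (\<Sum>q\<in>C. \<bar>s q - s' q\<bar>)"
    using box_lipschitzE[OF assms(1)] by blast
  obtain M where M: "M \<ge> 0" "\<And>s s'. in_box C B s \<Longrightarrow> in_box C B s' \<Longrightarrow>
     norm (h s - h s') \<le> M * (\<Sum>q\<in>C. \<bar>s q - s' q\<bar>)"
    using box_lipschitzE[OF assms(2)] by blast
  show ?thesis
  proof (rule box_lipschitzI[of "L + M"])
    fix s s' :: "'a \<Rightarrow> real" assume s: "in_box C B s" "in_box C B s'"
    have "norm (f s + h s - (f s' + h s')) \<le> norm (f s - f s') + norm (h s - h s')"
      by (rule norm_diff_triangle_ineq)
    then show "norm (f s + h s - (f s' + h s')) \<le> (L + M) * (\<Sum>q\<in>C. \<bar>s q - s' q\<bar>)"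
      using L(2)[OF s] M(2)[OF s] by (simp add: distrib_right)
  qed (use L M in auto)
qed

text \<open>Products need bounds of the factors, which is why Lipschitz continuity is stated on
  boxes throughout.\<close>

lemma box_lipschitz_bilinear:
  assumes bil: "bounded_bilinear prd" and B: "B \<ge> 0" and f: "box_lipschitz C B f" and h: "box_lipschitz C B h"
  shows "box_lipschitz C B (\<lambda>s. prd (f s) (h s))"
proof -
  interpret bounded_bilinear prd by (rule bil)
  obtain K where K: "K \<ge> 0" "\<And>a b. norm (prd a b) \<le> norm a * norm b * K" using nonneg_bounded by blast
  obtain L where L: "L \<ge> 0" "\<And>s s'. in_box C B s \<Longrightarrow> in_box C B s' \<Longrightarrow>
     norm (f s - f s') \<le> L * (\<Sum>q\<in>C. \<bar>s q - s' q\<bar>)"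
    using box_lipschitzE[OF f] by blast
  obtain M where M: "M \<ge> 0" "\<And>s s'. in_box C B s \<Longrightarrow> in_box C B s' \<Longrightarrow>
     norm (h s - h s') \<le> M * (\<Sum>q\<in>C. \<bar>s q - s' q\<bar>)"
    using box_lipschitzE[OF h] by blast
  obtain bf where bf: "bf \<ge> 0" "\<And>s. in_box C B s \<Longrightarrow> norm (f s) \<le> bf"
    using box_lipschitz_bounded[OF f B] by blast
  obtain bh where bh: "bh \<ge> 0" "\<And>s. in_box C B s \<Longrightarrow> norm (h s) \<le> bh"
    using box_lipschitz_bounded[OF h B] by blast
  show ?thesis
  proof (rule box_lipschitzI[of "(L * bh + bf * M) * K"])
    fix s s' :: "'d \<Rightarrow> real" assume s: "in_box C B s" "in_box C B s'"
    define S where "S = (\<Sum>q\<in>C. \<bar>s q - s' q\<bar>)"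
    have S: "S \<ge> 0" by (simp add: S_def sum_nonneg)
    have "prd (f s) (h s) - prd (f s') (h s') = prd (f s - f s') (h s) + prd (f s') (h s - h s')"
      by (simp add: diff_left diff_right)
    then have "norm (prd (f s) (h s) - prd (f s') (h s'))
        \<le> norm (prd (f s - f s') (h s)) + norm (prd (f s') (h s - h s'))"
      by (metis norm_triangle_ineq)
    also have "\<dots> \<le> norm (f s - f s') * norm (h s) * K + norm (f s') * norm (h s - h s') * K"
      by (intro add_mono K)
    also have "\<dots> \<le> (L * S) * bh * K + bf * (M * S) * K"
      using L(2)[OF s] M(2)[OF s] bf(2)[OF s(2)] bh(2)[OF s(1)] K L M bf bh S unfolding S_def[symmetric]
      by (intro add_mono mult_right_mono mult_mono mult_nonneg_nonneg) auto
    also have "\<dots> = (L * bh + bf * M) * K * S" by (simp add: algebra_simps)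
    finally show "norm (prd (f s) (h s) - prd (f s') (h s')) \<le> (L * bh + bf * M) * K * (\<Sum>q\<in>C. \<bar>s q - s' q\<bar>)"
      unfolding S_def .
  qed (use L M bf bh K in auto)
qed

lemma box_lipschitz_compose:
  assumes f: "box_lipschitz C B f" and B: "B \<ge> 0"
    and h: "\<And>R. \<exists>L\<ge>0. \<forall>x y. norm x \<le> R \<longrightarrow> norm y \<le> R \<longrightarrow> norm (h x - h y) \<le> L * norm (x - y)"
  shows "box_lipschitz C B (\<lambda>s. h (f s))"
proof -
  obtain L where L: "L \<ge> 0" "\<And>s s'. in_box C B s \<Longrightarrow> in_box C B s' \<Longrightarrow>
     norm (f s - f s') \<le> L * (\<Sum>q\<in>C. \<bar>s q - s' q\<bar>)"
    using box_lipschitzE[OF f] by blast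
  obtain b where b: "b \<ge> 0" "\<And>s. in_box C B s \<Longrightarrow> norm (f s) \<le> b"
    using box_lipschitz_bounded[OF f B] by blast
  obtain M where M: "M \<ge> 0" "\<And>x y. norm x \<le> b \<Longrightarrow> norm y \<le> b \<Longrightarrow> norm (h x - h y) \<le> M * norm (x - y)"
    using h[of b] by blast
  show ?thesis
  proof (rule box_lipschitzI[of "M * L"])
    fix s s' :: "'a \<Rightarrow> real" assume s: "in_box C B s" "in_box C B s'"
    have "norm (h (f s) - h (f s')) \<le> M * norm (f s - f s')" by (intro M b s)
    also have "\<dots> \<le> M * (L * (\<Sum>q\<in>C. \<bar>s q - s' q\<bar>))" using L(2)[OF s] M(1) by (rule mult_left_mono)
    finally show "norm (h (f s) - h (f s')) \<le> M * L * (\<Sum>q\<in>C. \<bar>s q - s' q\<bar>)" by (simp add: mult.assoc)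
  qed (use L M in auto)
qed

lemma box_lipschitz_minus: "box_lipschitz C B f \<Longrightarrow> box_lipschitz C B (\<lambda>s. - f s)"
  unfolding box_lipschitz_def by (simp add: norm_minus_commute)

lemma box_lipschitz_diff:
  "box_lipschitz C B f \<Longrightarrow> box_lipschitz C B h \<Longrightarrow> box_lipschitz C B (\<lambda>s. f s - h s)"
  using box_lipschitz_add[OF _ box_lipschitz_minus, of C B f h] by simp

lemma box_lipschitz_sum:
  "(\<And>x. x \<in> A \<Longrightarrow> box_lipschitz C B (f x)) \<Longrightarrow> box_lipschitz C B (\<lambda>s. \<Sum>x\<in>A. f x s)"
  by (induction A rule: infinite_finite_induct) (auto intro: box_lipschitz_const box_lipschitz_add)

lemma box_lipschitz_nth:
  fixes f :: "('c \<Rightarrow> real) \<Rightarrow> real^'n::finite"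
  assumes "box_lipschitz C B f" shows "box_lipschitz C B (\<lambda>s. f s $ l)"
proof -
  obtain L where L: "L \<ge> 0" "\<And>s s'. in_box C B s \<Longrightarrow> in_box C B s' \<Longrightarrow>
     norm (f s - f s') \<le> L * (\<Sum>q\<in>C. \<bar>s q - s' q\<bar>)"
    using box_lipschitzE[OF assms] by blast
  show ?thesis
  proof (rule box_lipschitzI[OF L(1)])
    fix s s' :: "'c \<Rightarrow> real" assume s: "in_box C B s" "in_box C B s'"
    have "norm (f s $ l - f s' $ l) \<le> norm (f s - f s')"
      using component_le_norm_cart[of "f s - f s'" l] by simp
    also have "\<dots> \<le> L * (\<Sum>q\<in>C. \<bar>s q - s' q\<bar>)"
      by (rule L(2)[OF s])
    finally show "norm (f s $ l - f s' $ l) \<le> L * (\<Sum>q\<in>C. \<bar>s q - s' q\<bar>)" .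
  qed
qed

lemma box_lipschitz_vec:
  fixes f :: "'n::finite \<Rightarrow> ('c \<Rightarrow> real) \<Rightarrow> 'a::real_normed_vector"
  assumes "\<And>l. box_lipschitz C B (f l)" shows "box_lipschitz C B (\<lambda>s. \<chi> l. f l s)"
proof -
  have "\<forall>l. \<exists>L\<ge>0. \<forall>s s'. in_box C B s \<longrightarrow> in_box C B s' \<longrightarrow>
     norm (f l s - f l s') \<le> L * (\<Sum>q\<in>C. \<bar>s q - s' q\<bar>)"
    using assms unfolding box_lipschitz_def by blast
  then obtain L where L: "\<And>l. L l \<ge> 0" "\<And>l s s'. in_box C B s \<Longrightarrow> in_box C B s' \<Longrightarrow>
     norm (f l s - f l s') \<le> L l * (\<Sum>q\<in>C. \<bar>s q - s' q\<bar>)"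
    using choice_iff[of "\<lambda>l L. L\<ge>0 \<and> (\<forall>s s'. in_box C B s \<longrightarrow> in_box C B s' \<longrightarrow>
     norm (f l s - f l s') \<le> L * (\<Sum>q\<in>C. \<bar>s q - s' q\<bar>))"] by blast
  show ?thesis
  proof (rule box_lipschitzI[of "\<Sum>l\<in>UNIV. L l"])
    fix s s' :: "'c \<Rightarrow> real" assume s: "in_box C B s" "in_box C B s'"
    have "norm ((\<chi> l. f l s) - (\<chi> l. f l s')) \<le> (\<Sum>l\<in>UNIV. norm (((\<chi> l. f l s) - (\<chi> l. f l s')) $ l))"
      unfolding norm_vec_def by (rule L2_set_le_sum) auto
    also have "\<dots> \<le> (\<Sum>l\<in>UNIV. L l * (\<Sum>q\<in>C. \<bar>s q - s' q\<bar>))"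
      by (intro sum_mono) (use L(2)[OF s] in auto)
    finally show "norm ((\<chi> l. f l s) - (\<chi> l. f l s')) \<le> (\<Sum>l\<in>UNIV. L l) * (\<Sum>q\<in>C. \<bar>s q - s' q\<bar>)"
      by (simp add: sum_distrib_right)
  qed (use L(1) in \<open>auto intro: sum_nonneg\<close>)
qed

lemma box_lipschitz_lipschitz_path:
  assumes f: "box_lipschitz C B f" and box: "\<And>t. t \<in> T \<Longrightarrow> in_box C B (X t)"
    and lip: "\<And>q. q \<in> C \<Longrightarrow> \<exists>K. \<forall>s\<in>T. \<forall>t\<in>T. \<bar>X s q - X t q\<bar> \<le> K * \<bar>s - t\<bar>"
  obtains K where "\<And>s t. s \<in> T \<Longrightarrow> t \<in> T \<Longrightarrow> norm (f (X s) - f (X t)) \<le> K * \<bar>s - (t::real)\<bar>"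
proof -
  obtain L where L: "L \<ge> 0" "\<And>s s'. in_box C B s \<Longrightarrow> in_box C B s' \<Longrightarrow>
     norm (f s - f s') \<le> L * (\<Sum>q\<in>C. \<bar>s q - s' q\<bar>)"
    using box_lipschitzE[OF f] by blast
  have "\<forall>q\<in>C. \<exists>K. \<forall>s\<in>T. \<forall>t\<in>T. \<bar>X s q - X t q\<bar> \<le> K * \<bar>s - t\<bar>" using lip by blast
  from bchoice[OF this] obtain K where K: "\<forall>q\<in>C. \<forall>s\<in>T. \<forall>t\<in>T. \<bar>X s q - X t q\<bar> \<le> K q * \<bar>s - t\<bar>" ..
  show thesis
  proof (rule that[of "L * (\<Sum>q\<in>C. K q)"])
    fix s t assume st: "s \<in> T" "t \<in> T"
    have "norm (f (X s) - f (X t)) \<le> L * (\<Sum>q\<in>C. \<bar>X s q - X t q\<bar>)" by (intro L(2) box st)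
    also have "\<dots> \<le> L * (\<Sum>q\<in>C. K q * \<bar>s - t\<bar>)" using K st L(1) by (intro mult_left_mono sum_mono) auto
    finally show "norm (f (X s) - f (X t)) \<le> L * (\<Sum>q\<in>C. K q) * \<bar>s - t\<bar>"
      by (simp add: sum_distrib_right mult.assoc)
  qed
qed

lemma box_lipschitz_continuous_path:
  fixes T :: "real set"
  assumes f: "box_lipschitz C B f" and box: "\<And>t. t \<in> T \<Longrightarrow> in_box C B (X t)"
    and cont: "\<And>q. q \<in> C \<Longrightarrow> continuous_on T (\<lambda>t. X t q)"
  shows "continuous_on T (\<lambda>t. f (X t))"
  unfolding continuous_on_def
proof
  fix t assume t: "t \<in> T"
  obtain L where L: "L \<ge> 0" "\<And>s s'. in_box C B s \<Longrightarrow> in_box C B s' \<Longrightarrow>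
     norm (f s - f s') \<le> L * (\<Sum>q\<in>C. \<bar>s q - s' q\<bar>)"
    using box_lipschitzE[OF f] by blast
  have "((\<lambda>\<tau>. L * (\<Sum>p\<in>C. \<bar>X \<tau> p - X t p\<bar>)) \<longlongrightarrow> L * (\<Sum>p\<in>C. \<bar>X t p - X t p\<bar>)) (at t within T)"
    by (intro tendsto_intros) (use cont t in \<open>auto simp: continuous_on_def\<close>)
  then have *: "((\<lambda>\<tau>. L * (\<Sum>p\<in>C. \<bar>X \<tau> p - X t p\<bar>)) \<longlongrightarrow> 0) (at t within T)" by simp
  have "((\<lambda>\<tau>. f (X \<tau>) - f (X t)) \<longlongrightarrow> 0) (at t within T)"
    by (rule Lim_null_comparison[OF _ *]) (use L(2) box t in \<open>auto simp: eventually_at_filter\<close>)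
  then show "((\<lambda>\<tau>. f (X \<tau>)) \<longlongrightarrow> f (X t)) (at t within T)"
    by (simp add: LIM_zero_iff)
qed

section \<open>The closed loop\<close>

lemma tangent_cone_orthant:
  fixes lam :: "real^'m::finite"
  assumes lam: "0 \<le> lam"
  shows "tangent_cone {0..} lam = {v. \<forall>a. lam $ a = 0 \<longrightarrow> 0 \<le> v $ a}" (is "_ = ?K")
proof
  have cl: "closed ?K"
    by (intro closed_Collect_all closed_Collect_imp open_Collect_const closed_Collect_le continuous_intros)
  have "(\<Union>\<delta>\<in>{0<..}. (\<lambda>z. (1 / \<delta>) *\<^sub>R (z - lam)) ` {0..}) \<subseteq> ?K"
    by (auto simp: less_eq_vec_def)
  then show "tangent_cone {0..} lam \<subseteq> ?K"
    unfolding tangent_cone_def by (rule closure_minimal[OF _ cl])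
  show "?K \<subseteq> tangent_cone {0..} lam"
  proof
    fix v assume v: "v \<in> ?K"
    \<comment> \<open>Step lengths that keep each positive component of
      \<open>lam + \<delta> *\<^sub>R v\<close> nonnegative. The element 1 keeps the set nonempty
      when \<open>lam\<close> has no positive component.\<close>
    define D where "D = insert 1 ((\<lambda>a. lam $ a / (\<bar>v $ a\<bar> + 1)) ` {a. lam $ a > 0})"
    have D: "finite D" "D \<noteq> {}" "\<And>d. d \<in> D \<Longrightarrow> d > 0" by (auto simp: D_def add_pos_nonneg)
    define \<delta> where "\<delta> = Min D"
    have \<delta>: "\<delta> > 0" using D by (simp add: \<delta>_def)
    have "0 \<le> (lam + \<delta> *\<^sub>R v) $ a" for a
    proof (cases "lam $ a > 0")
      case True
      have "\<delta> \<le> lam $ a / (\<bar>v $ a\<bar> + 1)" unfolding \<delta>_def using True D(1) by (intro Min_le) (auto simp: D_def)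
      then have "\<delta> * (\<bar>v $ a\<bar> + 1) \<le> lam $ a" by (simp add: pos_le_divide_eq add_pos_nonneg)
      moreover have "- (\<delta> * \<bar>v $ a\<bar>) \<le> \<delta> * v $ a" using \<delta> by (simp add: abs_if)
      ultimately have "0 \<le> lam $ a + \<delta> * v $ a" using \<delta> by (simp add: algebra_simps)
      then show ?thesis by simp
    next
      case False
      then have "lam $ a = 0" using lam by (auto simp: less_eq_vec_def intro: order_antisym)
      then show ?thesis using v \<delta> by auto
    qed
    then have "lam + \<delta> *\<^sub>R v \<in> {0..}" by (simp add: less_eq_vec_def)
    moreover have "v = (1 / \<delta>) *\<^sub>R ((lam + \<delta> *\<^sub>R v) - lam)" using \<delta> by simp
    ultimately have "v \<in> (\<Union>\<delta>\<in>{0<..}. (\<lambda>z. (1 / \<delta>) *\<^sub>R (z - lam)) ` {0..})" using \<delta> by blast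
    then show "v \<in> tangent_cone {0..} lam" unfolding tangent_cone_def by (rule subsetD[OF closure_subset])
  qed
qed

lemma proj_tangent_orthant:
  fixes lam :: "real^'m::finite"
  assumes lam: "0 \<le> lam"
  shows "proj_tangent {0..} lam v $ a = (if lam $ a \<le> 0 then max 0 (v $ a) else v $ a)"
proof -
  define K where "K = {v::real^'m. \<forall>a. lam $ a = 0 \<longrightarrow> 0 \<le> v $ a}"
  define w where "w = (\<chi> a. if lam $ a \<le> 0 then max 0 (v $ a) else v $ a)"
  have K: "tangent_cone {0..} lam = K" unfolding K_def by (rule tangent_cone_orthant[OF lam])
  have cl: "closed K" unfolding K[symmetric] tangent_cone_def by simp
  have conv: "convex K"
    unfolding K_def by (rule convexI) auto
  have lam0: "lam $ a \<ge> 0" for a using lam by (simp add: less_eq_vec_def)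
  have "w = closest_point K v"
  proof (rule closest_point_unique[OF conv cl])
    show "w \<in> K" by (auto simp: K_def w_def)
    show "\<forall>z\<in>K. dist v w \<le> dist v z"
    proof
      fix z assume z: "z \<in> K"
      show "dist v w \<le> dist v z"
        unfolding dist_norm
      proof (rule norm_le_componentwise_cart)
        fix b
        show "norm ((v - w) $ b) \<le> norm ((v - z) $ b)"
          using z lam0[of b] by (auto simp: K_def w_def max_def)
      qed
    qed
  qed
  then have "closest_point K v $ a = w $ a" by simp
  then show ?thesis unfolding proj_tangent_def K by (simp add: w_def)
qed

lemma proj_tangent_orthant_neg:
  fixes lam :: "real^'m::finite"
  assumes neg: "lam $ a < 0"
  shows "proj_tangent {0..} lam v $ a \<ge> 0"
proof -
  have cl: "closed {v::real^'m. 0 \<le> v $ a}" by (intro closed_Collect_le continuous_intros)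
  have "(\<Union>\<delta>\<in>{0<..}. (\<lambda>z. (1 / \<delta>) *\<^sub>R (z - lam)) ` {0..}) \<subseteq> {v. 0 \<le> v $ a}"
  proof
    fix x assume "x \<in> (\<Union>\<delta>\<in>{0<..}. (\<lambda>z. (1 / \<delta>) *\<^sub>R (z - lam)) ` {0..})"
    then obtain \<delta> :: real and z where dz: "\<delta> > 0" "0 \<le> z" "x = (1 / \<delta>) *\<^sub>R (z - lam)" by auto
    then have "z $ a \<ge> 0" by (auto simp: less_eq_vec_def)
    then show "x \<in> {v. 0 \<le> v $ a}" using dz neg by simp
  qed
  then have sub: "tangent_cone {0..} lam \<subseteq> {v. 0 \<le> v $ a}"
    unfolding tangent_cone_def by (rule closure_minimal[OF _ cl])
  have "(1 / 1) *\<^sub>R (0 - lam) \<in> (\<Union>\<delta>\<in>{0<..}. (\<lambda>z. (1 / \<delta>) *\<^sub>R (z - lam)) ` {0..})"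
    by (intro UN_I[of 1] imageI) auto
  then have "(1 / 1) *\<^sub>R (0 - lam) \<in> tangent_cone {0..} lam"
    unfolding tangent_cone_def by (rule subsetD[OF closure_subset])
  then have "tangent_cone {0..} lam \<noteq> {}" by blast
  moreover have "closed (tangent_cone {0..} lam)" by (simp add: tangent_cone_def)
  ultimately have "proj_tangent {0..} lam v \<in> tangent_cone {0..} lam"
    unfolding proj_tangent_def by (intro closest_point_in_set)
  then show ?thesis using sub by blast
qed

section \<open>The loop in the variables \<zeta> and its dissipation inequality\<close>

locale gne_closed_loop = gne_game own J g \<mu> \<theta>\<^sub>0
  for own :: "'n::finite \<Rightarrow> 'i::finite" and J :: "'i \<Rightarrow> real^'n \<Rightarrow> real"
    and g :: "'i \<Rightarrow> real^'n \<Rightarrow> real^'m::finite" and \<mu> \<theta>\<^sub>0 :: real +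
  fixes E :: "('i \<times> 'i) set" and \<gamma> :: "'i \<Rightarrow> real" and r :: "'n \<Rightarrow> nat" and c :: "'n \<Rightarrow> nat \<Rightarrow> real"
    and s\<^sub>0 :: "('i, 'n, 'm) state"
  assumes undirected: "sym E"
    and connected: "\<And>i j. (i, j) \<in> E\<^sup>*"
    and gains: "\<And>i. \<gamma> i > 0"
    and order: "\<And>l. r l \<ge> 1"
    and coeffs: "\<And>l. c l 0 = 1" "\<And>l. c l (r l - 1) = 1"
      "\<And>l. hurwitz (Poly (map (c l) [0..<r l]))"
    and init_z: "\<And>i. aux_var s\<^sub>0 i = 0"
    and init_lambda: "\<And>i. 0 \<le> dual_var s\<^sub>0 i"
begin

abbreviation C :: "('i, 'n, 'm) coord set" where "C \<equiv> coords own r"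
abbreviation CL where "CL \<equiv> closed_loop own E \<gamma> r c J g"
abbreviation est where "est \<equiv> estimate own r c"
abbreviation rh where "rh \<equiv> rho own E r c"
abbreviation ut where "ut \<equiv> u_tilde own E r c J g"

lemma finite_C: "finite C"
proof -
  have "{Deriv l j |l j. j < r l} = (\<lambda>(l, j). Deriv l j) ` (SIGMA l:UNIV. {..<r l})" by auto
  moreover have "finite ((\<lambda>(l, j). Deriv l j) ` (SIGMA l:UNIV. {..<r l}))"
    by (intro finite_imageI finite_SigmaI) auto
  ultimately have 1: "finite {Deriv l j |l j. j < r l}" by metis
  have 2: "finite {Est i l |(i::'i) (l::'n). own l \<noteq> i}"
    by (rule finite_subset[of _ "(\<lambda>(i, l). Est i l) ` UNIV"]) auto
  have 3: "finite {Aux i a |(i::'i) (a::'m). True}" "finite {Dual i a |(i::'i) (a::'m). True}"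
    by (rule finite_subset[of _ "(\<lambda>(i, l). Aux i l) ` UNIV"], auto,
        rule finite_subset[of _ "(\<lambda>(i, l). Dual i l) ` UNIV"], auto)
  show ?thesis unfolding coords_def using 1 2 3 by auto
qed

lemma in_C:
  "Deriv l j \<in> C \<longleftrightarrow> j < r l" "Est i l \<in> C \<longleftrightarrow> own l \<noteq> i" "Gain i \<in> C" "Aux i a \<in> C" "Dual i a \<in> C"
  by (auto simp: coords_def)

lemma rho_laplacian: "rh s = laplacian E (est s)"
  by (rule ext) (simp add: rho_def laplacian_def)

lemma weighted_laplacian: "weighted_disagreement own E r c s = laplacian E (\<lambda>i. s (Gain i) *\<^sub>R rh s i)"
  by (rule ext) (simp add: weighted_disagreement_def laplacian_def)

lemma dual_laplacian: "dual_disagreement E s = laplacian E (dual_var s)"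
  by (rule ext) (simp add: dual_disagreement_def laplacian_def)

lemma ut_eq: "ut s i = - G i (est s i) - A i (est s i) (dual_var s i) - laplacian E (\<lambda>i. s (Gain i) *\<^sub>R rh s i) i"
  by (simp add: u_tilde_def A_def weighted_laplacian)

lemma zeta_sum: "zeta r c s l = (\<Sum>j<r l. c l j * s (Deriv l j))"
proof -
  obtain m where m: "r l = Suc m" using order[of l] by (cases "r l") auto
  have "(\<Sum>j<Suc m. c l j * s (Deriv l j)) = c l 0 * s (Deriv l 0) + (\<Sum>j<m. c l (Suc j) * s (Deriv l (Suc j)))"
    by (rule sum.lessThan_Suc_shift)
  also have "(\<Sum>j<m. c l (Suc j) * s (Deriv l (Suc j))) = (\<Sum>j=1..m. c l j * s (Deriv l j))"
    by (rule sum.reindex_bij_witness[where i = "\<lambda>j. j - 1" and j = Suc]) auto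
  finally show ?thesis by (simp add: zeta_def m coeffs)
qed

text \<open>The chain of integrators seen through \<open>\<zeta>\<close> is a single integrator driven by the
  auxiliary input, by telescoping against the feedback term of the controller.\<close>

lemma zeta_rate: "(\<Sum>j<r l. c l j * CL s (Deriv l j)) = ut s (own l) $ l"
proof -
  obtain m where m: "r l = Suc m" using order[of l] by (cases "r l") auto
  have "(\<Sum>j<Suc m. c l j * CL s (Deriv l j))
      = (\<Sum>j<m. c l j * CL s (Deriv l j)) + c l m * CL s (Deriv l m)" by simp
  also have "(\<Sum>j<m. c l j * CL s (Deriv l j)) = (\<Sum>j<m. c l j * s (Deriv l (Suc j)))"
    by (rule sum.cong) (auto simp: m)
  also have "\<dots> = (\<Sum>j=1..m. c l (j - 1) * s (Deriv l j))"
    by (rule sum.reindex_bij_witness[where i = "\<lambda>j. j - 1" and j = Suc]) auto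
  \<comment> \<open>The leading coefficient is 1, so the feedback term enters with weight 1 and
    cancels the shifted sum exactly.\<close>
  also have "c l m * CL s (Deriv l m) = ut s (own l) $ l - (\<Sum>j=1..m. c l (j - 1) * s (Deriv l j))"
    using coeffs(2)[of l] by (simp add: m control_def)
  finally show ?thesis by (simp add: m)
qed

text \<open>Gradient and constraint terms vanish outside block \<open>i\<close>, so
  \<open>ut\<close> reduces to the consensus term there. Own and estimated entries thereby obey one
  formula, and each vector of estimates is a single integrator.\<close>

lemma est_deriv:
  assumes "\<And>q. q \<in> C \<Longrightarrow> ((\<lambda>\<tau>. X \<tau> q) has_real_derivative CL (X t) q) (at t within S)"
  shows "((\<lambda>\<tau>. est (X \<tau>) i $ l) has_real_derivative ut (X t) i $ l) (at t within S)"
proof (cases "own l = i")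
  case True
  have "((\<lambda>\<tau>. \<Sum>j<r l. c l j * X \<tau> (Deriv l j)) has_real_derivative (\<Sum>j<r l. c l j * CL (X t) (Deriv l j))) (at t within S)"
    by (intro DERIV_sum DERIV_cmult assms) (auto simp: in_C)
  then show ?thesis using True zeta_rate[of l "X t"] by (simp add: estimate_def zeta_sum)
next
  case False
  have "((\<lambda>\<tau>. X \<tau> (Est i l)) has_real_derivative CL (X t) (Est i l)) (at t within S)"
    by (rule assms) (use False in \<open>simp add: in_C\<close>)
  moreover have "CL (X t) (Est i l) = ut (X t) i $ l"
    using False by (simp add: ut_eq weighted_laplacian G_other_block A_other_block)
  ultimately show ?thesis using False by (simp add: estimate_def)
qed

text \<open>Agents evaluate their gradients at different estimates, whereas strong monotonicity
  compares \<open>F\<close> at two points. The vector of true values serves as the common reference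
  point.\<close>

definition own_profile :: "('i \<Rightarrow> real^'n) \<Rightarrow> real^'n" where
  "own_profile Z = (\<chi> l. Z (own l) $ l)"

text \<open>The gain threshold absorbs the cross term between the optimality error and the
  disagreement of the estimates.\<close>

lemma dissipation:
  obtains kstar where "\<And>(Z :: 'i \<Rightarrow> real^'n) (lam :: 'i \<Rightarrow> real^'m) k (z :: 'i \<Rightarrow> real^'m) xs ls zb P.
    \<lbrakk>\<And>a. ls $ a \<ge> 0; \<And>i. G i xs + A i xs ls = 0;
     \<And>i a. (g i xs - zb i) $ a \<le> 0; \<And>i. ls \<bullet> (g i xs - zb i) = 0; \<And>i a. lam i $ a \<ge> 0;
     \<And>i. (lam i - ls) \<bullet> P i \<le> (lam i - ls) \<bullet> (g i (Z i) - z i - laplacian E lam i)\<rbrakk> \<Longrightarrow>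
    (\<Sum>i\<in>UNIV. (Z i - xs) \<bullet> (- G i (Z i) - A i (Z i) (lam i) - laplacian E (\<lambda>i. k i *\<^sub>R laplacian E Z i) i))
     + (\<Sum>i\<in>UNIV. (k i - kstar) * (norm (laplacian E Z i))\<^sup>2)
     + (\<Sum>i\<in>UNIV. (lam i - ls) \<bullet> P i) + (\<Sum>i\<in>UNIV. (z i - zb i) \<bullet> (lam i - ls))
    \<le> - (\<mu> / 2 * (norm (own_profile Z - xs))\<^sup>2 + (\<Sum>i\<in>UNIV. (norm (laplacian E Z i))\<^sup>2)
        + (\<Sum>i\<in>UNIV. lam i \<bullet> laplacian E lam i))"
proof -
  obtain D where D: "D > 0" "\<And>(w :: 'i \<Rightarrow> real^'n) i j. norm (w i - w j) \<le> D * (\<Sum>k\<in>UNIV. norm (laplacian E w k))"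
    using disagreement_le_laplacian[where ?'a = "real^'n", OF undirected connected] by blast
  define n where "n = real CARD('n)"
  define N where "N = real CARD('i)"
  \<comment> \<open>The Lipschitz error of \<open>F\<close> between an estimate and the true profile
    is at most \<theta>0 times \<open>n * D * S\<close>, and there are \<open>n\<close> components
    to sum.\<close>
  define b where "b = n * (\<theta>\<^sub>0 * (n * D))"
  \<comment> \<open>Young's inequality splits \<open>b * d * S\<close> into half of the strong
    monotonicity term and a multiple of \<open>S\<^sup>2\<close>, which is at most
    \<open>N * R\<close>. The extra 1 leaves a full \<open>R\<close> in the dissipation.\<close>
  define kstar where "kstar = 1 + b\<^sup>2 * N / (2 * \<mu>)"
  show thesis
  proof (rule that[of kstar])
    \<comment> \<open>\<open>P\<close> stands for the projected rate of the multipliers; the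
      projection enters through the inequality \<open>P\<close> alone.\<close>
    fix Z :: "'i \<Rightarrow> real^'n" and lam :: "'i \<Rightarrow> real^'m" and k and z :: "'i \<Rightarrow> real^'m" and xs ls zb P
    assume ls: "\<And>a. ls $ a \<ge> 0" and stat: "\<And>i. G i xs + A i xs ls = 0"
      and q: "\<And>i a. (g i xs - zb i) $ a \<le> 0" "\<And>i. ls \<bullet> (g i xs - zb i) = 0" and lam: "\<And>i a. lam i $ a \<ge> 0"
      and P: "\<And>i. (lam i - ls) \<bullet> P i \<le> (lam i - ls) \<bullet> (g i (Z i) - z i - laplacian E lam i)"
    define S where "S = (\<Sum>i\<in>UNIV. norm (laplacian E Z i))"
    define R where "R = (\<Sum>i\<in>UNIV. (norm (laplacian E Z i))\<^sup>2)"
    define y where "y = own_profile Z"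
    define d where "d = norm (y - xs)"
    have SR: "S\<^sup>2 \<le> N * R"
    proof -
      have "S\<^sup>2 \<le> (\<Sum>i\<in>(UNIV::'i set). 1\<^sup>2) * (\<Sum>i\<in>UNIV. (norm (laplacian E Z i))\<^sup>2)"
        using Cauchy_Schwarz_ineq_sum[of "\<lambda>i. 1" "\<lambda>i. norm (laplacian E Z i)" UNIV] by (simp add: S_def)
      then show ?thesis by (simp add: N_def R_def)
    qed
    have s1: "(\<Sum>i\<in>UNIV. (Z i - xs) \<bullet> laplacian E (\<lambda>i. k i *\<^sub>R laplacian E Z i) i)
        = (\<Sum>i\<in>UNIV. k i * (norm (laplacian E Z i))\<^sup>2)"
    proof -
      have "laplacian E (\<lambda>i. Z i - xs) i = laplacian E Z i" for i by (simp add: laplacian_def)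
      then show ?thesis
        unfolding laplacian_symmetric[OF undirected]
        by (simp add: power2_norm_eq_inner)
    qed
    have Zy: "norm (Z i - y) \<le> n * D * S" for i
    proof -
      have "norm (Z i - y) \<le> (\<Sum>l\<in>UNIV. \<bar>(Z i - y) $ l\<bar>)" by (rule norm_le_l1_cart)
      also have "\<dots> \<le> (\<Sum>l\<in>(UNIV::'n set). D * S)"
      proof (rule sum_mono)
        fix l
        have "\<bar>(Z i - y) $ l\<bar> = \<bar>(Z i - Z (own l)) $ l\<bar>" by (simp add: y_def own_profile_def)
        also have "\<dots> \<le> norm (Z i - Z (own l))" by (rule component_le_norm_cart)
        also have "\<dots> \<le> D * S" unfolding S_def by (rule D(2))
        finally show "\<bar>(Z i - y) $ l\<bar> \<le> D * S" .
      qed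
      finally show ?thesis by (simp add: n_def mult.assoc)
    qed
    \<comment> \<open>Exchanging the sums leaves, for component \<open>l\<close>, the value of
      \<open>F\<close> at the estimate of its owner. Replacing that estimate by the true profile
      \<open>y\<close> isolates a strongly monotone part and an error linear in
      \<open>S\<close>.\<close>
    have s2: "(\<Sum>i\<in>UNIV. (Z i - xs) \<bullet> (G i (Z i) - G i xs)) \<ge> \<mu> * d\<^sup>2 - b * d * S"
    proof -
      have "(Z i - xs) \<bullet> (G i (Z i) - G i xs) = (\<Sum>l\<in>UNIV. if own l = i then (Z i - xs) $ l * (F (Z i) - F xs) $ l else 0)" for i
        unfolding inner_vec_def by (rule sum.cong) (auto simp: G_own_block G_other_block)
      then have "(\<Sum>i\<in>UNIV. (Z i - xs) \<bullet> (G i (Z i) - G i xs))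
          = (\<Sum>i\<in>UNIV. \<Sum>l\<in>UNIV. if own l = i then (Z i - xs) $ l * (F (Z i) - F xs) $ l else 0)" by simp
      also have "\<dots> = (\<Sum>l\<in>UNIV. \<Sum>i\<in>UNIV. if own l = i then (Z i - xs) $ l * (F (Z i) - F xs) $ l else 0)"
        by (rule sum.swap)
      also have "\<dots> = (\<Sum>l\<in>UNIV. (y - xs) $ l * (F (Z (own l)) - F xs) $ l)"
        by (rule sum.cong) (auto simp: y_def own_profile_def)
      also have "\<dots> = (\<Sum>l\<in>UNIV. (y - xs) $ l * (F y - F xs) $ l) + (\<Sum>l\<in>UNIV. (y - xs) $ l * (F (Z (own l)) - F y) $ l)"
        unfolding sum.distrib[symmetric] by (rule sum.cong) (auto simp: algebra_simps)
      also have "(\<Sum>l\<in>UNIV. (y - xs) $ l * (F y - F xs) $ l) = (F y - F xs) \<bullet> (y - xs)"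
        by (simp add: inner_vec_def mult.commute)
      finally have eq: "(\<Sum>i\<in>UNIV. (Z i - xs) \<bullet> (G i (Z i) - G i xs))
        = (F y - F xs) \<bullet> (y - xs) + (\<Sum>l\<in>UNIV. (y - xs) $ l * (F (Z (own l)) - F y) $ l)" .
      have m: "(F y - F xs) \<bullet> (y - xs) \<ge> \<mu> * d\<^sup>2"
        using F_monotone(2) by (simp add: strongly_monotone_def d_def)
      have "(\<Sum>l\<in>(UNIV::'n set). - (d * (\<theta>\<^sub>0 * (n * D * S)))) \<le> (\<Sum>l\<in>UNIV. (y - xs) $ l * (F (Z (own l)) - F y) $ l)"
      proof (rule sum_mono)
        fix l
        have "\<bar>(F (Z (own l)) - F y) $ l\<bar> \<le> norm (F (Z (own l)) - F y)" by (rule component_le_norm_cart)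
        also have "\<dots> \<le> \<theta>\<^sub>0 * norm (Z (own l) - y)"
          using lipschitz_onD[OF F_lipschitz(2), of "Z (own l)" y] by (simp add: dist_norm)
        also have "\<dots> \<le> \<theta>\<^sub>0 * (n * D * S)" using Zy F_lipschitz(1) by (intro mult_left_mono) auto
        finally have "\<bar>(F (Z (own l)) - F y) $ l\<bar> \<le> \<theta>\<^sub>0 * (n * D * S)" .
        then have "\<bar>(y - xs) $ l * (F (Z (own l)) - F y) $ l\<bar> \<le> d * (\<theta>\<^sub>0 * (n * D * S))"
          unfolding abs_mult d_def using component_le_norm_cart[of "y - xs" l] by (intro mult_mono) auto
        then show "- (d * (\<theta>\<^sub>0 * (n * D * S))) \<le> (y - xs) $ l * (F (Z (own l)) - F y) $ l" by linarith
      qed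
      then have "- (b * d * S) \<le> (\<Sum>l\<in>UNIV. (y - xs) $ l * (F (Z (own l)) - F y) $ l)"
        by (simp add: b_def n_def mult_ac)
      then show ?thesis using eq m by linarith
    qed
    \<comment> \<open>Monotonicity of the saddle operator: the tangent inequality at
      \<open>Z i\<close> with weights \<open>lam i\<close> is added to the one at \<open>xs\<close>
      with weights \<open>ls\<close>.\<close>
    have s3: "(lam i - ls) \<bullet> (g i (Z i) - g i xs) \<le> (Z i - xs) \<bullet> (A i (Z i) (lam i) - A i xs ls)" for i
    proof -
      have "A i (Z i) (lam i) \<bullet> (xs - Z i) \<le> lam i \<bullet> (g i xs - g i (Z i))" by (rule A_above_tangent[OF lam])
      moreover have "A i xs ls \<bullet> (Z i - xs) \<le> ls \<bullet> (g i (Z i) - g i xs)" by (rule A_above_tangent[OF ls])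
      ultimately show ?thesis
        by (simp add: inner_diff_left inner_diff_right inner_commute)
    qed
    have s4: "(lam i - ls) \<bullet> (g i xs - zb i) \<le> 0" for i
    proof -
      have "lam i \<bullet> (g i xs - zb i) \<le> 0"
        unfolding inner_vec_def using lam q(1) by (intro sum_nonpos) (auto intro: mult_nonneg_nonpos)
      then show ?thesis using q(2)[of i] by (simp add: inner_diff_left)
    qed
    \<comment> \<open>The common vector \<open>ls\<close> drops out because the Laplacian sums to
      zero.\<close>
    have s6: "(\<Sum>i\<in>UNIV. (lam i - ls) \<bullet> laplacian E lam i) = (\<Sum>i\<in>UNIV. lam i \<bullet> laplacian E lam i)"
      by (simp add: inner_diff_left sum_subtractf inner_sum_right[symmetric] sum_laplacian[OF undirected])
    have GA: "(Z i - xs) \<bullet> (G i xs + A i xs ls) = 0" for i using stat[of i] by simp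
    \<comment> \<open>The coupling between \<open>z\<close> and the multipliers cancels: the rate of
      the multipliers contains \<open>- z i\<close>, and the added inner product brings it
      back.\<close>
    have pt: "(Z i - xs) \<bullet> (- G i (Z i) - A i (Z i) (lam i) - w) + (lam i - ls) \<bullet> P i + (z i - zb i) \<bullet> (lam i - ls)
        \<le> - ((Z i - xs) \<bullet> (G i (Z i) - G i xs)) - (Z i - xs) \<bullet> w - (lam i - ls) \<bullet> laplacian E lam i" for i w
    proof -
      have "(lam i - ls) \<bullet> (g i (Z i) - z i - laplacian E lam i) = (lam i - ls) \<bullet> (g i (Z i) - g i xs)
         + (lam i - ls) \<bullet> (g i xs - zb i) - (z i - zb i) \<bullet> (lam i - ls) - (lam i - ls) \<bullet> laplacian E lam i"
        by (simp add: inner_diff_left inner_diff_right inner_commute)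
      then have "(lam i - ls) \<bullet> P i + (z i - zb i) \<bullet> (lam i - ls)
        \<le> (Z i - xs) \<bullet> (A i (Z i) (lam i) - A i xs ls) - (lam i - ls) \<bullet> laplacian E lam i"
        using P[of i] s3[of i] s4[of i] by linarith
      then show ?thesis using GA[of i] by (simp add: inner_diff_right inner_add_right inner_minus_right)
    qed
    let ?W = "\<lambda>i. laplacian E (\<lambda>i. k i *\<^sub>R laplacian E Z i) i"
    have "(\<Sum>i\<in>UNIV. (Z i - xs) \<bullet> (- G i (Z i) - A i (Z i) (lam i) - ?W i))
       + (\<Sum>i\<in>UNIV. (lam i - ls) \<bullet> P i) + (\<Sum>i\<in>UNIV. (z i - zb i) \<bullet> (lam i - ls))
      \<le> (\<Sum>i\<in>UNIV. - ((Z i - xs) \<bullet> (G i (Z i) - G i xs)) - (Z i - xs) \<bullet> ?W i - (lam i - ls) \<bullet> laplacian E lam i)"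
      unfolding sum.distrib[symmetric] by (rule sum_mono) (rule pt)
    also have "\<dots> = - (\<Sum>i\<in>UNIV. (Z i - xs) \<bullet> (G i (Z i) - G i xs)) - (\<Sum>i\<in>UNIV. k i * (norm (laplacian E Z i))\<^sup>2)
        - (\<Sum>i\<in>UNIV. lam i \<bullet> laplacian E lam i)"
      by (simp add: sum_subtractf sum_negf s1 s6)
    also have "\<dots> \<le> - (\<mu> * d\<^sup>2) + b * d * S - (\<Sum>i\<in>UNIV. k i * (norm (laplacian E Z i))\<^sup>2)
        - (\<Sum>i\<in>UNIV. lam i \<bullet> laplacian E lam i)"
      using s2 by linarith
    finally have main: "(\<Sum>i\<in>UNIV. (Z i - xs) \<bullet> (- G i (Z i) - A i (Z i) (lam i) - ?W i))
       + (\<Sum>i\<in>UNIV. (lam i - ls) \<bullet> P i) + (\<Sum>i\<in>UNIV. (z i - zb i) \<bullet> (lam i - ls))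
      \<le> - (\<mu> * d\<^sup>2) + b * d * S - (\<Sum>i\<in>UNIV. k i * (norm (laplacian E Z i))\<^sup>2)
        - (\<Sum>i\<in>UNIV. lam i \<bullet> laplacian E lam i)" .
    have k: "(\<Sum>i\<in>UNIV. (k i - kstar) * (norm (laplacian E Z i))\<^sup>2)
        = (\<Sum>i\<in>UNIV. k i * (norm (laplacian E Z i))\<^sup>2) - kstar * R"
      by (simp add: R_def left_diff_distrib sum_subtractf sum_distrib_left)
    have "b * d * S \<le> \<mu> / 2 * d\<^sup>2 + b\<^sup>2 * S\<^sup>2 / (2 * \<mu>)"
    proof -
      have "0 \<le> (\<mu> * d - b * S)\<^sup>2 / (2 * \<mu>)" using F_monotone(1) by simp
      also have "\<dots> = \<mu> / 2 * d\<^sup>2 + b\<^sup>2 * S\<^sup>2 / (2 * \<mu>) - b * d * S"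
        using F_monotone(1) by (simp add: field_simps power2_eq_square)
      finally show ?thesis by simp
    qed
    also have "b\<^sup>2 * S\<^sup>2 / (2 * \<mu>) \<le> b\<^sup>2 * (N * R) / (2 * \<mu>)"
      using SR F_monotone(1) by (intro divide_right_mono mult_left_mono) auto
    also have "b\<^sup>2 * (N * R) / (2 * \<mu>) = (kstar - 1) * R" by (simp add: kstar_def)
    finally have cross: "b * d * S \<le> \<mu> / 2 * d\<^sup>2 + kstar * R - R" by (simp add: algebra_simps)
    show "(\<Sum>i\<in>UNIV. (Z i - xs) \<bullet> (- G i (Z i) - A i (Z i) (lam i) - laplacian E (\<lambda>i. k i *\<^sub>R laplacian E Z i) i))
     + (\<Sum>i\<in>UNIV. (k i - kstar) * (norm (laplacian E Z i))\<^sup>2)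
     + (\<Sum>i\<in>UNIV. (lam i - ls) \<bullet> P i) + (\<Sum>i\<in>UNIV. (z i - zb i) \<bullet> (lam i - ls))
    \<le> - (\<mu> / 2 * (norm (own_profile Z - xs))\<^sup>2 + (\<Sum>i\<in>UNIV. (norm (laplacian E Z i))\<^sup>2)
        + (\<Sum>i\<in>UNIV. lam i \<bullet> laplacian E lam i))"
      using main cross unfolding k d_def[symmetric] y_def[symmetric] R_def[symmetric] by linarith
  qed
qed

end

lemma box_lipschitz_Pair:
  assumes "box_lipschitz C B f" "box_lipschitz C B h"
  shows "box_lipschitz C B (\<lambda>s. (f s, h s))"
proof -
  obtain L where L: "L \<ge> 0" "\<And>s s'. in_box C B s \<Longrightarrow> in_box C B s' \<Longrightarrow>
     norm (f s - f s') \<le> L * (\<Sum>q\<in>C. \<bar>s q - s' q\<bar>)"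
    using box_lipschitzE[OF assms(1)] by blast
  obtain M where M: "M \<ge> 0" "\<And>s s'. in_box C B s \<Longrightarrow> in_box C B s' \<Longrightarrow>
     norm (h s - h s') \<le> M * (\<Sum>q\<in>C. \<bar>s q - s' q\<bar>)"
    using box_lipschitzE[OF assms(2)] by blast
  show ?thesis
  proof (rule box_lipschitzI[of "L + M"])
    fix s s' :: "'a \<Rightarrow> real" assume s: "in_box C B s" "in_box C B s'"
    have "norm ((f s, h s) - (f s', h s')) \<le> norm (f s - f s') + norm (h s - h s')"
      by (simp add: norm_Pair_le)
    then show "norm ((f s, h s) - (f s', h s')) \<le> (L + M) * (\<Sum>q\<in>C. \<bar>s q - s' q\<bar>)"
      using L(2)[OF s] M(2)[OF s] by (simp add: distrib_right)
  qed (use L M in auto)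
qed

lemma box_lipschitz_laplacian:
  assumes "\<And>i. box_lipschitz C B (\<lambda>s. w s i)"
  shows "box_lipschitz C B (\<lambda>s. laplacian E (w s) i)"
  unfolding laplacian_def by (intro box_lipschitz_sum box_lipschitz_diff assms)

lemma box_lipschitz_cong:
  assumes f: "box_lipschitz C B f" and s: "in_box C B s" and eq: "\<And>q. q \<in> C \<Longrightarrow> s q = s' q"
  shows "f s = f s'"
proof -
  have s': "in_box C B s'" using s eq by (simp add: in_box_def)
  obtain L where L: "L \<ge> 0" "\<And>s s'. in_box C B s \<Longrightarrow> in_box C B s' \<Longrightarrow>
     norm (f s - f s') \<le> L * (\<Sum>q\<in>C. \<bar>s q - s' q\<bar>)"
    using box_lipschitzE[OF f] by blast
  have "norm (f s - f s') \<le> L * (\<Sum>q\<in>C. \<bar>s q - s' q\<bar>)" by (rule L(2)[OF s s'])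
  also have "(\<Sum>q\<in>C. \<bar>s q - s' q\<bar>) = 0" using eq by (intro sum.neutral) auto
  finally show ?thesis by simp
qed

lemma has_vector_derivative_vec:
  fixes f :: "real \<Rightarrow> real^'n::finite"
  assumes "\<And>l. ((\<lambda>t. f t $ l) has_real_derivative f' $ l) (at t within S)"
  shows "(f has_vector_derivative f') (at t within S)"
  unfolding has_vector_derivative_def has_derivative_componentwise_within[of f]
proof
  fix b :: "real^'n" assume "b \<in> Basis"
  then obtain l where b: "b = axis l 1" by (auto simp: Basis_vec_def)
  have "((\<lambda>t. f t $ l) has_derivative (\<lambda>h. h * f' $ l)) (at t within S)"
    using assms[of l] by (simp add: has_field_derivative_def mult_commute_abs)
  then show "((\<lambda>x. f x \<bullet> b) has_derivative (\<lambda>x. x *\<^sub>R f' \<bullet> b)) (at t within S)"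
    by (simp add: b inner_axis)
qed

lemma inner_has_real_derivative:
  fixes f h :: "real \<Rightarrow> 'a::real_inner"
  assumes "(f has_vector_derivative f') (at t within S)" "(h has_vector_derivative h') (at t within S)"
  shows "((\<lambda>t. f t \<bullet> h t) has_real_derivative f t \<bullet> h' + f' \<bullet> h t) (at t within S)"
  using bounded_bilinear.has_vector_derivative[OF bounded_bilinear_inner assms]
  by (simp add: has_real_derivative_iff_has_vector_derivative)

lemma abs_continuous_on_inner:
  fixes f h :: "real \<Rightarrow> real^'n::finite"
  assumes "\<And>l. abs_continuous_on {a..b} (\<lambda>t. f t $ l)" "\<And>l. abs_continuous_on {a..b} (\<lambda>t. h t $ l)"
  shows "abs_continuous_on {a..b} (\<lambda>t. f t \<bullet> h t)"
  unfolding inner_vec_def using assms by (simp add: abs_continuous_on_sum abs_continuous_on_mult)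

text \<open>Projecting a rate onto the tangent cone subtracts a normal vector, and normal cones are
  monotone. For uniqueness this replaces the Lipschitz continuity that the projection lacks.\<close>

lemma reflection_monotone:
  fixes a b v w :: real
  assumes "a \<ge> 0" "b \<ge> 0"
  shows "(a - b) * ((if a \<le> 0 then max 0 v else v) - (if b \<le> 0 then max 0 w else w)) \<le> (a - b) * (v - w)"
proof -
  have 1: "- b * (max 0 v - w) \<le> - b * (v - w)" if "b > 0"
    using that by (intro mult_left_mono_neg) auto
  have 2: "a * (v - max 0 w) \<le> a * (v - w)" if "a > 0"
    using that by (intro mult_left_mono) auto
  consider "a = 0" "b = 0" | "a = 0" "b > 0" | "a > 0" "b = 0" | "a > 0" "b > 0"
    using assms by linarith
  then show ?thesis by cases (use 1 2 in auto)
qed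

section \<open>Local Lipschitz bounds and uniqueness of solutions\<close>

context gne_closed_loop
begin

text \<open>The field before projection. It is Lipschitz on boxes, whereas \<open>CL\<close> jumps
  where a multiplier reaches zero; both agree on all other coordinates.\<close>

definition drift :: "('i, 'n, 'm) state \<Rightarrow> ('i, 'n, 'm) coord \<Rightarrow> real" where
  "drift s q = (case q of Dual i a \<Rightarrow> (g i (est s i) - aux_var s i - laplacian E (dual_var s) i) $ a | _ \<Rightarrow> CL s q)"

lemma drift_simps:
  "drift s (Deriv l j) = (if Suc j < r l then s (Deriv l (Suc j))
     else ut s (own l) $ l - (\<Sum>j=1..r l - 1. c l (j - 1) * s (Deriv l j)))"
  "drift s (Est i l) = - laplacian E (\<lambda>i. s (Gain i) *\<^sub>R rh s i) i $ l"
  "drift s (Gain i) = \<gamma> i * (rh s i \<bullet> rh s i)"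
  "drift s (Aux i a) = laplacian E (dual_var s) i $ a"
  "drift s (Dual i a) = (g i (est s i) - aux_var s i - laplacian E (dual_var s) i) $ a"
  by (simp_all add: drift_def control_def weighted_laplacian dual_laplacian power2_norm_eq_inner)

lemma CL_eq_drift: "(\<And>i a. q \<noteq> Dual i a) \<Longrightarrow> CL s q = drift s q"
  by (cases q) (auto simp: drift_def)

lemma CL_dual:
  assumes "0 \<le> dual_var s i"
  shows "CL s (Dual i a) = (if s (Dual i a) \<le> 0 then max 0 (drift s (Dual i a)) else drift s (Dual i a))"
  using proj_tangent_orthant[OF assms, of "g i (est s i) - aux_var s i - dual_disagreement E s i" a]
  by (simp add: drift_simps dual_laplacian dual_var_def)

lemma zeta_lip: "box_lipschitz C B (\<lambda>s. zeta r c s l)" if "B \<ge> 0"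
  unfolding zeta_sum using that finite_C
  by (intro box_lipschitz_sum box_lipschitz_bilinear[OF bounded_bilinear_mult] box_lipschitz_const box_lipschitz_coord)
     (auto simp: in_C)

lemma est_lip: "box_lipschitz C B (\<lambda>s. est s i)" if "B \<ge> 0"
  unfolding estimate_def
proof (rule box_lipschitz_vec)
  fix l show "box_lipschitz C B (\<lambda>s. if own l = i then zeta r c s l else s (Est i l))"
    using that zeta_lip[of B l] finite_C by (cases "own l = i") (auto intro!: box_lipschitz_coord simp: in_C)
qed

lemma dual_lip: "box_lipschitz C B (\<lambda>s. dual_var s i)"
  unfolding dual_var_def by (intro box_lipschitz_vec box_lipschitz_coord finite_C in_C)

lemma aux_lip: "box_lipschitz C B (\<lambda>s. aux_var s i)"
  unfolding aux_var_def by (intro box_lipschitz_vec box_lipschitz_coord finite_C in_C)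

lemma rho_lip: "box_lipschitz C B (\<lambda>s. rh s i)" if "B \<ge> 0"
  unfolding rho_laplacian using that by (intro box_lipschitz_laplacian est_lip)

lemma weighted_lip: "box_lipschitz C B (\<lambda>s. laplacian E (\<lambda>i. s (Gain i) *\<^sub>R rh s i) i)" if "B \<ge> 0"
  using that by (intro box_lipschitz_laplacian box_lipschitz_bilinear[OF bounded_bilinear_scaleR] rho_lip
      box_lipschitz_coord finite_C in_C)

lemma F_est_lip: "box_lipschitz C B (\<lambda>s. F (est s i))" if "B \<ge> 0"
proof (rule box_lipschitz_compose[OF est_lip[OF that] that])
  show "\<exists>L\<ge>0. \<forall>x y. norm x \<le> R \<longrightarrow> norm y \<le> R \<longrightarrow> norm (F x - F y) \<le> L * norm (x - y)" for R
    using lipschitz_onD[OF F_lipschitz(2)] F_lipschitz(1) by (intro exI[of _ \<theta>\<^sub>0]) (auto simp: dist_norm)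
qed

lemma G_est_lip: "box_lipschitz C B (\<lambda>s. G i (est s i) $ l)" if "B \<ge> 0"
  using box_lipschitz_nth[OF F_est_lip[OF that], of i l]
  by (cases "own l = i") (auto simp: G_own_block G_other_block box_lipschitz_const)

lemma A_pair_lip: "\<exists>L\<ge>0. \<forall>p q. norm p \<le> R \<longrightarrow> norm q \<le> R \<longrightarrow>
    norm (A i (fst p) (snd p) $ l - A i (fst q) (snd q) $ l) \<le> L * norm (p - q)"
proof -
  obtain L where L: "L \<ge> 0" "\<And>x y lam. norm x \<le> \<bar>R\<bar> \<Longrightarrow> norm y \<le> \<bar>R\<bar> \<Longrightarrow>
    \<bar>A i x lam $ l - A i y lam $ l\<bar> \<le> L * norm (x - y) * norm lam"
    using A_lipschitz[of "\<bar>R\<bar>" i l] by blast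
  \<comment> \<open>Joint Lipschitz continuity: the point is changed first, then the multiplier. The
    second change is linear in the multiplier with a point-dependent factor, which is compared with
    its value at the origin, bounded by \<open>J0\<close>.\<close>
  define J0 where "J0 = norm (jacobian (g i) (at 0) *v axis l 1)"
  have A0: "\<bar>A i 0 lam $ l\<bar> \<le> J0 * norm lam" for lam
    using Cauchy_Schwarz_ineq2[of lam "jacobian (g i) (at 0) *v axis l 1"] A_inner[of i 0 lam "axis l 1"]
    by (simp add: inner_axis J0_def mult.commute)
  show ?thesis
  proof (intro exI[of _ "L * \<bar>R\<bar> + (L * \<bar>R\<bar> + J0)"] conjI allI impI)
    show "L * \<bar>R\<bar> + (L * \<bar>R\<bar> + J0) \<ge> 0" using L(1) by (simp add: J0_def)
    fix p q :: "(real^'n) \<times> (real^'m)" assume pq: "norm p \<le> R" "norm q \<le> R"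
    have nf: "norm (fst x) \<le> norm x" "norm (snd x) \<le> norm x" for x :: "(real^'n) \<times> (real^'m)"
      using norm_fst_le[of "fst x" "snd x"] norm_snd_le[of "snd x" "fst x"] by simp_all
    have n: "norm (fst p) \<le> \<bar>R\<bar>" "norm (fst q) \<le> \<bar>R\<bar>" "norm (snd p) \<le> \<bar>R\<bar>"
      "norm (fst p - fst q) \<le> norm (p - q)" "norm (snd p - snd q) \<le> norm (p - q)"
      using pq nf[of p] nf[of q] nf[of "p - q"] by auto
    define \<kappa> where "\<kappa> = snd p - snd q"
    have lin: "A i (fst q) (snd p) $ l - A i (fst q) (snd q) $ l = A i (fst q) \<kappa> $ l"
      by (simp add: A_def \<kappa>_def matrix_vector_mult_diff_distrib del: transpose_matrix_vector)
    have "\<bar>A i (fst p) (snd p) $ l - A i (fst q) (snd p) $ l\<bar> \<le> L * norm (fst p - fst q) * norm (snd p)"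
      by (rule L(2)) (use n in auto)
    also have "\<dots> \<le> L * norm (p - q) * \<bar>R\<bar>"
      using n L(1) by (intro mult_mono mult_left_mono mult_nonneg_nonneg) auto
    finally have 1: "\<bar>A i (fst p) (snd p) $ l - A i (fst q) (snd p) $ l\<bar> \<le> L * norm (p - q) * \<bar>R\<bar>" .
    have "\<bar>A i (fst q) \<kappa> $ l - A i 0 \<kappa> $ l\<bar> \<le> L * norm (fst q - 0) * norm \<kappa>"
      by (rule L(2)) (use n in auto)
    also have "\<dots> \<le> L * \<bar>R\<bar> * norm (p - q)"
      using n L(1) unfolding \<kappa>_def by (intro mult_mono mult_left_mono mult_nonneg_nonneg) auto
    finally have 2: "\<bar>A i (fst q) \<kappa> $ l - A i 0 \<kappa> $ l\<bar> \<le> L * \<bar>R\<bar> * norm (p - q)" .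
    have "J0 * norm \<kappa> \<le> J0 * norm (p - q)" using n unfolding \<kappa>_def J0_def by (intro mult_left_mono) auto
    then have 3: "\<bar>A i 0 \<kappa> $ l\<bar> \<le> J0 * norm (p - q)" using A0[of \<kappa>] by linarith
    have "\<bar>A i (fst p) (snd p) $ l - A i (fst q) (snd q) $ l\<bar>
        \<le> L * norm (p - q) * \<bar>R\<bar> + (L * \<bar>R\<bar> * norm (p - q) + J0 * norm (p - q))"
      using 1 2 3 lin by linarith
    then show "norm (A i (fst p) (snd p) $ l - A i (fst q) (snd q) $ l) \<le> (L * \<bar>R\<bar> + (L * \<bar>R\<bar> + J0)) * norm (p - q)"
      by (simp add: algebra_simps)
  qed
qed

lemma A_est_lip: "box_lipschitz C B (\<lambda>s. A i (est s i) (dual_var s i) $ l)" if "B \<ge> 0"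
  using box_lipschitz_compose[OF box_lipschitz_Pair[OF est_lip[OF that, of i] dual_lip[of B i]] that
      A_pair_lip[of _ i l]] by simp

lemma ut_lip: "box_lipschitz C B (\<lambda>s. ut s i $ l)" if "B \<ge> 0"
  unfolding ut_eq vector_minus_component vector_uminus_component
  using that by (intro box_lipschitz_diff box_lipschitz_minus G_est_lip A_est_lip box_lipschitz_nth weighted_lip)

lemma g_est_lip: "box_lipschitz C B (\<lambda>s. g i (est s i))" if "B \<ge> 0"
proof (rule box_lipschitz_compose[OF est_lip[OF that] that])
  fix R
  obtain L where "L \<ge> 0" "\<And>x y. norm x \<le> R \<Longrightarrow> norm y \<le> R \<Longrightarrow> norm (g i x - g i y) \<le> L * norm (x - y)"
    using g_lipschitz[of R i] by blast
  then show "\<exists>L\<ge>0. \<forall>x y. norm x \<le> R \<longrightarrow> norm y \<le> R \<longrightarrow> norm (g i x - g i y) \<le> L * norm (x - y)" by blast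
qed

lemma drift_lip:
  assumes "B \<ge> 0" "q \<in> C"
  shows "box_lipschitz C B (\<lambda>s. drift s q)"
proof (cases q)
  case (Deriv l j)
  have "box_lipschitz C B (\<lambda>s. s (Deriv l (Suc j)))" if "Suc j < r l"
    using that finite_C by (intro box_lipschitz_coord) (auto simp: in_C)
  moreover have "box_lipschitz C B (\<lambda>s. ut s (own l) $ l - (\<Sum>j=1..r l - 1. c l (j - 1) * s (Deriv l j)))"
    using assms(1) finite_C order[of l]
    by (intro box_lipschitz_diff ut_lip box_lipschitz_sum box_lipschitz_bilinear[OF bounded_bilinear_mult]
        box_lipschitz_const box_lipschitz_coord) (auto simp: in_C)
  ultimately show ?thesis unfolding Deriv drift_simps by (cases "Suc j < r l") auto
next
  case (Est i l)
  then show ?thesis using assms(1) unfolding Est drift_simps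
    by (intro box_lipschitz_minus box_lipschitz_nth weighted_lip)
next
  case (Gain i)
  then show ?thesis using assms(1) unfolding Gain drift_simps
    by (intro box_lipschitz_bilinear[OF bounded_bilinear_mult] box_lipschitz_bilinear[OF bounded_bilinear_inner]
        box_lipschitz_const rho_lip)
next
  case (Aux i a)
  then show ?thesis unfolding Aux drift_simps
    by (intro box_lipschitz_nth box_lipschitz_laplacian dual_lip)
next
  case (Dual i a)
  then show ?thesis using assms(1) unfolding Dual drift_simps
    by (intro box_lipschitz_nth box_lipschitz_diff g_est_lip aux_lip box_lipschitz_laplacian dual_lip)
qed

text \<open>The finite-horizon form of a Caratheodory solution. A priori bounds are proved for it
  before any global solution is known.\<close>

definition sol :: "real \<Rightarrow> (real \<Rightarrow> ('i, 'n, 'm) state) \<Rightarrow> bool" where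
  "sol T X \<longleftrightarrow> (\<forall>q\<in>C. X 0 q = s\<^sub>0 q) \<and> (\<forall>q\<in>C. abs_continuous_on {0..T} (\<lambda>t. X t q)) \<and>
     (AE t in lebesgue. 0 \<le> t \<and> t \<le> T \<longrightarrow> (\<forall>q\<in>C. ((\<lambda>\<tau>. X \<tau> q) has_real_derivative CL (X t) q) (at t)))"

text \<open>After the last time at which the multiplier is nonnegative it stays negative, hence its
  rate is nonnegative almost everywhere and it cannot have fallen. Behaviour of the projection
  outside the orthant is what counts here.\<close>

lemma sol_dual_nonneg:
  assumes "sol T X" "0 \<le> t" "t \<le> T"
  shows "X t (Dual i a) \<ge> 0"
proof (rule ccontr)
  assume neg: "\<not> X t (Dual i a) \<ge> 0"
  define h where "h = (\<lambda>t. X t (Dual i a))"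
  have ac: "abs_continuous_on {0..t} h"
  proof (rule abs_continuous_on_subset)
    show "abs_continuous_on {0..T} h" using assms(1) in_C unfolding sol_def h_def by blast
  qed (use assms(3) in auto)
  have "h 0 = s\<^sub>0 (Dual i a)" using assms(1) in_C unfolding sol_def h_def by blast
  then have h0: "h 0 \<ge> 0" using init_lambda[of i] by (simp add: less_eq_vec_def dual_var_def)
  define Z where "Z = {u \<in> {0..t}. h u \<ge> 0}"
  have "closed Z" unfolding Z_def
    using continuous_on_closed_Collect_le[OF continuous_on_const abs_continuous_on_imp_continuous[OF ac], of 0] by simp
  moreover have "bounded Z" unfolding Z_def by (rule bounded_subset[of "{0..t}"]) auto
  ultimately have "compact Z" by (simp add: compact_eq_bounded_closed)
  moreover have "0 \<in> Z" using h0 assms(2) by (simp add: Z_def)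
  ultimately obtain b where b: "b \<in> Z" "\<And>u. u \<in> Z \<Longrightarrow> u \<le> b" using compact_attains_sup[of Z] by blast
  have bt: "0 \<le> b" "b \<le> t" "h b \<ge> 0" using b(1) by (auto simp: Z_def)
  have after: "h u < 0" if "b < u" "u \<le> t" for u
    using b(2)[of u] that bt by (force simp: Z_def)
  have "0 - h t \<le> 0 - h b"
  proof (rule AE_deriv_nonpos_imp_le[OF bt(2)])
    show "abs_continuous_on {b..t} (\<lambda>t. 0 - h t)"
      using bt by (intro abs_continuous_on_diff abs_continuous_on_const abs_continuous_on_subset[OF ac]) auto
    have "AE u in lebesgue. u \<noteq> b" by (rule AE_completion[OF AE_lborel_singleton])
    moreover have "AE u in lebesgue. 0 \<le> u \<and> u \<le> T \<longrightarrow> (\<forall>q\<in>C. ((\<lambda>\<tau>. X \<tau> q) has_real_derivative CL (X u) q) (at u))"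
      using assms(1) by (simp add: sol_def)
    ultimately show "AE u in lebesgue. b \<le> u \<and> u \<le> t \<longrightarrow> (\<exists>D\<le>0. ((\<lambda>t. 0 - h t) has_real_derivative D) (at u))"
    proof eventually_elim
      case (elim u)
      show ?case
      proof
        assume u: "b \<le> u \<and> u \<le> t"
        have "(h has_real_derivative CL (X u) (Dual i a)) (at u)"
        proof -
          have "\<forall>q\<in>C. ((\<lambda>\<tau>. X \<tau> q) has_real_derivative CL (X u) q) (at u)"
            using elim(2) u bt assms(3) by auto
          then show ?thesis unfolding h_def using in_C(5) by blast
        qed
        moreover have "CL (X u) (Dual i a) \<ge> 0"
          using after[of u] u elim(1) proj_tangent_orthant_neg[of "dual_var (X u) i" a]
          by (simp add: h_def dual_var_def)
        ultimately show "\<exists>D\<le>0. ((\<lambda>t. 0 - h t) has_real_derivative D) (at u)"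
          by (intro exI[of _ "0 - CL (X u) (Dual i a)"] conjI DERIV_diff DERIV_const) auto
      qed
    qed
  qed
  then show False using bt neg by (simp add: h_def)
qed

lemma sol_dual_var_nonneg: "sol T X \<Longrightarrow> 0 \<le> t \<Longrightarrow> t \<le> T \<Longrightarrow> 0 \<le> dual_var (X t) i"
  using sol_dual_nonneg by (simp add: less_eq_vec_def dual_var_def)

lemma sol_continuous: "sol T X \<Longrightarrow> q \<in> C \<Longrightarrow> continuous_on {0..T} (\<lambda>t. X t q)"
  using abs_continuous_on_imp_continuous by (auto simp: sol_def)

lemma sol_bounded:
  assumes "sol T X" obtains B where "B \<ge> 0" "\<And>t. t \<in> {0..T} \<Longrightarrow> in_box C B (X t)"
proof -
  have "\<forall>q\<in>C. \<exists>B. \<forall>t\<in>{0..T}. \<bar>X t q\<bar> \<le> B"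
  proof
    fix q assume "q \<in> C"
    then have "bounded ((\<lambda>t. X t q) ` {0..T})"
      using compact_continuous_image[OF sol_continuous[OF assms]] compact_imp_bounded compact_Icc by metis
    then show "\<exists>B. \<forall>t\<in>{0..T}. \<bar>X t q\<bar> \<le> B" unfolding bounded_iff real_norm_def ball_simps .
  qed
  from bchoice[OF this] obtain B where B: "\<forall>q\<in>C. \<forall>t\<in>{0..T}. \<bar>X t q\<bar> \<le> B q" ..
  show thesis
  proof (rule that[of "\<Sum>q\<in>C. \<bar>B q\<bar>"])
    fix t assume t: "t \<in> {0..T}"
    show "in_box C (\<Sum>q\<in>C. \<bar>B q\<bar>) (X t)" unfolding in_box_def
    proof
      fix q assume q: "q \<in> C"
      have "\<bar>X t q\<bar> \<le> \<bar>B q\<bar>" using B q t by force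
      also have "\<dots> \<le> (\<Sum>q\<in>C. \<bar>B q\<bar>)" using q finite_C by (intro member_le_sum) auto
      finally show "\<bar>X t q\<bar> \<le> (\<Sum>q\<in>C. \<bar>B q\<bar>)" .
    qed
  qed (auto intro: sum_nonneg)
qed

lemma sol_path_continuous:
  assumes "sol T X" "\<And>B. B \<ge> 0 \<Longrightarrow> box_lipschitz C B f"
  shows "continuous_on {0..T} (\<lambda>t. f (X t))"
proof -
  obtain B where B: "B \<ge> 0" "\<And>t. t \<in> {0..T} \<Longrightarrow> in_box C B (X t)" by (rule sol_bounded[OF assms(1)]) blast
  show ?thesis
    by (rule box_lipschitz_continuous_path[OF assms(2)[OF B(1)] B(2) sol_continuous[OF assms(1)]])
qed

lemma sol_deriv:
  assumes "sol T X" "q \<in> C" "\<And>i a. q \<noteq> Dual i a" "t \<in> {0..T}"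
  shows "((\<lambda>\<tau>. X \<tau> q) has_real_derivative CL (X t) q) (at t within {0..T})"
proof -
  have "((\<lambda>\<tau>. X \<tau> q) has_real_derivative drift (X t) q) (at t within {0..T})"
  proof (rule AE_deriv_continuous_imp_deriv[OF _ _ _ assms(4)])
    show "abs_continuous_on {0..T} (\<lambda>t. X t q)" using assms by (simp add: sol_def)
    show "continuous_on {0..T} (\<lambda>t. drift (X t) q)"
      by (rule sol_path_continuous[OF assms(1) drift_lip[OF _ assms(2)]])
    have "AE u in lebesgue. 0 \<le> u \<and> u \<le> T \<longrightarrow> (\<forall>q\<in>C. ((\<lambda>\<tau>. X \<tau> q) has_real_derivative CL (X u) q) (at u))"
      using assms(1) by (simp add: sol_def)
    then show "AE u in lebesgue. 0 \<le> u \<and> u \<le> T \<longrightarrow> ((\<lambda>\<tau>. X \<tau> q) has_real_derivative drift (X u) q) (at u)"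
      by eventually_elim (use assms(2) CL_eq_drift[OF assms(3)] in auto)
  qed
  then show ?thesis using CL_eq_drift[OF assms(3)] by simp
qed

text \<open>The projection is discontinuous but never increases the growth of the squared distance
  between two states with nonnegative multipliers, so the Lipschitz bound of the drift
  decides.\<close>

lemma closed_loop_one_sided:
  assumes B: "B \<ge> 0"
  obtains K where "\<And>s s'. in_box C B s \<Longrightarrow> in_box C B s' \<Longrightarrow> (\<And>i. 0 \<le> dual_var s i) \<Longrightarrow> (\<And>i. 0 \<le> dual_var s' i) \<Longrightarrow>
    (\<Sum>q\<in>C. 2 * (s q - s' q) * (CL s q - CL s' q)) \<le> K * (\<Sum>q\<in>C. (s q - s' q)\<^sup>2)"
proof -
  have "\<forall>q\<in>C. \<exists>L. L \<ge> 0 \<and> (\<forall>s s'. in_box C B s \<longrightarrow> in_box C B s' \<longrightarrow>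
      \<bar>drift s q - drift s' q\<bar> \<le> L * (\<Sum>q\<in>C. \<bar>s q - s' q\<bar>))"
    using drift_lip[OF B] unfolding box_lipschitz_def real_norm_def by blast
  from bchoice[OF this] obtain L where L: "\<forall>q\<in>C. L q \<ge> 0 \<and> (\<forall>s s'. in_box C B s \<longrightarrow> in_box C B s' \<longrightarrow>
      \<bar>drift s q - drift s' q\<bar> \<le> L q * (\<Sum>q\<in>C. \<bar>s q - s' q\<bar>))" ..
  define M where "M = (\<Sum>q\<in>C. L q)"
  have LM: "L q \<le> M" if "q \<in> C" for q unfolding M_def using L finite_C that by (intro member_le_sum) auto
  have M0: "M \<ge> 0" unfolding M_def using L by (intro sum_nonneg) auto
  show thesis
  proof (rule that[of "2 * M * real (card C)"])
    fix s s' assume s: "in_box C B s" "in_box C B s'" and nn: "\<And>i. 0 \<le> dual_var s i" "\<And>i. 0 \<le> dual_var s' i"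
    define S where "S = (\<Sum>q\<in>C. \<bar>s q - s' q\<bar>)"
    have S0: "S \<ge> 0" unfolding S_def by (intro sum_nonneg) auto
    have pt: "2 * (s q - s' q) * (CL s q - CL s' q) \<le> 2 * M * S * \<bar>s q - s' q\<bar>" if q: "q \<in> C" for q
    proof -
      have "(s q - s' q) * (CL s q - CL s' q) \<le> (s q - s' q) * (drift s q - drift s' q)"
      proof (cases "\<exists>i a. q = Dual i a")
        case True
        then obtain i a where qd: "q = Dual i a" by blast
        have "s q \<ge> 0" "s' q \<ge> 0" using nn(1)[of i] nn(2)[of i] by (auto simp: qd less_eq_vec_def dual_var_def)
        from reflection_monotone[OF this, of "drift s q" "drift s' q"] show ?thesis
          unfolding qd CL_dual[OF nn(1)] CL_dual[OF nn(2)] .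
      next
        case False
        then show ?thesis using CL_eq_drift[of q] by auto
      qed
      also have "\<dots> \<le> \<bar>s q - s' q\<bar> * \<bar>drift s q - drift s' q\<bar>" by (metis abs_ge_self abs_mult)
      also have "\<dots> \<le> \<bar>s q - s' q\<bar> * (M * S)"
      proof (rule mult_left_mono)
        have "\<bar>drift s q - drift s' q\<bar> \<le> L q * S" using L q s unfolding S_def by blast
        also have "\<dots> \<le> M * S" using LM[OF q] S0 by (rule mult_right_mono)
        finally show "\<bar>drift s q - drift s' q\<bar> \<le> M * S" .
      qed simp
      finally have "2 * ((s q - s' q) * (CL s q - CL s' q)) \<le> 2 * (\<bar>s q - s' q\<bar> * (M * S))"
        by (rule mult_left_mono) simp
      then show ?thesis by (simp only: mult_ac)
    qed
    have "(\<Sum>q\<in>C. 2 * (s q - s' q) * (CL s q - CL s' q)) \<le> (\<Sum>q\<in>C. 2 * M * S * \<bar>s q - s' q\<bar>)"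
      by (rule sum_mono) (rule pt)
    also have "\<dots> = 2 * M * (S * S)" by (simp add: S_def sum_distrib_left mult_ac)
    also have "S * S \<le> real (card C) * (\<Sum>q\<in>C. (s q - s' q)\<^sup>2)"
      using Cauchy_Schwarz_ineq_sum[of "\<lambda>q. 1" "\<lambda>q. \<bar>s q - s' q\<bar>" C] by (simp add: S_def power2_eq_square)
    finally show "(\<Sum>q\<in>C. 2 * (s q - s' q) * (CL s q - CL s' q)) \<le> 2 * M * real (card C) * (\<Sum>q\<in>C. (s q - s' q)\<^sup>2)"
      using M0 by (simp add: mult_left_mono mult.assoc)
  qed
qed

text \<open>Gronwall's inequality for the squared distance \<open>W\<close> in almost-everywhere
  form: \<open>exp (- K * t) * W t\<close> is absolutely continuous with nonpositive derivative and
  starts at 0.\<close>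

lemma sol_unique:
  assumes X: "sol T X" and Y: "sol T Y" and t: "0 \<le> t" "t \<le> T" and q: "q \<in> C"
  shows "X t q = Y t q"
proof -
  obtain B1 where B1: "B1 \<ge> 0" "\<And>t. t \<in> {0..T} \<Longrightarrow> in_box C B1 (X t)" by (rule sol_bounded[OF X]) blast
  obtain B2 where B2: "B2 \<ge> 0" "\<And>t. t \<in> {0..T} \<Longrightarrow> in_box C B2 (Y t)" by (rule sol_bounded[OF Y]) blast
  define B where "B = max B1 B2"
  have B: "B \<ge> 0" "\<And>t. t \<in> {0..T} \<Longrightarrow> in_box C B (X t)" "\<And>t. t \<in> {0..T} \<Longrightarrow> in_box C B (Y t)"
    using B1 B2 by (auto simp: B_def in_box_def le_max_iff_disj)
  obtain K where K: "\<And>s s'. in_box C B s \<Longrightarrow> in_box C B s' \<Longrightarrow> (\<And>i. 0 \<le> dual_var s i) \<Longrightarrow> (\<And>i. 0 \<le> dual_var s' i) \<Longrightarrow>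
    (\<Sum>q\<in>C. 2 * (s q - s' q) * (CL s q - CL s' q)) \<le> K * (\<Sum>q\<in>C. (s q - s' q)\<^sup>2)"
    by (rule closed_loop_one_sided[OF B(1)]) blast
  define W where "W \<tau> = (\<Sum>q\<in>C. (X \<tau> q - Y \<tau> q) * (X \<tau> q - Y \<tau> q))" for \<tau>
  have acW: "abs_continuous_on {0..t} W" unfolding W_def using X Y t
    by (intro abs_continuous_on_sum abs_continuous_on_mult abs_continuous_on_diff)
       (auto simp: sol_def intro: abs_continuous_on_subset)
  have acE: "abs_continuous_on {0..t} (\<lambda>\<tau>. exp (- K * \<tau>))"
  proof (rule abs_continuous_on_C1[where f' = "\<lambda>\<tau>. exp (- K * \<tau>) * (- K)"])
    show "((\<lambda>\<tau>. exp (- K * \<tau>)) has_real_derivative exp (- K * u) * (- K)) (at u within {0..t})" for u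
      by (auto intro!: derivative_eq_intros)
  qed (intro continuous_intros)
  have "exp (- K * t) * W t \<le> exp (- K * 0) * W 0"
  proof (rule AE_deriv_nonpos_imp_le[OF t(1)])
    show "abs_continuous_on {0..t} (\<lambda>\<tau>. exp (- K * \<tau>) * W \<tau>)" by (rule abs_continuous_on_mult[OF acE acW])
    have "AE u in lebesgue. 0 \<le> u \<and> u \<le> T \<longrightarrow> (\<forall>q\<in>C. ((\<lambda>\<tau>. X \<tau> q) has_real_derivative CL (X u) q) (at u))"
      "AE u in lebesgue. 0 \<le> u \<and> u \<le> T \<longrightarrow> (\<forall>q\<in>C. ((\<lambda>\<tau>. Y \<tau> q) has_real_derivative CL (Y u) q) (at u))"
      using X Y by (simp_all add: sol_def)
    then show "AE u in lebesgue. 0 \<le> u \<and> u \<le> t \<longrightarrow> (\<exists>D\<le>0. ((\<lambda>\<tau>. exp (- K * \<tau>) * W \<tau>) has_real_derivative D) (at u))"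
    proof eventually_elim
      case (elim u)
      show ?case
      proof
        assume u: "0 \<le> u \<and> u \<le> t"
        then have uT: "u \<in> {0..T}" using t by auto
        have dW: "(W has_real_derivative (\<Sum>q\<in>C. 2 * (X u q - Y u q) * (CL (X u) q - CL (Y u) q))) (at u)"
          unfolding W_def
        proof (rule DERIV_sum)
          fix p assume p: "p \<in> C"
          have "((\<lambda>\<tau>. X \<tau> p - Y \<tau> p) has_real_derivative CL (X u) p - CL (Y u) p) (at u)"
            using elim uT p by (intro DERIV_diff) auto
          from DERIV_mult[OF this this]
          show "((\<lambda>\<tau>. (X \<tau> p - Y \<tau> p) * (X \<tau> p - Y \<tau> p)) has_real_derivative
              2 * (X u p - Y u p) * (CL (X u) p - CL (Y u) p)) (at u)" by (simp add: algebra_simps)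
        qed
        let ?D = "\<Sum>q\<in>C. 2 * (X u q - Y u q) * (CL (X u) q - CL (Y u) q)"
        have "?D \<le> K * W u"
          using K[OF B(2)[OF uT] B(3)[OF uT]] sol_dual_var_nonneg[OF X] sol_dual_var_nonneg[OF Y] uT
          by (simp add: W_def power2_eq_square)
        then have "exp (- K * u) * (?D - K * W u) \<le> 0" by (simp add: mult_nonneg_nonpos)
        moreover have "((\<lambda>\<tau>. exp (- K * \<tau>) * W \<tau>) has_real_derivative exp (- K * u) * (?D - K * W u)) (at u)"
          using dW by (auto intro!: derivative_eq_intros simp: algebra_simps)
        ultimately show "\<exists>D\<le>0. ((\<lambda>\<tau>. exp (- K * \<tau>) * W \<tau>) has_real_derivative D) (at u)" by blast
      qed
    qed
  qed
  moreover have "W 0 = 0" unfolding W_def using X Y by (simp add: sol_def)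
  ultimately have "W t \<le> 0" by (simp add: mult_le_0_iff)
  moreover have "(X t q - Y t q) * (X t q - Y t q) \<le> W t"
    unfolding W_def using q finite_C by (intro member_le_sum) auto
  ultimately have "(X t q - Y t q) * (X t q - Y t q) \<le> 0" by linarith
  then show ?thesis by (auto simp: mult_le_0_iff)
qed

end

section \<open>The Lyapunov function\<close>

text \<open>The quadratic form cannot see a common shift of all \<open>w i\<close>, so it gives no
  bound on \<open>w\<close>; but it controls edge differences, and the Laplacian is a sum of those.
  In this way the Lyapunov function bounds \<open>z\<close> although the integrals \<open>w\<close>
  may grow.\<close>

lemma norm_le_of_form:
  fixes E :: "('i::finite \<times> 'i) set" and w :: "'i \<Rightarrow> 'a::real_inner"
  assumes "sym E" "(\<Sum>i\<in>UNIV. w i \<bullet> laplacian E w i) \<le> c"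
  shows "norm (laplacian E w i) \<le> real CARD('i) * sqrt (2 * c)"
proof -
  have e: "norm (w a - w b) \<le> sqrt (2 * c)" if "(a, b) \<in> E" for a b
  proof (rule real_le_rsqrt)
    have "(norm (w a - w b))\<^sup>2 \<le> (\<Sum>(a,b)\<in>E. (norm (w a - w b))\<^sup>2)"
      using member_le_sum[of "(a,b)" E "\<lambda>(a,b). (norm (w a - w b))\<^sup>2"] that by auto
    also have "\<dots> = 2 * (\<Sum>i\<in>UNIV. w i \<bullet> laplacian E w i)"
      unfolding laplacian_form[OF assms(1)] by (simp add: power2_norm_eq_inner)
    also have "\<dots> \<le> 2 * c" using assms(2) by simp
    finally show "(norm (w a - w b))\<^sup>2 \<le> 2 * c" .
  qed
  have c: "c \<ge> 0" using laplacian_nonneg[OF assms(1), of w] assms(2) by linarith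
  have "norm (laplacian E w i) \<le> (\<Sum>j\<in>neighbors E i. norm (w i - w j))"
    unfolding laplacian_def by (rule norm_sum)
  also have "\<dots> \<le> (\<Sum>j\<in>neighbors E i. sqrt (2 * c))"
    by (rule sum_mono) (auto simp: neighbors_def intro: e)
  also have "\<dots> = real (card (neighbors E i)) * sqrt (2 * c)" by simp
  also have "\<dots> \<le> real CARD('i) * sqrt (2 * c)"
    using c by (intro mult_right_mono) (auto intro: card_mono)
  finally show ?thesis .
qed

context gne_closed_loop
begin

text \<open>Data \<open>(x, \<lambda>, z)\<close> of an equilibrium of the closed loop; the coupling constraint is split
  among the agents by \<open>z\<close>.\<close>

definition equilibrium_data :: "real^'n \<Rightarrow> real^'m \<Rightarrow> ('i \<Rightarrow> real^'m) \<Rightarrow> bool" where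
  "equilibrium_data xs ls zb \<longleftrightarrow> (\<forall>a. ls $ a \<ge> 0) \<and> (\<forall>i. G i xs + A i xs ls = 0) \<and>
     (\<forall>i a. (g i xs - zb i) $ a \<le> 0) \<and> (\<forall>i. ls \<bullet> (g i xs - zb i) = 0) \<and> (\<Sum>i\<in>UNIV. zb i) = 0"

lemma stationary_iff: "(\<forall>i. G i x + A i x lam = 0) \<longleftrightarrow> (\<forall>l. F x $ l + A (own l) x lam $ l = 0)"
proof
  assume *: "\<forall>i. G i x + A i x lam = 0"
  show "\<forall>l. F x $ l + A (own l) x lam $ l = 0"
  proof
    fix l
    have "(G (own l) x + A (own l) x lam) $ l = 0" using * by simp
    then show "F x $ l + A (own l) x lam $ l = 0" by (simp add: G_own_block)
  qed
next
  assume *: "\<forall>l. F x $ l + A (own l) x lam $ l = 0"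
  show "\<forall>i. G i x + A i x lam = 0"
  proof
    fix i
    have "(G i x + A i x lam) $ l = 0" for l
      using *[rule_format, of l] G_own_block[of l i x] G_other_block[of l i x] A_other_block[of l i x lam]
      by (cases "own l = i") auto
    then show "G i x + A i x lam = 0" by (simp add: vec_eq_iff)
  qed
qed

text \<open>Each agent receives the same share of the total constraint value. Signs and
  complementarity pass to every share, and the resulting \<open>zb\<close> sum to zero.\<close>

lemma KKT_imp_equilibrium_data:
  assumes "KKT own UNIV J g x lam"
  obtains zb where "equilibrium_data x lam zb"
proof
  define N where "N = real CARD('i)"
  have N: "N > 0" by (simp add: N_def)
  have k: "\<And>a. 0 \<le> lam $ a" "\<forall>l. F x $ l + A (own l) x lam $ l = 0"
    "\<And>a. coupling g x $ a \<le> 0" "lam \<bullet> coupling g x = 0"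
    using assms unfolding KKT_iff by auto
  have eq: "g i x - (g i x - (1 / N) *\<^sub>R coupling g x) = (1 / N) *\<^sub>R coupling g x" for i by simp
  have "(\<Sum>i\<in>(UNIV::'i set). (1 / N) *\<^sub>R coupling g x) = N *\<^sub>R ((1 / N) *\<^sub>R coupling g x)"
    by (simp only: sum_constant_scaleR N_def)
  then have "(\<Sum>i\<in>UNIV. g i x - (1 / N) *\<^sub>R coupling g x) = coupling g x - N *\<^sub>R ((1 / N) *\<^sub>R coupling g x)"
    unfolding sum_subtractf by (simp only: coupling_def)
  then have "(\<Sum>i\<in>UNIV. g i x - (1 / N) *\<^sub>R coupling g x) = 0" using N by simp
  then show "equilibrium_data x lam (\<lambda>i. g i x - (1 / N) *\<^sub>R coupling g x)"
    unfolding equilibrium_data_def eq using k stationary_iff[of x lam] N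
    by (auto simp: divide_nonpos_pos)
qed

lemma equilibrium_data_imp_KKT:
  assumes "equilibrium_data x lam zb"
  shows "KKT own UNIV J g x lam"
proof -
  have e: "\<And>a. lam $ a \<ge> 0" "\<forall>i. G i x + A i x lam = 0" "\<And>i a. (g i x - zb i) $ a \<le> 0"
     "\<And>i. lam \<bullet> (g i x - zb i) = 0" "(\<Sum>i\<in>UNIV. zb i) = 0"
    using assms unfolding equilibrium_data_def by auto
  have cp: "coupling g x = (\<Sum>i\<in>UNIV. g i x - zb i)" using e(5) by (simp add: coupling_def sum_subtractf)
  have "coupling g x $ a \<le> 0" for a unfolding cp sum_component using e(3) by (intro sum_nonpos) auto
  moreover have "lam \<bullet> coupling g x = 0" unfolding cp inner_sum_right using e(4) by simp
  ultimately show ?thesis unfolding KKT_iff using e(1,2) stationary_iff[of x lam] by blast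
qed

definition dissipation_rate :: "real^'n \<Rightarrow> ('i, 'n, 'm) state \<Rightarrow> real" where
  "dissipation_rate xs s = \<mu> / 2 * (norm (own_profile (est s) - xs))\<^sup>2
     + (\<Sum>i\<in>UNIV. (norm (laplacian E (est s) i))\<^sup>2) + (\<Sum>i\<in>UNIV. dual_var s i \<bullet> laplacian E (dual_var s) i)"

lemma dissipation_rate_nonneg:
  "\<mu> / 2 * (norm (own_profile (est s) - xs))\<^sup>2 \<ge> 0"
  "(\<Sum>i\<in>UNIV. (norm (laplacian E (est s) i))\<^sup>2) \<ge> 0" "(\<Sum>i\<in>UNIV. dual_var s i \<bullet> laplacian E (dual_var s) i) \<ge> 0"
  "dissipation_rate xs s \<ge> 0"
proof -
  show 1: "\<mu> / 2 * (norm (own_profile (est s) - xs))\<^sup>2 \<ge> 0" using F_monotone(1) by simp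
  show 2: "(\<Sum>i\<in>UNIV. (norm (laplacian E (est s) i))\<^sup>2) \<ge> 0" by (intro sum_nonneg) auto
  show 3: "(\<Sum>i\<in>UNIV. dual_var s i \<bullet> laplacian E (dual_var s) i) \<ge> 0" by (rule laplacian_nonneg[OF undirected])
  show "dissipation_rate xs s \<ge> 0" unfolding dissipation_rate_def using 1 2 3 by linarith
qed

lemma own_profile_lip: "box_lipschitz C B (\<lambda>s. own_profile (est s))" if "B \<ge> 0"
  unfolding own_profile_def using that by (intro box_lipschitz_vec box_lipschitz_nth est_lip)

lemma dissipation_rate_lip: "box_lipschitz C B (dissipation_rate xs)" if "B \<ge> 0"
  unfolding dissipation_rate_def[abs_def] power2_norm_eq_inner
  using that by (intro box_lipschitz_add box_lipschitz_sum box_lipschitz_bilinear[OF bounded_bilinear_mult]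
     box_lipschitz_bilinear[OF bounded_bilinear_inner] box_lipschitz_const box_lipschitz_diff own_profile_lip
     box_lipschitz_laplacian est_lip dual_lip)

definition dual_integral :: "(real \<Rightarrow> ('i, 'n, 'm) state) \<Rightarrow> real \<Rightarrow> 'i \<Rightarrow> real^'m" where
  "dual_integral X t i = (\<chi> a. integral {0..t} (\<lambda>\<tau>. X \<tau> (Dual i a)))"

lemma dual_integral_deriv:
  assumes "sol T X" "t \<in> {0..T}"
  shows "((\<lambda>\<tau>. dual_integral X \<tau> i $ a) has_real_derivative dual_var (X t) i $ a) (at t within {0..T})"
  using integral_has_real_derivative[OF sol_continuous[OF assms(1) in_C(5)] assms(2), of i a]
  by (simp add: dual_integral_def dual_var_def)

text \<open>Both sides have the same derivative, and both vanish at time 0; this is where the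
  initial condition on \<open>z\<close> enters.\<close>

lemma aux_eq_laplacian:
  assumes X: "sol T X" and t: "t \<in> {0..T}"
  shows "aux_var (X t) i = laplacian E (dual_integral X t) i"
proof -
  have "X t (Aux i a) - laplacian E (dual_integral X t) i $ a = X 0 (Aux i a) - laplacian E (dual_integral X 0) i $ a" for a
  proof -
    define h where "h = (\<lambda>\<tau>. X \<tau> (Aux i a) - (\<Sum>j\<in>neighbors E i. dual_integral X \<tau> i $ a - dual_integral X \<tau> j $ a))"
    have d: "(h has_real_derivative 0) (at u within {0..T})" if u: "u \<in> {0..T}" for u
    proof -
      have "((\<lambda>\<tau>. X \<tau> (Aux i a)) has_real_derivative CL (X u) (Aux i a)) (at u within {0..T})"
        by (rule sol_deriv[OF X _ _ u]) (auto simp: in_C)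
      moreover have "((\<lambda>\<tau>. \<Sum>j\<in>neighbors E i. dual_integral X \<tau> i $ a - dual_integral X \<tau> j $ a) has_real_derivative
          (\<Sum>j\<in>neighbors E i. dual_var (X u) i $ a - dual_var (X u) j $ a)) (at u within {0..T})"
        by (intro DERIV_sum DERIV_diff dual_integral_deriv[OF X u])
      ultimately show ?thesis
        unfolding h_def using DERIV_diff by (force simp: dual_disagreement_def)
    qed
    have "h t = h 0"
    proof (rule has_field_derivative_zero_constant[of "{0..T}" h, THEN exE])
      show "convex {0..T}" by simp
      show "(h has_field_derivative 0) (at u within {0..T})" if "u \<in> {0..T}" for u by (rule d[OF that])
      fix k assume "\<forall>u\<in>{0..T}. h u = k"
      then show "h t = h 0" using t by auto
    qed
    then show ?thesis by (simp add: h_def laplacian_def)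
  qed
  moreover have "X 0 (Aux i a) = 0" for a
    using X init_z[of i] in_C(4)[of i a] by (simp add: sol_def aux_var_def vec_eq_iff)
  moreover have "laplacian E (dual_integral X 0) i = 0" by (simp add: laplacian_def dual_integral_def vec_eq_iff)
  ultimately show ?thesis by (simp add: vec_eq_iff aux_var_def)
qed

text \<open>For \<open>z = L w\<close> and \<open>zb = L wb\<close> the last term is the quadratic
  form of the pseudoinverse of the Laplacian at \<open>z - zb\<close>. Carrying \<open>w\<close> and
  \<open>wb\<close> as arguments avoids constructing that pseudoinverse.\<close>

definition lyapunov :: "real \<Rightarrow> real^'n \<Rightarrow> real^'m \<Rightarrow> ('i \<Rightarrow> real^'m) \<Rightarrow> ('i \<Rightarrow> real^'m) \<Rightarrow> ('i, 'n, 'm) state \<Rightarrow> ('i \<Rightarrow> real^'m) \<Rightarrow> real" where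
  "lyapunov ks xs ls zb wb s w = (\<Sum>i\<in>UNIV. (est s i - xs) \<bullet> (est s i - xs)) / 2
     + (\<Sum>i\<in>UNIV. (s (Gain i) - ks) * (s (Gain i) - ks) / (2 * \<gamma> i))
     + (\<Sum>i\<in>UNIV. (dual_var s i - ls) \<bullet> (dual_var s i - ls)) / 2
     + (\<Sum>i\<in>UNIV. (w i - wb i) \<bullet> (aux_var s i - zb i)) / 2"

lemma lyapunov_parts:
  assumes wb: "\<And>i. laplacian E wb i = zb i" and w: "\<And>i. aux_var s i = laplacian E w i"
  shows "(\<Sum>i\<in>UNIV. (est s i - xs) \<bullet> (est s i - xs)) \<ge> 0"
    "(\<Sum>i\<in>UNIV. (s (Gain i) - ks) * (s (Gain i) - ks) / (2 * \<gamma> i)) \<ge> 0"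
    "(\<Sum>i\<in>UNIV. (dual_var s i - ls) \<bullet> (dual_var s i - ls)) \<ge> 0"
    "(\<Sum>i\<in>UNIV. (w i - wb i) \<bullet> (aux_var s i - zb i)) \<ge> 0"
    "(\<Sum>i\<in>UNIV. (w i - wb i) \<bullet> (aux_var s i - zb i)) = (\<Sum>i\<in>UNIV. (w i - wb i) \<bullet> laplacian E (\<lambda>i. w i - wb i) i)"
proof -
  show "(\<Sum>i\<in>UNIV. (est s i - xs) \<bullet> (est s i - xs)) \<ge> 0" "(\<Sum>i\<in>UNIV. (dual_var s i - ls) \<bullet> (dual_var s i - ls)) \<ge> 0"
    by (auto intro: sum_nonneg)
  show "(\<Sum>i\<in>UNIV. (s (Gain i) - ks) * (s (Gain i) - ks) / (2 * \<gamma> i)) \<ge> 0"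
    using gains by (intro sum_nonneg divide_nonneg_pos) auto
  show eq: "(\<Sum>i\<in>UNIV. (w i - wb i) \<bullet> (aux_var s i - zb i)) = (\<Sum>i\<in>UNIV. (w i - wb i) \<bullet> laplacian E (\<lambda>i. w i - wb i) i)"
    by (simp add: laplacian_diff wb w)
  show "(\<Sum>i\<in>UNIV. (w i - wb i) \<bullet> (aux_var s i - zb i)) \<ge> 0"
    unfolding eq by (rule laplacian_nonneg[OF undirected])
qed

lemma lyapunov_coercive:
  assumes wb: "\<And>i. laplacian E wb i = zb i" and w: "\<And>i. aux_var s i = laplacian E w i"
    and V: "lyapunov ks xs ls zb wb s w \<le> V"
  shows "norm (est s i - xs) \<le> sqrt (2 * V)" "\<bar>s (Gain i) - ks\<bar> \<le> sqrt (2 * \<gamma> i * V)"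
    "norm (dual_var s i - ls) \<le> sqrt (2 * V)" "norm (aux_var s i - zb i) \<le> real CARD('i) * sqrt (2 * (2 * V))"
proof -
  note p = lyapunov_parts(1)[OF wb w, of xs] lyapunov_parts(2)[OF wb w, of ks]
    lyapunov_parts(3)[OF wb w, of ls] lyapunov_parts(4,5)[OF wb w]
  have V': "(\<Sum>i\<in>UNIV. (est s i - xs) \<bullet> (est s i - xs)) \<le> 2 * V"
    "(\<Sum>i\<in>UNIV. (s (Gain i) - ks) * (s (Gain i) - ks) / (2 * \<gamma> i)) \<le> V"
    "(\<Sum>i\<in>UNIV. (dual_var s i - ls) \<bullet> (dual_var s i - ls)) \<le> 2 * V"
    "(\<Sum>i\<in>UNIV. (w i - wb i) \<bullet> (aux_var s i - zb i)) \<le> 2 * V"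
    using V p(1-4) unfolding lyapunov_def by linarith+
  have "(est s i - xs) \<bullet> (est s i - xs) \<le> (\<Sum>i\<in>UNIV. (est s i - xs) \<bullet> (est s i - xs))"
    by (rule member_le_sum) auto
  then show "norm (est s i - xs) \<le> sqrt (2 * V)" using V'(1) unfolding norm_eq_sqrt_inner by simp
  have "(dual_var s i - ls) \<bullet> (dual_var s i - ls) \<le> (\<Sum>i\<in>UNIV. (dual_var s i - ls) \<bullet> (dual_var s i - ls))"
    by (rule member_le_sum) auto
  then show "norm (dual_var s i - ls) \<le> sqrt (2 * V)" using V'(3) unfolding norm_eq_sqrt_inner by simp
  have "(s (Gain i) - ks) * (s (Gain i) - ks) / (2 * \<gamma> i) \<le> (\<Sum>i\<in>UNIV. (s (Gain i) - ks) * (s (Gain i) - ks) / (2 * \<gamma> i))"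
    by (rule member_le_sum) (use gains in \<open>auto intro: divide_nonneg_pos\<close>)
  then have "(s (Gain i) - ks) * (s (Gain i) - ks) / (2 * \<gamma> i) \<le> V" using V'(2) by linarith
  then have "(s (Gain i) - ks)\<^sup>2 \<le> 2 * \<gamma> i * V"
    using gains[of i] by (simp add: divide_le_eq power2_eq_square mult.commute)
  then show "\<bar>s (Gain i) - ks\<bar> \<le> sqrt (2 * \<gamma> i * V)" by (intro real_le_rsqrt) simp
  have "aux_var s i - zb i = laplacian E (\<lambda>i. w i - wb i) i" by (simp add: laplacian_diff wb w)
  then show "norm (aux_var s i - zb i) \<le> real CARD('i) * sqrt (2 * (2 * V))"
    using norm_le_of_form[OF undirected, of "\<lambda>i. w i - wb i" "2 * V" i] V'(4) p(5) by simp
qed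

text \<open>The order of quantifiers matters: one \<open>ks\<close> serves every solution, every
  horizon and every equilibrium. The decrease is integrated because the function is merely
  absolutely continuous along solutions.\<close>

lemma lyapunov_decrease:
  obtains ks where "\<And>T X a b xs ls zb wb. sol T X \<Longrightarrow> equilibrium_data xs ls zb \<Longrightarrow> (\<And>i. laplacian E wb i = zb i) \<Longrightarrow>
    0 \<le> a \<Longrightarrow> a \<le> b \<Longrightarrow> b \<le> T \<Longrightarrow>
    lyapunov ks xs ls zb wb (X b) (dual_integral X b) + integral {a..b} (\<lambda>t. dissipation_rate xs (X t))
      \<le> lyapunov ks xs ls zb wb (X a) (dual_integral X a)"
proof (rule dissipation)
  fix ks
  assume ks: "\<And>(Z :: 'i \<Rightarrow> real^'n) (lam :: 'i \<Rightarrow> real^'m) k (z :: 'i \<Rightarrow> real^'m) xs ls zb P.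
    \<lbrakk>\<And>a. ls $ a \<ge> 0; \<And>i. G i xs + A i xs ls = 0;
     \<And>i a. (g i xs - zb i) $ a \<le> 0; \<And>i. ls \<bullet> (g i xs - zb i) = 0; \<And>i a. lam i $ a \<ge> 0;
     \<And>i. (lam i - ls) \<bullet> P i \<le> (lam i - ls) \<bullet> (g i (Z i) - z i - laplacian E lam i)\<rbrakk> \<Longrightarrow>
    (\<Sum>i\<in>UNIV. (Z i - xs) \<bullet> (- G i (Z i) - A i (Z i) (lam i) - laplacian E (\<lambda>i. k i *\<^sub>R laplacian E Z i) i))
     + (\<Sum>i\<in>UNIV. (k i - ks) * (norm (laplacian E Z i))\<^sup>2)
     + (\<Sum>i\<in>UNIV. (lam i - ls) \<bullet> P i) + (\<Sum>i\<in>UNIV. (z i - zb i) \<bullet> (lam i - ls))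
    \<le> - (\<mu> / 2 * (norm (own_profile Z - xs))\<^sup>2 + (\<Sum>i\<in>UNIV. (norm (laplacian E Z i))\<^sup>2)
        + (\<Sum>i\<in>UNIV. lam i \<bullet> laplacian E lam i))"
  show thesis
  proof (rule that[of ks])
    fix T X a b xs ls zb wb
    assume X: "sol T X" and ed: "equilibrium_data xs ls zb" and wb: "\<And>i. laplacian E wb i = zb i"
      and ab: "0 \<le> a" "a \<le> b" "b \<le> T"
    have e: "\<And>a. ls $ a \<ge> 0" "\<And>i. G i xs + A i xs ls = 0" "\<And>i a. (g i xs - zb i) $ a \<le> 0"
     "\<And>i. ls \<bullet> (g i xs - zb i) = 0" "(\<Sum>i\<in>UNIV. zb i) = 0"
      using ed unfolding equilibrium_data_def by auto
    define V where "V t = lyapunov ks xs ls zb wb (X t) (dual_integral X t)" for t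
    have AC: "abs_continuous_on {0..T} (\<lambda>t. X t q)" if "q \<in> C" for q using X that by (simp add: sol_def)
    have ACe: "abs_continuous_on {0..T} (\<lambda>t. (est (X t) i - xs) $ l)" for i l
    proof -
      have "abs_continuous_on {0..T} (\<lambda>t. est (X t) i $ l)"
      proof (cases "own l = i")
        case True
        have "abs_continuous_on {0..T} (\<lambda>t. \<Sum>j<r l. c l j * X t (Deriv l j))"
          by (intro abs_continuous_on_sum abs_continuous_on_mult abs_continuous_on_const AC) (auto simp: in_C)
        then show ?thesis using True by (simp add: estimate_def zeta_sum)
      qed (auto simp: estimate_def in_C intro: AC)
      then show ?thesis by (simp add: abs_continuous_on_diff abs_continuous_on_const)
    qed
    have ACd: "abs_continuous_on {0..T} (\<lambda>t. (dual_var (X t) i - ls) $ k)" for i k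
      using AC[OF in_C(5)] by (simp add: dual_var_def abs_continuous_on_diff abs_continuous_on_const)
    have ACa: "abs_continuous_on {0..T} (\<lambda>t. (aux_var (X t) i - zb i) $ k)" for i k
      using AC[OF in_C(4)] by (simp add: aux_var_def abs_continuous_on_diff abs_continuous_on_const)
    have ACw: "abs_continuous_on {0..T} (\<lambda>t. (dual_integral X t i - wb i) $ k)" for i k
    proof -
      have "continuous_on {0..T} (\<lambda>t. dual_var (X t) i $ k)"
        using sol_continuous[OF X in_C(5)] by (simp add: dual_var_def)
      from abs_continuous_on_C1[OF dual_integral_deriv[OF X] this]
      show ?thesis by (simp add: abs_continuous_on_diff abs_continuous_on_const)
    qed
    have acV: "abs_continuous_on {0..T} V"
      unfolding V_def lyapunov_def divide_inverse
      by (intro abs_continuous_on_add abs_continuous_on_mult abs_continuous_on_const abs_continuous_on_sum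
           abs_continuous_on_inner ACe ACd ACa ACw abs_continuous_on_diff AC in_C)
    have cd: "continuous_on {0..T} (\<lambda>t. dissipation_rate xs (X t))"
      by (rule sol_path_continuous[OF X dissipation_rate_lip])
    have "V b - V a \<le> integral {a..b} (\<lambda>t. - dissipation_rate xs (X t))"
    proof (rule AE_deriv_le_imp_diff_le[OF ab(2)])
      show "abs_continuous_on {a..b} V" using ab by (intro abs_continuous_on_subset[OF acV]) auto
      show "continuous_on {a..b} (\<lambda>t. - dissipation_rate xs (X t))"
        using ab by (intro continuous_intros continuous_on_subset[OF cd]) auto
      have "AE t in lebesgue. 0 \<le> t \<and> t \<le> T \<longrightarrow> (\<forall>q\<in>C. ((\<lambda>\<tau>. X \<tau> q) has_real_derivative CL (X t) q) (at t))"
        using X by (simp add: sol_def)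
      \<comment> \<open>The integrals of the multipliers are differentiable within
        \<open>{0..T}\<close>; excluding the two ends makes the derivative two-sided.\<close>
      moreover have "AE t in lebesgue. t \<noteq> 0" "AE t in lebesgue. t \<noteq> T"
        by (rule AE_completion[OF AE_lborel_singleton])+
      ultimately show "AE t in lebesgue. a \<le> t \<and> t \<le> b \<longrightarrow>
          (\<exists>D\<le>- dissipation_rate xs (X t). (V has_real_derivative D) (at t))"
      proof eventually_elim
        case (elim t)
        show ?case
        proof
          assume t: "a \<le> t \<and> t \<le> b"
          then have tT: "t \<in> {0..T}" and t0: "0 < t" "t < T" using ab elim by auto
          have dq: "((\<lambda>\<tau>. X \<tau> q) has_real_derivative CL (X t) q) (at t)" if "q \<in> C" for q
            using elim tT that by auto
          let ?P = "\<lambda>i. \<chi> k. CL (X t) (Dual i k)"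
          have de: "((\<lambda>\<tau>. est (X \<tau>) i - xs) has_vector_derivative ut (X t) i) (at t)" for i
            by (rule has_vector_derivative_vec) (use est_deriv[of X t UNIV i, OF dq] in \<open>auto intro!: derivative_eq_intros\<close>)
          have dd: "((\<lambda>\<tau>. dual_var (X \<tau>) i - ls) has_vector_derivative ?P i) (at t)" for i
            by (rule has_vector_derivative_vec) (use dq[OF in_C(5)] in \<open>auto intro!: derivative_eq_intros simp: dual_var_def\<close>)
          have da: "((\<lambda>\<tau>. aux_var (X \<tau>) i - zb i) has_vector_derivative laplacian E (dual_var (X t)) i) (at t)" for i
            by (rule has_vector_derivative_vec)
               (use dq[OF in_C(4)] in \<open>auto intro!: derivative_eq_intros simp: aux_var_def dual_laplacian[symmetric]\<close>)
          have "((\<lambda>\<tau>. dual_integral X \<tau> i $ k) has_real_derivative dual_var (X t) i $ k) (at t)" for i k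
            using dual_integral_deriv[OF X tT, of i k] at_within_Icc_at[OF t0] by simp
          then have dw: "((\<lambda>\<tau>. dual_integral X \<tau> i - wb i) has_vector_derivative dual_var (X t) i) (at t)" for i
            by (intro has_vector_derivative_vec) (auto intro!: derivative_eq_intros)
          have dk: "((\<lambda>\<tau>. X \<tau> (Gain i) - ks) has_real_derivative \<gamma> i * (norm (rh (X t) i))\<^sup>2) (at t)" for i
            using dq[OF in_C(3)[of i]] by (auto intro!: derivative_eq_intros)
          define D1 where "D1 = (\<Sum>i\<in>UNIV. (est (X t) i - xs) \<bullet> ut (X t) i + ut (X t) i \<bullet> (est (X t) i - xs)) / 2"
          define D2 where "D2 = (\<Sum>i\<in>UNIV. (\<gamma> i * (norm (rh (X t) i))\<^sup>2 * (X t (Gain i) - ks)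
             + \<gamma> i * (norm (rh (X t) i))\<^sup>2 * (X t (Gain i) - ks)) / (2 * \<gamma> i))"
          define D3 where "D3 = (\<Sum>i\<in>UNIV. (dual_var (X t) i - ls) \<bullet> ?P i + ?P i \<bullet> (dual_var (X t) i - ls)) / 2"
          define D4 where "D4 = (\<Sum>i\<in>UNIV. (dual_integral X t i - wb i) \<bullet> laplacian E (dual_var (X t)) i
             + dual_var (X t) i \<bullet> (aux_var (X t) i - zb i)) / 2"
          have dV: "(V has_real_derivative D1 + D2 + D3 + D4) (at t)"
            unfolding V_def lyapunov_def D1_def D2_def D3_def D4_def
            by (intro DERIV_add DERIV_cdivide DERIV_sum inner_has_real_derivative de dd da dw DERIV_mult dk)
          have D1: "D1 = (\<Sum>i\<in>UNIV. (est (X t) i - xs) \<bullet> ut (X t) i)"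
            by (simp add: D1_def inner_commute sum_divide_distrib)
          have D2: "D2 = (\<Sum>i\<in>UNIV. (X t (Gain i) - ks) * (norm (laplacian E (est (X t)) i))\<^sup>2)"
            unfolding D2_def rho_laplacian using gains by (intro sum.cong) (auto simp: less_imp_neq[symmetric] field_simps)
          have D3: "D3 = (\<Sum>i\<in>UNIV. (dual_var (X t) i - ls) \<bullet> ?P i)"
            by (simp add: D3_def inner_commute sum_divide_distrib)
          have sumz: "(\<Sum>i\<in>UNIV. aux_var (X t) i - zb i) = 0"
            using aux_eq_laplacian[OF X tT] sum_laplacian[OF undirected] e(5) by (simp add: sum_subtractf)
          \<comment> \<open>Symmetry of the Laplacian moves it from the multipliers onto
            \<open>w - wb\<close>, so both halves of the product rule coincide. Subtracting
            \<open>ls\<close> is free because \<open>z - zb\<close> sums to zero.\<close>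
          have D4: "D4 = (\<Sum>i\<in>UNIV. (aux_var (X t) i - zb i) \<bullet> (dual_var (X t) i - ls))"
          proof -
            have "(\<Sum>i\<in>UNIV. (dual_integral X t i - wb i) \<bullet> laplacian E (dual_var (X t)) i)
                = (\<Sum>i\<in>UNIV. laplacian E (\<lambda>i. dual_integral X t i - wb i) i \<bullet> dual_var (X t) i)"
              by (rule laplacian_symmetric[OF undirected])
            also have "\<dots> = (\<Sum>i\<in>UNIV. (aux_var (X t) i - zb i) \<bullet> dual_var (X t) i)"
              by (simp add: laplacian_diff wb aux_eq_laplacian[OF X tT])
            finally have "D4 = (\<Sum>i\<in>UNIV. (aux_var (X t) i - zb i) \<bullet> dual_var (X t) i)"
              by (simp add: D4_def sum.distrib inner_commute)
            moreover have "(\<Sum>i\<in>UNIV. (aux_var (X t) i - zb i) \<bullet> ls) = 0"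
              unfolding inner_sum_left[symmetric] sumz by simp
            ultimately show ?thesis by (simp add: inner_diff_right sum_subtractf)
          qed
          have lam0: "dual_var (X t) i $ k \<ge> 0" for i k
            using sol_dual_nonneg[OF X] tT by (simp add: dual_var_def)
          have "D1 + D2 + D3 + D4 \<le> - dissipation_rate xs (X t)"
            unfolding D1 D2 D3 D4 dissipation_rate_def ut_eq rho_laplacian
          proof (rule ks[OF e(1-4) lam0])
            fix i
            have nn: "0 \<le> dual_var (X t) i" by (rule sol_dual_var_nonneg[OF X]) (use tT in auto)
            show "(dual_var (X t) i - ls) \<bullet> ?P i
                \<le> (dual_var (X t) i - ls) \<bullet> (g i (est (X t) i) - aux_var (X t) i - laplacian E (dual_var (X t)) i)"
              unfolding inner_vec_def
            proof (rule sum_mono)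
              fix k
              \<comment> \<open>Projection alters the drift only at a vanishing multiplier, and then
                upwards, while the multiplier lies at or below its equilibrium value.\<close>
              have "(X t (Dual i k) - ls $ k) * ((if X t (Dual i k) \<le> 0 then max 0 (drift (X t) (Dual i k)) else drift (X t) (Dual i k))
                  - drift (X t) (Dual i k)) \<le> 0"
                using lam0[of i k] e(1)[of k] by (auto simp: dual_var_def max_def mult_nonpos_nonneg)
              then show "(dual_var (X t) i - ls) $ k \<bullet> ?P i $ k
                  \<le> (dual_var (X t) i - ls) $ k \<bullet> (g i (est (X t) i) - aux_var (X t) i - laplacian E (dual_var (X t)) i) $ k"
                unfolding vec_lambda_beta CL_dual[OF nn] by (simp add: drift_simps dual_var_def right_diff_distrib)
            qed
          qed
          then show "\<exists>D\<le>- dissipation_rate xs (X t). (V has_real_derivative D) (at t)" using dV by blast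
        qed
      qed
    qed
    then show "lyapunov ks xs ls zb wb (X b) (dual_integral X b) + integral {a..b} (\<lambda>t. dissipation_rate xs (X t))
      \<le> lyapunov ks xs ls zb wb (X a) (dual_integral X a)"
      by (simp add: V_def)
  qed
qed

end

section \<open>Global existence\<close>

context gne_closed_loop
begin

abbreviation chain_poly :: "'n \<Rightarrow> real poly" where
  "chain_poly l \<equiv> Poly (map (c l) [0..<r l])"

lemma chain_poly_coeff: "coeff (chain_poly l) j = (if j < r l then c l j else 0)"
  by (simp add: coeff_Poly_eq nth_default_def)

lemma chain_poly_degree: "degree (chain_poly l) = r l - 1"
proof (rule antisym)
  show "degree (chain_poly l) \<le> r l - 1" by (rule degree_le) (auto simp: chain_poly_coeff simp del: coeff_Poly_eq)
  show "r l - 1 \<le> degree (chain_poly l)"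
    using order[of l] coeffs(2)[of l] by (intro le_degree) (auto simp: chain_poly_coeff simp del: coeff_Poly_eq)
qed

lemma chain_poly_nonzero: "chain_poly l \<noteq> 0"
proof
  assume "chain_poly l = 0"
  then have "coeff (chain_poly l) 0 = 0" by simp
  then show False using coeffs(1)[of l] order[of l] by (simp add: chain_poly_coeff del: coeff_Poly_eq)
qed

lemma chain_poly_zeta: "(\<Sum>j\<le>degree (chain_poly l). coeff (chain_poly l) j * s (Deriv l j)) = zeta r c s l"
proof -
  have "{..r l - 1} = {..<r l}" using order[of l] by auto
  then show ?thesis unfolding chain_poly_degree zeta_sum by (simp add: chain_poly_coeff del: coeff_Poly_eq)
qed

lemma sol_chain_deriv:
  assumes "sol T X" "j < degree (chain_poly l)" "t \<in> {0..T}"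
  shows "((\<lambda>t. X t (Deriv l j)) has_real_derivative X t (Deriv l (Suc j))) (at t within {0..T})"
proof -
  have j: "Suc j < r l" using assms(2) by (simp add: chain_poly_degree)
  have "((\<lambda>t. X t (Deriv l j)) has_real_derivative CL (X t) (Deriv l j)) (at t within {0..T})"
    by (rule sol_deriv[OF assms(1) _ _ assms(3)]) (use j in \<open>auto simp: in_C\<close>)
  then show ?thesis using j by simp
qed

text \<open>Estimates, gains, multipliers and \<open>z\<close> are bounded by the coercivity of the
  Lyapunov function; the integrator chains are then bounded as stable filters of \<zeta>. The bound
  precedes the horizon.\<close>

lemma sol_apriori:
  obtains B where "B \<ge> 0" "\<And>T X t. sol T X \<Longrightarrow> 0 \<le> t \<Longrightarrow> t \<le> T \<Longrightarrow> in_box C B (X t)"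
proof -
  obtain xs ls where "KKT own UNIV J g xs ls" by (rule KKT_exists)
  then obtain zb where ed: "equilibrium_data xs ls zb" by (rule KKT_imp_equilibrium_data)
  have "(\<Sum>i\<in>UNIV. zb i) = 0" using ed by (simp add: equilibrium_data_def)
  then obtain wb where wb: "\<And>i. laplacian E wb i = zb i"
    using laplacian_surj[OF undirected connected] by metis
  obtain ks where ks: "\<And>T X a b xs ls zb wb. sol T X \<Longrightarrow> equilibrium_data xs ls zb \<Longrightarrow> (\<And>i. laplacian E wb i = zb i) \<Longrightarrow>
    0 \<le> a \<Longrightarrow> a \<le> b \<Longrightarrow> b \<le> T \<Longrightarrow>
    lyapunov ks xs ls zb wb (X b) (dual_integral X b) + integral {a..b} (\<lambda>t. dissipation_rate xs (X t))
      \<le> lyapunov ks xs ls zb wb (X a) (dual_integral X a)"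
    using lyapunov_decrease by metis
  \<comment> \<open>The initial value for every solution: it depends on \<open>s\<^sub>0\<close>
    only, and the integral of the multipliers starts at 0.\<close>
  define V where "V = lyapunov ks xs ls zb wb s\<^sub>0 (\<lambda>_. 0)"
  have red: "norm (est (X t) i - xs) \<le> sqrt (2 * V)" "\<bar>X t (Gain i) - ks\<bar> \<le> sqrt (2 * \<gamma> i * V)"
    "norm (dual_var (X t) i - ls) \<le> sqrt (2 * V)" "norm (aux_var (X t) i - zb i) \<le> real CARD('i) * sqrt (2 * (2 * V))"
    if X: "sol T X" and t: "0 \<le> t" "t \<le> T" for T X t i
  proof -
    have X0: "\<And>q. q \<in> C \<Longrightarrow> X 0 q = s\<^sub>0 q" using X by (simp add: sol_def)
    obtain b where b: "b \<ge> 0" "\<And>t. t \<in> {0..T} \<Longrightarrow> in_box C b (X t)" by (rule sol_bounded[OF X]) blast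
    have ib: "in_box C b (X 0)" using b(2)[of 0] t by simp
    have "est (X 0) i = est s\<^sub>0 i" "dual_var (X 0) i = dual_var s\<^sub>0 i" "aux_var (X 0) i = aux_var s\<^sub>0 i" for i
      using box_lipschitz_cong[OF est_lip[OF b(1)] ib X0] box_lipschitz_cong[OF dual_lip ib X0]
        box_lipschitz_cong[OF aux_lip ib X0] by auto
    moreover have "dual_integral X 0 = (\<lambda>_. 0)" by (auto simp: dual_integral_def vec_eq_iff)
    ultimately have V0: "lyapunov ks xs ls zb wb (X 0) (dual_integral X 0) = V"
      by (simp add: V_def lyapunov_def X0 in_C)
    have "integral {0..t} (\<lambda>t. dissipation_rate xs (X t)) \<ge> 0"
      using dissipation_rate_nonneg(4) by (intro integral_nonneg integrable_continuous_interval
        continuous_on_subset[OF sol_path_continuous[OF X dissipation_rate_lip]]) (use t in auto)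
    then have "lyapunov ks xs ls zb wb (X t) (dual_integral X t) \<le> V"
      using ks[OF X ed wb, of 0 t] t V0 by simp
    note co = lyapunov_coercive[OF wb aux_eq_laplacian[OF X] this]
    show "norm (est (X t) i - xs) \<le> sqrt (2 * V)" "\<bar>X t (Gain i) - ks\<bar> \<le> sqrt (2 * \<gamma> i * V)"
      "norm (dual_var (X t) i - ls) \<le> sqrt (2 * V)" "norm (aux_var (X t) i - zb i) \<le> real CARD('i) * sqrt (2 * (2 * V))"
      using co t by auto
  qed
  define b1 where "b1 = norm xs + sqrt (2 * V)"
  define b2 where "b2 i = \<bar>ks\<bar> + sqrt (2 * \<gamma> i * V)" for i
  define b3 where "b3 = norm ls + sqrt (2 * V)"
  define b4 where "b4 i = norm (zb i) + real CARD('i) * sqrt (2 * (2 * V))" for i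
  \<comment> \<open>The filter estimate takes one constant for both the initial chain and the input
    \<zeta>, so the two bounds are added.\<close>
  define I where "I l = \<bar>b1\<bar> + (\<Sum>j<r l. \<bar>s\<^sub>0 (Deriv l j)\<bar>)" for l
  have estb: "\<bar>est (X t) i $ l\<bar> \<le> b1" if "sol T X" "0 \<le> t" "t \<le> T" for T X t i l
    using red(1)[OF that, of i] component_le_norm_cart[of "est (X t) i" l] norm_triangle_sub[of "est (X t) i" xs]
    by (simp add: b1_def)
  have "\<forall>l. \<exists>B'. \<forall>T x. (\<forall>j<degree (chain_poly l). \<forall>t\<in>{0..T}. (x j has_real_derivative x (Suc j) t) (at t within {0..T})) \<longrightarrow>
     (\<forall>j\<le>degree (chain_poly l). \<bar>x j 0\<bar> \<le> I l) \<longrightarrow>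
     (\<forall>t\<in>{0..T}. \<bar>\<Sum>j\<le>degree (chain_poly l). coeff (chain_poly l) j * x j t\<bar> \<le> I l) \<longrightarrow>
     (\<forall>j\<le>degree (chain_poly l). \<forall>t\<in>{0..T}. \<bar>x j t\<bar> \<le> B')"
    using hurwitz_chain_bounded[OF coeffs(3) chain_poly_nonzero] by blast
  from choice[OF this] obtain b5 where b5: "\<forall>l T x. (\<forall>j<degree (chain_poly l). \<forall>t\<in>{0..T}. (x j has_real_derivative x (Suc j) t) (at t within {0..T})) \<longrightarrow>
     (\<forall>j\<le>degree (chain_poly l). \<bar>x j 0\<bar> \<le> I l) \<longrightarrow>
     (\<forall>t\<in>{0..T}. \<bar>\<Sum>j\<le>degree (chain_poly l). coeff (chain_poly l) j * x j t\<bar> \<le> I l) \<longrightarrow>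
     (\<forall>j\<le>degree (chain_poly l). \<forall>t\<in>{0..T}. \<bar>x j t\<bar> \<le> b5 l)" ..
  have chain: "\<bar>X t (Deriv l j)\<bar> \<le> b5 l" if X: "sol T X" and t: "0 \<le> t" "t \<le> T" and j: "j < r l" for T X t l j
  proof -
    have "\<forall>j<degree (chain_poly l). \<forall>t\<in>{0..T}. ((\<lambda>t. X t (Deriv l j)) has_real_derivative X t (Deriv l (Suc j))) (at t within {0..T})"
      using sol_chain_deriv[OF X] by blast
    moreover have "\<forall>j\<le>degree (chain_poly l). \<bar>X 0 (Deriv l j)\<bar> \<le> I l"
    proof (intro allI impI)
      fix j assume "j \<le> degree (chain_poly l)"
      then have j: "j < r l" using order[of l] by (simp add: chain_poly_degree)
      then have "X 0 (Deriv l j) = s\<^sub>0 (Deriv l j)" using X in_C by (simp add: sol_def)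
      moreover have "\<bar>s\<^sub>0 (Deriv l j)\<bar> \<le> (\<Sum>j<r l. \<bar>s\<^sub>0 (Deriv l j)\<bar>)" using j by (intro member_le_sum) auto
      ultimately show "\<bar>X 0 (Deriv l j)\<bar> \<le> I l" by (simp add: I_def)
    qed
    moreover have "\<forall>t\<in>{0..T}. \<bar>\<Sum>j\<le>degree (chain_poly l). coeff (chain_poly l) j * X t (Deriv l j)\<bar> \<le> I l"
    proof
      fix u assume u: "u \<in> {0..T}"
      have "zeta r c (X u) l = est (X u) (own l) $ l" by (simp add: estimate_def)
      then have "\<bar>zeta r c (X u) l\<bar> \<le> b1" using estb[OF X, of u "own l" l] u by simp
      moreover have "0 \<le> (\<Sum>j<r l. \<bar>s\<^sub>0 (Deriv l j)\<bar>)" by (intro sum_nonneg) auto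
      ultimately show "\<bar>\<Sum>j\<le>degree (chain_poly l). coeff (chain_poly l) j * X u (Deriv l j)\<bar> \<le> I l"
        unfolding chain_poly_zeta I_def by linarith
    qed
    ultimately have "\<forall>j\<le>degree (chain_poly l). \<forall>t\<in>{0..T}. \<bar>X t (Deriv l j)\<bar> \<le> b5 l"
      using b5[rule_format, of l T "\<lambda>j t. X t (Deriv l j)"] by blast
    moreover have "j \<le> degree (chain_poly l)" using j by (simp add: chain_poly_degree)
    ultimately show ?thesis using t by simp
  qed
  define B where "B = \<bar>b1\<bar> + (\<Sum>i\<in>UNIV. \<bar>b2 i\<bar>) + \<bar>b3\<bar> + (\<Sum>i\<in>UNIV. \<bar>b4 i\<bar>) + (\<Sum>l\<in>UNIV. \<bar>b5 l\<bar>)"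
  have nn: "0 \<le> (\<Sum>i\<in>UNIV. \<bar>b2 i\<bar>)" "0 \<le> (\<Sum>i\<in>UNIV. \<bar>b4 i\<bar>)" "0 \<le> (\<Sum>l\<in>UNIV. \<bar>b5 l\<bar>)"
    by (auto intro: sum_nonneg)
  have le: "\<bar>b2 i\<bar> \<le> (\<Sum>i\<in>UNIV. \<bar>b2 i\<bar>)" "\<bar>b4 i\<bar> \<le> (\<Sum>i\<in>UNIV. \<bar>b4 i\<bar>)" "\<bar>b5 l\<bar> \<le> (\<Sum>l\<in>UNIV. \<bar>b5 l\<bar>)" for i l
    by (auto intro!: member_le_sum[where f = "\<lambda>x. \<bar>_ x\<bar>"])
  show thesis
  proof (rule that[of B])
    show "B \<ge> 0" using nn by (simp add: B_def)
    fix T X t assume X: "sol T X" and t: "0 \<le> t" "t \<le> T"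
    show "in_box C B (X t)" unfolding in_box_def
    proof
      fix q assume q: "q \<in> C"
      show "\<bar>X t q\<bar> \<le> B"
      proof (cases q)
        case (Deriv l j)
        then have "\<bar>X t q\<bar> \<le> b5 l" using chain[OF X t] q by (simp add: in_C)
        then show ?thesis using le(3)[of l] nn unfolding B_def by linarith
      next
        case (Est i l)
        then have "X t q = est (X t) i $ l" using q by (simp add: in_C estimate_def)
        then have "\<bar>X t q\<bar> \<le> b1" using estb[OF X t, of i l] by simp
        then show ?thesis using nn unfolding B_def by linarith
      next
        case (Gain i)
        then have "\<bar>X t q\<bar> \<le> b2 i" using red(2)[OF X t, of i] by (simp add: b2_def)
        then show ?thesis using le(1)[of i] nn unfolding B_def by linarith
      next
        case (Aux i a)
        then have "X t q = aux_var (X t) i $ a" by (simp add: aux_var_def)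
        then have "\<bar>X t q\<bar> \<le> b4 i"
          using red(4)[OF X t, of i] component_le_norm_cart[of "aux_var (X t) i" a] norm_triangle_sub[of "aux_var (X t) i" "zb i"]
          by (simp add: b4_def)
        then show ?thesis using le(2)[of i] nn unfolding B_def by linarith
      next
        case (Dual i a)
        then have "X t q = dual_var (X t) i $ a" by (simp add: dual_var_def)
        then have "\<bar>X t q\<bar> \<le> b3"
          using red(3)[OF X t, of i] component_le_norm_cart[of "dual_var (X t) i" a] norm_triangle_sub[of "dual_var (X t) i" ls]
          by (simp add: b3_def)
        then show ?thesis using nn unfolding B_def by linarith
      qed
    qed
  qed
qed

section \<open>Truncation and global solutions\<close>

definition clamp_state :: "real \<Rightarrow> ('i, 'n, 'm) state \<Rightarrow> ('i, 'n, 'm) state" where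
  "clamp_state R s q = max (- R) (min R (s q))"

lemma clamp_state_box: "R \<ge> 0 \<Longrightarrow> in_box C R (clamp_state R s)"
  by (auto simp: in_box_def clamp_state_def)

lemma clamp_state_id: "in_box C R s \<Longrightarrow> q \<in> C \<Longrightarrow> clamp_state R s q = s q"
  by (force simp: in_box_def clamp_state_def)

lemma clamp_state_lip: "\<bar>clamp_state R s q - clamp_state R s' q\<bar> \<le> \<bar>s q - s' q\<bar>"
  by (auto simp: clamp_state_def max_def min_def)

text \<open>The solution of the truncated system never reaches the truncation radius.\<close>

lemma global_sol_exists: obtains X where "\<And>T. 0 \<le> T \<Longrightarrow> sol T X"
proof -
  obtain B where B: "B \<ge> 0" "\<And>T X t. sol T X \<Longrightarrow> 0 \<le> t \<Longrightarrow> t \<le> T \<Longrightarrow> in_box C B (X t)"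
    by (rule sol_apriori) blast
  define R where "R = B + 1"
  have R: "R \<ge> 0" "B < R" using B(1) by (auto simp: R_def)
  have "\<forall>q\<in>C. \<exists>L. L \<ge> 0 \<and> (\<forall>s s'. in_box C R s \<longrightarrow> in_box C R s' \<longrightarrow>
      \<bar>drift s q - drift s' q\<bar> \<le> L * (\<Sum>q\<in>C. \<bar>s q - s' q\<bar>))"
    using drift_lip[OF R(1)] unfolding box_lipschitz_def real_norm_def by blast
  from bchoice[OF this] obtain L where L: "\<forall>q\<in>C. L q \<ge> 0 \<and> (\<forall>s s'. in_box C R s \<longrightarrow> in_box C R s' \<longrightarrow>
      \<bar>drift s q - drift s' q\<bar> \<le> L q * (\<Sum>q\<in>C. \<bar>s q - s' q\<bar>))" ..
  define M where "M = (\<Sum>q\<in>C. L q)"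
  have M0: "M \<ge> 0" unfolding M_def using L by (intro sum_nonneg) auto
  \<comment> \<open>Clamping is 1-Lipschitz in each coordinate and lands in the box, so the clamped
    drift is globally Lipschitz and the reflected Picard scheme applies.\<close>
  define f where "f s q = drift (clamp_state R s) q" for s q
  have lip: "\<bar>f s q - f s' q\<bar> \<le> M * (\<Sum>p\<in>C. \<bar>s p - s' p\<bar>)" if q: "q \<in> C" for s s' q
  proof -
    have "\<bar>f s q - f s' q\<bar> \<le> L q * (\<Sum>p\<in>C. \<bar>clamp_state R s p - clamp_state R s' p\<bar>)"
      unfolding f_def using L q clamp_state_box[OF R(1)] by blast
    also have "\<dots> \<le> M * (\<Sum>p\<in>C. \<bar>s p - s' p\<bar>)"
    proof (rule mult_mono)
      show "L q \<le> M" unfolding M_def using L finite_C q by (intro member_le_sum) auto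
      show "(\<Sum>p\<in>C. \<bar>clamp_state R s p - clamp_state R s' p\<bar>) \<le> (\<Sum>p\<in>C. \<bar>s p - s' p\<bar>)"
        by (rule sum_mono) (rule clamp_state_lip)
    qed (use M0 in \<open>auto intro: sum_nonneg\<close>)
    finally show ?thesis .
  qed
  define D :: "('i, 'n, 'm) coord set" where "D = {Dual i a |i a. True}"
  have s0D: "s\<^sub>0 q \<ge> 0" if "q \<in> D" for q
    using that init_lambda by (auto simp: D_def less_eq_vec_def dual_var_def)
  show thesis
  proof (rule reflected_ode_exists[where C = C and D = D and f = f and K = M and s\<^sub>0 = s\<^sub>0])
    show "finite C" by (rule finite_C)
    show "0 \<le> M" by (rule M0)
    show "\<bar>f s q - f s' q\<bar> \<le> M * (\<Sum>p\<in>C. \<bar>s p - s' p\<bar>)" if "q \<in> C" for s s' q by (rule lip[OF that])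
    show "0 \<le> s\<^sub>0 q" if "q \<in> D" for q by (rule s0D[OF that])
    fix X assume X: "\<And>q. q \<in> C \<Longrightarrow> X 0 q = s\<^sub>0 q"
      "\<And>q T. q \<in> C \<Longrightarrow> abs_continuous_on {0..T} (\<lambda>t. X t q)"
      "\<And>q t. q \<in> C \<Longrightarrow> q \<in> D \<Longrightarrow> t \<ge> 0 \<Longrightarrow> X t q \<ge> 0"
      "AE t in lebesgue. 0 \<le> t \<longrightarrow> (\<forall>q\<in>C. ((\<lambda>\<tau>. X \<tau> q) has_real_derivative
         (if q \<in> D \<and> X t q \<le> 0 then max 0 (f (X t) q) else f (X t) q)) (at t))"
    have dual0: "0 \<le> dual_var (X t) i" if "t \<ge> 0" for t i
      using X(3)[OF in_C(5) _ that] by (auto simp: less_eq_vec_def dual_var_def D_def)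
    have rhs: "(if q \<in> D \<and> X t q \<le> 0 then max 0 (f (X t) q) else f (X t) q) = CL (X t) q"
      if q: "q \<in> C" and t: "t \<ge> 0" and box: "in_box C R (X t)" for q t
    proof -
      have "f (X t) q = drift (X t) q"
        unfolding f_def
        by (rule box_lipschitz_cong[OF drift_lip[OF R(1) q] clamp_state_box[OF R(1)]]) (rule clamp_state_id[OF box])
      then show ?thesis
        using CL_dual[OF dual0[OF t]] CL_eq_drift[of q "X t"] by (cases "q \<in> D") (auto simp: D_def simp del: closed_loop.simps)
    qed
    \<comment> \<open>The box is required before \<open>T\<close> only, as the single time
      \<open>T\<close> is negligible. This permits an application at the first time the radius is
      reached.\<close>
    have solI: "sol T X" if T: "0 \<le> T" and box: "\<And>t. 0 \<le> t \<Longrightarrow> t < T \<Longrightarrow> in_box C R (X t)" for T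
    proof -
      have "AE t in lebesgue. t \<noteq> T" by (rule AE_completion[OF AE_lborel_singleton])
      then have "AE t in lebesgue. 0 \<le> t \<and> t \<le> T \<longrightarrow> (\<forall>q\<in>C. ((\<lambda>\<tau>. X \<tau> q) has_real_derivative CL (X t) q) (at t))"
        using X(4)
      proof eventually_elim
        case (elim t)
        show ?case
        proof (intro impI ballI)
          fix q assume t: "0 \<le> t \<and> t \<le> T" and q: "q \<in> C"
          then have bx: "in_box C R (X t)" using box[of t] elim(1) by auto
          have "((\<lambda>\<tau>. X \<tau> q) has_real_derivative
             (if q \<in> D \<and> X t q \<le> 0 then max 0 (f (X t) q) else f (X t) q)) (at t)"
            using elim(2) t q by blast
          then show "((\<lambda>\<tau>. X \<tau> q) has_real_derivative CL (X t) q) (at t)"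
            using t by (simp only: rhs[OF q _ bx])
        qed
      qed
      then show ?thesis using X(1,2) by (simp add: sol_def)
    qed
    \<comment> \<open>Up to the first time at which some coordinate reaches \<open>R\<close> the
      path solves the original loop, so it obeys the a priori bound \<open>B\<close>, which is
      strictly below \<open>R\<close>.\<close>
    have box: "in_box C R (X t)" if t: "0 \<le> t" for t
    proof (rule ccontr)
      assume "\<not> in_box C R (X t)"
      then obtain q where q: "q \<in> C" "\<bar>X t q\<bar> > R" by (auto simp: in_box_def not_le)
      define Z where "Z = (\<Union>q\<in>C. {u \<in> {0..t}. R \<le> \<bar>X u q\<bar>})"
      have "closed {u \<in> {0..t}. R \<le> \<bar>X u q\<bar>}" if "q \<in> C" for q
        using abs_continuous_on_imp_continuous[OF X(2)[OF that, of t]]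
        by (intro continuous_on_closed_Collect_le continuous_intros) auto
      then have "closed Z" unfolding Z_def using finite_C by (intro closed_UN) auto
      moreover have "bounded Z" unfolding Z_def by (rule bounded_subset[of "{0..t}"]) auto
      ultimately have "compact Z" by (simp add: compact_eq_bounded_closed)
      moreover have "t \<in> Z" unfolding Z_def using q t by (intro UN_I[of q]) auto
      ultimately obtain T where T: "T \<in> Z" "\<And>u. u \<in> Z \<Longrightarrow> T \<le> u" using compact_attains_inf[of Z] by blast
      have Tt: "0 \<le> T" "T \<le> t" using T(1) by (auto simp: Z_def)
      have "sol T X"
      proof (rule solI[OF Tt(1)])
        fix u assume u: "0 \<le> u" "u < T"
        then have "u \<notin> Z" using T(2)[of u] by auto
        then show "in_box C R (X u)" using u Tt by (force simp: Z_def in_box_def not_le)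
      qed
      then have "in_box C B (X T)" using B(2) Tt by blast
      moreover obtain p where "p \<in> C" "R \<le> \<bar>X T p\<bar>" using T(1) by (auto simp: Z_def)
      ultimately show False using R(2) by (auto simp: in_box_def)
    qed
    show thesis by (rule that[of X]) (rule solI, auto intro: box)
  qed
qed

lemma caratheodory_imp_sol: "caratheodory_solution C CL s\<^sub>0 X \<Longrightarrow> 0 \<le> T \<Longrightarrow> sol T X"
  unfolding caratheodory_solution_def sol_def by (auto elim!: eventually_mono)

lemma sol_imp_caratheodory:
  assumes X: "\<And>T. 0 \<le> T \<Longrightarrow> sol T X"
  shows "caratheodory_solution C CL s\<^sub>0 X"
  unfolding caratheodory_solution_def
proof (intro conjI ballI allI impI)
  show "X 0 q = s\<^sub>0 q" if "q \<in> C" for q using X[of 0] that by (simp add: sol_def)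
  show "abs_continuous_on {0..T} (\<lambda>t. X t q)" if "q \<in> C" "0 \<le> T" for q T using X[of T] that by (simp add: sol_def)
  \<comment> \<open>Each horizon has its own exceptional null set; integer horizons suffice and form
    a countable family.\<close>
  have "AE t in lebesgue. \<forall>k::nat. 0 \<le> t \<and> t \<le> real k \<longrightarrow> (\<forall>q\<in>C. ((\<lambda>\<tau>. X \<tau> q) has_real_derivative CL (X t) q) (at t))"
    unfolding AE_all_countable using X by (simp add: sol_def del: closed_loop.simps)
  then show "AE t in lebesgue. 0 \<le> t \<longrightarrow> (\<forall>q\<in>C. ((\<lambda>\<tau>. X \<tau> q) has_real_derivative CL (X t) q) (at t))"
  proof eventually_elim
    case (elim t)
    then show ?case using real_arch_simple[of t] by blast
  qed
qed

end

section \<open>Asymptotic behaviour\<close>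

lemma mono_bounded_tendsto:
  fixes f :: "real \<Rightarrow> real"
  assumes mono: "\<And>s t. 0 \<le> s \<Longrightarrow> s \<le> t \<Longrightarrow> f s \<le> f t" and bdd: "\<And>t. 0 \<le> t \<Longrightarrow> f t \<le> M"
  obtains l where "(f \<longlongrightarrow> l) at_top"
proof
  define l where "l = Sup (f ` {0..})"
  have b: "bdd_above (f ` {0..})" using bdd by (intro bdd_aboveI[of _ M]) auto
  show "(f \<longlongrightarrow> l) at_top"
  proof (rule tendstoI)
    fix e :: real assume e: "e > 0"
    then have "l - e < Sup (f ` {0..})" by (simp add: l_def)
    then obtain t0 where t0: "t0 \<ge> 0" "l - e < f t0" using less_cSup_iff[OF _ b] by auto
    have "dist (f t) l < e" if "t \<ge> t0" for t
    proof -
      have "f t \<le> l" unfolding l_def using that t0 by (intro cSUP_upper b) auto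
      moreover have "f t0 \<le> f t" using mono[OF t0(1) that] .
      ultimately show ?thesis using t0(2) e by (simp add: dist_real_def)
    qed
    then show "\<forall>\<^sub>F t in at_top. dist (f t) l < e" by (auto simp: eventually_at_top_linorder)
  qed
qed

text \<open>Variation over windows of any fixed length vanishes at infinity. This is weaker than
  convergence and holds for \<open>z\<close> before its convergence is known.\<close>

definition slow :: "(real \<Rightarrow> real) \<Rightarrow> bool" where
  "slow f \<longleftrightarrow> (\<forall>T e. e > 0 \<longrightarrow> (\<exists>t0. \<forall>s t. s \<ge> t0 \<longrightarrow> t \<ge> t0 \<longrightarrow> \<bar>s - t\<bar> \<le> T \<longrightarrow> \<bar>f s - f t\<bar> \<le> e))"

lemma slow_tendsto:
  assumes "(f \<longlongrightarrow> l) at_top" shows "slow f"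
  unfolding slow_def
proof (intro allI impI)
  fix T e :: real assume "e > 0"
  then have "\<forall>\<^sub>F t in at_top. dist (f t) l < e / 2" using assms by (intro tendstoD) auto
  then obtain t0 where t0: "\<And>t. t \<ge> t0 \<Longrightarrow> \<bar>f t - l\<bar> < e / 2"
    unfolding eventually_at_top_linorder dist_real_def by blast
  have "\<bar>f s - f t\<bar> \<le> e" if "s \<ge> t0" "t \<ge> t0" for s t using t0[OF that(1)] t0[OF that(2)] by linarith
  then show "\<exists>t0. \<forall>s t. s \<ge> t0 \<longrightarrow> t \<ge> t0 \<longrightarrow> \<bar>s - t\<bar> \<le> T \<longrightarrow> \<bar>f s - f t\<bar> \<le> e" by blast
qed

lemma slow_diff:
  assumes "slow f" "slow h" shows "slow (\<lambda>t. f t - h t)"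
  unfolding slow_def
proof (intro allI impI)
  fix T e :: real assume "e > 0"
  then have "e / 2 > 0" by simp
  then obtain a where a: "\<And>s t. s \<ge> a \<Longrightarrow> t \<ge> a \<Longrightarrow> \<bar>s - t\<bar> \<le> T \<Longrightarrow> \<bar>f s - f t\<bar> \<le> e / 2"
    using assms(1) unfolding slow_def by meson
  obtain b where b: "\<And>s t. s \<ge> b \<Longrightarrow> t \<ge> b \<Longrightarrow> \<bar>s - t\<bar> \<le> T \<Longrightarrow> \<bar>h s - h t\<bar> \<le> e / 2"
    using assms(2) \<open>e / 2 > 0\<close> unfolding slow_def by meson
  have "\<bar>(f s - h s) - (f t - h t)\<bar> \<le> e" if "s \<ge> max a b" "t \<ge> max a b" "\<bar>s - t\<bar> \<le> T" for s t
  proof -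
    have "\<bar>f s - f t\<bar> \<le> e / 2" "\<bar>h s - h t\<bar> \<le> e / 2" using a[of s t] b[of s t] that by auto
    then show ?thesis by linarith
  qed
  then show "\<exists>t0. \<forall>s t. s \<ge> t0 \<longrightarrow> t \<ge> t0 \<longrightarrow> \<bar>s - t\<bar> \<le> T \<longrightarrow> \<bar>(f s - h s) - (f t - h t)\<bar> \<le> e" by blast
qed

lemma slow_deriv:
  assumes d: "\<And>t. t \<ge> 0 \<Longrightarrow> (f has_real_derivative f' t) (at t within {0..})" and f': "(f' \<longlongrightarrow> 0) at_top"
  shows "slow f"
  unfolding slow_def
proof (intro allI impI)
  fix T e :: real assume e: "e > 0"
  define \<epsilon> where "\<epsilon> = e / (\<bar>T\<bar> + 1)"
  have eps: "\<epsilon> > 0" using e by (simp add: \<epsilon>_def add_nonneg_pos)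
  have "\<forall>\<^sub>F t in at_top. dist (f' t) 0 < \<epsilon>" using f' eps by (intro tendstoD)
  then obtain t1 where t1: "\<And>t. t \<ge> t1 \<Longrightarrow> \<bar>f' t\<bar> < \<epsilon>" unfolding eventually_at_top_linorder by auto
  have *: "\<bar>f t - f s\<bar> \<le> e" if s: "s \<ge> max t1 0" "s < t" "t - s \<le> T" for s t
  proof -
    obtain \<xi> where \<xi>: "s < \<xi>" "\<xi> < s + (t - s)" "f (s + (t - s)) - f s = (t - s) * f' \<xi>"
      by (rule mvt_half_line[OF d, of s "t - s"]) (use s in auto)
    have "\<bar>f t - f s\<bar> = (t - s) * \<bar>f' \<xi>\<bar>" using \<xi>(3) s by (simp add: abs_mult)
    also have "\<dots> \<le> (\<bar>T\<bar> + 1) * \<epsilon>" using t1[of \<xi>] \<xi> s by (intro mult_mono) auto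
    also have "\<dots> = e" by (simp add: \<epsilon>_def add_nonneg_pos field_simps)
    finally show ?thesis .
  qed
  have "\<bar>f s - f t\<bar> \<le> e" if "s \<ge> max t1 0" "t \<ge> max t1 0" "\<bar>s - t\<bar> \<le> T" for s t
    using *[of s t] *[of t s] that e by (cases s t rule: linorder_cases) (auto simp: abs_minus_commute)
  then show "\<exists>t0. \<forall>s t. s \<ge> t0 \<longrightarrow> t \<ge> t0 \<longrightarrow> \<bar>s - t\<bar> \<le> T \<longrightarrow> \<bar>f s - f t\<bar> \<le> e" by blast
qed

lemma local_lipschitz_imp_isCont:
  assumes "\<And>R. \<exists>L\<ge>0. \<forall>x y. norm x \<le> R \<longrightarrow> norm y \<le> R \<longrightarrow> norm (h x - h y) \<le> L * norm (x - y)"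
  shows "isCont h (x::'a::real_normed_vector)"
proof -
  obtain L where L: "L \<ge> 0" "\<And>y z. norm y \<le> norm x + 1 \<Longrightarrow> norm z \<le> norm x + 1 \<Longrightarrow> norm (h y - h z) \<le> L * norm (y - z)"
    using assms[of "norm x + 1"] by blast
  have "((\<lambda>y. h y - h x) \<longlongrightarrow> 0) (at x)"
  proof (rule Lim_null_comparison)
    have "\<forall>\<^sub>F y in at x. dist y x < 1" by (rule eventually_at_ball'[THEN eventually_mono]) (auto simp: dist_commute)
    then show "\<forall>\<^sub>F y in at x. norm (h y - h x) \<le> L * norm (y - x)"
    proof eventually_elim
      case (elim y)
      then have "norm y \<le> norm x + 1" using norm_triangle_sub[of y x] by (simp add: dist_norm)
      then show ?case by (intro L(2)) auto
    qed
    have "((\<lambda>y. L * norm (y - x)) \<longlongrightarrow> L * norm (x - x)) (at x)" by (intro tendsto_intros)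
    then show "((\<lambda>y. L * norm (y - x)) \<longlongrightarrow> 0) (at x)" by simp
  qed
  then show ?thesis by (simp add: isCont_def LIM_zero_iff)
qed

section \<open>Consensus of the estimates and limiting rates\<close>

locale gne_solution = gne_closed_loop own J g \<mu> \<theta>\<^sub>0 E \<gamma> r c s\<^sub>0
  for own :: "'n::finite \<Rightarrow> 'i::finite" and J :: "'i \<Rightarrow> real^'n \<Rightarrow> real"
    and g :: "'i \<Rightarrow> real^'n \<Rightarrow> real^'m::finite" and \<mu> \<theta>\<^sub>0 :: real
    and E :: "('i \<times> 'i) set" and \<gamma> :: "'i \<Rightarrow> real" and r :: "'n \<Rightarrow> nat" and c :: "'n \<Rightarrow> nat \<Rightarrow> real"
    and s\<^sub>0 :: "('i, 'n, 'm) state" +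
  fixes X :: "real \<Rightarrow> ('i, 'n, 'm) state" and B :: real
  assumes sol: "\<And>T. 0 \<le> T \<Longrightarrow> sol T X" and B0: "B \<ge> 0" and box: "\<And>t. 0 \<le> t \<Longrightarrow> in_box C B (X t)"
begin

lemma deriv_on_half_line:
  assumes "q \<in> C" "\<And>i a. q \<noteq> Dual i a" "t \<ge> 0"
  shows "((\<lambda>\<tau>. X \<tau> q) has_real_derivative CL (X t) q) (at t within {0..})"
proof -
  have "((\<lambda>\<tau>. X \<tau> q) has_real_derivative CL (X t) q) (at t within {0..t+1})"
    by (rule sol_deriv[OF sol assms(1,2)]) (use assms in auto)
  moreover have "at t within {0..t+1} = at t within {0..}"
    by (rule at_within_nhd[of _ "{..<t+1}"]) (use assms in auto)
  ultimately show ?thesis by simp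
qed

lemma est_deriv_half_line:
  assumes "t \<ge> 0" shows "((\<lambda>\<tau>. est (X \<tau>) i $ l) has_real_derivative ut (X t) i $ l) (at t within {0..})"
proof (cases "own l = i")
  case True
  have "((\<lambda>\<tau>. \<Sum>j<r l. c l j * X \<tau> (Deriv l j)) has_real_derivative (\<Sum>j<r l. c l j * CL (X t) (Deriv l j))) (at t within {0..})"
    by (intro DERIV_sum DERIV_cmult deriv_on_half_line assms) (auto simp: in_C)
  then show ?thesis using True zeta_rate[of l "X t"] by (simp add: estimate_def zeta_sum del: closed_loop.simps)
next
  case False
  have "((\<lambda>\<tau>. X \<tau> (Est i l)) has_real_derivative CL (X t) (Est i l)) (at t within {0..})"
    by (rule deriv_on_half_line) (use False assms in \<open>auto simp: in_C\<close>)
  moreover have "CL (X t) (Est i l) = ut (X t) i $ l"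
    using False by (simp add: ut_eq weighted_laplacian G_other_block A_other_block)
  ultimately show ?thesis using False by (simp add: estimate_def)
qed

lemma AE_deriv: "AE t in lebesgue. 0 \<le> t \<longrightarrow> (\<forall>q\<in>C. ((\<lambda>\<tau>. X \<tau> q) has_real_derivative CL (X t) q) (at t))"
  using sol_imp_caratheodory[OF sol] by (simp add: caratheodory_solution_def del: closed_loop.simps)

lemma dual_nonneg: "t \<ge> 0 \<Longrightarrow> X t (Dual i a) \<ge> 0"
  using sol_dual_nonneg[OF sol] by blast

lemma dual_var_nonneg: "t \<ge> 0 \<Longrightarrow> 0 \<le> dual_var (X t) i"
  using sol_dual_var_nonneg[OF sol] by blast

lemma CL_bound:
  assumes "q \<in> C" obtains M where "\<And>t. t \<ge> 0 \<Longrightarrow> \<bar>CL (X t) q\<bar> \<le> M"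
proof -
  obtain M where M: "M \<ge> 0" "\<And>s. in_box C B s \<Longrightarrow> norm (drift s q) \<le> M"
    using box_lipschitz_bounded[OF drift_lip[OF B0 assms] B0] by blast
  show thesis
  proof (rule that[of M])
    fix t :: real assume t: "t \<ge> 0"
    have d: "\<bar>drift (X t) q\<bar> \<le> M" using M(2)[OF box[OF t]] by simp
    show "\<bar>CL (X t) q\<bar> \<le> M"
    proof (cases "\<exists>i a. q = Dual i a")
      case True
      then obtain i a where q: "q = Dual i a" by blast
      show ?thesis using d M(1) unfolding q CL_dual[OF dual_var_nonneg[OF t]] by auto
    next
      case False then show ?thesis using d CL_eq_drift[of q "X t"] by auto
    qed
  qed
qed

lemma coord_lipschitz:
  assumes q: "q \<in> C" shows "\<exists>K. \<forall>s\<in>{0..}. \<forall>t\<in>{0..}. \<bar>X s q - X t q\<bar> \<le> K * \<bar>s - t\<bar>"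
proof -
  obtain M where M: "\<And>t. t \<ge> 0 \<Longrightarrow> \<bar>CL (X t) q\<bar> \<le> M" by (rule CL_bound[OF q]) blast
  have *: "\<bar>X t q - X s q\<bar> \<le> M * (t - s)" if st: "0 \<le> s" "s \<le> t" for s t
  proof (rule AE_deriv_bounded_imp_lipschitz[OF st(2)])
    have "abs_continuous_on {0..t} (\<lambda>\<tau>. X \<tau> q)" using sol[of t] q st by (simp add: sol_def)
    then show "abs_continuous_on {s..t} (\<lambda>\<tau>. X \<tau> q)" by (rule abs_continuous_on_subset) (use st in auto)
    show "AE u in lebesgue. s \<le> u \<and> u \<le> t \<longrightarrow> (\<exists>D. \<bar>D\<bar> \<le> M \<and> ((\<lambda>\<tau>. X \<tau> q) has_real_derivative D) (at u))"
      using AE_deriv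
    proof eventually_elim
      case (elim u)
      show ?case
      proof
        assume "s \<le> u \<and> u \<le> t"
        then have u: "u \<ge> 0" using st by simp
        then show "\<exists>D. \<bar>D\<bar> \<le> M \<and> ((\<lambda>\<tau>. X \<tau> q) has_real_derivative D) (at u)"
          using elim q M[OF u] by blast
      qed
    qed
  qed
  show ?thesis
  proof (intro exI[of _ M] ballI)
    fix s t :: real assume "s \<in> {0..}" "t \<in> {0..}"
    then show "\<bar>X s q - X t q\<bar> \<le> M * \<bar>s - t\<bar>"
      using *[of s t] *[of t s] by (cases "s \<le> t") (auto simp: abs_minus_commute)
  qed
qed

lemma path_lipschitz:
  assumes "\<And>B. B \<ge> 0 \<Longrightarrow> box_lipschitz C B f"
  shows "\<exists>K. \<forall>s t. s \<ge> 0 \<longrightarrow> t \<ge> 0 \<longrightarrow> norm (f (X s) - f (X t)) \<le> K * \<bar>s - t\<bar>"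
proof -
  obtain K where "\<And>s t. s \<in> {0..} \<Longrightarrow> t \<in> {0..} \<Longrightarrow> norm (f (X s) - f (X t)) \<le> K * \<bar>s - t\<bar>"
    by (rule box_lipschitz_lipschitz_path[OF assms[OF B0], of "{0..}" X]) (use box coord_lipschitz in auto)
  then show ?thesis by (intro exI[of _ K]) auto
qed

lemma path_bounded:
  assumes "\<And>B. B \<ge> 0 \<Longrightarrow> box_lipschitz C B f"
  shows "\<exists>M. \<forall>t\<ge>0. norm (f (X t)) \<le> M"
proof -
  obtain M where "M \<ge> 0" "\<And>s. in_box C B s \<Longrightarrow> norm (f s) \<le> M"
    using box_lipschitz_bounded[OF assms[OF B0] B0] by blast
  then show ?thesis using box by blast
qed

text \<open>The integral of the dissipation rate is bounded by the initial Lyapunov value.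
  Coordinates of a bounded solution are Lipschitz in time, multipliers included, so the rate is too,
  as Barbalat's lemma requires.\<close>

lemma dissipation_tendsto_zero:
  assumes ed: "equilibrium_data xs ls zb"
  shows "((\<lambda>t. dissipation_rate xs (X t)) \<longlongrightarrow> 0) at_top"
proof -
  have "(\<Sum>i\<in>UNIV. zb i) = 0" using ed by (simp add: equilibrium_data_def)
  then obtain wb where wb: "\<And>i. laplacian E wb i = zb i"
    using laplacian_surj[OF undirected connected] by metis
  obtain ks where ks: "\<And>T X a b xs ls zb wb. sol T X \<Longrightarrow> equilibrium_data xs ls zb \<Longrightarrow> (\<And>i. laplacian E wb i = zb i) \<Longrightarrow>
    0 \<le> a \<Longrightarrow> a \<le> b \<Longrightarrow> b \<le> T \<Longrightarrow>
    lyapunov ks xs ls zb wb (X b) (dual_integral X b) + integral {a..b} (\<lambda>t. dissipation_rate xs (X t))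
      \<le> lyapunov ks xs ls zb wb (X a) (dual_integral X a)"
    using lyapunov_decrease by metis
  define V where "V t = lyapunov ks xs ls zb wb (X t) (dual_integral X t)" for t
  define h where "h t = dissipation_rate xs (X t)" for t
  define H where "H t = integral {0..t} h" for t
  have V0: "V t \<ge> 0" if "t \<ge> 0" for t
    using lyapunov_parts[OF wb aux_eq_laplacian[OF sol[OF that]], of t] that
    unfolding V_def lyapunov_def by fastforce
  have hc: "continuous_on {0..T} h" if "T \<ge> 0" for T
    unfolding h_def by (rule sol_path_continuous[OF sol[OF that] dissipation_rate_lip])
  have hn: "h t \<ge> 0" for t unfolding h_def by (rule dissipation_rate_nonneg(4))
  have Hd: "(H has_real_derivative h t) (at t within {0..})" if t: "t \<ge> 0" for t
  proof -
    have "(H has_real_derivative h t) (at t within {0..t+1})"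
      unfolding H_def[abs_def] by (rule integral_has_real_derivative[OF hc]) (use t in auto)
    moreover have "at t within {0..t+1} = at t within {0..}"
      by (rule at_within_nhd[of _ "{..<t+1}"]) (use t in auto)
    ultimately show ?thesis by simp
  qed
  have "H t \<le> V 0" if "t \<ge> 0" for t
    using ks[OF sol[OF that] ed wb, of 0 t] that V0[OF that] unfolding H_def h_def V_def by simp
  moreover have "H s \<le> H t" if "0 \<le> s" "s \<le> t" for s t
    unfolding H_def
    by (rule integral_subset_le) (use that hn hc[of s] hc[of t] in \<open>auto intro: integrable_continuous_interval\<close>)
  ultimately obtain l where l: "(H \<longlongrightarrow> l) at_top" using mono_bounded_tendsto[of H "V 0"] by blast
  obtain K where K: "\<forall>s t. s \<ge> 0 \<longrightarrow> t \<ge> 0 \<longrightarrow> norm (h s - h t) \<le> K * \<bar>s - t\<bar>"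
    using path_lipschitz[OF dissipation_rate_lip, of xs] unfolding h_def by blast
  have "(h \<longlongrightarrow> 0) at_top" by (rule barbalat[OF Hd l]) (use K in auto)
  then show ?thesis unfolding h_def[abs_def] .
qed

lemma tendsto_zero_squeeze:
  fixes f :: "real \<Rightarrow> real"
  assumes "(h \<longlongrightarrow> 0) at_top" "\<And>t. 0 \<le> f t" "\<And>t. f t \<le> h t"
  shows "(f \<longlongrightarrow> 0) at_top"
  by (rule tendsto_sandwich[OF _ _ tendsto_const assms(1)]) (use assms(2,3) in auto)

lemma consensus:
  assumes ed: "equilibrium_data xs ls zb"
  shows "((\<lambda>t. own_profile (est (X t))) \<longlongrightarrow> xs) at_top"
    and "((\<lambda>t. laplacian E (est (X t)) i) \<longlongrightarrow> 0) at_top"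
    and "((\<lambda>t. laplacian E (dual_var (X t)) i) \<longlongrightarrow> 0) at_top"
    and "((\<lambda>t. est (X t) i) \<longlongrightarrow> xs) at_top"
proof -
  note D = dissipation_tendsto_zero[OF ed]
  have "((\<lambda>t. \<mu> / 2 * (norm (own_profile (est (X t)) - xs))\<^sup>2) \<longlongrightarrow> 0) at_top"
    by (rule tendsto_zero_squeeze[OF D])
       (use dissipation_rate_nonneg in \<open>auto simp: dissipation_rate_def add_increasing2\<close>)
  then have "((\<lambda>t. sqrt (2 / \<mu> * (\<mu> / 2 * (norm (own_profile (est (X t)) - xs))\<^sup>2))) \<longlongrightarrow> sqrt (2 / \<mu> * 0)) at_top"
    by (intro tendsto_intros)
  then have "((\<lambda>t. norm (own_profile (est (X t)) - xs)) \<longlongrightarrow> 0) at_top" using F_monotone(1) by simp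
  then show own: "((\<lambda>t. own_profile (est (X t))) \<longlongrightarrow> xs) at_top"
    by (simp add: tendsto_norm_zero_iff LIM_zero_iff)
  have R: "((\<lambda>t. \<Sum>i\<in>UNIV. (norm (laplacian E (est (X t)) i))\<^sup>2) \<longlongrightarrow> 0) at_top"
  proof (rule tendsto_zero_squeeze[OF D])
    fix t
    show "0 \<le> (\<Sum>i\<in>UNIV. (norm (laplacian E (est (X t)) i))\<^sup>2)" by (rule dissipation_rate_nonneg)
    show "(\<Sum>i\<in>UNIV. (norm (laplacian E (est (X t)) i))\<^sup>2) \<le> dissipation_rate xs (X t)"
      using dissipation_rate_nonneg(1,3)[where s = "X t"] by (simp add: dissipation_rate_def)
  qed
  show lap: "((\<lambda>t. laplacian E (est (X t)) i) \<longlongrightarrow> 0) at_top" for i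
  proof -
    have "((\<lambda>t. (norm (laplacian E (est (X t)) i))\<^sup>2) \<longlongrightarrow> 0) at_top"
      by (rule tendsto_zero_squeeze[OF R]) (auto intro!: member_le_sum[where f = "\<lambda>i. (norm (laplacian E (est (X _)) i))\<^sup>2"])
    then have "((\<lambda>t. sqrt ((norm (laplacian E (est (X t)) i))\<^sup>2)) \<longlongrightarrow> sqrt 0) at_top" by (intro tendsto_intros)
    then show ?thesis by (simp add: tendsto_norm_zero_iff)
  qed
  have "((\<lambda>t. \<Sum>i\<in>UNIV. dual_var (X t) i \<bullet> laplacian E (dual_var (X t)) i) \<longlongrightarrow> 0) at_top"
  proof (rule tendsto_zero_squeeze[OF D])
    fix t
    show "0 \<le> (\<Sum>i\<in>UNIV. dual_var (X t) i \<bullet> laplacian E (dual_var (X t)) i)" by (rule dissipation_rate_nonneg)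
    show "(\<Sum>i\<in>UNIV. dual_var (X t) i \<bullet> laplacian E (dual_var (X t)) i) \<le> dissipation_rate xs (X t)"
      using dissipation_rate_nonneg(1,2)[where s = "X t"] by (simp add: dissipation_rate_def)
  qed
  then have "((\<lambda>t. real CARD('i) * sqrt (2 * (\<Sum>i\<in>UNIV. dual_var (X t) i \<bullet> laplacian E (dual_var (X t)) i)))
      \<longlongrightarrow> real CARD('i) * sqrt (2 * 0)) at_top" by (intro tendsto_intros)
  then show "((\<lambda>t. laplacian E (dual_var (X t)) i) \<longlongrightarrow> 0) at_top"
    by (intro Lim_null_comparison[OF always_eventually[OF allI[OF norm_le_of_form[OF undirected order_refl]]]]) simp
  obtain D where D: "D > 0" "\<And>(w :: 'i \<Rightarrow> real^'n) i j. norm (w i - w j) \<le> D * (\<Sum>k\<in>UNIV. norm (laplacian E w k))"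
    using disagreement_le_laplacian[where ?'a = "real^'n", OF undirected connected] by blast
  show "((\<lambda>t. est (X t) i) \<longlongrightarrow> xs) at_top"
  proof (rule vec_tendstoI)
    fix l
    have "((\<lambda>t. est (X t) i $ l - own_profile (est (X t)) $ l) \<longlongrightarrow> 0) at_top"
    proof (rule Lim_null_comparison[OF always_eventually])
      show "\<forall>t. norm (est (X t) i $ l - own_profile (est (X t)) $ l) \<le> D * (\<Sum>k\<in>UNIV. norm (laplacian E (est (X t)) k))"
      proof
        fix t
        have "norm (est (X t) i $ l - own_profile (est (X t)) $ l) = \<bar>(est (X t) i - est (X t) (own l)) $ l\<bar>"
          by (simp add: own_profile_def)
        also have "\<dots> \<le> norm (est (X t) i - est (X t) (own l))" by (rule component_le_norm_cart)
        also have "\<dots> \<le> D * (\<Sum>k\<in>UNIV. norm (laplacian E (est (X t)) k))" by (rule D(2))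
        finally show "norm (est (X t) i $ l - own_profile (est (X t)) $ l) \<le> D * (\<Sum>k\<in>UNIV. norm (laplacian E (est (X t)) k))" .
      qed
      have "((\<lambda>t. D * (\<Sum>k\<in>UNIV. norm (laplacian E (est (X t)) k))) \<longlongrightarrow> D * (\<Sum>k\<in>(UNIV::'i set). norm (0::real^'n))) at_top"
        by (intro tendsto_intros lap)
      then show "((\<lambda>t. D * (\<Sum>k\<in>UNIV. norm (laplacian E (est (X t)) k))) \<longlongrightarrow> 0) at_top" by simp
    qed
    from tendsto_add[OF this tendsto_vec_nth[OF own, of l]]
    show "((\<lambda>t. est (X t) i $ l) \<longlongrightarrow> xs $ l) at_top" by simp
  qed
qed


lemma gain_converges: obtains k where "((\<lambda>t. X t (Gain i)) \<longlongrightarrow> k) at_top"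
proof -
  obtain M where M: "\<forall>t\<ge>0. norm (X t (Gain i)) \<le> M"
    using path_bounded[OF box_lipschitz_coord[OF finite_C in_C(3)]] by blast
  have mono: "X s (Gain i) \<le> X t (Gain i)" if st: "0 \<le> s" "s \<le> t" for s t
  proof (rule DERIV_nonneg_imp_increasing_open[OF st(2)])
    fix u assume u: "s < u" "u < t"
    then have "((\<lambda>\<tau>. X \<tau> (Gain i)) has_real_derivative CL (X u) (Gain i)) (at u within {0..})"
      using st by (intro deriv_on_half_line in_C) auto
    then have "((\<lambda>\<tau>. X \<tau> (Gain i)) has_real_derivative CL (X u) (Gain i)) (at u)"
      using at_within_interior[of u "{0..}"] u st by simp
    then show "\<exists>y. ((\<lambda>\<tau>. X \<tau> (Gain i)) has_real_derivative y) (at u) \<and> 0 \<le> y"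
      using gains[of i] by (intro exI[of _ "CL (X u) (Gain i)"]) auto
  next
    show "continuous_on {s..t} (\<lambda>a. X a (Gain i))"
      using st by (intro continuous_on_subset[OF sol_continuous[OF sol[of t] in_C(3)]]) auto
  qed
  have "X t (Gain i) \<le> M" if "0 \<le> t" for t using M that by force
  then show thesis using mono_bounded_tendsto[of "\<lambda>t. X t (Gain i)" M] mono that by metis
qed

text \<open>A second use of Barbalat's lemma: \<open>ut\<close> is the derivative of the convergent
  estimates.\<close>

lemma input_tendsto_zero:
  assumes ed: "equilibrium_data xs ls zb"
  shows "((\<lambda>t. ut (X t) i $ l) \<longlongrightarrow> 0) at_top"
proof -
  obtain K where K: "\<forall>s t. s \<ge> 0 \<longrightarrow> t \<ge> 0 \<longrightarrow> norm (ut (X s) i $ l - ut (X t) i $ l) \<le> K * \<bar>s - t\<bar>"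
    using path_lipschitz[OF ut_lip, of i l] by blast
  show ?thesis
    by (rule barbalat[OF est_deriv_half_line tendsto_vec_nth[OF consensus(4)[OF ed]]]) (use K in auto)
qed

text \<open>The input, the gradient and the consensus term all have known limits, so the constraint
  term in \<open>ut\<close> converges too, although the multipliers are not yet known to
  converge.\<close>

lemma stationarity_limit:
  assumes ed: "equilibrium_data xs ls zb"
  shows "((\<lambda>t. A i (est (X t) i) (dual_var (X t) i) $ l) \<longlongrightarrow> - G i xs $ l) at_top"
proof -
  have rho0: "((\<lambda>t. X t (Gain i) *\<^sub>R rh (X t) i) \<longlongrightarrow> 0) at_top" for i
  proof -
    obtain k where "((\<lambda>t. X t (Gain i)) \<longlongrightarrow> k) at_top" by (rule gain_converges)
    then have "((\<lambda>t. X t (Gain i) *\<^sub>R laplacian E (est (X t)) i) \<longlongrightarrow> k *\<^sub>R 0) at_top"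
      by (intro tendsto_intros consensus(2)[OF ed])
    then show ?thesis by (simp add: rho_laplacian)
  qed
  have "((\<lambda>t. laplacian E (\<lambda>i. X t (Gain i) *\<^sub>R rh (X t) i) i) \<longlongrightarrow> (\<Sum>j\<in>neighbors E i. 0 - 0)) at_top"
    unfolding laplacian_def by (intro tendsto_intros rho0)
  then have W: "((\<lambda>t. laplacian E (\<lambda>i. X t (Gain i) *\<^sub>R rh (X t) i) i $ l) \<longlongrightarrow> 0) at_top"
    using tendsto_vec_nth[of "\<lambda>t. laplacian E (\<lambda>i. X t (Gain i) *\<^sub>R rh (X t) i) i" 0 at_top l] by simp
  have Gc: "((\<lambda>t. G i (est (X t) i) $ l) \<longlongrightarrow> G i xs $ l) at_top"
  proof (cases "own l = i")
    case True
    have "isCont F xs"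
      by (rule local_lipschitz_imp_isCont)
         (use lipschitz_onD[OF F_lipschitz(2)] F_lipschitz(1) in \<open>auto intro!: exI[of _ \<theta>\<^sub>0] simp: dist_norm\<close>)
    then have "((\<lambda>t. F (est (X t) i)) \<longlongrightarrow> F xs) at_top"
      by (rule isCont_tendsto_compose) (rule consensus(4)[OF ed])
    then show ?thesis using True by (simp add: G_own_block tendsto_vec_nth)
  next
    case False then show ?thesis by (simp add: G_other_block)
  qed
  have "((\<lambda>t. - G i (est (X t) i) $ l - laplacian E (\<lambda>i. X t (Gain i) *\<^sub>R rh (X t) i) i $ l - ut (X t) i $ l)
      \<longlongrightarrow> - G i xs $ l - 0 - 0) at_top"
    by (intro tendsto_intros Gc W input_tendsto_zero[OF ed])
  then show ?thesis by (simp add: ut_eq)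
qed

text \<open>The derivative of \<open>z\<close> is the Laplacian of the multipliers, which tends to
  0.\<close>

lemma aux_slow:
  assumes ed: "equilibrium_data xs ls zb"
  shows "slow (\<lambda>t. X t (Aux i a))"
proof (rule slow_deriv)
  show "((\<lambda>t. X t (Aux i a)) has_real_derivative CL (X t) (Aux i a)) (at t within {0..})" if "t \<ge> 0" for t
    by (rule deriv_on_half_line) (use that in \<open>auto simp: in_C\<close>)
  show "((\<lambda>t. CL (X t) (Aux i a)) \<longlongrightarrow> 0) at_top"
    using tendsto_vec_nth[OF consensus(3)[OF ed], of i a] by (simp add: dual_laplacian)
qed

lemma dual_drift_slow:
  assumes ed: "equilibrium_data xs ls zb"
  shows "slow (\<lambda>t. drift (X t) (Dual i a))"
    and "((\<lambda>t. g i (est (X t) i)) \<longlongrightarrow> g i xs) at_top"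
proof -
  have "isCont (g i) xs"
  proof (rule local_lipschitz_imp_isCont)
    fix R
    obtain L where "L \<ge> 0" "\<And>x y. norm x \<le> R \<Longrightarrow> norm y \<le> R \<Longrightarrow> norm (g i x - g i y) \<le> L * norm (x - y)"
      using g_lipschitz[of R i] by blast
    then show "\<exists>L\<ge>0. \<forall>x y. norm x \<le> R \<longrightarrow> norm y \<le> R \<longrightarrow> norm (g i x - g i y) \<le> L * norm (x - y)" by blast
  qed
  then show gc: "((\<lambda>t. g i (est (X t) i)) \<longlongrightarrow> g i xs) at_top"
    by (rule isCont_tendsto_compose) (rule consensus(4)[OF ed])
  have "((\<lambda>t. g i (est (X t) i) $ a - laplacian E (dual_var (X t)) i $ a) \<longlongrightarrow> g i xs $ a - (0::real^'m) $ a) at_top"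
    by (intro tendsto_intros gc consensus(3)[OF ed])
  moreover have eq: "drift (X t) (Dual i a) = (g i (est (X t) i) $ a - laplacian E (dual_var (X t)) i $ a) - X t (Aux i a)" for t
    by (simp add: drift_simps aux_var_def)
  ultimately show "slow (\<lambda>t. drift (X t) (Dual i a))"
    unfolding eq by (intro slow_diff slow_tendsto aux_slow[OF ed])
qed

section \<open>Limit points of the multipliers\<close>

lemma dual_increment_le:
  assumes st: "0 \<le> s" "s \<le> t" and D: "\<And>u. s \<le> u \<Longrightarrow> u \<le> t \<Longrightarrow> CL (X u) (Dual i a) \<le> b"
  shows "X t (Dual i a) - X s (Dual i a) \<le> b * (t - s)"
proof -
  have "X t (Dual i a) - X s (Dual i a) \<le> integral {s..t} (\<lambda>_. b)"
  proof (rule AE_deriv_le_imp_diff_le[OF st(2)])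
    have "abs_continuous_on {0..t} (\<lambda>\<tau>. X \<tau> (Dual i a))" using sol[of t] in_C(5) st by (simp add: sol_def)
    then show "abs_continuous_on {s..t} (\<lambda>\<tau>. X \<tau> (Dual i a))" by (rule abs_continuous_on_subset) (use st in auto)
    show "AE u in lebesgue. s \<le> u \<and> u \<le> t \<longrightarrow> (\<exists>D\<le>b. ((\<lambda>\<tau>. X \<tau> (Dual i a)) has_real_derivative D) (at u))"
      using AE_deriv
    proof eventually_elim
      case (elim u)
      show ?case
      proof
        assume u: "s \<le> u \<and> u \<le> t"
        then have "((\<lambda>\<tau>. X \<tau> (Dual i a)) has_real_derivative CL (X u) (Dual i a)) (at u)"
          using elim st in_C(5)[of i a] by (meson order_trans)
        then show "\<exists>D\<le>b. ((\<lambda>\<tau>. X \<tau> (Dual i a)) has_real_derivative D) (at u)" using D u by blast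
      qed
    qed
  qed auto
  then show ?thesis using st by (simp add: mult.commute)
qed

lemma dual_increment_ge:
  assumes st: "0 \<le> s" "s \<le> t" and D: "\<And>u. s \<le> u \<Longrightarrow> u \<le> t \<Longrightarrow> b \<le> CL (X u) (Dual i a)"
  shows "b * (t - s) \<le> X t (Dual i a) - X s (Dual i a)"
proof -
  have "(0 - X t (Dual i a)) - (0 - X s (Dual i a)) \<le> integral {s..t} (\<lambda>_. - b)"
  proof (rule AE_deriv_le_imp_diff_le[OF st(2)])
    have "abs_continuous_on {0..t} (\<lambda>\<tau>. X \<tau> (Dual i a))" using sol[of t] in_C(5) st by (simp add: sol_def)
    then have "abs_continuous_on {s..t} (\<lambda>\<tau>. X \<tau> (Dual i a))" by (rule abs_continuous_on_subset) (use st in auto)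
    then show "abs_continuous_on {s..t} (\<lambda>\<tau>. 0 - X \<tau> (Dual i a))" by (intro abs_continuous_on_diff abs_continuous_on_const)
    show "AE u in lebesgue. s \<le> u \<and> u \<le> t \<longrightarrow> (\<exists>D\<le>- b. ((\<lambda>\<tau>. 0 - X \<tau> (Dual i a)) has_real_derivative D) (at u))"
      using AE_deriv
    proof eventually_elim
      case (elim u)
      show ?case
      proof
        assume u: "s \<le> u \<and> u \<le> t"
        then have "((\<lambda>\<tau>. X \<tau> (Dual i a)) has_real_derivative CL (X u) (Dual i a)) (at u)"
          using elim st in_C(5)[of i a] by (meson order_trans)
        then have "((\<lambda>\<tau>. 0 - X \<tau> (Dual i a)) has_real_derivative 0 - CL (X u) (Dual i a)) (at u)"
          by (intro DERIV_diff DERIV_const)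
        then show "\<exists>D\<le>- b. ((\<lambda>\<tau>. 0 - X \<tau> (Dual i a)) has_real_derivative D) (at u)"
          using D u by (intro exI[of _ "0 - CL (X u) (Dual i a)"]) (auto simp del: closed_loop.simps)
      qed
    qed
  qed auto
  then show ?thesis using st by (simp add: mult.commute)
qed

text \<open>A limiting drift of the wrong sign would persist on arbitrarily long windows and push the
  multiplier out of its bounds.\<close>

lemma limit_drift_sign:
  assumes ed: "equilibrium_data xs ls zb"
    and tn: "filterlim \<sigma> at_top sequentially"
    and v: "(\<lambda>n. drift (X (\<sigma> n)) (Dual i a)) \<longlonglongrightarrow> v"
    and lam: "(\<lambda>n. X (\<sigma> n) (Dual i a)) \<longlonglongrightarrow> lam"
  shows "v \<le> 0" and "lam > 0 \<Longrightarrow> v = 0"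
proof -
  have bd: "\<bar>X t (Dual i a)\<bar> \<le> B" if "t \<ge> 0" for t using box[OF that] in_C(5) by (auto simp: in_box_def)
  have slow: "slow (\<lambda>t. drift (X t) (Dual i a))" by (rule dual_drift_slow[OF ed])
  show v0: "v \<le> 0"
  proof (rule ccontr)
    assume "\<not> v \<le> 0"
    then have vp: "v > 0" by simp
    \<comment> \<open>The drift stays above \<open>v / 4\<close> on a window of length
      \<open>T\<close> after \<open>\<sigma> n\<close>, so the multiplier would gain
      \<open>B + 1\<close> there, more than its range \<open>{0..B}\<close> allows.\<close>
    define T where "T = 4 * (B + 1) / v"
    have T: "T > 0" using vp B0 by (simp add: T_def)
    have "v / 4 > 0" using vp by simp
    then obtain t0 where t0: "\<And>s t. s \<ge> t0 \<Longrightarrow> t \<ge> t0 \<Longrightarrow> \<bar>s - t\<bar> \<le> T \<Longrightarrow>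
        \<bar>drift (X s) (Dual i a) - drift (X t) (Dual i a)\<bar> \<le> v / 4"
      using slow unfolding slow_def by meson
    have "\<forall>\<^sub>F n in sequentially. drift (X (\<sigma> n)) (Dual i a) > v / 2"
      by (rule order_tendstoD(1)[OF v]) (use vp in simp)
    moreover have "\<forall>\<^sub>F n in sequentially. \<sigma> n \<ge> max t0 0"
      using tn unfolding filterlim_at_top by blast
    ultimately have "\<forall>\<^sub>F n in sequentially. drift (X (\<sigma> n)) (Dual i a) > v / 2 \<and> \<sigma> n \<ge> max t0 0"
      by eventually_elim auto
    from eventually_happens'[OF sequentially_bot this]
    obtain n where n: "drift (X (\<sigma> n)) (Dual i a) > v / 2" "\<sigma> n \<ge> max t0 0" by blast
    have "v / 4 * ((\<sigma> n + T) - \<sigma> n) \<le> X (\<sigma> n + T) (Dual i a) - X (\<sigma> n) (Dual i a)"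
    proof (rule dual_increment_ge)
      fix u assume u: "\<sigma> n \<le> u" "u \<le> \<sigma> n + T"
      have "\<bar>drift (X u) (Dual i a) - drift (X (\<sigma> n)) (Dual i a)\<bar> \<le> v / 4" using u n by (intro t0) auto
      then have d: "drift (X u) (Dual i a) \<ge> v / 4" using n(1) by linarith
      have nn: "0 \<le> dual_var (X u) i" using u n by (intro dual_var_nonneg) auto
      show "v / 4 \<le> CL (X u) (Dual i a)" unfolding CL_dual[OF nn] using d by auto
    qed (use n T in auto)
    then have "v / 4 * T \<le> X (\<sigma> n + T) (Dual i a) - X (\<sigma> n) (Dual i a)" by simp
    moreover have "X (\<sigma> n + T) (Dual i a) \<le> B" using bd[of "\<sigma> n + T"] n T by auto
    moreover have "X (\<sigma> n) (Dual i a) \<ge> 0" using n by (intro dual_nonneg) auto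
    moreover have "v / 4 * T = B + 1" using vp by (simp add: T_def)
    ultimately show False by linarith
  qed
  show "v = 0" if lp: "lam > 0"
  proof (rule ccontr)
    assume "v \<noteq> 0"
    then have vn: "v < 0" using v0 by simp
    define T where "T = 4 * (B + 1) / (- v)"
    have T: "T > 0" using vn B0 by (simp add: T_def divide_pos_neg)
    have "- v / 4 > 0" using vn by simp
    then obtain t0 where t0: "\<And>s t. s \<ge> t0 \<Longrightarrow> t \<ge> t0 \<Longrightarrow> \<bar>s - t\<bar> \<le> T \<Longrightarrow>
        \<bar>drift (X s) (Dual i a) - drift (X t) (Dual i a)\<bar> \<le> - v / 4"
      using slow unfolding slow_def by meson
    have "\<forall>\<^sub>F n in sequentially. drift (X (\<sigma> n)) (Dual i a) < v / 2"
      by (rule order_tendstoD(2)[OF v]) (use vn in simp)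
    \<comment> \<open>This time the window extends backwards from \<open>\<sigma> n\<close>, so it
      must fit after \<open>t0\<close> and after time 0.\<close>
    moreover have "\<forall>\<^sub>F n in sequentially. \<sigma> n \<ge> max t0 0 + T"
      using tn unfolding filterlim_at_top by blast
    moreover have "\<forall>\<^sub>F n in sequentially. X (\<sigma> n) (Dual i a) > 0"
      by (rule order_tendstoD(1)[OF lam lp])
    ultimately have "\<forall>\<^sub>F n in sequentially. drift (X (\<sigma> n)) (Dual i a) < v / 2 \<and> \<sigma> n \<ge> max t0 0 + T \<and> X (\<sigma> n) (Dual i a) > 0"
      by eventually_elim auto
    from eventually_happens'[OF sequentially_bot this]
    obtain n where n: "drift (X (\<sigma> n)) (Dual i a) < v / 2" "\<sigma> n \<ge> max t0 0 + T" "X (\<sigma> n) (Dual i a) > 0" by blast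
    have dr: "drift (X u) (Dual i a) \<le> v / 4" if "\<sigma> n - T \<le> u" "u \<le> \<sigma> n" for u
    proof -
      have "\<bar>drift (X u) (Dual i a) - drift (X (\<sigma> n)) (Dual i a)\<bar> \<le> - v / 4" using that n T by (intro t0) auto
      then show ?thesis using n(1) by linarith
    qed
    have CLu: "CL (X u) (Dual i a) = (if X u (Dual i a) \<le> 0 then max 0 (drift (X u) (Dual i a)) else drift (X u) (Dual i a))"
      if "\<sigma> n - T \<le> u" for u
      by (rule CL_dual) (use that n in \<open>auto intro: dual_var_nonneg\<close>)
    \<comment> \<open>With negative drift the multiplier is nonincreasing on the window, hence
      positive throughout since it is positive at the end. The projection is inactive there, and the
      multiplier must have started above \<open>B\<close>.\<close>
    have pos: "X u (Dual i a) > 0" if u: "\<sigma> n - T \<le> u" "u \<le> \<sigma> n" for u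
    proof -
      have "X (\<sigma> n) (Dual i a) - X u (Dual i a) \<le> 0 * (\<sigma> n - u)"
      proof (rule dual_increment_le)
        fix w assume "u \<le> w" "w \<le> \<sigma> n"
        then show "CL (X w) (Dual i a) \<le> 0" using CLu[of w] dr[of w] u vn by auto
      qed (use u n in auto)
      then show ?thesis using n(3) by simp
    qed
    have "X (\<sigma> n) (Dual i a) - X (\<sigma> n - T) (Dual i a) \<le> v / 4 * (\<sigma> n - (\<sigma> n - T))"
    proof (rule dual_increment_le)
      fix w assume w: "\<sigma> n - T \<le> w" "w \<le> \<sigma> n"
      show "CL (X w) (Dual i a) \<le> v / 4" using CLu[OF w(1)] dr[OF w] pos[OF w] by auto
    qed (use n T in auto)
    then have "X (\<sigma> n) (Dual i a) - X (\<sigma> n - T) (Dual i a) \<le> v / 4 * T" by simp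
    moreover have "0 \<le> max t0 0" by simp
    then have "0 \<le> \<sigma> n - T" using n(2) by linarith
    then have "X (\<sigma> n - T) (Dual i a) \<le> B" using bd[of "\<sigma> n - T"] by auto
    moreover have "v / 4 * T = - (B + 1)" using vn by (simp add: T_def field_simps)
    ultimately show False using n(3) by linarith
  qed
qed

text \<open>Takes the place of an invariance principle. The strategy \<open>xs\<close> stays the one
  used for consensus, while the limiting multipliers and \<open>zb\<close> may differ from those of
  the initial equilibrium.\<close>

lemma limit_point_equilibrium:
  obtains \<sigma> xs ls zb where "filterlim \<sigma> at_top sequentially" "equilibrium_data xs ls zb"
    "\<And>i. (\<lambda>n. dual_var (X (\<sigma> n)) i) \<longlonglongrightarrow> ls" "\<And>i. (\<lambda>n. aux_var (X (\<sigma> n)) i) \<longlonglongrightarrow> zb i"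
proof -
  obtain xs ls' where "KKT own UNIV J g xs ls'" by (rule KKT_exists)
  then obtain zb' where ed: "equilibrium_data xs ls' zb'" by (rule KKT_imp_equilibrium_data)
  \<comment> \<open>All multipliers and all \<open>z\<close> are packed into one Euclidean vector,
    so that a single convergent subsequence serves every agent.\<close>
  define P where "P s = ((\<chi> i. dual_var s i) :: real^'m^'i, (\<chi> i. aux_var s i) :: real^'m^'i)" for s :: "('i, 'n, 'm) state"
  define Y where "Y n = P (X (real n))" for n :: nat
  have "box_lipschitz C b P" for b
    unfolding P_def by (intro box_lipschitz_Pair box_lipschitz_vec dual_lip aux_lip)
  then obtain M where "\<forall>t\<ge>0. norm (P (X t)) \<le> M" using path_bounded by blast
  then have "bounded (range Y)" unfolding bounded_iff Y_def by (intro exI[of _ M]) auto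
  then obtain L \<rho> where L: "strict_mono \<rho>" "(Y \<circ> \<rho>) \<longlonglongrightarrow> L"
    using bounded_imp_convergent_subsequence by blast
  define \<sigma> where "\<sigma> n = real (\<rho> n)" for n
  have tn: "filterlim \<sigma> at_top sequentially"
    unfolding \<sigma>_def by (rule filterlim_compose[OF filterlim_real_sequentially filterlim_subseq[OF L(1)]])
  have dl: "(\<lambda>n. dual_var (X (\<sigma> n)) i) \<longlonglongrightarrow> fst L $ i" for i
    using tendsto_vec_nth[OF tendsto_fst[OF L(2)], of i] by (simp add: Y_def P_def \<sigma>_def comp_def)
  have al: "(\<lambda>n. aux_var (X (\<sigma> n)) i) \<longlonglongrightarrow> snd L $ i" for i
    using tendsto_vec_nth[OF tendsto_snd[OF L(2)], of i] by (simp add: Y_def P_def \<sigma>_def comp_def)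
  define zb where "zb i = snd L $ i" for i
  have lapl: "laplacian E (($) (fst L)) i = 0" for i
  proof -
    have "(\<lambda>n. laplacian E (dual_var (X (\<sigma> n))) i) \<longlonglongrightarrow> laplacian E (($) (fst L)) i"
      unfolding laplacian_def by (intro tendsto_intros dl)
    moreover have "(\<lambda>n. laplacian E (dual_var (X (\<sigma> n))) i) \<longlonglongrightarrow> 0"
      by (rule filterlim_compose[OF consensus(3)[OF ed] tn])
    ultimately show ?thesis by (rule LIMSEQ_unique)
  qed
  obtain D where D: "D > 0" "\<And>(w :: 'i \<Rightarrow> real^'m) i j. norm (w i - w j) \<le> D * (\<Sum>k\<in>UNIV. norm (laplacian E w k))"
    using disagreement_le_laplacian[where ?'a = "real^'m", OF undirected connected] by blast
  obtain i0 :: 'i where True by simp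
  define ls where "ls = fst L $ i0"
  have ls: "fst L $ i = ls" for i using D(2)[of "($) (fst L)" i i0] lapl by (simp add: ls_def)
  have dls: "(\<lambda>n. dual_var (X (\<sigma> n)) i) \<longlonglongrightarrow> ls" for i using dl[of i] ls by simp
  have azb: "(\<lambda>n. aux_var (X (\<sigma> n)) i) \<longlonglongrightarrow> zb i" for i using al[of i] by (simp add: zb_def)
  have ev0: "\<forall>\<^sub>F n in sequentially. \<sigma> n \<ge> 0" using tn unfolding filterlim_at_top by blast
  have ls0: "ls $ a \<ge> 0" for a
  proof (rule tendsto_lowerbound[OF tendsto_vec_nth[OF dls[of i0], of a]])
    show "\<forall>\<^sub>F n in sequentially. 0 \<le> dual_var (X (\<sigma> n)) i0 $ a"
      using ev0 by eventually_elim (simp add: dual_var_def dual_nonneg)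
  qed simp
  have stat: "G i xs + A i xs ls = 0" for i
  proof -
    have "(G i xs + A i xs ls) $ l = 0" for l
    proof -
      have "isCont (\<lambda>p. A i (fst p) (snd p) $ l) (xs, ls)" by (rule local_lipschitz_imp_isCont) (rule A_pair_lip)
      moreover have "(\<lambda>n. (est (X (\<sigma> n)) i, dual_var (X (\<sigma> n)) i)) \<longlonglongrightarrow> (xs, ls)"
        by (intro tendsto_Pair dls filterlim_compose[OF consensus(4)[OF ed] tn])
      ultimately have "(\<lambda>n. A i (fst (est (X (\<sigma> n)) i, dual_var (X (\<sigma> n)) i)) (snd (est (X (\<sigma> n)) i, dual_var (X (\<sigma> n)) i)) $ l)
         \<longlonglongrightarrow> A i (fst (xs, ls)) (snd (xs, ls)) $ l"
        by (rule isCont_tendsto_compose)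
      then have "(\<lambda>n. A i (est (X (\<sigma> n)) i) (dual_var (X (\<sigma> n)) i) $ l) \<longlonglongrightarrow> A i xs ls $ l" by simp
      moreover have "(\<lambda>n. A i (est (X (\<sigma> n)) i) (dual_var (X (\<sigma> n)) i) $ l) \<longlonglongrightarrow> - G i xs $ l"
        by (rule filterlim_compose[OF stationarity_limit[OF ed] tn])
      ultimately have "A i xs ls $ l = - G i xs $ l" by (rule LIMSEQ_unique)
      then show ?thesis by simp
    qed
    then show ?thesis by (simp add: vec_eq_iff)
  qed
  \<comment> \<open>At every time \<open>z\<close> lies in the range of the Laplacian, whose values
    sum to zero.\<close>
  have sumz: "(\<Sum>i\<in>UNIV. zb i) = 0"
  proof -
    have "(\<lambda>n. \<Sum>i\<in>UNIV. aux_var (X (\<sigma> n)) i) \<longlonglongrightarrow> (\<Sum>i\<in>UNIV. zb i)" by (intro tendsto_intros azb)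
    moreover have "(\<lambda>n. \<Sum>i\<in>UNIV. aux_var (X (\<sigma> n)) i) \<longlonglongrightarrow> 0"
    proof (rule tendsto_eventually)
      show "\<forall>\<^sub>F n in sequentially. (\<Sum>i\<in>UNIV. aux_var (X (\<sigma> n)) i) = 0"
        using ev0
      proof eventually_elim
        case (elim n)
        then have "aux_var (X (\<sigma> n)) i = laplacian E (dual_integral X (\<sigma> n)) i" for i
          by (intro aux_eq_laplacian[OF sol[OF elim]]) auto
        then show ?case using sum_laplacian[OF undirected, of "dual_integral X (\<sigma> n)"] by simp
      qed
    qed
    ultimately show ?thesis by (rule LIMSEQ_unique)
  qed
  have drl: "(\<lambda>n. drift (X (\<sigma> n)) (Dual i a)) \<longlonglongrightarrow> (g i xs - zb i) $ a" for i a
  proof -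
    have "(\<lambda>n. (g i (est (X (\<sigma> n)) i) - aux_var (X (\<sigma> n)) i - laplacian E (dual_var (X (\<sigma> n))) i) $ a)
        \<longlonglongrightarrow> (g i xs - zb i - 0) $ a"
      by (intro tendsto_vec_nth tendsto_diff azb filterlim_compose[OF dual_drift_slow(2)[OF ed] tn]
          filterlim_compose[OF consensus(3)[OF ed] tn])
    then show ?thesis by (simp add: drift_simps)
  qed
  have dc: "(\<lambda>n. X (\<sigma> n) (Dual i a)) \<longlonglongrightarrow> ls $ a" for i a
    using tendsto_vec_nth[OF dls[of i], of a] by (simp add: dual_var_def)
  have sgn: "(g i xs - zb i) $ a \<le> 0" "ls $ a > 0 \<Longrightarrow> (g i xs - zb i) $ a = 0" for i a
    using limit_drift_sign[OF ed tn drl dc] by auto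
  have "ls \<bullet> (g i xs - zb i) = 0" for i
    unfolding inner_vec_def
  proof (rule sum.neutral, rule ballI)
    fix a show "ls $ a \<bullet> (g i xs - zb i) $ a = 0" using ls0[of a] sgn(2)[of a i] by (cases "ls $ a = 0") auto
  qed
  then have "equilibrium_data xs ls zb" unfolding equilibrium_data_def using ls0 stat sgn(1) sumz by blast
  then show thesis using that tn dls azb by blast
qed

end

section \<open>Convergence\<close>

text \<open>The converse estimate to \<open>norm_le_of_form\<close>: the last Lyapunov term vanishes
  as soon as \<open>z\<close> approaches \<open>zb\<close>, without any control of \<open>w\<close>
  itself.\<close>

lemma laplacian_form_le:
  fixes E :: "('i::finite \<times> 'i) set" and w :: "'i \<Rightarrow> 'a::real_inner"
  assumes "sym E" and D: "\<And>i j. norm (w i - w j) \<le> D * (\<Sum>k\<in>UNIV. norm (laplacian E w k))"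
  shows "(\<Sum>i\<in>UNIV. w i \<bullet> laplacian E w i) \<le> D * (\<Sum>k\<in>UNIV. norm (laplacian E w k))\<^sup>2"
proof -
  define S where "S = (\<Sum>k\<in>UNIV. norm (laplacian E w k))"
  fix i0 :: 'i
  have "(\<Sum>i\<in>UNIV. w i \<bullet> laplacian E w i) = (\<Sum>i\<in>UNIV. (w i - w i0) \<bullet> laplacian E w i)"
    by (simp add: inner_diff_left sum_subtractf inner_sum_right[symmetric] sum_laplacian[OF assms(1)])
  also have "\<dots> \<le> (\<Sum>i\<in>UNIV. D * S * norm (laplacian E w i))"
  proof (rule sum_mono)
    fix i
    have "(w i - w i0) \<bullet> laplacian E w i \<le> norm (w i - w i0) * norm (laplacian E w i)"
      by (rule norm_cauchy_schwarz)
    also have "\<dots> \<le> D * S * norm (laplacian E w i)"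
      unfolding S_def by (rule mult_right_mono[OF D]) simp
    finally show "(w i - w i0) \<bullet> laplacian E w i \<le> D * S * norm (laplacian E w i)" .
  qed
  also have "\<dots> = D * S\<^sup>2" unfolding sum_distrib_left[symmetric] S_def[symmetric] by (simp add: power2_eq_square)
  finally show ?thesis unfolding S_def .
qed

context gne_solution
begin

text \<open>Taking the Lyapunov function at the limit point upgrades convergence along a sequence to
  convergence in time, because the function is monotone.\<close>

lemma multipliers_converge:
  obtains xs ls zb where "equilibrium_data xs ls zb"
    "\<And>i. ((\<lambda>t. dual_var (X t) i) \<longlongrightarrow> ls) at_top" "\<And>i. ((\<lambda>t. aux_var (X t) i) \<longlongrightarrow> zb i) at_top"
proof -
  obtain \<sigma> xs ls zb where \<sigma>: "filterlim \<sigma> at_top sequentially" and ed: "equilibrium_data xs ls zb"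
    and dl: "\<And>i. (\<lambda>n. dual_var (X (\<sigma> n)) i) \<longlonglongrightarrow> ls" and al: "\<And>i. (\<lambda>n. aux_var (X (\<sigma> n)) i) \<longlonglongrightarrow> zb i"
    using limit_point_equilibrium by metis
  have "(\<Sum>i\<in>UNIV. zb i) = 0" using ed by (simp add: equilibrium_data_def)
  then obtain wb where wb: "\<And>i. laplacian E wb i = zb i"
    using laplacian_surj[OF undirected connected] by metis
  obtain ks where ks: "\<And>T X a b xs ls zb wb. sol T X \<Longrightarrow> equilibrium_data xs ls zb \<Longrightarrow> (\<And>i. laplacian E wb i = zb i) \<Longrightarrow>
    0 \<le> a \<Longrightarrow> a \<le> b \<Longrightarrow> b \<le> T \<Longrightarrow>
    lyapunov ks xs ls zb wb (X b) (dual_integral X b) + integral {a..b} (\<lambda>t. dissipation_rate xs (X t))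
      \<le> lyapunov ks xs ls zb wb (X a) (dual_integral X a)"
    using lyapunov_decrease by metis
  define V where "V t = lyapunov ks xs ls zb wb (X t) (dual_integral X t)" for t
  define P1 where "P1 t = (\<Sum>i\<in>UNIV. (est (X t) i - xs) \<bullet> (est (X t) i - xs)) / 2" for t
  define P2 where "P2 t = (\<Sum>i\<in>UNIV. (X t (Gain i) - ks) * (X t (Gain i) - ks) / (2 * \<gamma> i))" for t
  define P3 where "P3 t = (\<Sum>i\<in>UNIV. (dual_var (X t) i - ls) \<bullet> (dual_var (X t) i - ls)) / 2" for t
  define d where "d t i = dual_integral X t i - wb i" for t i
  define P4 where "P4 t = (\<Sum>i\<in>UNIV. d t i \<bullet> (aux_var (X t) i - zb i)) / 2" for t
  have V: "V t = P1 t + P2 t + P3 t + P4 t" for t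
    by (simp add: V_def lyapunov_def P1_def P2_def P3_def P4_def d_def)
  have aux: "aux_var (X t) i = laplacian E (dual_integral X t) i" if "t \<ge> 0" for t i
    by (rule aux_eq_laplacian[OF sol[OF that]]) (use that in auto)
  have auxd: "aux_var (X t) i - zb i = laplacian E (d t) i" if "t \<ge> 0" for t i
  proof -
    have "d t = (\<lambda>i. dual_integral X t i - wb i)" by (rule ext) (simp add: d_def)
    then show ?thesis using aux[OF that, of i] wb[of i] by (simp add: laplacian_diff)
  qed
  have P4d: "P4 t = (\<Sum>i\<in>UNIV. d t i \<bullet> laplacian E (d t) i) / 2" if "t \<ge> 0" for t
    by (simp add: P4_def auxd[OF that])
  have nn: "P1 t \<ge> 0" "P2 t \<ge> 0" "P3 t \<ge> 0" "P4 t \<ge> 0" if "t \<ge> 0" for t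
    unfolding P1_def P2_def P3_def P4d[OF that] using gains laplacian_nonneg[OF undirected, of "d t"]
    by (auto intro!: sum_nonneg divide_nonneg_pos)
  have Vmono: "- V s \<le> - V t" if st: "0 \<le> s" "s \<le> t" for s t
  proof -
    have "integral {s..t} (\<lambda>t. dissipation_rate xs (X t)) \<ge> 0"
      using dissipation_rate_nonneg(4) st by (intro integral_nonneg integrable_continuous_interval
        continuous_on_subset[OF sol_path_continuous[OF sol[of t] dissipation_rate_lip]]) auto
    then show ?thesis using ks[OF sol[of t] ed wb st(1,2)] st unfolding V_def by simp
  qed
  have "- V t \<le> 0" if "0 \<le> t" for t using nn[OF that] V[of t] by simp
  then obtain \<nu> where "((\<lambda>t. - V t) \<longlongrightarrow> \<nu>) at_top"
    using mono_bounded_tendsto[of "\<lambda>t. - V t" 0] Vmono by blast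
  then have Vlim: "(V \<longlongrightarrow> - \<nu>) at_top" using tendsto_minus by fastforce
  have P1lim: "(P1 \<longlongrightarrow> 0) at_top"
  proof -
    have "((\<lambda>t. (\<Sum>i\<in>UNIV. (est (X t) i - xs) \<bullet> (est (X t) i - xs)) / 2)
        \<longlongrightarrow> (\<Sum>i\<in>(UNIV::'i set). (xs - xs) \<bullet> (xs - xs)) / 2) at_top"
      by (intro tendsto_intros consensus(4)[OF ed]) simp
    then show ?thesis unfolding P1_def[abs_def] by simp
  qed
  have "\<forall>i. \<exists>k. ((\<lambda>t. X t (Gain i)) \<longlongrightarrow> k) at_top" using gain_converges by blast
  from choice[OF this] obtain k where k: "\<And>i. ((\<lambda>t. X t (Gain i)) \<longlongrightarrow> k i) at_top" by blast
  define \<kappa> where "\<kappa> = (\<Sum>i\<in>UNIV. (k i - ks) * (k i - ks) / (2 * \<gamma> i))"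
  have P2lim: "(P2 \<longlongrightarrow> \<kappa>) at_top"
    unfolding P2_def[abs_def] \<kappa>_def using gains by (intro tendsto_intros k) (auto simp: less_imp_neq[symmetric])
  have "((\<lambda>t. V t - P1 t - P2 t) \<longlongrightarrow> - \<nu> - 0 - \<kappa>) at_top" by (intro tendsto_intros Vlim P1lim P2lim)
  \<comment> \<open>The sum of the multiplier and \<open>z\<close> parts has a limit in time, since
    the whole function, the estimate part and the gain part have one. The sequence of the limit
    point identifies it as 0.\<close>
  then have P34: "((\<lambda>t. P3 t + P4 t) \<longlongrightarrow> - \<nu> - \<kappa>) at_top" by (simp add: V add.commute)
  have "- \<nu> - \<kappa> = 0"
  proof (rule LIMSEQ_unique)
    show "(\<lambda>n. P3 (\<sigma> n) + P4 (\<sigma> n)) \<longlonglongrightarrow> - \<nu> - \<kappa>" by (rule filterlim_compose[OF P34 \<sigma>])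
    have "(\<lambda>n. (\<Sum>i\<in>UNIV. (dual_var (X (\<sigma> n)) i - ls) \<bullet> (dual_var (X (\<sigma> n)) i - ls)) / 2)
        \<longlonglongrightarrow> (\<Sum>i\<in>(UNIV::'i set). (ls - ls) \<bullet> (ls - ls)) / 2"
      by (intro tendsto_intros dl) simp
    then have 3: "(\<lambda>n. P3 (\<sigma> n)) \<longlonglongrightarrow> 0" unfolding P3_def by simp
    obtain D where D: "D > 0" "\<And>(w :: 'i \<Rightarrow> real^'m) i j. norm (w i - w j) \<le> D * (\<Sum>k\<in>UNIV. norm (laplacian E w k))"
      using disagreement_le_laplacian[where ?'a = "real^'m", OF undirected connected] by blast
    have "(\<lambda>n. D * (\<Sum>i\<in>UNIV. norm (aux_var (X (\<sigma> n)) i - zb i))\<^sup>2 / 2)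
        \<longlonglongrightarrow> D * (\<Sum>i\<in>UNIV. norm (zb i - zb i))\<^sup>2 / 2"
      by (intro tendsto_intros al) simp
    then have up: "(\<lambda>n. D * (\<Sum>i\<in>UNIV. norm (aux_var (X (\<sigma> n)) i - zb i))\<^sup>2 / 2) \<longlonglongrightarrow> 0" by simp
    have ev: "\<forall>\<^sub>F n in sequentially. \<sigma> n \<ge> 0" using \<sigma> unfolding filterlim_at_top by blast
    have 4: "(\<lambda>n. P4 (\<sigma> n)) \<longlonglongrightarrow> 0"
    proof (rule tendsto_sandwich[OF _ _ tendsto_const up])
      show "\<forall>\<^sub>F n in sequentially. 0 \<le> P4 (\<sigma> n)" using ev by eventually_elim (rule nn)
      show "\<forall>\<^sub>F n in sequentially. P4 (\<sigma> n) \<le> D * (\<Sum>i\<in>UNIV. norm (aux_var (X (\<sigma> n)) i - zb i))\<^sup>2 / 2"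
        using ev
      proof eventually_elim
        case (elim n)
        show ?case unfolding P4d[OF elim] auxd[OF elim]
          by (rule divide_right_mono[OF laplacian_form_le[OF undirected D(2)]]) simp
      qed
    qed
    show "(\<lambda>n. P3 (\<sigma> n) + P4 (\<sigma> n)) \<longlonglongrightarrow> 0" using tendsto_add[OF 3 4] by simp
  qed
  then have P34: "((\<lambda>t. P3 t + P4 t) \<longlongrightarrow> 0) at_top" using P34 by simp
  have ev: "\<forall>\<^sub>F t::real in at_top. t \<ge> 0" by (rule eventually_ge_at_top)
  have P3lim: "(P3 \<longlongrightarrow> 0) at_top"
    by (rule tendsto_sandwich[OF _ _ tendsto_const P34]; use ev in eventually_elim) (use nn in auto)
  have P4lim: "(P4 \<longlongrightarrow> 0) at_top"
    by (rule tendsto_sandwich[OF _ _ tendsto_const P34]; use ev in eventually_elim) (use nn in auto)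
  have "((\<lambda>t. dual_var (X t) i - ls) \<longlongrightarrow> 0) at_top" for i
  proof (rule Lim_null_comparison)
    show "\<forall>\<^sub>F t in at_top. norm (dual_var (X t) i - ls) \<le> sqrt (2 * P3 t)"
    proof (rule always_eventually, rule allI)
      fix t
      have "(dual_var (X t) i - ls) \<bullet> (dual_var (X t) i - ls) \<le> (\<Sum>i\<in>UNIV. (dual_var (X t) i - ls) \<bullet> (dual_var (X t) i - ls))"
        by (rule member_le_sum) auto
      then show "norm (dual_var (X t) i - ls) \<le> sqrt (2 * P3 t)" unfolding norm_eq_sqrt_inner by (simp add: P3_def)
    qed
    have "((\<lambda>t. sqrt (2 * P3 t)) \<longlongrightarrow> sqrt (2 * 0)) at_top" by (intro tendsto_intros P3lim)
    then show "((\<lambda>t. sqrt (2 * P3 t)) \<longlongrightarrow> 0) at_top" by simp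
  qed
  then have dual: "((\<lambda>t. dual_var (X t) i) \<longlongrightarrow> ls) at_top" for i by (simp add: LIM_zero_iff)
  have "((\<lambda>t. aux_var (X t) i - zb i) \<longlongrightarrow> 0) at_top" for i
  proof (rule Lim_null_comparison)
    show "\<forall>\<^sub>F t in at_top. norm (aux_var (X t) i - zb i) \<le> real CARD('i) * sqrt (2 * (2 * P4 t))"
      using ev
    proof eventually_elim
      case (elim t)
      show ?case unfolding auxd[OF elim]
        by (rule norm_le_of_form[OF undirected]) (simp add: P4d[OF elim])
    qed
    have "((\<lambda>t. real CARD('i) * sqrt (2 * (2 * P4 t))) \<longlongrightarrow> real CARD('i) * sqrt (2 * (2 * 0))) at_top"
      by (intro tendsto_intros P4lim)
    then show "((\<lambda>t. real CARD('i) * sqrt (2 * (2 * P4 t))) \<longlongrightarrow> 0) at_top" by simp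
  qed
  then have "((\<lambda>t. aux_var (X t) i) \<longlongrightarrow> zb i) at_top" for i by (simp add: LIM_zero_iff)
  then show thesis using that ed dual by blast
qed

text \<open>The filter input \<zeta> tends to \<open>xs\<close>, and the constant coefficient 1
  gives static gain 1; so the position has the same limit as \<zeta>.\<close>

lemma chain_converges:
  assumes ed: "equilibrium_data xs ls zb" and j: "j < r l"
  shows "((\<lambda>t. X t (Deriv l j)) \<longlongrightarrow> (if j = 0 then xs $ l else 0)) at_top"
proof -
  have "((\<lambda>t. X t (Deriv l j)) \<longlongrightarrow> (if j = 0 then xs $ l / coeff (chain_poly l) 0 else 0)) at_top"
  proof (rule hurwitz_chain_tendsto[OF coeffs(3) chain_poly_nonzero, of l "\<lambda>j t. X t (Deriv l j)"])
    show "((\<lambda>t. X t (Deriv l j)) has_real_derivative X t (Deriv l (Suc j))) (at t within {0..})"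
      if "j < degree (chain_poly l)" "0 \<le> t" for j t
    proof -
      have j: "Suc j < r l" using that(1) by (simp add: chain_poly_degree)
      have "((\<lambda>t. X t (Deriv l j)) has_real_derivative CL (X t) (Deriv l j)) (at t within {0..})"
        by (rule deriv_on_half_line) (use j that in \<open>auto simp: in_C\<close>)
      then show ?thesis using j by simp
    qed
    have "((\<lambda>t. est (X t) (own l) $ l) \<longlongrightarrow> xs $ l) at_top" by (rule tendsto_vec_nth[OF consensus(4)[OF ed]])
    then show "((\<lambda>t. \<Sum>j\<le>degree (chain_poly l). coeff (chain_poly l) j * X t (Deriv l j)) \<longlongrightarrow> xs $ l) at_top"
      unfolding chain_poly_zeta by (simp add: estimate_def)
    show "j \<le> degree (chain_poly l)" using j by (simp add: chain_poly_degree)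
  qed
  moreover have "coeff (chain_poly l) 0 = 1"
    using coeffs(1)[of l] order[of l] by (simp add: chain_poly_coeff del: coeff_Poly_eq)
  ultimately show ?thesis by (cases "j = 0") (simp_all del: coeff_Poly_eq)
qed

lemma converges_to_equilibrium:
  "\<exists>s x lam. equilibrium C CL s \<and> converges_to C X s \<and> (\<forall>l. s (Deriv l 0) = x $ l) \<and>
     (\<forall>i. est s i = x) \<and> (\<forall>i. dual_var s i = lam) \<and> KKT own UNIV J g x lam"
proof -
  obtain xs ls zb where ed: "equilibrium_data xs ls zb"
    and dual: "\<And>i. ((\<lambda>t. dual_var (X t) i) \<longlongrightarrow> ls) at_top"
    and aux: "\<And>i. ((\<lambda>t. aux_var (X t) i) \<longlongrightarrow> zb i) at_top"
    by (rule multipliers_converge) blast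
  have "\<forall>i. \<exists>k. ((\<lambda>t. X t (Gain i)) \<longlongrightarrow> k) at_top" using gain_converges by blast
  from choice[OF this] obtain k where k: "\<And>i. ((\<lambda>t. X t (Gain i)) \<longlongrightarrow> k i) at_top" by blast
  define s :: "('i, 'n, 'm) state" where "s q = (case q of Deriv l j \<Rightarrow> if j = 0 then xs $ l else 0
     | Est i l \<Rightarrow> xs $ l | Gain i \<Rightarrow> k i | Aux i a \<Rightarrow> zb i $ a | Dual i a \<Rightarrow> ls $ a)" for q
  have est: "est s i = xs" for i
    by (simp add: vec_eq_iff estimate_def zeta_def s_def)
  have dv: "dual_var s i = ls" and av: "aux_var s i = zb i" for i
    by (simp_all add: dual_var_def aux_var_def s_def vec_eq_iff)
  have rh0: "rh s i = 0" for i by (simp add: rho_laplacian laplacian_def est)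
  have e: "\<And>a. ls $ a \<ge> 0" "\<And>i. G i xs + A i xs ls = 0" "\<And>i a. (g i xs - zb i) $ a \<le> 0"
     "\<And>i. ls \<bullet> (g i xs - zb i) = 0"
    using ed unfolding equilibrium_data_def by auto
  have ut0: "ut s i = 0" for i
    using e(2)[of i] by (simp add: ut_eq est dv rh0 laplacian_def) (metis add_eq_0_iff diff_0 minus_diff_eq diff_minus_eq_add)
  \<comment> \<open>A sum of nonpositive products that equals zero has only zero terms;
    complementarity becomes componentwise.\<close>
  have compl: "ls $ a > 0 \<Longrightarrow> (g i xs - zb i) $ a = 0" for i a
  proof -
    assume a: "ls $ a > 0"
    have "ls $ b \<bullet> (g i xs - zb i) $ b \<le> 0" for b using e(1)[of b] e(3)[of i b] by (simp add: mult_nonneg_nonpos)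
    then have "\<forall>b\<in>UNIV. - (ls $ b \<bullet> (g i xs - zb i) $ b) = 0"
      using e(4)[of i] by (subst sum_nonneg_eq_0_iff[symmetric]) (simp_all add: inner_vec_def sum_negf)
    then show "(g i xs - zb i) $ a = 0" using a by (metis UNIV_I inner_real_def less_irrefl mult_eq_0_iff neg_equal_0_iff_equal)
  qed
  have "equilibrium C CL s" unfolding equilibrium_def
  proof
    fix q assume "q \<in> C"
    show "CL s q = 0"
    proof (cases q)
      case (Deriv l j)
      then show ?thesis by (simp add: control_def ut0) (simp add: s_def)
    next
      case (Est i l) then show ?thesis by (simp add: weighted_laplacian rh0 laplacian_def)
    next
      case (Gain i) then show ?thesis by (simp add: rh0)
    next
      case (Aux i a) then show ?thesis by (simp add: dual_laplacian laplacian_def dv)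
    next
      case (Dual i a)
      have "0 \<le> dual_var s i" using e(1) by (simp add: dv less_eq_vec_def)
      from CL_dual[OF this, of a] have "CL s q = (if ls $ a \<le> 0 then max 0 ((g i xs - zb i) $ a) else (g i xs - zb i) $ a)"
        unfolding Dual drift_simps est dv av by (simp add: s_def laplacian_def dv del: closed_loop.simps)
      then show ?thesis using compl[of a i] e(3)[of i a] by auto
    qed
  qed
  moreover have "converges_to C X s" unfolding converges_to_def
  proof
    fix q assume q: "q \<in> C"
    show "((\<lambda>t. X t q) \<longlongrightarrow> s q) at_top"
    proof (cases q)
      case (Deriv l j)
      then show ?thesis using chain_converges[OF ed, of j l] q by (simp add: s_def in_C)
    next
      case (Est i l)
      then have "own l \<noteq> i" using q by (simp add: in_C)
      then show ?thesis using tendsto_vec_nth[OF consensus(4)[OF ed], of i l] by (simp add: Est s_def estimate_def)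
    next
      case (Gain i) then show ?thesis using k[of i] by (simp add: s_def)
    next
      case (Aux i a)
      then show ?thesis using tendsto_vec_nth[OF aux[of i], of a] by (simp add: s_def aux_var_def)
    next
      case (Dual i a)
      then show ?thesis using tendsto_vec_nth[OF dual[of i], of a] by (simp add: s_def dual_var_def)
    qed
  qed
  moreover have "\<forall>l. s (Deriv l 0) = xs $ l" by (simp add: s_def)
  ultimately show ?thesis using est dv equilibrium_data_imp_KKT[OF ed] by blast
qed

end

theorem theorem5:
  fixes own :: "'n::finite \<Rightarrow> 'i::finite"
    and \<Omega> :: "(real^'n) set"
    and J :: "'i \<Rightarrow> real^'n \<Rightarrow> real"
    and g :: "'i \<Rightarrow> real^'n \<Rightarrow> real^'m::finite"
    and E :: "('i \<times> 'i) set"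
    and \<mu> \<theta>\<^sub>0 :: real
    and \<gamma> :: "'i \<Rightarrow> real"
    and r :: "'n \<Rightarrow> nat"
    and c :: "'n \<Rightarrow> nat \<Rightarrow> real"
    and s\<^sub>0 :: "('i, 'n, 'm) state"
  assumes g_block: "\<And>i. depends_on_block own i (g i)"
    and g_convex: "\<And>i a. convex_on UNIV (\<lambda>x. g i x $ a)"
    and g_C2: "\<And>i. C2 (g i)"
    and slater: "slater \<Omega> g"
    and J_C1: "\<And>i. C1 (J i)"
    and J_convex: "\<And>i x. convex_on UNIV (\<lambda>y. J i (block_upd own i y x))"
    and F_monotone: "\<mu> > 0" "strongly_monotone \<mu> (pseudo_gradient own J)"
    and F_lipschitz: "\<theta>\<^sub>0 > 0" "\<theta>\<^sub>0-lipschitz_on UNIV (pseudo_gradient own J)"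
    and undirected: "sym E"
    and connected: "\<And>i j. (i, j) \<in> E\<^sup>*"
    and Omega: "\<Omega> = UNIV"
    and gains: "\<And>i. \<gamma> i > 0"
    and order: "\<And>l. r l \<ge> 1"
    and coeffs: "\<And>l. c l 0 = 1" "\<And>l. c l (r l - 1) = 1"
      "\<And>l. hurwitz (Poly (map (c l) [0..<r l]))"
    and init_z: "\<And>i. aux_var s\<^sub>0 i = 0"
    and init_lambda: "\<And>i. 0 \<le> dual_var s\<^sub>0 i"
  shows "\<exists>\<phi>. caratheodory_solution (coords own r) (closed_loop own E \<gamma> r c J g) s\<^sub>0 \<phi> \<and>
    (\<forall>\<psi>. caratheodory_solution (coords own r) (closed_loop own E \<gamma> r c J g) s\<^sub>0 \<psi> \<longrightarrow>
       (\<forall>t\<ge>0. \<forall>q\<in>coords own r. \<psi> t q = \<phi> t q)) \<and>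
    (\<exists>s x lam.
       equilibrium (coords own r) (closed_loop own E \<gamma> r c J g) s \<and>
       converges_to (coords own r) \<phi> s \<and>
       (\<forall>l. s (Deriv l 0) = x $ l) \<and>
       (\<forall>i. estimate own r c s i = x) \<and>
       (\<forall>i. dual_var s i = lam) \<and>
       KKT own \<Omega> J g x lam \<and>
       v_GNE own \<Omega> J g x \<and>
       (\<forall>y. v_GNE own \<Omega> J g y \<longrightarrow> y = x))"
proof -
  have sl: "slater UNIV g" using slater Omega by simp
  interpret gne_closed_loop own J g \<mu> \<theta>\<^sub>0 E \<gamma> r c s\<^sub>0
    by (unfold_locales) (fact g_block g_convex g_C2 sl J_C1 J_convex F_monotone F_lipschitz undirected connected
      gains order coeffs init_z init_lambda)+
  obtain X where X: "\<And>T. 0 \<le> T \<Longrightarrow> sol T X" by (rule global_sol_exists) blast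
  \<comment> \<open>Bounds from all horizons coincide, which confines the global solution to one box
    for all times.\<close>
  obtain B where B: "B \<ge> 0" "\<And>T X t. sol T X \<Longrightarrow> 0 \<le> t \<Longrightarrow> t \<le> T \<Longrightarrow> in_box C B (X t)"
    by (rule sol_apriori) blast
  interpret gne_solution own J g \<mu> \<theta>\<^sub>0 E \<gamma> r c s\<^sub>0 X B
    by unfold_locales (use X B in blast)+
  obtain s x lam where lim: "equilibrium C CL s" "converges_to C X s" "\<forall>l. s (Deriv l 0) = x $ l"
     "\<forall>i. est s i = x" "\<forall>i. dual_var s i = lam" "KKT own UNIV J g x lam"
    using converges_to_equilibrium by blast
  have unique: "\<forall>\<psi>. caratheodory_solution C CL s\<^sub>0 \<psi> \<longrightarrow> (\<forall>t\<ge>0. \<forall>q\<in>C. \<psi> t q = X t q)"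
    using sol_unique[OF caratheodory_imp_sol X] by blast
  \<comment> \<open>Uniqueness of KKT strategies holds across different multipliers, so any
    variational equilibrium coincides with the limit.\<close>
  have "\<forall>y. v_GNE own \<Omega> J g y \<longrightarrow> y = x"
    using KKT_unique[OF _ lim(6)] unfolding v_GNE_def Omega by blast
  moreover have "v_GNE own \<Omega> J g x" using KKT_imp_v_GNE[OF lim(6)] unfolding Omega .
  moreover have "KKT own \<Omega> J g x lam" using lim(6) unfolding Omega .
  ultimately show ?thesis
    using sol_imp_caratheodory[OF X] unique lim by blast
qed

end
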